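(* Let $(W_1,S_1)$, $(W_2,S_2)$ be Coxeter systems of finite rank with sets of reflections $T_1,T_2$, let $S_1=\{s_1,\dots,s_k\}$, $S_2=\{s_{k+1},\dots,s_n\}$, $h_1=s_1\cdots s_k$, $h_2=s_{k+1}\cdots s_n$. Let $(W,S)$ be the Coxeter system with $W=W_1*W_2$, $S=S_1\sqcup S_2$, set of reflections $T$, and $h=h_1h_2$. Assume that $(W_1,(s_1,\dots,s_k))$ and $(W_2,(s_{k+1},\dots,s_n))$ are well-stabilized and that $(W_1,T_1,h_1)$ and $(W_2,T_2,h_2)$ are pan-transitive. Then $(W,(s_1,\dots,s_n))$ is well-stabilized and $(W,T,h)$ is pan-transitive. In particular, $\mathrm{Art}(W,S)$ is isomorphic to $\mathrm{Art}^*(W,T,h)$.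
   Context: A Coxeter system $(W,S)$: $W=\langle S\mid (ss')^{m(s,s')}=1\text{ whenever } m(s,s')\neq\infty\rangle$ with $m$ symmetric, $m(s,s)=1$, $m(s,s')\in\{2,3,\dots,\infty\}$ for $s\neq s'$; reflections are conjugates of elements of $S$; $W_1*W_2$ with $S_1\sqcup S_2$ is the Coxeter system with $m(s,s')=\infty$ for $s\in S_1,s'\in S_2$. For a group $G$ with generating set $X$ and $a\in G$: $\ell_X(a)$ is the minimal $k$ with $a=x_1\cdots x_k$, $x_i\in X\cup X^{-1}$; $\mathrm{Red}_X(a)$ the set of such tuples of length $\ell_X(a)$; $a\le_X b$ iff $\ell_X(a)+\ell_X(a^{-1}b)=\ell_X(b)$; $[1,b]_X=\{a:a\le_Xb\}$. The braid group $B_m$ acts on $G^m$ by the Hurwitz action $\sigma_i\cdot(g_1,\dots,g_m)=(g_1,\dots,g_{i-1},g_ig_{i+1}g_i^{-1},g_i,g_{i+2},\dots,g_m)$. For a Coxeter system $(V,R)$ with ordering $(r_1,\dots,r_m)$ of $R$: $\mathrm{Art}(V,R)$ is generated by $\bar r_1,\dots,\bar r_m$ subject to $\bar r_i\bar r_j\bar r_i\cdots=\bar r_j\bar r_i\bar r_j\cdots$ (each side with $m(r_i,r_j)$ factors) whenever $m(r_i,r_j)\neq\infty$; $(V,(r_1,\dots,r_m))$ is well-stabilized if the stabilizer in $B_m$ of $(r_1,\dots,r_m)\in V^m$ equals the stabilizer of $(\bar r_1,\dots,\bar r_m)\in\mathrm{Art}(V,R)^m$ under the Hurwitz action. With reflections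 $T_V$ and Coxeter element $c$, the dual Artin group $\mathrm{Art}^*(V,T_V,c)$ is generated by symbols $\{t\}$, $t\in T_V\cap[1,c]_{T_V}$, subject to $\{t_1\}\cdots\{t_k\}=\{t'_1\}\cdots\{t'_k\}$ whenever both tuples lie in $\mathrm{Red}_{T_V}(a)$ for some $a\in[1,c]_{T_V}$; $(V,T_V,c)$ is pan-transitive if for each $a\in[1,c]_{T_V}$ the Hurwitz action of $B_{\ell_{T_V}(a)}$ on $\mathrm{Red}_{T_V}(a)$ is transitive. *)

theory Defs
  imports "HOL-Algebra.Algebra" "HOL-Library.Extended_Nat"
begin

text \<open>Words over a generator alphabet: letters (x, True) = x, (x, False) = x^-1.\<close>

definition inv_word :: "('g \<times> bool) list \<Rightarrow> ('g \<times> bool) list" where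
  "inv_word w = rev (map (\<lambda>(x, b). (x, \<not> b)) w)"

inductive word_cong :: "('g \<times> bool) list set \<Rightarrow> ('g \<times> bool) list \<Rightarrow> ('g \<times> bool) list \<Rightarrow> bool"
  for R where
  wc_refl: "word_cong R w w"
| wc_sym: "word_cong R u v \<Longrightarrow> word_cong R v u"
| wc_trans: "word_cong R u v \<Longrightarrow> word_cong R v w \<Longrightarrow> word_cong R u w"
| wc_cancel: "word_cong R [(x, b), (x, \<not> b)] []"
| wc_rel: "r \<in> R \<Longrightarrow> word_cong R r []"
| wc_app: "word_cong R u u' \<Longrightarrow> word_cong R v v' \<Longrightarrow> word_cong R (u @ v) (u' @ v')"

definition word_class :: "('g \<times> bool) list set \<Rightarrow> ('g \<times> bool) list \<Rightarrow> ('g \<times> bool) list set" where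
  "word_class R w = {v. word_cong R w v}"

definition presented_group :: "'g set \<Rightarrow> ('g \<times> bool) list set \<Rightarrow> ('g \<times> bool) list set monoid" where
  "presented_group Gen R =
     \<lparr>carrier = {word_class R w | w. set w \<subseteq> Gen \<times> UNIV},
      monoid.mult = (\<lambda>A B. {v. \<exists>a\<in>A. \<exists>b\<in>B. word_cong R (a @ b) v}),
      monoid.one = word_class R []\<rparr>"

definition pres_gen :: "('g \<times> bool) list set \<Rightarrow> 'g \<Rightarrow> ('g \<times> bool) list set" where
  "pres_gen R x = word_class R [(x, True)]"

definition presents :: "('a, 'm) monoid_scheme \<Rightarrow> 'a set \<Rightarrow> ('a \<times> bool) list set \<Rightarrow> bool" where
  "presents G Gen R \<longleftrightarrow>
     (\<exists>\<phi>. \<phi> \<in> iso (presented_group Gen R) G \<and> (\<forall>x\<in>Gen. \<phi> (pres_gen R x) = x))"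

definition coxeter_matrix :: "'a set \<Rightarrow> ('a \<Rightarrow> 'a \<Rightarrow> enat) \<Rightarrow> bool" where
  "coxeter_matrix S m \<longleftrightarrow>
     (\<forall>s\<in>S. \<forall>s'\<in>S. m s s' = m s' s) \<and> (\<forall>s\<in>S. m s s = 1) \<and>
     (\<forall>s\<in>S. \<forall>s'\<in>S. s \<noteq> s' \<longrightarrow> m s s' \<ge> 2)"

definition alt_word :: "'g \<Rightarrow> 'g \<Rightarrow> nat \<Rightarrow> ('g \<times> bool) list" where
  "alt_word s s' n = map (\<lambda>i. if even i then (s, True) else (s', True)) [0..<n]"

definition coxeter_relators :: "'g set \<Rightarrow> ('g \<Rightarrow> 'g \<Rightarrow> enat) \<Rightarrow> ('g \<times> bool) list set" where
  "coxeter_relators S m =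
     {alt_word s s' (2 * n) | s s' n. s \<in> S \<and> s' \<in> S \<and> m s s' = enat n}"

definition artin_relators :: "'g set \<Rightarrow> ('g \<Rightarrow> 'g \<Rightarrow> enat) \<Rightarrow> ('g \<times> bool) list set" where
  "artin_relators S m =
     {alt_word s s' n @ inv_word (alt_word s' s n) | s s' n. s \<in> S \<and> s' \<in> S \<and> m s s' = enat n}"

definition coxeter_system :: "('a, 'm) monoid_scheme \<Rightarrow> 'a set \<Rightarrow> ('a \<Rightarrow> 'a \<Rightarrow> enat) \<Rightarrow> bool" where
  "coxeter_system W S m \<longleftrightarrow>
     group W \<and> S \<subseteq> carrier W \<and> coxeter_matrix S m \<and> presents W S (coxeter_relators S m)"

definition reflections :: "('a, 'm) monoid_scheme \<Rightarrow> 'a set \<Rightarrow> 'a set" where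
  "reflections W S = {w \<otimes>\<^bsub>W\<^esub> s \<otimes>\<^bsub>W\<^esub> inv\<^bsub>W\<^esub> w | w s. w \<in> carrier W \<and> s \<in> S}"

definition artin_group :: "'a set \<Rightarrow> ('a \<Rightarrow> 'a \<Rightarrow> enat) \<Rightarrow> ('a \<times> bool) list set monoid" where
  "artin_group R m = presented_group R (artin_relators R m)"

definition artin_gen :: "'a set \<Rightarrow> ('a \<Rightarrow> 'a \<Rightarrow> enat) \<Rightarrow> 'a \<Rightarrow> ('a \<times> bool) list set" where
  "artin_gen R m r = pres_gen (artin_relators R m) r"

definition prodl :: "('a, 'm) monoid_scheme \<Rightarrow> 'a list \<Rightarrow> 'a" where
  "prodl G xs = foldr (\<lambda>x y. x \<otimes>\<^bsub>G\<^esub> y) xs \<one>\<^bsub>G\<^esub>"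

definition len :: "('a, 'm) monoid_scheme \<Rightarrow> 'a set \<Rightarrow> 'a \<Rightarrow> nat" where
  "len G Gen a = (LEAST k. \<exists>xs. set xs \<subseteq> Gen \<union> (\<lambda>x. inv\<^bsub>G\<^esub> x) ` Gen \<and> length xs = k \<and> prodl G xs = a)"

definition red :: "('a, 'm) monoid_scheme \<Rightarrow> 'a set \<Rightarrow> 'a \<Rightarrow> 'a list set" where
  "red G Gen a = {xs. set xs \<subseteq> Gen \<union> (\<lambda>x. inv\<^bsub>G\<^esub> x) ` Gen \<and> prodl G xs = a \<and> length xs = len G Gen a}"

definition prefix_le :: "('a, 'm) monoid_scheme \<Rightarrow> 'a set \<Rightarrow> 'a \<Rightarrow> 'a \<Rightarrow> bool" where
  "prefix_le G Gen a b \<longleftrightarrow> len G Gen a + len G Gen (inv\<^bsub>G\<^esub> a \<otimes>\<^bsub>G\<^esub> b) = len G Gen b"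

definition interval :: "('a, 'm) monoid_scheme \<Rightarrow> 'a set \<Rightarrow> 'a \<Rightarrow> 'a set" where
  "interval G Gen b = {a \<in> carrier G. prefix_le G Gen a b}"

text \<open>Letter (i, True) is sigma_(i+1), (i, False) its inverse (0-indexed positions).\<close>
definition hurwitz_step :: "('a, 'm) monoid_scheme \<Rightarrow> nat \<times> bool \<Rightarrow> 'a list \<Rightarrow> 'a list" where
  "hurwitz_step G l xs = (case l of (i, b) \<Rightarrow>
     if Suc i < length xs then
       (if b then xs[i := xs ! i \<otimes>\<^bsub>G\<^esub> xs ! Suc i \<otimes>\<^bsub>G\<^esub> inv\<^bsub>G\<^esub> (xs ! i), Suc i := xs ! i]
        else xs[i := xs ! Suc i, Suc i := inv\<^bsub>G\<^esub> (xs ! Suc i) \<otimes>\<^bsub>G\<^esub> xs ! i \<otimes>\<^bsub>G\<^esub> xs ! Suc i])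
     else xs)"

definition hurwitz :: "('a, 'm) monoid_scheme \<Rightarrow> (nat \<times> bool) list \<Rightarrow> 'a list \<Rightarrow> 'a list" where
  "hurwitz G w xs = fold (hurwitz_step G) w xs"

definition braid_word :: "nat \<Rightarrow> (nat \<times> bool) list \<Rightarrow> bool" where
  "braid_word n w \<longleftrightarrow> (\<forall>(i, b) \<in> set w. Suc i < n)"

text \<open>Stabilizers in B_m coincide; since the action factors through B_m, this is
  the same as: every braid word fixes one tuple iff it fixes the other.\<close>
definition well_stabilized :: "('a, 'm) monoid_scheme \<Rightarrow> ('a \<Rightarrow> 'a \<Rightarrow> enat) \<Rightarrow> 'a list \<Rightarrow> bool" where
  "well_stabilized V m rs \<longleftrightarrow>
     (\<forall>w. braid_word (length rs) w \<longrightarrow>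
        (hurwitz V w rs = rs \<longleftrightarrow>
         hurwitz (artin_group (set rs) m) w (map (artin_gen (set rs) m) rs)
           = map (artin_gen (set rs) m) rs))"

definition pan_transitive :: "('a, 'm) monoid_scheme \<Rightarrow> 'a set \<Rightarrow> 'a \<Rightarrow> bool" where
  "pan_transitive V T c \<longleftrightarrow>
     (\<forall>a \<in> interval V T c. \<forall>xs \<in> red V T a. \<forall>ys \<in> red V T a.
        \<exists>w. braid_word (len V T a) w \<and> hurwitz V w xs = ys)"

definition dual_relators :: "('a, 'm) monoid_scheme \<Rightarrow> 'a set \<Rightarrow> 'a \<Rightarrow> ('a \<times> bool) list set" where
  "dual_relators V T c =
     {map (\<lambda>t. (t, True)) ts @ inv_word (map (\<lambda>t. (t, True)) ts') | ts ts' a.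
        a \<in> interval V T c \<and> ts \<in> red V T a \<and> ts' \<in> red V T a}"

definition dual_artin_group :: "('a, 'm) monoid_scheme \<Rightarrow> 'a set \<Rightarrow> 'a \<Rightarrow> ('a \<times> bool) list set monoid" where
  "dual_artin_group V T c = presented_group (T \<inter> interval V T c) (dual_relators V T c)"

end

theory Submission
  imports Defs "HOL-Library.Function_Algebras" Complex_Main
begin

text \<open>The free product acts on its Bass--Serre tree, where the reflections are elliptic. By Hurwitz
  moves, a tuple of elliptic elements without trivial subproducts is brought into a form whose walk
  through the tree is reduced.

  For a tuple in another free product lying over a reduced factorization of \<open>h1 h2\<close>, the walks
  of its first and second part cancel to the unique reduced path between two known vertices. Matching
  every edge with its return crossing turns each part into alternating letters of a normal form in
  \<open>W\<close>, and the order of the crossings is decided by whether move spaces of segments in the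
  geometric representation meet; here it enters that a Coxeter element has full move space. Hence the
  product determines the tuple up to Hurwitz moves. Applied to the Artin group this splits the action
  of a stabilizing braid into the two factors. Applied to the free product of two copies of \<open>W\<close>,
  with a factorization of \<open>a\<close> in the first and one of \<open>a\<^sup>-\<^sup>1h\<close> in the second copy,
  it shows transitivity on the reduced factorizations of \<open>a\<close>.

  Finally, the braid that moves a reflection \<open>t\<close> to the front of the Coxeter word also
  moves a well-defined element of the Artin group to the front, which yields the inverse of the natural
  map from the Artin group to the dual Artin group.\<close>

text \<open>Transitivity for \<open>h\<close> does not pass directly to a prefix \<open>a\<close>:
  two factorizations of \<open>a\<close>, extended by one factorization of the complement, are
  joined by a braid, but this braid may mix the two parts. Letters from different copies of
  \<open>W\<close> remember their origin, and a braid between doubled tuples projects to the first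
  copy, where the complement vanishes.

  The difficulty in the comparison is the folded part: the first walk may end with edges
  \<open>B\<close> through which the second walk runs back, and the product in the free product does
  not see them. The crossings match the edges of \<open>A @ B\<close> among themselves and those of
  \<open>rev B @ A'\<close> among themselves. Together the two matchings form one meander from one
  surviving edge to the other. Two arcs of one matching are disjoint or nested; passing to their
  other ends keeps the order of the ends if they are disjoint and flips it if they are nested.
  Sliding two edges along the meander until one of them reaches an end therefore computes their
  order in \<open>B\<close> from data in \<open>W\<close> alone.\<close>

section \<open>The Hurwitz action on tuples\<close>

lemma hurwitz_Nil [simp]: "hurwitz G [] xs = xs"
  by (simp add: hurwitz_def)

lemma hurwitz_Cons [simp]: "hurwitz G (l # w) xs = hurwitz G w (hurwitz_step G l xs)"
  by (simp add: hurwitz_def)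

lemma hurwitz_append: "hurwitz G (v @ w) xs = hurwitz G w (hurwitz G v xs)"
  by (simp add: hurwitz_def)

lemma length_hurwitz_step [simp]: "length (hurwitz_step G l xs) = length xs"
  by (auto simp: hurwitz_step_def split: prod.splits)

lemma length_hurwitz [simp]: "length (hurwitz G w xs) = length xs"
  by (induction w arbitrary: xs) auto

lemma list_split_two:
  assumes "Suc i < length xs"
  shows "xs = take i xs @ xs ! i # xs ! Suc i # drop (Suc (Suc i)) xs"
  using assms by (metis Cons_nth_drop_Suc Suc_lessD append_take_drop_id)

lemma hurwitz_step_split:
  "hurwitz_step G (length us, b) (us @ x # y # vs) =
     us @ (if b then [x \<otimes>\<^bsub>G\<^esub> y \<otimes>\<^bsub>G\<^esub> inv\<^bsub>G\<^esub> x, x]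
           else [y, inv\<^bsub>G\<^esub> y \<otimes>\<^bsub>G\<^esub> x \<otimes>\<^bsub>G\<^esub> y]) @ vs"
  by (auto simp: hurwitz_step_def nth_append list_update_append)

lemma prodl_Nil [simp]: "prodl G [] = \<one>\<^bsub>G\<^esub>"
  and prodl_Cons [simp]: "prodl G (x # xs) = x \<otimes>\<^bsub>G\<^esub> prodl G xs"
  by (simp_all add: prodl_def)

context group
begin

lemma prodl_closed [intro]: "set xs \<subseteq> carrier G \<Longrightarrow> prodl G xs \<in> carrier G"
  by (induction xs) auto

lemma prodl_append:
  "set xs \<subseteq> carrier G \<Longrightarrow> set ys \<subseteq> carrier G \<Longrightarrow> prodl G (xs @ ys) = prodl G xs \<otimes> prodl G ys"
  by (induction xs) (auto simp: m_assoc prodl_closed)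

text \<open>Most arguments about a single move start from this split, which replaces list updates by
  concatenation. An index beyond the tuple falls under the first case.\<close>

lemma hurwitz_step_cases:
  obtains "hurwitz_step G l xs = xs"
  | us x y vs b where "xs = us @ x # y # vs" "l = (length us, b)"
proof (cases l)
  case (Pair i b)
  show thesis
  proof (cases "Suc i < length xs")
    case True
    then show thesis
      using that(2)[of "take i xs" "xs ! i" "xs ! Suc i" "drop (Suc (Suc i)) xs" b]
        list_split_two[OF True] Pair by (simp add: min_absorb2)
  next
    case False
    then show thesis using that(1) Pair by (simp add: hurwitz_step_def)
  qed
qed

lemma hurwitz_step_closed:
  assumes "set xs \<subseteq> T" "T \<subseteq> carrier G"
    and "\<And>g t. g \<in> carrier G \<Longrightarrow> t \<in> T \<Longrightarrow> g \<otimes> t \<otimes> inv g \<in> T"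
  shows "set (hurwitz_step G l xs) \<subseteq> T"
proof (cases rule: hurwitz_step_cases[of l xs])
  case 1
  then show ?thesis using assms by simp
next
  case (2 us x y vs b)
  then have *: "x \<in> T" "y \<in> T" "x \<in> carrier G" "y \<in> carrier G" using assms by auto
  then have "x \<otimes> y \<otimes> inv x \<in> T" "inv y \<otimes> x \<otimes> y \<in> T"
    using assms(3)[of x y] assms(3)[of "inv y" x] by auto
  then show ?thesis using 2 * assms(1) by (auto simp: hurwitz_step_split)
qed

lemma hurwitz_closed:
  assumes "set xs \<subseteq> T" "T \<subseteq> carrier G"
    and "\<And>g t. g \<in> carrier G \<Longrightarrow> t \<in> T \<Longrightarrow> g \<otimes> t \<otimes> inv g \<in> T"
  shows "set (hurwitz G w xs) \<subseteq> T"
  using assms(1)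
proof (induction w arbitrary: xs)
  case (Cons l w)
  show ?case using Cons.IH[OF hurwitz_step_closed[OF Cons.prems assms(2,3)]] by simp
qed simp

lemma prodl_hurwitz_step:
  assumes "set xs \<subseteq> carrier G"
  shows "prodl G (hurwitz_step G l xs) = prodl G xs"
proof (cases rule: hurwitz_step_cases[of l xs])
  case (2 us x y vs b)
  have c: "set us \<subseteq> carrier G" "set vs \<subseteq> carrier G" "x \<in> carrier G" "y \<in> carrier G"
    using assms 2 by auto
  then have v: "prodl G vs \<in> carrier G" by auto
  have "x \<otimes> y \<otimes> inv x \<otimes> (x \<otimes> prodl G vs) = x \<otimes> (y \<otimes> prodl G vs)"
    using c v by (simp add: m_assoc) (simp add: m_assoc[symmetric])
  moreover have "y \<otimes> (inv y \<otimes> x \<otimes> y \<otimes> prodl G vs) = x \<otimes> (y \<otimes> prodl G vs)"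
    using c v by (simp add: m_assoc[symmetric])
  ultimately show ?thesis
    using 2 c by (cases b) (auto simp: hurwitz_step_split prodl_append)
qed simp

lemma prodl_hurwitz:
  assumes "set xs \<subseteq> carrier G"
  shows "prodl G (hurwitz G w xs) = prodl G xs"
  using assms
proof (induction w arbitrary: xs)
  case (Cons l w)
  have "set (hurwitz_step G l xs) \<subseteq> carrier G"
    using hurwitz_step_closed[OF Cons.prems order_refl] by simp
  then show ?case using Cons.IH prodl_hurwitz_step[OF Cons.prems] by simp
qed simp

lemma hurwitz_step_inverse:
  assumes "set xs \<subseteq> carrier G"
  shows "hurwitz_step G (i, \<not> b) (hurwitz_step G (i, b) xs) = xs"
proof (cases "Suc i < length xs")
  case True
  define us where "us = take i xs"
  define vs where "vs = drop (Suc (Suc i)) xs"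
  define x where "x = xs ! i"
  define y where "y = xs ! Suc i"
  have xs: "xs = us @ x # y # vs" and i: "i = length us"
    using list_split_two[OF True] True by (simp_all add: us_def vs_def x_def y_def)
  have c: "x \<in> carrier G" "y \<in> carrier G" using assms xs by auto
  have *: "inv x \<otimes> (x \<otimes> y \<otimes> inv x) \<otimes> x = y" "y \<otimes> (inv y \<otimes> x \<otimes> y) \<otimes> inv y = x"
    using c by (simp_all add: m_assoc) (simp_all add: m_assoc[symmetric])
  show ?thesis
    unfolding xs i using * by (cases b) (simp_all add: hurwitz_step_split)
qed (simp add: hurwitz_step_def)

lemma hurwitz_inv_word:
  assumes "set xs \<subseteq> carrier G"
  shows "hurwitz G (inv_word w) (hurwitz G w xs) = xs"
  using assms
proof (induction w arbitrary: xs)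
  case (Cons l w)
  have "set (hurwitz_step G l xs) \<subseteq> carrier G"
    using hurwitz_step_closed[OF Cons.prems order_refl] by simp
  from Cons.IH[OF this] show ?case
    using hurwitz_step_inverse[OF Cons.prems] by (cases l) (simp add: inv_word_def hurwitz_append)
qed (simp add: inv_word_def)

end

lemma hurwitz_map_hom:
  assumes "group G" "group H" "f \<in> hom G H" "set xs \<subseteq> carrier G"
  shows "hurwitz H w (map f xs) = map f (hurwitz G w xs)"
  using assms(4)
proof (induction w arbitrary: xs)
  case (Cons l w)
  interpret G: group G by fact
  interpret group_hom G H f using assms by (simp add: group_hom_def group_hom_axioms_def)
  have "hurwitz_step H l (map f xs) = map f (hurwitz_step G l xs)"
  proof (cases rule: G.hurwitz_step_cases[of l xs])
    \<comment> \<open>An unchanged tuple may still have its index in range, so the index is examined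
      again.\<close>
    case 1
    show ?thesis
    proof (cases l)
      case (Pair i b)
      show ?thesis
      proof (cases "Suc i < length xs")
        case True
        then have "xs ! i \<in> carrier G" "xs ! Suc i \<in> carrier G"
          using Cons.prems by (auto simp: subset_iff)
        then show ?thesis using True Pair by (simp add: hurwitz_step_def map_update)
      qed (simp add: hurwitz_step_def Pair)
    qed
  next
    case (2 us x y vs b)
    then have "x \<in> carrier G" "y \<in> carrier G" using Cons.prems by auto
    then show ?thesis
      using 2 hurwitz_step_split[of H "map f us" b "f x" "f y" "map f vs"]
      by (simp add: hurwitz_step_split)
  qed
  moreover have "set (hurwitz_step G l xs) \<subseteq> carrier G"
    using G.hurwitz_step_closed[OF Cons.prems order_refl] by simp
  ultimately show ?case using Cons.IH by simp
qed simp

section \<open>Hurwitz equivalence\<close>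

text \<open>Positions are bounded, although a letter out of range acts as the identity: only then
  can a witness be shifted and applied to a block inside a longer tuple. The carrier condition lets
  inverse moves cancel, which gives symmetry.\<close>

definition heq :: "('a, 'm) monoid_scheme \<Rightarrow> 'a list \<Rightarrow> 'a list \<Rightarrow> bool" where
  "heq G xs ys \<longleftrightarrow> set xs \<subseteq> carrier G \<and> (\<exists>w. braid_word (length xs) w \<and> hurwitz G w xs = ys)"

definition conjg :: "('a, 'm) monoid_scheme \<Rightarrow> 'a \<Rightarrow> 'a \<Rightarrow> 'a" where
  "conjg G g x = g \<otimes>\<^bsub>G\<^esub> x \<otimes>\<^bsub>G\<^esub> inv\<^bsub>G\<^esub> g"

lemma braid_word_Nil [simp]: "braid_word n []"
  and braid_word_append [simp]: "braid_word n (u @ v) \<longleftrightarrow> braid_word n u \<and> braid_word n v"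
  and braid_word_Cons [simp]: "braid_word n (l # v) \<longleftrightarrow> Suc (fst l) < n \<and> braid_word n v"
  by (auto simp: braid_word_def split: prod.splits)

lemma braid_word_inv_word [simp]: "braid_word n (inv_word w) \<longleftrightarrow> braid_word n w"
  by (auto simp: braid_word_def inv_word_def)

lemma braid_word_mono: "braid_word n w \<Longrightarrow> n \<le> m \<Longrightarrow> braid_word m w"
  by (auto simp: braid_word_def)

lemma heq_length: "heq G xs ys \<Longrightarrow> length ys = length xs"
  by (auto simp: heq_def)

definition shift_word :: "nat \<Rightarrow> (nat \<times> bool) list \<Rightarrow> (nat \<times> bool) list" where
  "shift_word k w = map (\<lambda>(i, b). (i + k, b)) w"

lemma braid_word_shift: "braid_word n w \<Longrightarrow> braid_word (k + n) (shift_word k w)"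
  by (auto simp: braid_word_def shift_word_def)

lemma hurwitz_step_context:
  assumes "Suc i < length xs"
  shows "hurwitz_step G (i + length us, b) (us @ xs @ vs) = us @ hurwitz_step G (i, b) xs @ vs"
proof -
  define as where "as = take i xs"
  define cs where "cs = drop (Suc (Suc i)) xs"
  define x where "x = xs ! i"
  define y where "y = xs ! Suc i"
  have xs: "xs = as @ x # y # cs" and i: "i = length as"
    using list_split_two[OF assms] assms by (simp_all add: as_def cs_def x_def y_def)
  show ?thesis
    using hurwitz_step_split[of G "us @ as" b x y "cs @ vs"] hurwitz_step_split[of G as b x y cs]
    by (simp add: xs i add.commute)
qed

lemma hurwitz_context:
  assumes "braid_word (length xs) w"
  shows "hurwitz G (shift_word (length us) w) (us @ xs @ vs) = us @ hurwitz G w xs @ vs"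
  using assms
proof (induction w arbitrary: xs)
  case (Cons l w)
  obtain i b where l: "l = (i, b)" by fastforce
  from Cons.prems have "Suc i < length xs" "braid_word (length (hurwitz_step G (i, b) xs)) w"
    by (auto simp: l)
  then show ?case using Cons.IH[of "hurwitz_step G (i, b) xs"]
    by (simp add: shift_word_def l hurwitz_step_context)
qed (simp add: shift_word_def)

context group
begin

lemma conjg_closed [simp, intro]: "g \<in> carrier G \<Longrightarrow> x \<in> carrier G \<Longrightarrow> conjg G g x \<in> carrier G"
  by (simp add: conjg_def)

lemma conjg_conjg:
  "g \<in> carrier G \<Longrightarrow> h \<in> carrier G \<Longrightarrow> x \<in> carrier G \<Longrightarrow>
   conjg G g (conjg G h x) = conjg G (g \<otimes> h) x"
  by (simp add: conjg_def m_assoc inv_mult_group)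

lemma conjg_one [simp]: "x \<in> carrier G \<Longrightarrow> conjg G \<one> x = x"
  by (simp add: conjg_def)

lemma conjg_inv_cancel [simp]:
  "g \<in> carrier G \<Longrightarrow> x \<in> carrier G \<Longrightarrow> conjg G g (conjg G (inv g) x) = x"
  "g \<in> carrier G \<Longrightarrow> x \<in> carrier G \<Longrightarrow> conjg G (inv g) (conjg G g x) = x"
  by (simp_all add: conjg_conjg)

lemma conjg_mult:
  "g \<in> carrier G \<Longrightarrow> x \<in> carrier G \<Longrightarrow> y \<in> carrier G \<Longrightarrow>
   conjg G g (x \<otimes> y) = conjg G g x \<otimes> conjg G g y"
  by (simp add: conjg_def m_assoc) (simp add: m_assoc[symmetric])

lemma conjg_m_one [simp]: "g \<in> carrier G \<Longrightarrow> conjg G g \<one> = \<one>"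
  by (simp add: conjg_def)

lemma prodl_map_conjg:
  "g \<in> carrier G \<Longrightarrow> set xs \<subseteq> carrier G \<Longrightarrow> prodl G (map (conjg G g) xs) = conjg G g (prodl G xs)"
  by (induction xs) (auto simp: conjg_mult prodl_closed)

lemma heq_refl: "set xs \<subseteq> carrier G \<Longrightarrow> heq G xs xs"
  unfolding heq_def by (metis braid_word_Nil hurwitz_Nil)

lemma heq_carrier: "heq G xs ys \<Longrightarrow> set ys \<subseteq> carrier G"
  unfolding heq_def using hurwitz_closed[OF _ order_refl] by (metis inv_closed m_closed)

lemma heq_carrier': "heq G xs ys \<Longrightarrow> set xs \<subseteq> carrier G"
  by (simp add: heq_def)

lemma heq_sym: "heq G xs ys \<Longrightarrow> heq G ys xs"
proof -
  assume a: "heq G xs ys"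
  then obtain w where "braid_word (length xs) w" "hurwitz G w xs = ys" "set xs \<subseteq> carrier G"
    by (auto simp: heq_def)
  moreover from this have "hurwitz G (inv_word w) ys = xs" using hurwitz_inv_word by blast
  ultimately show ?thesis
    using heq_carrier[OF a] heq_length[OF a] unfolding heq_def by (metis braid_word_inv_word)
qed

lemma heq_trans [trans]: "heq G xs ys \<Longrightarrow> heq G ys zs \<Longrightarrow> heq G xs zs"
  unfolding heq_def by (metis braid_word_append hurwitz_append length_hurwitz)

lemma heq_prodl: "heq G xs ys \<Longrightarrow> prodl G ys = prodl G xs"
  unfolding heq_def using prodl_hurwitz by blast

lemma heq_closed:
  assumes "heq G xs ys" "set xs \<subseteq> T" "T \<subseteq> carrier G"
    and "\<And>g t. g \<in> carrier G \<Longrightarrow> t \<in> T \<Longrightarrow> g \<otimes> t \<otimes> inv g \<in> T"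
  shows "set ys \<subseteq> T"
proof -
  obtain w where "hurwitz G w xs = ys" using assms(1) by (auto simp: heq_def)
  then show ?thesis using hurwitz_closed[OF assms(2,3), of w] assms(4) by blast
qed

lemma heq_context:
  assumes "heq G xs ys" "set us \<subseteq> carrier G" "set vs \<subseteq> carrier G"
  shows "heq G (us @ xs @ vs) (us @ ys @ vs)"
proof -
  obtain w where w: "braid_word (length xs) w" "hurwitz G w xs = ys" "set xs \<subseteq> carrier G"
    using assms by (auto simp: heq_def)
  have "braid_word (length (us @ xs @ vs)) (shift_word (length us) w)"
    using braid_word_mono[OF braid_word_shift[OF w(1)]] by simp
  then show ?thesis
    using hurwitz_context[OF w(1), of G us vs] w assms unfolding heq_def
    by (metis set_append Un_least)
qed

lemma heq_append:
  assumes "heq G xs ys" "heq G us vs"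
  shows "heq G (xs @ us) (ys @ vs)"
proof -
  have "heq G (xs @ us) (ys @ us)"
    using heq_context[OF assms(1), of "[]" us] heq_carrier'[OF assms(2)] by simp
  also have "heq G (ys @ us) (ys @ vs)"
    using heq_context[OF assms(2), of ys "[]"] heq_carrier[OF assms(1)] by simp
  finally show ?thesis .
qed

lemma heq_swap: "x \<in> carrier G \<Longrightarrow> y \<in> carrier G \<Longrightarrow> heq G [x, y] [conjg G x y, x]"
  unfolding heq_def conjg_def using hurwitz_step_split[of G "[]" True x y "[]"]
  by (auto intro!: exI[of _ "[(0, True)]"])

lemma heq_move1:
  "x \<in> carrier G \<Longrightarrow> set ys \<subseteq> carrier G \<Longrightarrow> heq G (x # ys) (map (conjg G x) ys @ [x])"
proof (induction ys)
  case Nil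
  then show ?case by (simp add: heq_refl)
next
  case (Cons y ys)
  have "heq G (x # y # ys) (conjg G x y # x # ys)"
    using heq_context[OF heq_swap[of x y], of "[]" ys] Cons.prems by simp
  also have "heq G (conjg G x y # x # ys) (conjg G x y # map (conjg G x) ys @ [x])"
    using heq_context[OF Cons.IH, of "[conjg G x y]" "[]"] Cons.prems by simp
  finally show ?case by simp
qed

text \<open>The letters of \<open>xs\<close> pass one at a time, and their conjugations compose to
  the conjugation by the product. Blocks of letters are exchanged by this move throughout.\<close>

lemma heq_move:
  "set xs \<subseteq> carrier G \<Longrightarrow> set ys \<subseteq> carrier G \<Longrightarrow>
   heq G (xs @ ys) (map (conjg G (prodl G xs)) ys @ xs)"
proof (induction xs)
  case Nil
  then have "map (conjg G \<one>) ys = ys" by (induction ys) auto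
  then show ?case using Nil by (simp add: heq_refl)
next
  case (Cons x xs)
  let ?p = "prodl G xs"
  have p: "?p \<in> carrier G" using Cons.prems by auto
  have zs: "set (map (conjg G ?p) ys) \<subseteq> carrier G" using p Cons.prems by auto
  have "heq G (x # xs @ ys) (x # map (conjg G ?p) ys @ xs)"
    using heq_context[OF Cons.IH, of "[x]" "[]"] Cons.prems by simp
  also have "heq G (x # map (conjg G ?p) ys @ xs) ((map (conjg G x) (map (conjg G ?p) ys) @ [x]) @ xs)"
    using heq_context[OF heq_move1[OF _ zs, of x], of "[]" xs] Cons.prems by simp
  also have "map (conjg G x) (map (conjg G ?p) ys) = map (conjg G (prodl G (x # xs))) ys"
    using Cons.prems p by (auto simp: conjg_conjg)
  finally show ?case by simp
qed

lemma heq_move':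
  assumes "set xs \<subseteq> carrier G" "set ys \<subseteq> carrier G"
  shows "heq G (xs @ ys) (ys @ map (conjg G (inv (prodl G ys))) xs)"
proof -
  let ?zs = "map (conjg G (inv (prodl G ys))) xs"
  have p: "prodl G ys \<in> carrier G" using assms by auto
  have "map (conjg G (prodl G ys)) ?zs = xs" using assms p by (simp add: map_idI subset_iff)
  moreover have "set ?zs \<subseteq> carrier G" using assms p by auto
  ultimately show ?thesis using heq_move[OF assms(2), of ?zs] heq_sym by metis
qed

end

lemma heq_map_hom:
  assumes "group G" "group H" "f \<in> hom G H" "heq G xs ys"
  shows "heq H (map f xs) (map f ys)"
  using assms hurwitz_map_hom[OF assms(1-3)] unfolding heq_def
  by (auto simp: hom_def Pi_def)

section \<open>Free products and their Bass--Serre trees\<close>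

primrec alternating :: "('a, 'm) monoid_scheme \<Rightarrow> (bool \<Rightarrow> 'a set) \<Rightarrow> bool \<Rightarrow> 'a list \<Rightarrow> bool" where
  "alternating G H c [] \<longleftrightarrow> True"
| "alternating G H c (x # xs) \<longleftrightarrow> x \<in> H c \<and> x \<noteq> \<one>\<^bsub>G\<^esub> \<and> alternating G H (\<not> c) xs"

text \<open>The internal description by normal forms serves the Coxeter group, its Artin group and
  its double alike, without a common concrete model.\<close>

locale free_prod = group G for G (structure) +
  fixes H :: "bool \<Rightarrow> 'a set"
  assumes H_subgroup: "subgroup (H c) G"
    and alternating_prodl: "alternating G H c xs \<Longrightarrow> xs \<noteq> [] \<Longrightarrow> prodl G xs \<noteq> \<one>"
    and H_generates: "g \<in> carrier G \<Longrightarrow> \<exists>xs. set xs \<subseteq> H True \<union> H False \<and> prodl G xs = g"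
begin

lemma H_carrier: "x \<in> H c \<Longrightarrow> x \<in> carrier G"
  using subgroup.mem_carrier[OF H_subgroup] .

lemma H_one [simp]: "\<one> \<in> H c"
  using subgroup.one_closed[OF H_subgroup] .

lemma H_mult: "x \<in> H c \<Longrightarrow> y \<in> H c \<Longrightarrow> x \<otimes> y \<in> H c"
  using subgroup.m_closed[OF H_subgroup] .

lemma H_inv: "x \<in> H c \<Longrightarrow> inv x \<in> H c"
  using subgroup.m_inv_closed[OF H_subgroup] .

lemma H_inv_mult_commute:
  "x \<in> carrier G \<Longrightarrow> y \<in> carrier G \<Longrightarrow> inv x \<otimes> y \<in> H c \<Longrightarrow> inv y \<otimes> x \<in> H c"
  using H_inv[of "inv x \<otimes> y" c] by (simp add: inv_mult_group)

lemma H_inv_mult_trans: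
  assumes "x \<in> carrier G" "y \<in> carrier G" "z \<in> carrier G"
    and "inv x \<otimes> y \<in> H c" "inv y \<otimes> z \<in> H c"
  shows "inv x \<otimes> z \<in> H c"
proof -
  have "(inv x \<otimes> y) \<otimes> (inv y \<otimes> z) = inv x \<otimes> z"
    using assms(1-3) by (simp add: m_assoc) (simp add: m_assoc[symmetric])
  then show ?thesis using H_mult[OF assms(4,5)] by simp
qed

lemma alternating_carrier: "alternating G H c xs \<Longrightarrow> set xs \<subseteq> carrier G"
  by (induction xs arbitrary: c) (auto intro: H_carrier)

text \<open>If the product lay in the other factor, its inverse could be put in front of
  \<open>xs\<close>, giving a nonempty normal form of the identity.\<close>

lemma alternating_not_in:
  assumes "alternating G H d xs" "xs \<noteq> []"
  shows "prodl G xs \<notin> H (\<not> d)"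
proof
  assume p: "prodl G xs \<in> H (\<not> d)"
  have np: "prodl G xs \<noteq> \<one>" using alternating_prodl assms by blast
  have c: "prodl G xs \<in> carrier G" using prodl_closed alternating_carrier assms by blast
  have "inv (prodl G xs) \<noteq> \<one>" using c np by (metis inv_one inv_inv)
  then have "alternating G H (\<not> d) (inv (prodl G xs) # xs)" using p H_inv assms by auto
  from alternating_prodl[OF this] show False using c by simp
qed

text \<open>The element \<open>e\<close> stands for the edge of the Bass--Serre tree joining the vertices
  \<open>e H True\<close> and \<open>e H False\<close>; a path starts at the vertex \<open>u H c\<close>.\<close>

primrec path :: "bool \<Rightarrow> 'a \<Rightarrow> 'a list \<Rightarrow> bool" where
  "path c u [] \<longleftrightarrow> True"
| "path c u (e # es) \<longleftrightarrow> e \<in> carrier G \<and> inv u \<otimes> e \<in> H c \<and> path (\<not> c) e es"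

lemma path_carrier: "path c u es \<Longrightarrow> set es \<subseteq> carrier G"
  by (induction es arbitrary: c u) auto

lemma even_eq_Not:
  "(even (n :: nat) = (\<not> c)) \<longleftrightarrow> (odd n = c)"
  "(even n = (odd n = c)) \<longleftrightarrow> \<not> c"
  by blast+

lemma path_append:
  "path c u (xs @ ys) \<longleftrightarrow> path c u xs \<and> path (even (length xs) = c) (last (u # xs)) ys"
  by (induction xs arbitrary: c u) (auto simp: even_eq_Not)

text \<open>A path depends only on its starting vertex, and two representatives of that coset differ
  by an element of \<open>H c\<close>.\<close>

lemma path_cong:
  assumes "inv u \<otimes> u' \<in> H c" "u \<in> carrier G" "u' \<in> carrier G"
  shows "path c u es \<longleftrightarrow> path c u' es"
proof (cases es)
  case (Cons e es')
  have "inv u \<otimes> e \<in> H c \<longleftrightarrow> inv u' \<otimes> e \<in> H c" if "e \<in> carrier G"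
    using H_inv_mult_trans H_inv_mult_commute assms that by blast
  then show ?thesis using Cons by auto
qed simp

lemma path_mult:
  assumes "x \<in> carrier G" "u \<in> carrier G" "path c u es"
  shows "path c (x \<otimes> u) (map ((\<otimes>) x) es)"
  using assms(2,3)
proof (induction es arbitrary: c u)
  case (Cons e es)
  have "inv (x \<otimes> u) \<otimes> (x \<otimes> e) = inv u \<otimes> e"
    using assms(1) Cons.prems by (simp add: inv_mult_group m_assoc) (simp add: m_assoc[symmetric])
  then show ?case using Cons assms(1) by simp
qed simp

text \<open>Consecutive edges share a vertex, so the step between them lies in one factor, and the
  factors alternate. Distinct neighbours make every step nontrivial: reduced paths are normal
  forms.\<close>

lemma path_steps:
  assumes "path d e es" "distinct_adj (e # es)" "es \<noteq> []" "e \<in> carrier G"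
  shows "\<exists>xs. alternating G H d xs \<and> xs \<noteq> [] \<and> prodl G xs = inv e \<otimes> last es"
  using assms
proof (induction es arbitrary: d e)
  case (Cons f es)
  have f: "f \<in> carrier G" "inv e \<otimes> f \<in> H d" "e \<noteq> f" using Cons.prems by auto
  then have ne: "inv e \<otimes> f \<noteq> \<one>" using Cons.prems by (metis inv_solve_left one_closed r_one)
  show ?case
  proof (cases "es = []")
    case True
    then show ?thesis using f ne Cons.prems by (intro exI[of _ "[inv e \<otimes> f]"]) simp
  next
    case False
    then obtain xs where xs: "alternating G H (\<not> d) xs" "prodl G xs = inv f \<otimes> last es"
      using Cons.IH[of "\<not> d" f] Cons.prems f by auto
    have "last es \<in> carrier G" using False Cons.prems path_carrier[of d e "f # es"] by auto
    then have "(inv e \<otimes> f) \<otimes> (inv f \<otimes> last es) = inv e \<otimes> last es"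
      using f Cons.prems by (simp add: m_assoc) (simp add: m_assoc[symmetric])
    then show ?thesis using xs f ne False by (intro exI[of _ "(inv e \<otimes> f) # xs"]) simp
  qed
qed simp

text \<open>The steps after the first edge are a normal form starting in the other factor, while a
  return to the start vertex would put their product into \<open>H c\<close>. This is the absence of
  circuits in the tree.\<close>

lemma path_last_near:
  assumes "path c u es" "distinct_adj es" "es \<noteq> []" "u \<in> carrier G" "inv u \<otimes> last es \<in> H c"
  shows "length es = 1"
proof (rule ccontr)
  assume n: "length es \<noteq> 1"
  obtain e es' where es: "es = e # es'" using assms(3) by (cases es) auto
  with n have ne: "es' \<noteq> []" by auto
  have e: "e \<in> carrier G" "inv u \<otimes> e \<in> H c" using assms es by auto
  have l: "last es' \<in> carrier G" using path_carrier[OF assms(1)] ne es by auto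
  obtain xs where xs: "alternating G H (\<not> c) xs" "xs \<noteq> []" "prodl G xs = inv e \<otimes> last es'"
    using path_steps[of "\<not> c" e es'] assms es ne by auto
  have "inv e \<otimes> last es' \<in> H c"
    using H_inv_mult_trans[OF e(1) assms(4) l] H_inv_mult_commute[OF assms(4) e] assms(5) ne es
    by auto
  then show False using alternating_not_in[OF xs(1,2)] xs(3) by simp
qed

text \<open>The part between two visits to one edge would be a reduced path of length at least two
  ending next to its start.\<close>

lemma path_distinct:
  assumes "path c u es" "distinct_adj es" "u \<in> carrier G"
  shows "distinct es"
  using assms
proof (induction es arbitrary: c u)
  case (Cons e es)
  have "e \<notin> set es"
  proof
    assume "e \<in> set es"
    then obtain as bs where "es = as @ e # bs" by (meson split_list)
    then have "path c u (e # as @ [e])" "distinct_adj (e # as @ [e])"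
      using Cons.prems path_append[of c u "e # as @ [e]" bs]
        distinct_adj_appendD1[of "e # as @ [e]" bs] by auto
    from path_last_near[OF this] show False using Cons.prems by auto
  qed
  moreover have "distinct es" using Cons.IH[of "\<not> c" e] Cons.prems distinct_adj_ConsD[OF Cons.prems(2)] by simp
  ultimately show ?case by simp
qed simp

lemma path_rev:
  assumes "path c u es" "es \<noteq> []" "u \<in> carrier G"
  shows "path (even (length es) = c) (last es) (rev es)"
  using assms
proof (induction es arbitrary: c u)
  case (Cons e es)
  show ?case
  proof (cases "es = []")
    case False
    have e: "e \<in> carrier G" using Cons.prems by simp
    have 1: "path (even (length es) = (\<not> c)) (last es) (rev es)"
      using Cons.IH[of "\<not> c" e] Cons.prems False by auto
    have h: "inv e \<otimes> hd es \<in> H (\<not> c)" "hd es \<in> carrier G"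
      using Cons.prems False by (cases es; auto)+
    then have "inv (hd es) \<otimes> e \<in> H (\<not> c)" using H_inv_mult_commute e by blast
    then have "path (\<not> c) (hd es) [e]" using e by simp
    moreover have "last (last es # rev es) = hd es" using False by (simp add: last_rev)
    ultimately show ?thesis using 1 False by (simp add: path_append even_eq_Not)
  qed (use Cons.prems in auto)
qed simp

text \<open>Where the paths first separate, the reverse of one followed by the other would be a
  reduced circuit. The parity condition makes the two end vertices cosets of the same factor, so
  that they can be compared.\<close>

lemma path_unique:
  assumes "path c u L" "path c u M" "distinct_adj L" "distinct_adj M" "u \<in> carrier G"
    and "even (length L) = even (length M)"
    and "inv (last (u # L)) \<otimes> last (u # M) \<in> H (even (length L) = c)"
  shows "L = M"
  using assms
proof (induction L arbitrary: c u M)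
  case Nil
  show ?case
  proof (rule ccontr)
    assume "[] \<noteq> M"
    then show False using path_last_near[of c u M] Nil by simp
  qed
next
  case (Cons e L)
  have e: "e \<in> carrier G" "inv u \<otimes> e \<in> H c" using Cons.prems by auto
  show ?case
  proof (cases M)
    case Nil
    have "last (e # L) \<in> carrier G" using path_carrier[OF Cons.prems(1)] last_in_set[of "e # L"] by blast
    then have "inv u \<otimes> last (e # L) \<in> H c"
      using Cons.prems(5-7) Nil H_inv_mult_commute[of "last (e # L)" u] by auto
    then show ?thesis using path_last_near[OF Cons.prems(1,3)] Cons.prems(5,6) Nil by simp
  next
    case M: (Cons e' M')
    have e': "e' \<in> carrier G" "inv u \<otimes> e' \<in> H c" using Cons.prems M by auto
    show ?thesis
    proof (cases "e = e'")
      case True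
      have "L = M'"
      proof (rule Cons.IH[of "\<not> c" e])
        show "distinct_adj L" "distinct_adj M'"
          using distinct_adj_ConsD[of e L] distinct_adj_ConsD[of e' M'] Cons.prems(3,4) M by simp_all
        show "inv (last (e # L)) \<otimes> last (e # M') \<in> H (even (length L) = (\<not> c))"
          using Cons.prems(7) M True by (simp add: even_eq_Not)
      qed (use Cons.prems M True e in auto)
      then show ?thesis using True M by simp
    next
      case False
      let ?d = "even (length (e # L)) = c"
      let ?l = "last (e # L)"
      have 1: "path ?d ?l (rev (e # L))" using path_rev[OF Cons.prems(1)] Cons.prems(5) by simp
      have "path c e M" using path_cong[OF e(2) Cons.prems(5) e(1)] Cons.prems(2) by simp
      moreover have "(even (length (rev (e # L))) = ?d) = c" by auto
      moreover have "last (?l # rev (e # L)) = e" by simp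
      ultimately have 2: "path ?d ?l (rev (e # L) @ M)" using 1 unfolding path_append by simp
      have "distinct_adj (rev (e # L))" using Cons.prems(3) distinct_adj_rev by blast
      then have 3: "distinct_adj (rev (e # L) @ M)"
        using Cons.prems(4) M False by (auto simp: distinct_adj_append_iff)
      have "?l \<in> carrier G" using path_carrier[OF Cons.prems(1)] last_in_set[of "e # L"] by blast
      from path_last_near[OF 2 3 _ this] Cons.prems(7) M show ?thesis by simp
    qed
  qed
qed

text \<open>Edges cancel one by one at the junction. Since the final edge of the walk may cancel
  too, the last conjunct keeps its end vertex rather than its last edge.\<close>

lemma path_cancel:
  assumes "path c u (L @ M)" "distinct_adj L" "distinct_adj M" "u \<in> carrier G"
  shows "\<exists>A B A'. L = A @ B \<and> M = rev B @ A' \<and> path c u (A @ A') \<and> distinct_adj (A @ A')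
    \<and> inv (last (u # A @ A')) \<otimes> last (u # L @ M) \<in> H (even (length (L @ M)) = c)"
  using assms
proof (induction L arbitrary: M rule: rev_induct)
  case (snoc e L)
  show ?case
  proof (cases "M \<noteq> [] \<and> hd M = e")
    case False
    then have "distinct_adj ((L @ [e]) @ M)"
      using snoc.prems by (cases M) (auto simp: distinct_adj_append_iff)
    moreover have "last (u # L @ e # M) \<in> carrier G"
      using path_carrier[OF snoc.prems(1)] last_in_set[of "L @ e # M"] by auto
    ultimately show ?thesis using snoc.prems
      by (intro exI[of _ "L @ [e]"] exI[of _ "[]"] exI[of _ M]) simp
  next
    case True
    then obtain M' where M: "M = e # M'" by (cases M) auto
    let ?d = "even (length L) = c" and ?l = "last (u # L)"
    have p: "path c u L" "path ?d ?l [e]" "path (\<not> ?d) e [e]" "path (\<not> \<not> ?d) e M'"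
      using snoc.prems(1) unfolding M by (auto simp: path_append)
    have e: "e \<in> carrier G" "inv ?l \<otimes> e \<in> H ?d" using p by auto
    have l: "?l \<in> carrier G" using path_carrier[OF p(1)] snoc.prems(4) last_in_set[of "u # L"] by auto
    have "path ?d ?l M'" using path_cong[OF e(2) l e(1)] p(4) by simp
    then have pL: "path c u (L @ M')" using p(1) by (simp add: path_append)
    moreover have "distinct_adj L" using snoc.prems(2) distinct_adj_appendD1 by blast
    moreover have "distinct_adj M'" using snoc.prems(3) M distinct_adj_ConsD[of e M'] by simp
    ultimately obtain A B A' where A: "L = A @ B" "M' = rev B @ A'" "path c u (A @ A')"
      "distinct_adj (A @ A')"
      "inv (last (u # A @ A')) \<otimes> last (u # L @ M') \<in> H (even (length (L @ M')) = c)"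
      using snoc.IH snoc.prems(4) by blast
    have "inv (last (u # A @ A')) \<otimes> last (u # (L @ [e]) @ M) \<in> H (even (length ((L @ [e]) @ M)) = c)"
    proof (cases "M' = []")
      case True
      have "last (u # A @ A') \<in> carrier G"
        using path_carrier[OF A(3)] snoc.prems(4) last_in_set[of "u # A @ A'"] by auto
      then show ?thesis using H_inv_mult_trans[of _ ?l e ?d] A(5) e l M True by auto
    next
      case False
      then show ?thesis using A(5) M by simp
    qed
    then show ?thesis using A M by (intro exI[of _ A] exI[of _ "B @ [e]"] exI[of _ A']) simp
  qed
next
  case Nil
  then have "last (u # M) \<in> carrier G"
    using path_carrier[of c u M] last_in_set[of "u # M"] by auto
  with Nil show ?case by (intro exI[of _ "[]"] exI[of _ M]) simp
qed

end

section \<open>Tuples of elliptic elements\<close>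

text \<open>A tuple together with a walk in the tree: letters of a leaf fix the current vertex, and
  \<open>Branch e t f\<close> crosses the edge \<open>e\<close>, reads \<open>t\<close> at the far vertex, crosses back
  and continues with \<open>f\<close>.\<close>

datatype 'a forest = Leaf "'a list" | Branch 'a "'a forest" "'a forest"

primrec flat :: "'a forest \<Rightarrow> 'a list" where
  "flat (Leaf xs) = xs"
| "flat (Branch e t f) = flat t @ flat f"

primrec branches :: "'a forest \<Rightarrow> nat" where
  "branches (Leaf xs) = 0"
| "branches (Branch e t f) = Suc (branches t + branches f)"

text \<open>A leaf stands only at the end of a sequence of branches, so letters appended at the
  current vertex have to join that final leaf.\<close>

primrec add_leaf :: "'a forest \<Rightarrow> 'a list \<Rightarrow> 'a forest" where
  "add_leaf (Leaf xs) ys = Leaf (xs @ ys)"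
| "add_leaf (Branch e t f) ys = Branch e t (add_leaf f ys)"

lemma flat_add_leaf [simp]: "flat (add_leaf f ys) = flat f @ ys"
  by (induction f) auto

lemma branches_add_leaf [simp]: "branches (add_leaf f ys) = branches f"
  by (induction f) auto

context free_prod
begin

text \<open>The group acts on the tree from the left: edges are translated, and the letters, which
  are stabilizer elements, are conjugated.\<close>

primrec conj_forest :: "'a \<Rightarrow> 'a forest \<Rightarrow> 'a forest" where
  "conj_forest x (Leaf xs) = Leaf (map (conjg G x) xs)"
| "conj_forest x (Branch e t f) = Branch (x \<otimes> e) (conj_forest x t) (conj_forest x f)"

lemma flat_conj_forest [simp]: "flat (conj_forest x f) = map (conjg G x) (flat f)"
  by (induction f) auto

lemma branches_conj_forest [simp]: "branches (conj_forest x f) = branches f"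
  by (induction f) auto

text \<open>The condition on a letter says that it fixes the vertex \<open>u H c\<close>; the
  condition on an edge says that it is incident with this vertex.\<close>

primrec forest :: "bool \<Rightarrow> 'a \<Rightarrow> 'a forest \<Rightarrow> bool" where
  "forest c u (Leaf xs) \<longleftrightarrow> set xs \<subseteq> carrier G \<and> (\<forall>x\<in>set xs. inv u \<otimes> x \<otimes> u \<in> H c)"
| "forest c u (Branch e t f) \<longleftrightarrow>
     e \<in> carrier G \<and> inv u \<otimes> e \<in> H c \<and> forest (\<not> c) e t \<and> forest c u f"

text \<open>The walk from the root to its translate by the product of the tuple: each letter translates
  what follows.\<close>

primrec trace :: "'a forest \<Rightarrow> 'a list" where
  "trace (Leaf xs) = []"
| "trace (Branch e t f) =
     e # trace t @ [prodl G (flat t) \<otimes> e] @ map ((\<otimes>) (prodl G (flat t))) (trace f)"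

lemma forest_flat: "forest c u f \<Longrightarrow> set (flat f) \<subseteq> carrier G"
  by (induction f arbitrary: c u) (simp, simp, blast)

lemma prodl_flat: "forest c u f \<Longrightarrow> prodl G (flat f) \<in> carrier G"
  using forest_flat by blast

lemma elliptic_cong:
  assumes "inv u \<otimes> v \<in> H c" "u \<in> carrier G" "v \<in> carrier G" "x \<in> carrier G"
    and "inv u \<otimes> x \<otimes> u \<in> H c"
  shows "inv v \<otimes> x \<otimes> v \<in> H c"
proof -
  have "inv v \<otimes> x \<otimes> v = (inv v \<otimes> u) \<otimes> (inv u \<otimes> x \<otimes> u) \<otimes> (inv u \<otimes> v)"
    using assms(2-4) by (simp add: m_assoc) (simp add: m_assoc[symmetric])
  moreover have "inv v \<otimes> u \<in> H c" using H_inv_mult_commute[OF assms(2,3,1)] .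
  ultimately show ?thesis using H_mult assms(1,5) by simp
qed

lemma forest_cong:
  assumes "inv u \<otimes> v \<in> H c" "u \<in> carrier G" "v \<in> carrier G"
  shows "forest c u f \<longleftrightarrow> forest c v f"
proof -
  have *: "forest c u f \<Longrightarrow> forest c v f"
    if "inv u \<otimes> v \<in> H c" "u \<in> carrier G" "v \<in> carrier G" for u v
  proof (induction f)
    case (Leaf xs)
    then show ?case using elliptic_cong[OF that] by (simp add: subset_iff)
  next
    case (Branch e t f)
    have "inv v \<otimes> u \<in> H c" using H_inv_mult_commute that by blast
    then have "inv v \<otimes> e \<in> H c" using Branch.prems that H_inv_mult_trans[of v u e c] by simp
    then show ?case using Branch by simp
  qed
  show ?thesis using *[OF assms] *[OF H_inv_mult_commute[OF assms(2,3,1)] assms(3,2)] by blast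
qed

lemma forest_add_leaf:
  "forest c u f \<Longrightarrow> forest c u (Leaf ys) \<Longrightarrow> forest c u (add_leaf f ys)"
  by (induction f) auto

lemma inv_mult_cancel:
  assumes "x \<in> carrier G" "u \<in> carrier G" "v \<in> carrier G"
  shows "inv (x \<otimes> u) \<otimes> (x \<otimes> v) = inv u \<otimes> v"
  using assms by (simp add: inv_mult_group m_assoc) (simp add: m_assoc[symmetric])

lemma conj_cancel:
  assumes "g \<in> carrier G" "u \<in> carrier G" "x \<in> carrier G"
  shows "inv (g \<otimes> u) \<otimes> conjg G g x \<otimes> (g \<otimes> u) = inv u \<otimes> x \<otimes> u"
  using assms by (simp add: conjg_def inv_mult_group m_assoc) (simp add: m_assoc[symmetric])

lemma forest_conj:
  "x \<in> carrier G \<Longrightarrow> u \<in> carrier G \<Longrightarrow> forest c u f \<Longrightarrow> forest c (x \<otimes> u) (conj_forest x f)"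
  by (induction f arbitrary: c u) (auto simp: conj_cancel inv_mult_cancel subset_iff)

lemma elliptic_prodl:
  assumes "set xs \<subseteq> carrier G" "\<forall>x\<in>set xs. inv u \<otimes> x \<otimes> u \<in> H c" "u \<in> carrier G"
  shows "inv u \<otimes> (prodl G xs \<otimes> u) \<in> H c"
  using assms(1,2)
proof (induction xs)
  case Nil
  then show ?case using assms(3) by simp
next
  case (Cons x xs)
  have p: "prodl G xs \<in> carrier G" using Cons.prems by auto
  have "inv u \<otimes> (x \<otimes> prodl G xs \<otimes> u) = (inv u \<otimes> x \<otimes> u) \<otimes> (inv u \<otimes> (prodl G xs \<otimes> u))"
    using Cons.prems assms(3) p by (simp add: m_assoc) (simp add: m_assoc[symmetric])
  then show ?case using Cons H_mult by auto
qed

lemma inj_on_mult: "x \<in> carrier G \<Longrightarrow> inj_on ((\<otimes>) x) (carrier G)"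
  by (auto simp: inj_on_def)

text \<open>Every branch is crossed once in each direction, hence the even length. Reading a block
  translates the rest of the walk by its product, so the walk ends at the translate of its start by
  the whole product.\<close>

lemma trace_path_end:
  assumes "forest c u f" "u \<in> carrier G"
  shows "path c u (trace f) \<and> even (length (trace f))
    \<and> inv (last (u # trace f)) \<otimes> (prodl G (flat f) \<otimes> u) \<in> H c"
  using assms
proof (induction f arbitrary: c u)
  case (Leaf xs)
  then show ?case using elliptic_prodl[of xs u c] by simp
next
  case (Branch e t f)
  let ?p = "prodl G (flat t)" and ?q = "prodl G (flat f)"
  have e: "e \<in> carrier G" "inv u \<otimes> e \<in> H c" and t: "forest (\<not> c) e t" and f: "forest c u f"
    using Branch.prems by auto
  have u: "u \<in> carrier G" by fact
  have p: "?p \<in> carrier G" and q: "?q \<in> carrier G" using t f prodl_flat by blast+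
  note T = Branch.IH(1)[OF t e(1)] and F = Branch.IH(2)[OF f u]
  have uf: "path c (?p \<otimes> u) (map ((\<otimes>) ?p) (trace f))" using path_mult[OF p u] F by blast
  have pe: "inv (?p \<otimes> u) \<otimes> (?p \<otimes> e) \<in> H c" using e u p by (simp add: inv_mult_cancel)
  then have 1: "path c (?p \<otimes> e) (map ((\<otimes>) ?p) (trace f))"
    using uf path_cong[OF pe] p u e by simp
  have "path c u (trace (Branch e t f))"
    using T 1 e p by (simp add: path_append)
  moreover have "even (length (trace (Branch e t f)))" using T F by simp
  moreover have "inv (last (u # trace (Branch e t f))) \<otimes> (?p \<otimes> (?q \<otimes> u)) \<in> H c"
  proof (cases "trace f = []")
    case True
    have "inv u \<otimes> (?q \<otimes> u) \<in> H c" using F True by simp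
    moreover have "inv e \<otimes> u \<in> H c" using H_inv_mult_commute e u by blast
    ultimately have "inv e \<otimes> (?q \<otimes> u) \<in> H c" using H_inv_mult_trans[of e u "?q \<otimes> u" c] e u q by simp
    then show ?thesis using True p e u q by (simp add: inv_mult_cancel)
  next
    case False
    have "last (trace f) \<in> carrier G" using False path_carrier F last_in_set by blast
    then show ?thesis using F False p u q by (simp add: last_map inv_mult_cancel)
  qed
  moreover have "prodl G (flat (Branch e t f)) \<otimes> u = ?p \<otimes> (?q \<otimes> u)"
    using forest_flat[OF t] forest_flat[OF f] p q u by (simp add: prodl_append m_assoc)
  ultimately show ?case by simp
qed

lemma trace_carrier: "forest c u f \<Longrightarrow> u \<in> carrier G \<Longrightarrow> set (trace f) \<subseteq> carrier G"
  using trace_path_end path_carrier by blast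

text \<open>Juxtaposition at a common vertex. The leaf of the first forest has to travel past the
  second one to reach the final leaf, and this conjugates the second forest by its product.\<close>

primrec app :: "'a forest \<Rightarrow> 'a forest \<Rightarrow> 'a forest" where
  "app (Leaf xs) g = add_leaf (conj_forest (prodl G xs) g) xs"
| "app (Branch e t f) g = Branch e t (app f g)"

lemma branches_app [simp]: "branches (app f g) = branches f + branches g"
  by (induction f) auto

lemma forest_app:
  assumes "forest c u f" "forest c u g" "u \<in> carrier G"
  shows "forest c u (app f g)"
  using assms
proof (induction f)
  case (Leaf xs)
  let ?p = "prodl G xs"
  have p: "?p \<in> carrier G" using Leaf.prems by auto
  have "inv u \<otimes> (?p \<otimes> u) \<in> H c" using elliptic_prodl Leaf.prems by simp
  then have "forest c u (conj_forest ?p g)"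
    using forest_cong[of u "?p \<otimes> u" c] forest_conj[OF p] Leaf.prems p by simp
  then show ?case using Leaf.prems by (simp add: forest_add_leaf)
qed auto

lemma flat_app:
  assumes "forest c u f" "set (flat g) \<subseteq> carrier G"
  shows "heq G (flat f @ flat g) (flat (app f g))"
  using assms
proof (induction f)
  case (Leaf xs)
  then show ?case using heq_move[of xs "flat g"] by simp
next
  case (Branch e t f)
  then show ?case using heq_context[of "flat f @ flat g" _ "flat t" "[]"] forest_flat[of "\<not> c" e t] by simp
qed

end

section \<open>Reducing the walk of a tuple\<close>

text \<open>All equivalent tuples are included because a block with trivial product may become
  contiguous only after some moves. Factorizations of minimal length have this property.\<close>

definition (in group) nondegenerate :: "'a list \<Rightarrow> bool" where
  "nondegenerate xs \<longleftrightarrow>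
     set xs \<subseteq> carrier G \<and> (\<forall>us vs ws. heq G xs (us @ vs @ ws) \<longrightarrow> prodl G vs = \<one> \<longrightarrow> vs = [])"

context group
begin

lemma nondegenerate_sub:
  assumes "nondegenerate (us @ xs @ ws)"
  shows "nondegenerate xs"
  unfolding nondegenerate_def
proof (intro conjI allI impI)
  fix as vs bs assume "heq G xs (as @ vs @ bs)" "prodl G vs = \<one>"
  moreover have "set us \<subseteq> carrier G" "set ws \<subseteq> carrier G" using assms by (auto simp: nondegenerate_def)
  ultimately have "heq G (us @ xs @ ws) ((us @ as) @ vs @ (bs @ ws))"
    using heq_context[of xs "as @ vs @ bs" us ws] by simp
  then show "vs = []" using assms \<open>prodl G vs = \<one>\<close> unfolding nondegenerate_def by blast
qed (use assms in \<open>simp add: nondegenerate_def\<close>)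

lemma nondegenerate_heq: "nondegenerate xs \<Longrightarrow> heq G xs ys \<Longrightarrow> nondegenerate ys"
  unfolding nondegenerate_def using heq_trans heq_carrier by blast

end

context free_prod
begin

lemma trace_eq_Nil: "trace f = [] \<longleftrightarrow> (\<exists>xs. f = Leaf xs)"
  by (cases f) auto

text \<open>The hypothesis says that the last crossing uses the translate of \<open>e\<close> by the
  product. Once the letters of the final leaf are moved in front, the last branch is one over
  \<open>e\<close> itself, so what it encloses is a forest at the other end of \<open>e\<close>.
  That branch is the one that is saved.\<close>

lemma branch_at_end:
  assumes "forest c e t" "e \<in> carrier G" "trace t \<noteq> []" "last (trace t) = prodl G (flat t) \<otimes> e"
  shows "\<exists>g f. forest c e g \<and> forest (\<not> c) e f \<and> heq G (flat t) (flat g @ flat f)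
    \<and> branches g + branches f < branches t"
  using assms(1,3,4)
proof (induction t)
  case (Branch e1 t r)
  have t: "forest (\<not> c) e1 t" and r: "forest c e r" and e1: "e1 \<in> carrier G"
    using Branch.prems by auto
  let ?p = "prodl G (flat t)" and ?q = "prodl G (flat r)"
  have p: "?p \<in> carrier G" and q: "?q \<in> carrier G" using prodl_flat t r by auto
  have pq: "prodl G (flat (Branch e1 t r)) \<otimes> e = ?p \<otimes> (?q \<otimes> e)"
    using forest_flat t r p q assms(2) by (simp add: prodl_append m_assoc)
  show ?case
  proof (cases "trace r = []")
    case True
    then obtain xs where xs: "r = Leaf xs" using trace_eq_Nil by blast
    have "?p \<otimes> e1 = ?p \<otimes> (?q \<otimes> e)" using Branch.prems(3) pq True by simp
    then have e1q: "e1 = ?q \<otimes> e" using p q e1 assms(2) by simp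
    then have "inv ?q \<otimes> e1 = e" using q assms(2) by (simp add: m_assoc[symmetric])
    then have "forest (\<not> c) e (conj_forest (inv ?q) t)"
      using forest_conj[OF _ e1 t, of "inv ?q"] q by simp
    moreover have "heq G (flat (Branch e1 t r)) (flat r @ flat (conj_forest (inv ?q) t))"
      using heq_move'[of "flat t" "flat r"] forest_flat t r by simp
    ultimately show ?thesis using r xs
      by (intro exI[of _ r] exI[of _ "conj_forest (inv ?q) t"]) simp
  next
    case False
    then have "?p \<otimes> last (trace r) = ?p \<otimes> (?q \<otimes> e)"
      using Branch.prems(3) pq by (simp add: last_map)
    moreover have "last (trace r) \<in> carrier G"
      using trace_carrier[OF r assms(2)] False last_in_set by blast
    ultimately have "last (trace r) = ?q \<otimes> e" using p q assms(2) by simp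
    then obtain g f where gf: "forest c e g" "forest (\<not> c) e f" "heq G (flat r) (flat g @ flat f)"
      "branches g + branches f < branches r"
      using Branch.IH(2) r False by blast
    have "heq G (flat t @ flat r) (flat t @ flat g @ flat f)"
      using heq_context[OF gf(3), of "flat t" "[]"] forest_flat t by simp
    then show ?thesis using gf Branch.prems
      by (intro exI[of _ "Branch e1 t g"] exI[of _ f]) simp
  qed
qed simp

text \<open>An equal pair of neighbours lies inside one of the two subwalks or at one of the four
  junctions. At a junction the walk turns back over the edge just crossed, and what follows is
  regrouped at the vertex reached. Crossing back directly over the same edge would mean a block with
  trivial product, which nondegeneracy allows only if the block is empty.\<close>

lemma forest_reduce:
  assumes "forest c u f" "u \<in> carrier G" "nondegenerate (flat f)" "\<not> distinct_adj (trace f)"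
  shows "\<exists>f'. forest c u f' \<and> heq G (flat f) (flat f') \<and> branches f' < branches f"
  using assms
proof (induction f arbitrary: c u)
  case (Branch e t f)
  let ?p = "prodl G (flat t)"
  have e: "e \<in> carrier G" "inv u \<otimes> e \<in> H c" and t: "forest (\<not> c) e t" and f: "forest c u f"
    and u: "u \<in> carrier G" using Branch.prems by auto
  have p: "?p \<in> carrier G" using t prodl_flat by blast
  have ft: "set (flat t) \<subseteq> carrier G" and ff: "set (flat f) \<subseteq> carrier G"
    using t f forest_flat by blast+
  have nt: "nondegenerate (flat t)" and nf: "nondegenerate (flat f)"
    using nondegenerate_sub[of "[]" "flat t" "flat f"] nondegenerate_sub[of "flat t" "flat f" "[]"]
      Branch.prems(3) by simp_all
  have tt: "set (trace t) \<subseteq> carrier G" "set (trace f) \<subseteq> carrier G"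
    using trace_carrier t f e u by blast+
  consider "\<not> distinct_adj (trace t)" | "\<not> distinct_adj (trace f)"
    | "trace t = []" "?p \<otimes> e = e" | "trace t \<noteq> []" "hd (trace t) = e"
    | "trace t \<noteq> []" "last (trace t) = ?p \<otimes> e" | "trace f \<noteq> []" "hd (trace f) = e"
  proof (rule ccontr)
    assume n: "\<not> thesis"
    have "distinct_adj (trace t)" "distinct_adj (trace f)" using n that by blast+
    moreover from this have "distinct_adj (map ((\<otimes>) ?p) (trace f))"
      using inj_on_subset[OF inj_on_mult[OF p] tt(2)] distinct_adj_map_iff by blast
    moreover have "trace f \<noteq> [] \<Longrightarrow> hd (map ((\<otimes>) ?p) (trace f)) \<noteq> ?p \<otimes> e"
      using n that(6) p e tt(2) by (cases "trace f") auto
    moreover have "trace t = [] \<Longrightarrow> e \<noteq> ?p \<otimes> e" using n that(3) by metis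
    moreover have "trace t \<noteq> [] \<Longrightarrow> hd (trace t) \<noteq> e \<and> last (trace t) \<noteq> ?p \<otimes> e" using n that(4,5) by blast
    ultimately have "distinct_adj ([e] @ trace t @ [?p \<otimes> e] @ map ((\<otimes>) ?p) (trace f))"
      unfolding distinct_adj_append_iff
      by (cases "trace t = []"; cases "trace f = []") (auto simp: hd_append)
    then have "distinct_adj (trace (Branch e t f))" by simp
    then show False using Branch.prems by simp
  qed
  then show ?case
  proof cases
    case 1
    then obtain t' where t': "forest (\<not> c) e t'" "heq G (flat t) (flat t')" "branches t' < branches t"
      using Branch.IH(1)[OF t e(1) nt] by blast
    then show ?thesis
      using heq_context[OF t'(2), of "[]" "flat f"] ff Branch.prems
      by (intro exI[of _ "Branch e t' f"]) simp
  next
    case 2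
    then obtain f' where f': "forest c u f'" "heq G (flat f) (flat f')" "branches f' < branches f"
      using Branch.IH(2)[OF f u nf] by blast
    then show ?thesis
      using heq_context[OF f'(2), of "flat t" "[]"] ft Branch.prems
      by (intro exI[of _ "Branch e t f'"]) simp
  next
    case 3
    then obtain xs where xs: "t = Leaf xs" using trace_eq_Nil by blast
    have "?p = \<one>" using 3 p e by (metis l_one one_closed right_cancel)
    then have "xs = []" using nt xs heq_refl[OF ft] unfolding nondegenerate_def
      by (metis append_Nil append_Nil2 flat.simps(1))
    then show ?thesis using f xs ff by (intro exI[of _ f]) (simp add: heq_refl)
  next
    \<comment> \<open>The branch is left again at once through \<open>e\<close>, so
      \<open>us\<close> is read at the old vertex and can be placed in front of the branch.\<close>
    case 4
    then obtain e' us r where r: "t = Branch e' us r" by (cases t) auto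
    then have "e' = e" using 4 by simp
    then have us: "forest c e us" "forest (\<not> c) e r" using t r by auto
    then have us': "forest c u us" using forest_cong[OF e(2) u e(1)] by simp
    have b: "forest c u (Branch e r f)" using us e f by simp
    have "heq G (flat us @ flat (Branch e r f)) (flat (app us (Branch e r f)))"
      by (rule flat_app[OF us' forest_flat[OF b]])
    then show ?thesis using forest_app[OF us' b u] r
      by (intro exI[of _ "app us (Branch e r f)"]) simp
  next
    \<comment> \<open>The mirror image: the final piece of the branch is read at the old vertex and
      joins the continuation.\<close>
    case 5
    then obtain g us where g: "forest (\<not> c) e g" "forest c e us" "heq G (flat t) (flat g @ flat us)"
      "branches g + branches us < branches t"
      using branch_at_end[OF t e(1)] by auto
    have us: "forest c u us" using forest_cong[OF e(2) u e(1)] g by simp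
    have "heq G (flat t @ flat f) (flat g @ flat us @ flat f)"
      using heq_context[OF g(3), of "[]" "flat f"] ff by simp
    also have "heq G (flat g @ flat us @ flat f) (flat g @ flat (app us f))"
      using heq_context[OF flat_app[OF us ff], of "flat g" "[]"] forest_flat[OF g(1)] by simp
    finally show ?thesis using g e forest_app[OF us f u]
      by (intro exI[of _ "Branch e g (app us f)"]) simp
  next
    \<comment> \<open>Two successive branches over the same edge merge into one.\<close>
    case 6
    then obtain e' us r where r: "f = Branch e' us r" by (cases f) auto
    then have "e' = e" using 6 by simp
    then have us: "forest (\<not> c) e us" "forest c u r" using f r by auto
    have "heq G (flat t @ flat us @ flat r) (flat (app t us) @ flat r)"
      using heq_context[OF flat_app[OF t], of us "[]" "flat r"] forest_flat us by simp
    then show ?thesis using us e forest_app[OF t us(1) e(1)] r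
      by (intro exI[of _ "Branch e (app t us) r"]) simp
  qed
qed simp

definition elliptic :: "'a \<Rightarrow> bool" where
  "elliptic x \<longleftrightarrow> (\<exists>u\<in>carrier G. \<exists>d. \<exists>k\<in>H d. x = conjg G u k)"

text \<open>The word \<open>ws\<close> describes a walk to the vertex fixed by the letter. A letter
  of \<open>ws\<close> from the factor of the current vertex does not move this vertex; before a
  letter from the other factor, the edge \<open>u\<close> is crossed.\<close>

lemma elliptic_forest1:
  assumes "set ws \<subseteq> H True \<union> H False" "k \<in> H d" "u \<in> carrier G"
  shows "\<exists>f. forest c u f \<and> flat f = [conjg G (u \<otimes> prodl G ws) k]"
  using assms(1,3)
proof (induction ws arbitrary: c u)
  case Nil
  have k: "k \<in> carrier G" using assms H_carrier by blast
  have *: "inv u \<otimes> conjg G u k \<otimes> u = k"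
    using k Nil.prems by (simp add: conjg_def m_assoc) (simp add: m_assoc[symmetric])
  then show ?case
  proof (cases "c = d")
    case True
    then show ?thesis using Nil * k assms by (intro exI[of _ "Leaf [conjg G u k]"]) simp
  next
    case False
    then have "(\<not> c) = d" by blast
    then show ?thesis using Nil * k assms
      by (intro exI[of _ "Branch u (Leaf [conjg G u k]) (Leaf [])"]) simp
  qed
next
  case (Cons w ws)
  obtain b where w: "w \<in> H b" using Cons.prems by auto
  have wc: "w \<in> carrier G" using w H_carrier by blast
  have ws: "set ws \<subseteq> carrier G" using Cons.prems H_carrier by auto
  have near: "inv u \<otimes> (u \<otimes> w) \<in> H b" using w wc Cons.prems by (simp add: m_assoc[symmetric])
  have "u \<otimes> w \<in> carrier G" using wc Cons.prems by simp
  then obtain f where f: "forest b (u \<otimes> w) f" "flat f = [conjg G (u \<otimes> w \<otimes> prodl G ws) k]"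
    using Cons.IH[of "u \<otimes> w" b] Cons.prems by auto
  have f': "forest b u f" using forest_cong[OF near] f Cons.prems wc by simp
  have fl: "flat f = [conjg G (u \<otimes> prodl G (w # ws)) k]"
    using f(2) wc ws Cons.prems prodl_closed by (simp add: m_assoc)
  show ?case
  proof (cases "c = b")
    case True
    then show ?thesis using f' fl by blast
  next
    case False
    then have "(\<not> c) = b" by blast
    then show ?thesis using f' fl Cons.prems by (intro exI[of _ "Branch u f (Leaf [])"]) simp
  qed
qed

lemma elliptic_carrier: "elliptic x \<Longrightarrow> x \<in> carrier G"
  unfolding elliptic_def using H_carrier by auto

lemma elliptic_forest:
  assumes "\<forall>x\<in>set xs. elliptic x"
  shows "\<exists>f. forest c \<one> f \<and> heq G xs (flat f)"
  using assms
proof (induction xs)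
  case Nil
  then show ?case by (intro exI[of _ "Leaf []"]) (simp add: heq_refl)
next
  case (Cons x xs)
  then obtain f where f: "forest c \<one> f" "heq G xs (flat f)" by auto
  obtain u d k where u: "u \<in> carrier G" "k \<in> H d" "x = conjg G u k"
    using Cons.prems unfolding elliptic_def by auto
  obtain ws where ws: "set ws \<subseteq> H True \<union> H False" "prodl G ws = u"
    using H_generates u by blast
  obtain g where g: "forest c \<one> g" "flat g = [x]"
    using elliptic_forest1[OF ws(1) u(2) one_closed, of c] ws u by auto
  have "heq G (x # xs) (x # flat f)" using heq_context[OF f(2), of "[x]" "[]"] Cons.prems
    by (simp add: elliptic_carrier)
  also have "heq G (x # flat f) (flat (app g f))"
    using flat_app[OF g(1) forest_flat[OF f(1)]] g by simp
  finally show ?case using forest_app[OF g(1) f(1) one_closed] by blast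
qed

text \<open>A forest with the fewest branches among all that represent the orbit cannot be reduced
  further.\<close>

theorem reduced_forest:
  assumes "\<forall>x\<in>set xs. elliptic x" "nondegenerate xs"
  shows "\<exists>f. forest c \<one> f \<and> heq G xs (flat f) \<and> distinct_adj (trace f)"
proof -
  define P where "P f \<longleftrightarrow> forest c \<one> f \<and> heq G xs (flat f)" for f
  obtain f where f: "P f" "\<And>g. P g \<Longrightarrow> branches f \<le> branches g"
    using elliptic_forest[OF assms(1), of c] exists_least_iff[of "\<lambda>n. \<exists>f. P f \<and> branches f = n"]
    unfolding P_def by (metis linorder_not_less)
  have "distinct_adj (trace f)"
  proof (rule ccontr)
    assume "\<not> distinct_adj (trace f)"
    moreover have "nondegenerate (flat f)" using f(1) assms(2) nondegenerate_heq unfolding P_def by blast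
    ultimately obtain f' where "forest c \<one> f'" "heq G (flat f) (flat f')" "branches f' < branches f"
      using forest_reduce[of c \<one> f] f(1) unfolding P_def by auto
    moreover from this have "P f'" using f(1) heq_trans unfolding P_def by blast
    ultimately show False using f(2)[of f'] by simp
  qed
  then show ?thesis using f(1) unfolding P_def by blast
qed

end

section \<open>Crossings of a walk and uniqueness of normal forms\<close>

context free_prod
begin

text \<open>A quadruple \<open>(i, j, a, b)\<close> records that the positions \<open>i\<close> and \<open>j\<close> of the trace
  are the two crossings of one branch, which encloses the letters numbered from \<open>a\<close> to \<open>b - 1\<close>.\<close>

primrec pairs :: "'a forest \<Rightarrow> (nat \<times> nat \<times> nat \<times> nat) set" where
  "pairs (Leaf xs) = {}"
| "pairs (Branch e t f) = insert (0, Suc (length (trace t)), 0, length (flat t))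
     ((\<lambda>(i, j, a, b). (Suc i, Suc j, a, b)) ` pairs t \<union>
      (\<lambda>(i, j, a, b). (i + length (trace t) + 2, j + length (trace t) + 2,
                       a + length (flat t), b + length (flat t))) ` pairs f)"

lemma pairs_bounds:
  "(i, j, a, b) \<in> pairs f \<Longrightarrow> i < j \<and> j < length (trace f) \<and> a \<le> b \<and> b \<le> length (flat f)"
  by (induction f arbitrary: i j a b) (auto, fastforce+)

lemma pairs_left: "(i, j, a, b) \<in> pairs t \<Longrightarrow> (Suc i, Suc j, a, b) \<in> pairs (Branch e t f)"
  unfolding pairs.simps by (rule insertI2, rule UnI1, rule rev_image_eqI, assumption, simp)

lemma pairs_right:
  "(i, j, a, b) \<in> pairs f \<Longrightarrow>
   (i + length (trace t) + 2, j + length (trace t) + 2, a + length (flat t), b + length (flat t))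
     \<in> pairs (Branch e t f)"
  unfolding pairs.simps by (rule insertI2, rule UnI2, rule rev_image_eqI, assumption, simp)

lemma pairs_cover:
  "i < length (trace f) \<Longrightarrow> \<exists>j a b. (i, j, a, b) \<in> pairs f \<or> (j, i, a, b) \<in> pairs f"
proof (induction f arbitrary: i)
  case (Branch e t f)
  let ?l = "length (trace t)" and ?m = "length (flat t)"
  consider "i = 0" | "i = Suc ?l" | k where "i = Suc k" "k < ?l"
    | k where "i = k + ?l + 2" "k < length (trace f)"
  proof -
    have "i = 0 \<or> i = Suc ?l \<or> (i = Suc (i - 1) \<and> i - 1 < ?l)
      \<or> (i = (i - ?l - 2) + ?l + 2 \<and> i - ?l - 2 < length (trace f))"
      using Branch.prems by auto
    then show thesis using that by metis
  qed
  then show ?case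
  proof cases
    case (3 k)
    then obtain j a b where "(k, j, a, b) \<in> pairs t \<or> (j, k, a, b) \<in> pairs t"
      using Branch.IH(1) by blast
    then show ?thesis using pairs_left 3(1) by blast
  next
    case (4 k)
    then obtain j a b where "(k, j, a, b) \<in> pairs f \<or> (j, k, a, b) \<in> pairs f"
      using Branch.IH(2) by blast
    then show ?thesis using pairs_right unfolding 4(1) by blast
  qed auto
qed simp

text \<open>The two crossings of a branch behave like matching parentheses, and the letters enclosed
  are nested or separated in the same way as the crossings.\<close>

lemma pairs_laminar:
  assumes "(i, j, a, b) \<in> pairs f" "(i', j', a', b') \<in> pairs f"
  shows "(i, j, a, b) = (i', j', a', b') \<or> (j < i' \<and> b \<le> a') \<or> (j' < i \<and> b' \<le> a)
    \<or> (i < i' \<and> j' < j \<and> a \<le> a' \<and> b' \<le> b) \<or> (i' < i \<and> j < j' \<and> a' \<le> a \<and> b \<le> b')"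
  using assms
proof (induction f arbitrary: i j a b i' j' a' b')
  case (Branch e t f)
  let ?l = "length (trace t)" and ?m = "length (flat t)"
  have cs: "(i, j, a, b) = (0, Suc ?l, 0, ?m)
    \<or> (\<exists>i0 j0. i = Suc i0 \<and> j = Suc j0 \<and> (i0, j0, a, b) \<in> pairs t)
    \<or> (\<exists>i0 j0 a0 b0. i = i0 + ?l + 2 \<and> j = j0 + ?l + 2 \<and> a = a0 + ?m \<and> b = b0 + ?m
         \<and> (i0, j0, a0, b0) \<in> pairs f)"
    if "(i, j, a, b) \<in> pairs (Branch e t f)" for i j a b
    using that by auto
  have bt: "i0 < j0 \<and> j0 < ?l \<and> a0 \<le> b0 \<and> b0 \<le> ?m" if "(i0, j0, a0, b0) \<in> pairs t" for i0 j0 a0 b0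
    using pairs_bounds[OF that] .
  show ?case
    using cs[OF Branch.prems(1)]
  proof (elim disjE exE conjE)
    assume 1: "(i, j, a, b) = (0, Suc ?l, 0, ?m)"
    show ?thesis
      using cs[OF Branch.prems(2)]
    proof (elim disjE exE conjE)
      fix i0' j0' assume 2: "i' = Suc i0'" "j' = Suc j0'" "(i0', j0', a', b') \<in> pairs t"
      then show ?thesis using bt[OF 2(3)] 1 by simp
    qed (use 1 in auto)
  next
    fix i0 j0 assume 1: "i = Suc i0" "j = Suc j0" "(i0, j0, a, b) \<in> pairs t"
    show ?thesis
      using cs[OF Branch.prems(2)]
    proof (elim disjE exE conjE)
      fix i0' j0' assume 2: "i' = Suc i0'" "j' = Suc j0'" "(i0', j0', a', b') \<in> pairs t"
      then show ?thesis using Branch.IH(1)[OF 1(3) 2(3)] 1 by simp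
    qed (use 1 bt[OF 1(3)] in auto)
  next
    fix i0 j0 a0 b0 assume 1: "i = i0 + ?l + 2" "j = j0 + ?l + 2" "a = a0 + ?m" "b = b0 + ?m"
      "(i0, j0, a0, b0) \<in> pairs f"
    show ?thesis
      using cs[OF Branch.prems(2)]
    proof (elim disjE exE conjE)
      fix i0' j0' a0' b0' assume 2: "i' = i0' + ?l + 2" "j' = j0' + ?l + 2" "a' = a0' + ?m" "b' = b0' + ?m"
        "(i0', j0', a0', b0') \<in> pairs f"
      then show ?thesis using Branch.IH(2)[OF 1(5) 2(5)] 1 by simp
    next
      fix i0' j0' assume 2: "i' = Suc i0'" "j' = Suc j0'" "(i0', j0', a', b') \<in> pairs t"
      then show ?thesis using bt[OF 2(3)] 1 by simp
    qed (use 1 in auto)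
  qed
qed simp

text \<open>Before translation both crossings use the same edge. They are translated by the prefixes
  read before them, of lengths \<open>a\<close> and \<open>b\<close>, and the quotient of these
  prefixes relates them.\<close>

lemma pairs_mult:
  assumes "forest c u f" "u \<in> carrier G" "(i, j, a, b) \<in> pairs f"
  shows "trace f ! j =
    prodl G (take b (flat f)) \<otimes> inv (prodl G (take a (flat f))) \<otimes> trace f ! i"
  using assms
proof (induction f arbitrary: c u i j a b)
  case (Branch e t f)
  let ?l = "length (trace t)" and ?m = "length (flat t)" and ?p = "prodl G (flat t)"
  have e: "e \<in> carrier G" and t: "forest (\<not> c) e t" and f: "forest c u f" and u: "u \<in> carrier G"
    using Branch.prems by auto
  have p: "?p \<in> carrier G" using t prodl_flat by blast
  have ft: "set (flat t) \<subseteq> carrier G" and ff: "set (flat f) \<subseteq> carrier G"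
    using t f forest_flat by blast+
  consider "(i, j, a, b) = (0, Suc ?l, 0, ?m)"
    | i0 j0 where "i = Suc i0" "j = Suc j0" "(i0, j0, a, b) \<in> pairs t"
    | i0 j0 a0 b0 where "i = i0 + ?l + 2" "j = j0 + ?l + 2" "a = a0 + ?m" "b = b0 + ?m"
        "(i0, j0, a0, b0) \<in> pairs f"
    using Branch.prems(3) by auto
  then show ?case
  proof cases
    case 1
    then show ?thesis using p e by (simp add: nth_append)
  next
    case (2 i0 j0)
    have b: "i0 < ?l" "j0 < ?l" "a \<le> ?m" "b \<le> ?m" using pairs_bounds[OF 2(3)] by auto
    then show ?thesis using Branch.IH(1)[OF t e 2(3)] 2 by (simp add: nth_append)
  next
    case (3 i0 j0 a0 b0)
    have b: "i0 < length (trace f)" "j0 < length (trace f)" using pairs_bounds[OF 3(5)] by auto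
    have n: "trace (Branch e t f) ! (k + ?l + 2) = ?p \<otimes> trace f ! k" if "k < length (trace f)" for k
      using that by (simp add: nth_append)
    have q: "prodl G (take k (flat f)) \<in> carrier G" for k
      using ff set_take_subset by (metis order_trans prodl_closed)
    have tk: "prodl G (take (k + ?m) (flat (Branch e t f))) = ?p \<otimes> prodl G (take k (flat f))" for k
      using ft ff set_take_subset[of k "flat f"] by (simp add: prodl_append)
    have tr: "trace f ! i0 \<in> carrier G" using trace_carrier[OF f u] b by (meson nth_mem subsetD)
    have "?p \<otimes> (y \<otimes> inv x \<otimes> z) = ?p \<otimes> y \<otimes> inv (?p \<otimes> x) \<otimes> (?p \<otimes> z)"
      if "x \<in> carrier G" "y \<in> carrier G" "z \<in> carrier G" for x y z
      using p that by (simp add: inv_mult_group m_assoc) (simp add: m_assoc[symmetric])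
    then show ?thesis
      using Branch.IH(2)[OF f u 3(5)] q tr unfolding 3(1-4) n[OF b(1)] n[OF b(2)] tk by simp
  qed
qed simp

lemma alternating_append:
  "alternating G H c (xs @ ys) \<longleftrightarrow> alternating G H c xs \<and> alternating G H (even (length xs) = c) ys"
  by (induction xs arbitrary: c) (auto simp: even_eq_Not)

lemma alternating_rev:
  "alternating G H c xs \<Longrightarrow> alternating G H (odd (length xs) = c) (rev (map (m_inv G) xs))"
proof (induction xs arbitrary: c)
  case (Cons x xs)
  have x: "x \<in> H c" "x \<noteq> \<one>" "x \<in> carrier G" using Cons.prems H_carrier by auto
  have "inv x \<noteq> \<one>" using x by (metis inv_inv inv_one)
  moreover have "alternating G H (odd (length xs) = (\<not> c)) (rev (map (m_inv G) xs))"
    using Cons.IH[of "\<not> c"] Cons.prems by simp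
  ultimately show ?case using x H_inv
    by (cases "even (length xs)"; cases c) (simp_all add: alternating_append)
qed simp

lemma prodl_rev_inv:
  "set xs \<subseteq> carrier G \<Longrightarrow> prodl G (rev (map (m_inv G) xs)) = inv (prodl G xs)"
proof (induction xs)
  case (Cons x xs)
  have "set (rev (map (m_inv G) xs)) \<subseteq> carrier G" "prodl G xs \<in> carrier G" using Cons.prems by auto
  then show ?case using Cons by (simp add: prodl_append inv_mult_group)
qed simp

text \<open>The inverse of one form followed by the other would be a nonempty normal form of the
  identity. If the first letters differ inside one factor, their quotient serves as the single
  letter at the junction.\<close>

lemma alternating_unique:
  assumes "alternating G H c xs" "alternating G H d ys" "prodl G xs = prodl G ys"
  shows "xs = ys \<and> (xs = [] \<or> c = d)"
  using assms
proof (induction xs arbitrary: c d ys)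
  case Nil
  then show ?case using alternating_prodl[of d ys] by auto
next
  case (Cons x xs)
  show ?case
  proof (cases ys)
    case Nil
    then show ?thesis using alternating_prodl[of c "x # xs"] Cons.prems by auto
  next
    case ys: (Cons y ys')
    have cx: "set (x # xs) \<subseteq> carrier G" and cy: "set ys \<subseteq> carrier G"
      using alternating_carrier Cons.prems by blast+
    then have px: "prodl G xs \<in> carrier G" "prodl G ys' \<in> carrier G" "x \<in> carrier G" "y \<in> carrier G"
      using ys by auto
    have r: "set (rev (map (m_inv G) (x # xs))) \<subseteq> carrier G" "set (rev (map (m_inv G) xs)) \<subseteq> carrier G"
      using cx by auto
    show ?thesis
    proof (cases "c = d")
      case False
      then have "alternating G H (odd (length (x # xs)) = c) (rev (map (m_inv G) (x # xs)) @ ys)"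
        using alternating_rev[OF Cons.prems(1)] Cons.prems(2)
        unfolding alternating_append length_rev length_map
        by (smt (verit, best))
      then have "prodl G (rev (map (m_inv G) (x # xs)) @ ys) \<noteq> \<one>" using alternating_prodl ys by blast
      then show ?thesis using Cons.prems(3) prodl_closed[OF cy]
        unfolding prodl_append[OF r(1) cy] prodl_rev_inv[OF cx] by simp
    next
      case cd: True
      show ?thesis
      proof (cases "x = y")
        case True
        then have "prodl G xs = prodl G ys'" using Cons.prems ys px by simp
        then have "xs = ys'" using Cons.IH[of "\<not> c" "\<not> c" ys'] Cons.prems ys cd by simp
        then show ?thesis using True ys cd by simp
      next
        case False
        let ?z = "inv x \<otimes> y"
        have z: "?z \<in> H c" using Cons.prems ys cd H_inv H_mult by simp
        have nz: "?z \<noteq> \<one>" using False px by (metis inv_solve_left one_closed r_one)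
        have "alternating G H (odd (length xs) = (\<not> c)) (rev (map (m_inv G) xs) @ ?z # ys')"
          using alternating_rev[of "\<not> c" xs] Cons.prems z nz ys cd
          by (cases "even (length xs)"; cases c) (simp_all add: alternating_append)
        then have "prodl G (rev (map (m_inv G) xs) @ ?z # ys') \<noteq> \<one>" using alternating_prodl by blast
        moreover have "prodl G (rev (map (m_inv G) xs) @ ?z # ys') = inv (prodl G xs) \<otimes> (?z \<otimes> prodl G ys')"
          using prodl_append[OF r(2), of "?z # ys'"] prodl_rev_inv[of xs] cx cy ys px by simp
        moreover have "?z \<otimes> prodl G ys' = prodl G xs"
        proof -
          have "?z \<otimes> prodl G ys' = inv x \<otimes> (y \<otimes> prodl G ys')" using px by (simp add: m_assoc)
          also have "y \<otimes> prodl G ys' = x \<otimes> prodl G xs" using Cons.prems(3) ys by simp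
          finally show ?thesis using px by (simp add: m_assoc[symmetric])
        qed
        ultimately show ?thesis using px by simp
      qed
    qed
  qed
qed

end

section \<open>Chains in the union of two matchings\<close>

fun chain :: "(bool \<Rightarrow> 'e \<Rightarrow> 'e \<Rightarrow> bool) \<Rightarrow> bool \<Rightarrow> 'e list \<Rightarrow> bool" where
  "chain R c (x # y # r) \<longleftrightarrow> R c x y \<and> chain R (\<not> c) (y # r)"
| "chain R c xs \<longleftrightarrow> True"

lemma chain_append:
  "chain R c (xs @ y # zs) \<longleftrightarrow> chain R c (xs @ [y]) \<and> chain R (even (length xs) = c) (y # zs)"
proof (induction R c xs rule: chain.induct)
  case (1 R c x y' r)
  then show ?case by (cases "even (length r)"; cases c) auto
next
  case ("2_2" R c x)
  then show ?case by (cases zs) auto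
qed auto

lemma chain_snoc:
  assumes "chain R c xs" "xs \<noteq> []" "R (odd (length xs) = c) (last xs) y"
  shows "chain R c (xs @ [y])"
  using assms chain_append[of R c "butlast xs" "last xs" "[y]"]
  by (cases xs rule: rev_cases) auto

lemma chain_nth:
  "chain R c xs \<Longrightarrow> Suc i < length xs \<Longrightarrow> R (even i = c) (xs ! i) (xs ! Suc i)"
proof (induction R c xs arbitrary: i rule: chain.induct)
  case (1 R c x y r)
  show ?case
  proof (cases i)
    case (Suc j)
    have "R (even j = (\<not> c)) ((y # r) ! j) ((y # r) ! Suc j)" using 1 Suc by simp
    moreover have "(even j = (\<not> c)) = (even (Suc j) = c)" by auto
    ultimately show ?thesis using Suc by simp
  qed (use 1 in simp)
qed auto

text \<open>The relations \<open>R True\<close> and \<open>R False\<close> are perfect matchings of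
  \<open>D True\<close> and \<open>D False\<close>. Every link multiplies the position
  \<open>F\<close> by a nontrivial letter of the factor of its colour, so a chain that alternates
  between the matchings spells a normal form.\<close>

locale chase = free_prod W K for W (structure) and K +
  fixes R :: "bool \<Rightarrow> 'e \<Rightarrow> 'e \<Rightarrow> bool" and F :: "'e \<Rightarrow> 'a" and D :: "bool \<Rightarrow> 'e set"
  assumes F_carrier: "x \<in> D c \<Longrightarrow> F x \<in> carrier W"
    and R_step: "R c x y \<Longrightarrow> \<exists>z\<in>K c. z \<noteq> \<one> \<and> F x = z \<otimes> F y"
    and R_sym: "R c x y \<Longrightarrow> R c y x"
    and R_dom: "R c x y \<Longrightarrow> x \<in> D c"
    and R_ex: "x \<in> D c \<Longrightarrow> \<exists>y. R c x y"
    and R_unique: "R c x y \<Longrightarrow> R c x y' \<Longrightarrow> y = y'"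
    and fin: "finite (D c)"
begin

text \<open>The positions along a chain, recovered from its letters and its first position. Chains
  with equal letters and equal first positions thus have equal images under
  \<open>F\<close>.\<close>

primrec walk :: "'a list \<Rightarrow> 'a \<Rightarrow> 'a list" where
  "walk [] v = [v]"
| "walk (z # zs) v = v # walk zs (inv z \<otimes> v)"

lemma chain_alternating:
  assumes "chain R c (x # xs)" "x \<in> D c'"
  shows "\<exists>zs. alternating W K c zs \<and> length zs = length xs
    \<and> F x = prodl W zs \<otimes> F (last (x # xs)) \<and> map F (x # xs) = walk zs (F x)"
  using assms
proof (induction xs arbitrary: c x c')
  case (Cons y xs)
  then have r: "R c x y" by simp
  obtain z where z: "z \<in> K c" "z \<noteq> \<one>" "F x = z \<otimes> F y" using R_step[OF r] by blast
  have y: "y \<in> D c" using R_dom R_sym r by blast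
  have ch: "chain R (\<not> c) (y # xs)" using Cons.prems by simp
  obtain zs where zs: "alternating W K (\<not> c) zs" "length zs = length xs"
    "F y = prodl W zs \<otimes> F (last (y # xs))" "map F (y # xs) = walk zs (F y)"
    using Cons.IH[OF ch y] by blast
  have "last (y # xs) = y \<or> (\<exists>c. last (y # xs) \<in> D c)"
  proof (cases "xs = []")
    case False
    have "Suc (length xs - 1) < length (y # xs)" using False by simp
    from chain_nth[of R "\<not> c" "y # xs", OF _ this]
    have "\<exists>c a. R c a (last (y # xs))" using Cons.prems False by (auto simp: last_conv_nth nth_Cons')
    then show ?thesis using R_sym R_dom by blast
  qed simp
  then have l: "F (last (y # xs)) \<in> carrier W" using F_carrier y by auto
  have pz: "prodl W zs \<in> carrier W" using zs alternating_carrier by blast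
  have "F x = z \<otimes> (prodl W zs \<otimes> F (last (y # xs)))"
    using z(3) unfolding zs(3)[symmetric] .
  also have "\<dots> = prodl W (z # zs) \<otimes> F (last (y # xs))"
    using m_assoc[OF H_carrier[OF z(1)] pz l] by simp
  finally have "F x = prodl W (z # zs) \<otimes> F (last (x # y # xs))" by simp
  moreover have "inv z \<otimes> F x = F y"
    using z F_carrier[OF y] H_carrier[OF z(1)] by (simp add: m_assoc[symmetric])
  ultimately show ?case using z zs(1,2,4) by (intro exI[of _ "z # zs"]) simp
qed (intro exI[of _ "[]"], simp add: F_carrier)

lemma chain_in_D: "chain R c (x # xs) \<Longrightarrow> x \<in> D True \<union> D False \<Longrightarrow> set (x # xs) \<subseteq> D True \<union> D False"
proof (induction xs arbitrary: c x)
  case (Cons y xs)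
  then have "y \<in> D c" using R_dom[OF R_sym[of c x y]] by simp
  then have "y \<in> D True \<union> D False" by (cases c) auto
  then show ?case using Cons.IH[of "\<not> c" y] Cons.prems by auto
qed simp

text \<open>Between two equal positions the letters would form a nonempty normal form of the
  identity; in particular no chain closes up.\<close>

lemma chain_distinct_F:
  assumes "chain R c (x # xs)" "x \<in> D True \<union> D False"
  shows "distinct (map F (x # xs))"
  using assms
proof (induction xs arbitrary: c x)
  case (Cons y xs)
  then have "y \<in> D c" using R_dom[OF R_sym[of c x y]] by simp
  then have "y \<in> D True \<union> D False" by (cases c) auto
  then have d: "distinct (map F (y # xs))" using Cons.IH[of "\<not> c" y] Cons.prems by simp
  have "F x \<notin> F ` set (y # xs)"
  proof
    assume "F x \<in> F ` set (y # xs)"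
    then obtain x' where x': "x' \<in> set (y # xs)" "F x' = F x" unfolding image_iff by metis
    then obtain as bs where s: "y # xs = as @ x' # bs" by (meson split_list)
    have "chain R c (x # as @ [x'])"
      using Cons.prems(1) chain_append[of R c "x # as" x' bs] s by simp
    moreover obtain c' where x: "x \<in> D c'" using Cons.prems by blast
    ultimately obtain zs where zs: "alternating W K c zs" "length zs = length (as @ [x'])"
      "F x = prodl W zs \<otimes> F x"
      using chain_alternating[of c x "as @ [x']" c'] x' by auto
    have "prodl W zs \<in> carrier W" using zs alternating_carrier by blast
    then have "prodl W zs = \<one>" using zs(3) F_carrier[OF x] by (metis l_one one_closed right_cancel)
    moreover have "zs \<noteq> []" using zs(2) by auto
    ultimately show False using alternating_prodl[OF zs(1)] by blast
  qed
  then show ?case using d by simp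
qed simp

lemma chain_distinct: "chain R c (x # xs) \<Longrightarrow> x \<in> D True \<union> D False \<Longrightarrow> distinct (x # xs)"
  using chain_distinct_F distinct_map by blast

lemma chain_length:
  assumes "chain R c (x # xs)" "x \<in> D True \<union> D False"
  shows "length (x # xs) \<le> card (D True \<union> D False)"
  using card_mono[OF _ chain_in_D[OF assms]] chain_distinct[OF assms] fin
    distinct_card[of "x # xs"] by simp

text \<open>In the union of the matchings \<open>a0\<close> and \<open>b0\<close> have one neighbour
  and all other vertices have two. Circuits are excluded by distinct positions, and a further path
  component would need ends of its own, so a longest chain from \<open>a0\<close> ends in
  \<open>b0\<close> and visits everything.\<close>

theorem chase:
  assumes ends: "\<And>x. x \<in> D True \<union> D False \<Longrightarrow> x \<notin> D True \<inter> D False \<longleftrightarrow> x = a0 \<or> x = b0"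
    and a0: "a0 \<in> D True \<union> D False"
  shows "\<exists>vs. chain R (a0 \<in> D True) (a0 # vs) \<and> distinct (a0 # vs) \<and> vs \<noteq> []
    \<and> last vs = b0 \<and> set (a0 # vs) = D True \<union> D False
    \<and> (\<forall>c x y. R c x y \<longrightarrow> (\<exists>i<length vs. c = (even i = (a0 \<in> D True)) \<and>
          ({x, y} = {(a0 # vs) ! i, (a0 # vs) ! Suc i})))"
proof -
  let ?c = "a0 \<in> D True"
  have a0c: "a0 \<in> D ?c" "a0 \<notin> D (\<not> ?c)" using a0 ends[OF a0] by (cases ?c; auto)+
  let ?P = "\<lambda>xs. chain R ?c (a0 # xs)"
  have "?P []" by simp
  moreover have "\<forall>xs. ?P xs \<longrightarrow> length xs < Suc (card (D True \<union> D False))"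
    using chain_length[OF _ a0] by fastforce
  ultimately obtain vs where vs: "?P vs" "\<And>xs. ?P xs \<Longrightarrow> length xs \<le> length vs"
    using ex_has_greatest_nat[of ?P "[]" length "Suc (card (D True \<union> D False))"] by (metis less_le_not_le)
  let ?e = "last (a0 # vs)" and ?d = "even (length vs) = ?c"
  have no: "?e \<notin> D ?d"
  proof
    assume "?e \<in> D ?d"
    then obtain y where y: "R ?d ?e y" using R_ex by blast
    have "?P (vs @ [y])" using chain_snoc[OF vs(1), of y] y by simp
    from vs(2)[OF this] show False by simp
  qed
  have ne: "vs \<noteq> []" using no a0c by (cases "a0 \<in> D True") auto
  have dis: "distinct (a0 # vs)" using chain_distinct[OF vs(1) a0] .
  have sub: "set (a0 # vs) \<subseteq> D True \<union> D False" using chain_in_D[OF vs(1) a0] .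
  have "?e \<in> D True \<union> D False" using sub last_in_set[of "a0 # vs"] by blast
  moreover have "?e \<notin> D True \<inter> D False" using no by (cases ?d) auto
  moreover have "?e \<noteq> a0" using dis ne by auto
  ultimately have eb: "?e = b0" using ends by blast
  have nb: "\<exists>i<length vs. c = (even i = ?c) \<and> {x, y} = {(a0 # vs) ! i, (a0 # vs) ! Suc i}"
    if x: "x \<in> set (a0 # vs)" and r: "R c x y" for x y c
  proof -
    obtain i where i: "i < length (a0 # vs)" "x = (a0 # vs) ! i" using x by (metis in_set_conv_nth)
    show ?thesis
    proof (cases "c = (even i = ?c)")
      case True
      have "Suc i < length (a0 # vs)"
      proof (rule ccontr)
        assume "\<not> ?thesis"
        then have "i = length vs" using i by simp
        then show False using no R_dom[OF r] True i by (simp add: last_conv_nth nth_Cons' split: if_splits)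
      qed
      then have "i < length vs" "y = (a0 # vs) ! Suc i"
        using chain_nth[OF vs(1), of i] R_unique r True i by auto
      then show ?thesis using True i by blast
    next
      case False
      then have c: "c = (odd i = ?c)" by blast
      then obtain j where j: "i = Suc j"
        using R_dom[OF r] i a0c by (cases i) auto
      have "R (even j = ?c) ((a0 # vs) ! j) x" using chain_nth[OF vs(1), of j] i j by simp
      moreover have cj: "c = (even j = ?c)" using c j by auto
      ultimately have "y = (a0 # vs) ! j" using R_sym R_unique r by blast
      moreover have "j < length vs" using i j by simp
      ultimately show ?thesis using cj i(2) unfolding j by blast
    qed
  qed
  have closed: "y \<in> set (a0 # vs)" if x: "x \<in> set (a0 # vs)" and r: "R c x y" for x y c
  proof -
    obtain i where "i < length vs" "{x, y} = {(a0 # vs) ! i, (a0 # vs) ! Suc i}" using nb[OF x r] by blast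
    then have "y \<in> {(a0 # vs) ! i, (a0 # vs) ! Suc i}" "i < length (a0 # vs)" "Suc i < length (a0 # vs)"
      by auto
    then show ?thesis using nth_mem by (metis empty_iff insert_iff)
  qed
  have cov: "set (a0 # vs) = D True \<union> D False"
  proof (rule ccontr)
    assume "\<not> ?thesis"
    then obtain y where y: "y \<in> D True \<union> D False" "y \<notin> set (a0 # vs)" using sub by blast
    have "b0 \<in> set (a0 # vs)" using eb last_in_set[of "a0 # vs"] by auto
    then have both: "x \<in> D c" if "x \<in> D True \<union> D False" "x \<notin> set (a0 # vs)" for x c
      using that ends[of x] by (cases c) auto
    \<comment> \<open>A vertex off the chain lies in both domains, so a second chain can be
      continued from \<open>y\<close> forever without meeting the first one. This contradicts the
      bound on its length.\<close>
    have "\<exists>xs. length xs = n \<and> chain R True (y # xs) \<and> last (y # xs) \<notin> set (a0 # vs)" for n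
    proof (induction n)
      case (Suc n)
      then obtain xs where xs: "length xs = n" "chain R True (y # xs)" "last (y # xs) \<notin> set (a0 # vs)"
        by blast
      let ?z = "last (y # xs)"
      have "?z \<in> D True \<union> D False" using chain_in_D[OF xs(2) y(1)] last_in_set[of "y # xs"] by blast
      then obtain w where w: "R (even n = True) ?z w" using R_ex both xs(3) by metis
      have "chain R True (y # xs @ [w])" using chain_snoc[OF xs(2), of w] w xs(1) by simp
      moreover have "w \<notin> set (a0 # vs)" using closed[OF _ R_sym[OF w]] xs(3) by blast
      ultimately show ?case using xs(1) by (intro exI[of _ "xs @ [w]"]) simp
    qed (use y in \<open>intro exI[of _ "[]"], simp\<close>)
    then obtain xs where "length xs = card (D True \<union> D False)" "chain R True (y # xs)" by blast
    then show False using chain_length[OF _ y(1)] by fastforce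
  qed
  have "x \<in> D True \<union> D False" if "R c x y" for c x y using R_dom[OF that] by (cases c) auto
  then have "\<forall>c x y. R c x y \<longrightarrow> (\<exists>i<length vs. c = (even i = ?c) \<and>
      {x, y} = {(a0 # vs) ! i, (a0 # vs) ! Suc i})"
    using nb cov by blast
  moreover have "last vs = b0" using eb ne by simp
  ultimately show ?thesis using vs(1) dis ne cov by blast
qed

end

text \<open>The letters of the second part are read after the prefix \<open>h1\<close>. The elements
  that relate the crossings there lie in conjugates of the factors by \<open>h1\<close>, and normal
  forms are needed for these.\<close>

lemma (in free_prod) free_prod_conj:
  assumes g: "g \<in> carrier G"
  shows "free_prod G (\<lambda>c. conjg G g ` H c)"
proof (intro free_prod.intro free_prod_axioms.intro group_axioms)
  fix c
  have hom: "group_hom G G (conjg G g)"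
    using g by unfold_locales (auto simp: hom_def conjg_mult)
  show "subgroup (conjg G g ` H c) G" using group_hom.subgroup_img_is_subgroup[OF hom H_subgroup] .
next
  have inj: "conjg G g x = \<one> \<Longrightarrow> x = \<one>" if "x \<in> carrier G" for x
    using conjg_inv_cancel(2)[OF g that] g by simp
  fix c xs assume xs: "alternating G (\<lambda>c. conjg G g ` H c) c xs" "xs \<noteq> []"
  have "\<exists>ys. alternating G H c ys \<and> xs = map (conjg G g) ys"
    using xs(1)
  proof (induction xs arbitrary: c)
    case (Cons x xs)
    from Cons.prems have "x \<in> conjg G g ` H c" "alternating G (\<lambda>c. conjg G g ` H c) (\<not> c) xs" by auto
    then obtain y ys where "y \<in> H c" "x = conjg G g y" "alternating G H (\<not> c) ys" "xs = map (conjg G g) ys"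
      using Cons.IH by blast
    moreover from this have "y \<noteq> \<one>" using Cons.prems g by auto
    ultimately show ?case by (intro exI[of _ "y # ys"]) simp
  qed simp
  then obtain ys where ys: "alternating G H c ys" "xs = map (conjg G g) ys" by blast
  then show "prodl G xs \<noteq> \<one>"
    using prodl_map_conjg[OF g alternating_carrier[OF ys(1)]] inj prodl_closed[OF alternating_carrier[OF ys(1)]]
      alternating_prodl[OF ys(1)] xs(2) by auto
next
  fix x assume x: "x \<in> carrier G"
  obtain ys where ys: "set ys \<subseteq> H True \<union> H False" "prodl G ys = conjg G (inv g) x"
    using H_generates[of "conjg G (inv g) x"] x g by auto
  have "set ys \<subseteq> carrier G" using ys H_carrier by auto
  then have "prodl G (map (conjg G g) ys) = x" using ys x g by (simp add: prodl_map_conjg)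
  then show "\<exists>xs. set xs \<subseteq> conjg G g ` H True \<union> conjg G g ` H False \<and> prodl G xs = x"
    using ys by (intro exI[of _ "map (conjg G g) ys"]) auto
qed

definition before :: "'a list \<Rightarrow> 'a \<Rightarrow> 'a \<Rightarrow> bool" where
  "before L x y \<longleftrightarrow> (\<exists>i j. i < j \<and> j < length L \<and> L ! i = x \<and> L ! j = y)"

lemma (in free_prod) prodl_in_H: "set xs \<subseteq> H c \<Longrightarrow> prodl G xs \<in> H c"
  by (induction xs) (auto simp: H_mult)

lemma (in free_prod) H_disjoint: "x \<in> H True \<Longrightarrow> x \<in> H False \<Longrightarrow> x = \<one>"
  using alternating_not_in[of True "[x]"] H_carrier[of x True] by auto

section \<open>Lifts of factorizations\<close>

text \<open>What is required of the reflections and of the Coxeter element is stated abstractly: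
  conjugation invariance, and a lower bound for the length of factorizations of
  \<open>h1 \<otimes> h2\<close>.\<close>

locale factorized = free_prod W K for W (structure) and K +
  fixes T :: "'a set" and h1 h2 :: 'a and n :: nat
  assumes T_carrier: "T \<subseteq> carrier W"
    and T_conj: "g \<in> carrier W \<Longrightarrow> t \<in> T \<Longrightarrow> g \<otimes> t \<otimes> inv g \<in> T"
    and h1: "h1 \<in> K True" and h2: "h2 \<in> K False"
    and min_length: "set xs \<subseteq> T \<Longrightarrow> prodl W xs = h1 \<otimes> h2 \<Longrightarrow> n \<le> length xs"
begin

definition fac :: "'a list \<Rightarrow> bool" where
  "fac xs \<longleftrightarrow> set xs \<subseteq> T \<and> prodl W xs = h1 \<otimes> h2 \<and> length xs = n"

text \<open>For \<open>a \<le> b\<close> this is the block of letters from \<open>a\<close> to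
  \<open>b - 1\<close>, conjugated by the prefix before it: the left translation between the
  crossings of a branch that encloses the block.\<close>

definition seg :: "'a list \<Rightarrow> nat \<Rightarrow> nat \<Rightarrow> 'a" where
  "seg xs a b = prodl W (take b xs) \<otimes> inv (prodl W (take a xs))"

lemma fac_carrier: "fac xs \<Longrightarrow> set xs \<subseteq> carrier W"
  using T_carrier by (auto simp: fac_def)

lemma fac_heq: "fac xs \<Longrightarrow> heq W xs ys \<Longrightarrow> fac ys"
  unfolding fac_def using heq_closed[OF _ _ T_carrier T_conj] heq_prodl heq_length by metis

text \<open>Deleting a trivial block would shorten a factorization that has minimal length.\<close>

lemma fac_sub:
  assumes "fac (us @ vs @ ws)" "prodl W vs = \<one>"
  shows "vs = []"
proof -
  have c: "set us \<subseteq> carrier W" "set vs \<subseteq> carrier W" "set ws \<subseteq> carrier W"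
    using fac_carrier[OF assms(1)] by auto
  then have "prodl W (us @ ws) = prodl W (us @ vs @ ws)"
    using assms(2) by (simp add: prodl_append prodl_closed)
  then have "n \<le> length (us @ ws)" using min_length[of "us @ ws"] assms(1) unfolding fac_def by simp
  then show ?thesis using assms(1) unfolding fac_def by auto
qed

lemma fac_nondegenerate: "fac xs \<Longrightarrow> nondegenerate xs"
  unfolding nondegenerate_def using fac_heq fac_sub fac_carrier by blast

lemma seg_nontrivial:
  assumes "fac xs" "a < b" "b \<le> n"
  shows "seg xs a b \<noteq> \<one>"
proof
  assume s: "seg xs a b = \<one>"
  define vs where "vs = drop a (take b xs)"
  have tb: "take b xs = take a xs @ vs"
    unfolding vs_def using assms(2) by (metis append_take_drop_id less_imp_le_nat min.absorb2 take_take min.commute)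
  have xs: "xs = take a xs @ vs @ drop b xs" using tb by (metis append_assoc append_take_drop_id)
  then have c: "set (take a xs) \<subseteq> carrier W" "set vs \<subseteq> carrier W"
    using fac_carrier[OF assms(1)] by (metis Un_subset_iff set_append)+
  then have pc: "prodl W (take a xs) \<in> carrier W" "prodl W vs \<in> carrier W" by auto
  have "prodl W (take a xs) \<otimes> prodl W vs = prodl W (take a xs)"
    using s pc unfolding seg_def tb prodl_append[OF c] by (metis inv_equality inv_inv inv_closed m_closed)
  then have "prodl W vs = \<one>" using pc by simp
  then have "vs = []" using fac_sub assms(1) xs by metis
  then show False using assms unfolding vs_def fac_def by simp
qed

text \<open>Conjugation by \<open>h1\<close> preserves \<open>K True\<close> and takes
  \<open>K False\<close> to the factor that contains the segments of the second part.\<close>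

abbreviation K' :: "bool \<Rightarrow> 'a set" where "K' \<equiv> \<lambda>c. conjg W h1 ` K c"

lemma h1_carrier: "h1 \<in> carrier W" and h2_carrier: "h2 \<in> carrier W"
  using h1 h2 H_carrier by auto

lemma K'_True: "x \<in> K True \<Longrightarrow> x \<in> K' True"
proof -
  assume x: "x \<in> K True"
  have "conjg W (inv h1) x \<in> K True" unfolding conjg_def using x h1 H_inv H_mult h1_carrier by simp
  moreover have "x = conjg W h1 (conjg W (inv h1) x)" using x H_carrier h1_carrier by simp
  ultimately show ?thesis by blast
qed

lemma seg_H: "set xs \<subseteq> K c \<Longrightarrow> seg xs a b \<in> K c"
  unfolding seg_def using prodl_in_H[of "take b xs" c] prodl_in_H[of "take a xs" c] H_mult H_inv
    set_take_subset[of a xs] set_take_subset[of b xs] by blast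

lemma seg_append1:
  "b \<le> length xs \<Longrightarrow> a \<le> b \<Longrightarrow> seg (xs @ ys) a b = seg xs a b"
  by (simp add: seg_def)

lemma seg_append2:
  assumes "set xs \<subseteq> carrier W" "set ys \<subseteq> carrier W"
  shows "seg (xs @ ys) (length xs + a) (length xs + b) = conjg W (prodl W xs) (seg ys a b)"
proof -
  have c: "set (take k ys) \<subseteq> carrier W" for k using assms(2) set_take_subset[of k ys] by blast
  then have "prodl W (take k ys) \<in> carrier W" "prodl W xs \<in> carrier W" for k using assms by auto
  then show ?thesis using assms c
    by (simp add: seg_def conjg_def prodl_append inv_mult_group m_assoc)
qed

end

text \<open>Two instances are intended: the Artin group over its Coxeter group, and the free product
  of two copies of \<open>W\<close> folded onto \<open>W\<close>.\<close>

locale lift = W: factorized W K T h1 h2 n + G: free_prod G H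
  for W :: "('b, 'n) monoid_scheme" and K T h1 h2 n and G :: "('a, 'm) monoid_scheme" and H +
  fixes F :: "'a \<Rightarrow> 'b"
  assumes F_hom: "F \<in> hom G W"
begin

sublocale F: group_hom G W F
  by unfold_locales (rule F_hom)

lemma F_prodl: "set xs \<subseteq> carrier G \<Longrightarrow> F (prodl G xs) = prodl W (map F xs)"
  by (induction xs) (auto simp: G.prodl_closed)

lemma F_heq: "heq G xs ys \<Longrightarrow> heq W (map F xs) (map F ys)"
  using heq_map_hom[OF G.group_axioms W.group_axioms F_hom] .

lemma F_fac_nondegenerate:
  assumes "W.fac (us @ map F xs @ ws)" "set xs \<subseteq> carrier G"
  shows "G.nondegenerate xs"
  unfolding G.nondegenerate_def
proof (intro conjI allI impI assms(2))
  fix as vs bs assume v: "heq G xs (as @ vs @ bs)" "prodl G vs = \<one>\<^bsub>G\<^esub>"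
  have c: "set us \<subseteq> carrier W" "set ws \<subseteq> carrier W" using W.fac_carrier[OF assms(1)] by auto
  have "W.fac (us @ map F (as @ vs @ bs) @ ws)"
    using W.fac_heq[OF assms(1) W.heq_context[OF F_heq[OF v(1)] c]] .
  then have "W.fac ((us @ map F as) @ map F vs @ (map F bs @ ws))" by simp
  moreover have "prodl W (map F vs) = \<one>\<^bsub>W\<^esub>"
    using F_prodl[of vs] v(2) G.heq_carrier[OF v(1)] by simp
  ultimately show "vs = []" using W.fac_sub by blast
qed

text \<open>The list is a separate argument because the second walk enters translated by the product
  of the first part. Unordered pairs make the relation symmetric.\<close>

definition linked :: "'a forest \<Rightarrow> 'a list \<Rightarrow> 'a \<Rightarrow> 'a \<Rightarrow> bool" where
  "linked f L x y \<longleftrightarrow> (\<exists>i j a b. (i, j, a, b) \<in> G.pairs f \<and> {x, y} = {L ! i, L ! j})"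

lemma linked_sym: "linked f L x y \<Longrightarrow> linked f L y x"
  unfolding linked_def by (simp add: insert_commute)

lemma linked_unique:
  assumes "distinct L" "length L = length (G.trace f)" "linked f L x y" "linked f L x y'"
  shows "y = y'"
proof -
  obtain i j a b where p: "(i, j, a, b) \<in> G.pairs f" "{x, y} = {L ! i, L ! j}"
    using assms(3) linked_def by auto
  obtain i' j' a' b' where q: "(i', j', a', b') \<in> G.pairs f" "{x, y'} = {L ! i', L ! j'}"
    using assms(4) linked_def by auto
  have b: "i < j" "j < length L" "i' < j'" "j' < length L"
    using G.pairs_bounds[OF p(1)] G.pairs_bounds[OF q(1)] assms(2) by auto
  have "x \<in> {L ! i, L ! j} \<inter> {L ! i', L ! j'}" using p(2) q(2) by blast
  then have "i = i' \<or> i = j' \<or> j = i' \<or> j = j'"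
    using b assms(1) by (auto simp: nth_eq_iff_index_eq)
  then have "i = i' \<and> j = j'" using G.pairs_laminar[OF p(1) q(1)] b by auto
  then show ?thesis using p(2) q(2) b assms(1) by (auto simp: doubleton_eq_iff)
qed

lemma linked_dom:
  assumes "length L = length (G.trace f)" "linked f L x y"
  shows "x \<in> set L"
proof -
  obtain i j a b where p: "(i, j, a, b) \<in> G.pairs f" "{x, y} = {L ! i, L ! j}"
    using assms(2) linked_def by auto
  then have "i < length L" "j < length L" using G.pairs_bounds[OF p(1)] assms(1) by auto
  then show ?thesis using p(2) nth_mem by (metis insert_iff singletonD)
qed

lemma linked_ex:
  assumes "length L = length (G.trace f)" "x \<in> set L"
  shows "\<exists>y. linked f L x y"
proof -
  obtain i where i: "i < length L" "L ! i = x" using assms(2) by (metis in_set_conv_nth)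
  then obtain j a b where "(i, j, a, b) \<in> G.pairs f \<or> (j, i, a, b) \<in> G.pairs f"
    using G.pairs_cover assms(1) by metis
  then have "linked f L x (L ! j)" unfolding linked_def using i by (metis insert_commute)
  then show ?thesis by blast
qed

lemma trace_step:
  assumes f: "G.forest c u f" "u \<in> carrier G" and p: "(i, j, a, b) \<in> G.pairs f"
    and g: "g \<in> carrier G"
  shows "F (map ((\<otimes>\<^bsub>G\<^esub>) g) (G.trace f) ! j)
    = conjg W (F g) (W.seg (map F (flat f)) a b) \<otimes>\<^bsub>W\<^esub> F (map ((\<otimes>\<^bsub>G\<^esub>) g) (G.trace f) ! i)"
proof -
  have fl: "set (flat f) \<subseteq> carrier G" using G.forest_flat[OF f(1)] .
  have b: "i < length (G.trace f)" "j < length (G.trace f)" using G.pairs_bounds[OF p] by auto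
  then have tc: "G.trace f ! i \<in> carrier G" using G.trace_carrier[OF f] by (meson nth_mem subsetD)
  have q: "set (take k (flat f)) \<subseteq> carrier G" for k using fl set_take_subset by (metis order_trans)
  then have pc: "prodl G (take k (flat f)) \<in> carrier G" for k by blast
  have s: "F (prodl G (take k (flat f))) = prodl W (take k (map F (flat f)))" for k
    using F_prodl[OF q] by (simp add: take_map)
  have sc: "prodl W (take k (map F (flat f))) \<in> carrier W" for k using s pc by (metis F.hom_closed)
  show ?thesis
    using b g tc pc sc G.pairs_mult[OF f p]
    by (simp add: s W.seg_def conjg_def W.m_assoc)
      (simp add: W.m_assoc[symmetric])
qed

end

lemma (in group) heq_subgroup:
  assumes "heq G xs ys" "subgroup S G" "set xs \<subseteq> S"
  shows "set ys \<subseteq> S"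
proof -
  have step: "set (hurwitz_step G l zs) \<subseteq> S" if "set zs \<subseteq> S" for l zs
  proof (cases rule: hurwitz_step_cases[of l zs])
    case (2 us x y vs b)
    then have xy: "x \<in> S" "y \<in> S" using that by auto
    then have "x \<otimes> y \<otimes> inv x \<in> S" "inv y \<otimes> x \<otimes> y \<in> S"
      using subgroup.m_closed[OF assms(2)] subgroup.m_inv_closed[OF assms(2)] by auto
    then show ?thesis using 2 xy that by (auto simp: hurwitz_step_split)
  qed (use that in simp)
  have "set (hurwitz G w zs) \<subseteq> S" if "set zs \<subseteq> S" for w zs
    using that by (induction w arbitrary: zs) (use step in simp_all)
  then show ?thesis using assms by (auto simp: heq_def)
qed

context lift
begin

text \<open>The traces of the two forests cancel along \<open>B\<close>, leaving the path \<open>A @ A'\<close>.\<close>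

definition data :: "'a \<Rightarrow> 'a \<Rightarrow> 'a \<Rightarrow> (bool \<Rightarrow> 'a forest) \<Rightarrow> 'a list \<Rightarrow> 'a list \<Rightarrow> 'a list \<Rightarrow> bool" where
  "data a0 b0 p f A B A' \<longleftrightarrow>
     W.fac (map F (flat (f True)) @ map F (flat (f False))) \<and>
     (\<forall>c. set (map F (flat (f c))) \<subseteq> K c \<and> G.forest True \<one>\<^bsub>G\<^esub> (f c)) \<and>
     p = prodl G (flat (f True)) \<and> F p = h1 \<and>
     G.trace (f True) = A @ B \<and> map ((\<otimes>\<^bsub>G\<^esub>) p) (G.trace (f False)) = rev B @ A' \<and>
     A @ A' = [a0, b0] \<and> distinct (A @ B) \<and> distinct (rev B @ A') \<and> a0 \<noteq> b0"

text \<open>The parts are reduced separately. After cancellation at the junction a reduced path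
  remains from the base vertex to its translate by the whole product, and by uniqueness of such
  paths it is \<open>[a0, b0]\<close>.\<close>

theorem data_exists:
  assumes ell: "\<forall>y\<in>set (Y1 @ Y2). G.elliptic y"
    and fac: "W.fac (map F Y1 @ map F Y2)"
    and K: "set (map F Y1) \<subseteq> K True" "set (map F Y2) \<subseteq> K False"
    and prods: "prodl W (map F Y1) = h1"
    and L: "G.path True \<one>\<^bsub>G\<^esub> [a0, b0]" "a0 \<noteq> b0" "inv\<^bsub>G\<^esub> b0 \<otimes>\<^bsub>G\<^esub> prodl G (Y1 @ Y2) \<in> H True"
  shows "\<exists>f A B A'. data a0 b0 (prodl G Y1) f A B A' \<and> heq G Y1 (flat (f True)) \<and> heq G Y2 (flat (f False))"
proof -
  have Yc: "set Y1 \<subseteq> carrier G" "set Y2 \<subseteq> carrier G" using ell G.elliptic_carrier by auto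
  have nd: "G.nondegenerate Y1" "G.nondegenerate Y2"
    using F_fac_nondegenerate[of "[]" Y1 "map F Y2"] F_fac_nondegenerate[of "map F Y1" Y2 "[]"] fac Yc
    by simp_all
  have "\<forall>y\<in>set Y1. G.elliptic y" "\<forall>y\<in>set Y2. G.elliptic y" using ell by auto
  from G.reduced_forest[OF this(1) nd(1)] G.reduced_forest[OF this(2) nd(2)]
  obtain f1 f2 where f: "G.forest True \<one>\<^bsub>G\<^esub> f1" "heq G Y1 (flat f1)" "distinct_adj (G.trace f1)"
    "G.forest True \<one>\<^bsub>G\<^esub> f2" "heq G Y2 (flat f2)" "distinct_adj (G.trace f2)"
    by blast
  let ?p = "prodl G Y1" and ?q = "prodl G Y2" and ?L2 = "map ((\<otimes>\<^bsub>G\<^esub>) (prodl G Y1)) (G.trace f2)"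
  have pq: "?p \<in> carrier G" "?q \<in> carrier G" using Yc by auto
  have p: "prodl G (flat f1) = ?p" "prodl G (flat f2) = ?q" using G.heq_prodl f by auto
  note T1 = G.trace_path_end[OF f(1) G.one_closed] and T2 = G.trace_path_end[OF f(4) G.one_closed]
  let ?l1 = "last (\<one>\<^bsub>G\<^esub> # G.trace f1)" and ?l2 = "last (\<one>\<^bsub>G\<^esub> # G.trace f2)"
  have tr: "set (G.trace f1) \<subseteq> carrier G" "set (G.trace f2) \<subseteq> carrier G"
    using G.trace_carrier f by blast+
  have l: "?l1 \<in> carrier G" "?l2 \<in> carrier G"
    using tr last_in_set[of "\<one>\<^bsub>G\<^esub> # G.trace f1"] last_in_set[of "\<one>\<^bsub>G\<^esub> # G.trace f2"] by auto
  have e1: "inv\<^bsub>G\<^esub> ?l1 \<otimes>\<^bsub>G\<^esub> ?p \<in> H True" using T1 p pq by simp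
  have "G.path True ?p ?L2" using G.path_mult[OF pq(1) G.one_closed] T2 pq by simp
  then have "G.path True ?l1 ?L2" using G.path_cong[OF e1 l(1) pq(1)] by simp
  then have 1: "G.path True \<one>\<^bsub>G\<^esub> (G.trace f1 @ ?L2)" using T1 by (simp add: G.path_append)
  have da: "distinct_adj ?L2"
    using f(6) inj_on_subset[OF G.inj_on_mult[OF pq(1)] tr(2)] distinct_adj_map_iff by blast
  have ev0: "even (length (G.trace f1 @ ?L2)) = True" using T1 T2 by simp
  obtain A B A' where AB: "G.trace f1 = A @ B" "?L2 = rev B @ A'" "G.path True \<one>\<^bsub>G\<^esub> (A @ A')"
    "distinct_adj (A @ A')"
    "inv\<^bsub>G\<^esub> (last (\<one>\<^bsub>G\<^esub> # A @ A')) \<otimes>\<^bsub>G\<^esub> last (\<one>\<^bsub>G\<^esub> # G.trace f1 @ ?L2) \<in> H True"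
    using G.path_cancel[OF 1 f(3) da G.one_closed] unfolding ev0 simp_thms by blast
  have ev: "even (length (A @ A'))"
    using AB(1,2) T1 T2 by (metis even_add length_append length_map length_rev)
  have endL: "inv\<^bsub>G\<^esub> (last (\<one>\<^bsub>G\<^esub> # G.trace f1 @ ?L2)) \<otimes>\<^bsub>G\<^esub> (?p \<otimes>\<^bsub>G\<^esub> ?q) \<in> H True"
  proof (cases "G.trace f2 = []")
    case True
    have "inv\<^bsub>G\<^esub> ?p \<otimes>\<^bsub>G\<^esub> (?p \<otimes>\<^bsub>G\<^esub> ?q) \<in> H True"
      using T2 True p pq by (simp add: G.m_assoc[symmetric])
    then show ?thesis using True G.H_inv_mult_trans[OF l(1) pq(1) _ e1] pq by simp
  next
    case False
    then have "inv\<^bsub>G\<^esub> (?p \<otimes>\<^bsub>G\<^esub> ?l2) \<otimes>\<^bsub>G\<^esub> (?p \<otimes>\<^bsub>G\<^esub> ?q) \<in> H True"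
      using T2 p pq l G.inv_mult_cancel[of ?p ?l2 ?q] by simp
    then show ?thesis using False by (simp add: last_map)
  qed
  have cc: "last (\<one>\<^bsub>G\<^esub> # A @ A') \<in> carrier G" "last (\<one>\<^bsub>G\<^esub> # G.trace f1 @ ?L2) \<in> carrier G"
    using G.path_carrier[OF AB(3)] G.path_carrier[OF 1] last_in_set[of "\<one>\<^bsub>G\<^esub> # A @ A'"]
      last_in_set[of "\<one>\<^bsub>G\<^esub> # G.trace f1 @ ?L2"] by auto
  have bc: "b0 \<in> carrier G" using L(1) by simp
  have "inv\<^bsub>G\<^esub> (?p \<otimes>\<^bsub>G\<^esub> ?q) \<otimes>\<^bsub>G\<^esub> b0 \<in> H True"
    using G.H_inv_mult_commute[OF bc _ L(3)] Yc pq by (simp add: G.prodl_append)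
  then have "inv\<^bsub>G\<^esub> (last (\<one>\<^bsub>G\<^esub> # A @ A')) \<otimes>\<^bsub>G\<^esub> last (\<one>\<^bsub>G\<^esub> # [a0, b0]) \<in> H True"
    using G.H_inv_mult_trans[OF cc(1) _ bc G.H_inv_mult_trans[OF cc _ AB(5) endL]] pq by simp
  then have LA: "A @ A' = [a0, b0]"
    using G.path_unique[OF AB(3) L(1) AB(4)] L(2) ev by simp
  have "F ?p = h1" using F_prodl Yc prods by simp
  moreover have fl: "heq W (map F Y1) (map F (flat f1))" "heq W (map F Y2) (map F (flat f2))"
    using F_heq f by auto
  moreover have "W.fac (map F (flat f1) @ map F (flat f2))"
    using W.fac_heq[OF fac W.heq_append[OF fl]] .
  moreover have "set (map F (flat f1)) \<subseteq> K True" "set (map F (flat f2)) \<subseteq> K False"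
    using W.heq_subgroup[OF fl(1) W.H_subgroup K(1)] W.heq_subgroup[OF fl(2) W.H_subgroup K(2)] .
  moreover have "distinct (A @ B)" using G.path_distinct[of True "\<one>\<^bsub>G\<^esub>" "G.trace f1"] T1 f(3) AB(1) by simp
  moreover have "distinct (rev B @ A')"
    using G.path_distinct[OF \<open>G.path True ?p ?L2\<close> da pq(1)] AB(2) by simp
  ultimately have "data a0 b0 ?p (\<lambda>c. if c then f1 else f2) A B A'"
    unfolding data_def using AB(1,2) LA L(2) p f by (auto split: if_splits)
  then show ?thesis using f by (intro exI[of _ "\<lambda>c. if c then f1 else f2"]) auto
qed

end

locale lift_data = lift W K T h1 h2 n G H F
  for W :: "('b, 'n) monoid_scheme" and K T h1 h2 n and G :: "('a, 'm) monoid_scheme" and H F +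
  fixes a0 b0 p :: 'a and f :: "bool \<Rightarrow> 'a forest" and A B A' :: "'a list"
  assumes data: "data a0 b0 p f A B A'"
begin

text \<open>Both walks are placed in one tree, the second translated by \<open>p\<close>; the
  cancelled edges then occur in both lists. The word \<open>Z\<close> and the offset
  \<open>off\<close> number the letters of both parts consecutively.\<close>

definition L :: "bool \<Rightarrow> 'a list" where "L c = (if c then A @ B else rev B @ A')"
definition Z :: "'b list" where "Z = map F (flat (f True)) @ map F (flat (f False))"
definition off :: "bool \<Rightarrow> nat" where "off c = (if c then 0 else length (flat (f True)))"
definition shift :: "bool \<Rightarrow> 'a" where "shift c = (if c then \<one>\<^bsub>G\<^esub> else p)"

lemma facZ: "W.fac Z" and forest: "G.forest True \<one>\<^bsub>G\<^esub> (f c)" and flat_K: "set (map F (flat (f c))) \<subseteq> K c"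
  and p: "p = prodl G (flat (f True))" "F p = h1"
  and AA': "A @ A' = [a0, b0]" and a0b0: "a0 \<noteq> b0"
  and dAB: "distinct (A @ B)" "distinct (rev B @ A')"
  and tr: "G.trace (f True) = A @ B" "map ((\<otimes>\<^bsub>G\<^esub>) p) (G.trace (f False)) = rev B @ A'"
  using data unfolding data_def Z_def by blast+

lemma shift_carrier: "shift c \<in> carrier G"
proof -
  have "p \<in> carrier G" using G.prodl_flat[OF forest[of True]] p(1) by metis
  then show ?thesis by (simp add: shift_def)
qed

lemma trace_carrier: "set (G.trace (f c)) \<subseteq> carrier G"
  using G.trace_carrier[OF forest G.one_closed] .

lemma L_trace: "L c = map ((\<otimes>\<^bsub>G\<^esub>) (shift c)) (G.trace (f c))"
proof (cases c)
  case True
  have "map ((\<otimes>\<^bsub>G\<^esub>) \<one>\<^bsub>G\<^esub>) (G.trace (f c)) = G.trace (f c)"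
    using trace_carrier by (intro map_idI) (metis G.l_one subsetD)
  then show ?thesis using True tr(1) by (simp add: L_def shift_def)
qed (use tr(2) in \<open>simp add: L_def shift_def\<close>)

lemma L_length: "length (L c) = length (G.trace (f c))"
  by (simp add: L_trace)

lemma L_distinct: "distinct (L c)"
  using dAB by (auto simp: L_def)

lemma L_carrier: "set (L c) \<subseteq> carrier G"
  using trace_carrier shift_carrier by (auto simp: L_trace)

text \<open>The prefix \<open>h1\<close> in front of the second part accounts for the conjugation by
  the image of \<open>shift c\<close>, so segments of either part become segments of
  \<open>Z\<close>. A branch that encloses no letter would cross the same edge twice, against
  distinctness.\<close>

lemma pair_step:
  assumes "(i, j, a, b) \<in> G.pairs (f c)"
  shows "F (L c ! j) = W.seg Z (off c + a) (off c + b) \<otimes>\<^bsub>W\<^esub> F (L c ! i)"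
    and "a < b" and "off c + b \<le> n" and "W.seg Z (off c + a) (off c + b) \<in> W.K' c"
    and "i < j" and "j < length (L c)"
proof -
  note b = G.pairs_bounds[OF assms]
  have tc: "set (G.trace (f c)) \<subseteq> carrier G" using trace_carrier .
  show ij: "i < j" "j < length (L c)" using b L_length by auto
  have ln: "n = length (flat (f True)) + length (flat (f False))"
    using facZ unfolding W.fac_def Z_def by simp
  show "off c + b \<le> n" using b ln by (cases c) (auto simp: off_def)
  show "a < b"
  proof (rule ccontr)
    assume "\<not> a < b"
    then have "a = b" using b by simp
    moreover have "prodl G (take b (flat (f c))) \<in> carrier G"
      using G.forest_flat[OF forest] set_take_subset by (metis order_trans G.prodl_closed)
    moreover have "G.trace (f c) ! i \<in> carrier G" using tc b by (meson nth_mem order_less_trans subsetD)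
    ultimately have "G.trace (f c) ! j = G.trace (f c) ! i"
      using G.pairs_mult[OF forest G.one_closed assms] by simp
    then have "L c ! j = L c ! i" using b by (simp add: L_trace)
    then show False using L_distinct ij by (simp add: nth_eq_iff_index_eq)
  qed
  have Wc: "set (map F (flat (f c))) \<subseteq> carrier W" for c
    using flat_K W.H_carrier by (metis subsetD subsetI)
  have s: "W.seg Z (off c + a) (off c + b) = conjg W (F (shift c)) (W.seg (map F (flat (f c))) a b)"
  proof (cases c)
    case True
    then have "W.seg Z (off c + a) (off c + b) = W.seg (map F (flat (f c))) a b"
      using W.seg_append1[of b "map F (flat (f True))" a] b by (simp add: off_def Z_def)
    then show ?thesis using True W.H_carrier[OF W.seg_H[OF flat_K]] by (simp add: shift_def)
  next
    case False
    have "prodl W (map F (flat (f True))) = h1"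
      using F_prodl[OF G.forest_flat[OF forest]] p by simp
    then show ?thesis using False W.seg_append2[OF Wc Wc, of True False a b] p(2)
      by (simp add: shift_def off_def Z_def)
  qed
  show "W.seg Z (off c + a) (off c + b) \<in> W.K' c"
    using s W.seg_H[OF flat_K, of c a b] W.K'_True p(2) W.H_carrier by (cases c) (auto simp: shift_def)
  show "F (L c ! j) = W.seg Z (off c + a) (off c + b) \<otimes>\<^bsub>W\<^esub> F (L c ! i)"
    using trace_step[OF forest G.one_closed assms shift_carrier] s by (simp add: L_trace)
qed

abbreviation R :: "bool \<Rightarrow> 'a \<Rightarrow> 'a \<Rightarrow> bool" where "R \<equiv> \<lambda>c. linked (f c) (L c)"

lemma FL_carrier: "x \<in> set (L c) \<Longrightarrow> F x \<in> carrier W"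
  using L_carrier by (meson F.hom_closed subsetD)

lemma chase: "chase W W.K' R F (\<lambda>c. set (L c))"
proof (rule chase.intro[OF W.free_prod_conj[OF W.h1_carrier]], unfold_locales)
  fix c x y assume "R c x y"
  then obtain i j a b where q: "(i, j, a, b) \<in> G.pairs (f c)" "{x, y} = {L c ! i, L c ! j}"
    unfolding linked_def by auto
  note s = pair_step[OF q(1)]
  let ?s = "W.seg Z (off c + a) (off c + b)"
  have sc: "?s \<in> carrier W" using s(4) W.H_carrier W.h1_carrier by auto
  have n1: "?s \<noteq> \<one>\<^bsub>W\<^esub>" using W.seg_nontrivial[OF facZ] s(2,3) by simp
  interpret K': free_prod W W.K' by (rule W.free_prod_conj[OF W.h1_carrier])
  have Fi: "F (L c ! i) \<in> carrier W" using FL_carrier[of "L c ! i" c] s(5,6) by simp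
  consider "x = L c ! j" "y = L c ! i" | "x = L c ! i" "y = L c ! j" using q(2) by (auto simp: doubleton_eq_iff)
  then show "\<exists>z\<in>W.K' c. z \<noteq> \<one>\<^bsub>W\<^esub> \<and> F x = z \<otimes>\<^bsub>W\<^esub> F y"
  proof cases
    case 1
    then show ?thesis using s n1 by blast
  next
    case 2
    have "inv\<^bsub>W\<^esub> ?s \<in> W.K' c" using K'.H_inv[OF s(4)] .
    moreover have "inv\<^bsub>W\<^esub> ?s \<noteq> \<one>\<^bsub>W\<^esub>" using n1 sc by (metis W.inv_inv W.inv_one)
    moreover have "F x = inv\<^bsub>W\<^esub> ?s \<otimes>\<^bsub>W\<^esub> F y"
      using 2 s(1) sc Fi by (simp add: W.m_assoc[symmetric])
    ultimately show ?thesis by blast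
  qed
qed (use FL_carrier linked_sym linked_dom[OF L_length] linked_ex[OF L_length]
    linked_unique[OF L_distinct L_length] in \<open>(blast | simp)+\<close>)

lemma ends: "set A \<union> set A' = {a0, b0}" "set A \<inter> set A' = {}"
proof -
  show "set A \<union> set A' = {a0, b0}" using AA' by (metis empty_set list.simps(15) set_append)
  have "distinct (A @ A')" using AA' a0b0 by simp
  then show "set A \<inter> set A' = {}" by simp
qed

text \<open>Cancelled edges lie on both walks and surviving ones on a single walk. Hence
  \<open>a0\<close> and \<open>b0\<close> are the ends of the chain.\<close>

lemma sets: "set (L True) \<union> set (L False) = set A \<union> set B \<union> set A'"
  "x \<in> set (L True) \<union> set (L False) \<Longrightarrow> x \<notin> set (L True) \<inter> set (L False) \<longleftrightarrow> x = a0 \<or> x = b0"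
  "a0 \<in> set (L True) \<longleftrightarrow> a0 \<in> set A" "b0 \<in> set (L True) \<longleftrightarrow> b0 \<in> set A"
proof -
  show 1: "set (L True) \<union> set (L False) = set A \<union> set B \<union> set A'" unfolding L_def by auto
  have d: "set A \<inter> set B = {}" "set B \<inter> set A' = {}" using dAB by auto
  have "x \<notin> set (L True) \<inter> set (L False) \<longleftrightarrow> x \<in> set A \<union> set A'"
    if "x \<in> set A \<union> set B \<union> set A'" for x
    using that d ends(2) unfolding L_def by auto
  then show "x \<in> set (L True) \<union> set (L False) \<Longrightarrow> x \<notin> set (L True) \<inter> set (L False) \<longleftrightarrow> x = a0 \<or> x = b0"
    unfolding 1 ends(1) by blast
  have "a0 \<notin> set B" "b0 \<notin> set B" using ends(1) d by blast+
  then show "a0 \<in> set (L True) \<longleftrightarrow> a0 \<in> set A" "b0 \<in> set (L True) \<longleftrightarrow> b0 \<in> set A"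
    unfolding L_def by auto
qed

abbreviation c0 :: bool where "c0 \<equiv> a0 \<in> set A"

text \<open>The letters \<open>zs\<close> are the normal form of \<open>F a0\<close> divided by
  \<open>F b0\<close>, so they do not depend on the forests. The final conjunct holds because the
  colour of the last link tells which walk contains \<open>b0\<close>.\<close>

lemma normal_form:
  "\<exists>vs zs. chain R c0 (a0 # vs) \<and> distinct (a0 # vs) \<and> distinct (map F (a0 # vs)) \<and> vs \<noteq> []
    \<and> last vs = b0 \<and> set (a0 # vs) = set A \<union> set B \<union> set A'
    \<and> (\<forall>c x y. R c x y \<longrightarrow> (\<exists>i<length vs. c = (even i = c0) \<and>
          ({x, y} = {(a0 # vs) ! i, (a0 # vs) ! Suc i})))
    \<and> alternating W W.K' c0 zs \<and> length zs = length vs \<and> F a0 = prodl W zs \<otimes>\<^bsub>W\<^esub> F b0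
    \<and> map F (a0 # vs) = chase.walk W zs (F a0) \<and> (b0 \<in> set A \<longleftrightarrow> (odd (length vs) = c0))"
proof -
  interpret chase W W.K' R F "\<lambda>c. set (L c)" by (rule chase)
  have a0: "a0 \<in> set (L True) \<union> set (L False)" using ends(1) sets(1) by blast
  obtain vs where vs: "chain R c0 (a0 # vs)" "distinct (a0 # vs)" "vs \<noteq> []" "last vs = b0"
    "set (a0 # vs) = set (L True) \<union> set (L False)"
    "\<forall>c x y. R c x y \<longrightarrow> (\<exists>i<length vs. c = (even i = c0) \<and> {x, y} = {(a0 # vs) ! i, (a0 # vs) ! Suc i})"
    using chase[OF sets(2) a0] unfolding sets(3) by blast
  obtain c' where c': "a0 \<in> set (L c')" using a0 by blast
  obtain zs where zs: "alternating W W.K' c0 zs" "length zs = length vs"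
    "F a0 = prodl W zs \<otimes>\<^bsub>W\<^esub> F (last (a0 # vs))" "map F (a0 # vs) = walk zs (F a0)"
    using chain_alternating[OF vs(1) c'] by blast
  have l: "Suc (length vs - 1) = length vs" using vs(3) by simp
  then have "R (even (length vs - 1) = c0) ((a0 # vs) ! (length vs - 1)) ((a0 # vs) ! length vs)"
    using chain_nth[OF vs(1), of "length vs - 1"] by simp
  moreover have "(a0 # vs) ! length vs = b0" using vs(3,4) by (simp add: last_conv_nth nth_Cons')
  moreover have "(even (length vs - 1) = c0) = (odd (length vs) = c0)" using l by (metis even_Suc)
  ultimately have "R (odd (length vs) = c0) ((a0 # vs) ! (length vs - 1)) b0" by simp
  from R_dom[OF R_sym[OF this]] have b: "b0 \<in> set (L (odd (length vs) = c0))" .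
  have "b0 \<notin> set (L True) \<inter> set (L False)" using sets(2)[of b0] vs(4,5) vs(3) last_in_set by auto
  then have "b0 \<in> set (L True) \<longleftrightarrow> (odd (length vs) = c0)"
    using b by (cases "odd (length vs) = c0") auto
  then show ?thesis
    using vs zs chain_distinct_F[OF vs(1) a0] unfolding sets(1,4) by (intro exI[of _ vs] exI[of _ zs]) simp
qed

end

section \<open>The order in which edges are crossed\<close>

lemma before_nth:
  "distinct L \<Longrightarrow> i < length L \<Longrightarrow> j < length L \<Longrightarrow> before L (L ! i) (L ! j) \<longleftrightarrow> i < j"
  unfolding before_def by (metis distinct_conv_nth nth_eq_iff_index_eq order_less_trans)

lemma before_rev:
  assumes "distinct L" "x \<in> set L" "y \<in> set L" "x \<noteq> y"
  shows "before (rev L) x y \<longleftrightarrow> \<not> before L x y"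
proof -
  obtain i j where ij: "i < length L" "L ! i = x" "j < length L" "L ! j = y"
    using assms by (metis in_set_conv_nth)
  have "rev L ! (length L - Suc i) = x" "rev L ! (length L - Suc j) = y"
    using ij by (simp_all add: rev_nth)
  then have "before (rev L) x y \<longleftrightarrow> length L - Suc i < length L - Suc j"
    using before_nth[of "rev L" "length L - Suc i" "length L - Suc j"] ij assms(1) by simp
  moreover have "before L x y \<longleftrightarrow> i < j" using before_nth ij assms(1) by metis
  moreover have "i \<noteq> j" using ij assms(4) by auto
  ultimately show ?thesis using ij by auto
qed

lemma before_Cons:
  "before (z # L) x y \<longleftrightarrow> (x = z \<and> y \<in> set L) \<or> before L x y"
proof
  assume "before (z # L) x y"
  then obtain i j where ij: "i < j" "j < length (z # L)" "(z # L) ! i = x" "(z # L) ! j = y"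
    unfolding before_def by blast
  then obtain j' where j: "j = Suc j'" by (cases j) auto
  show "(x = z \<and> y \<in> set L) \<or> before L x y"
  proof (cases i)
    case 0
    then show ?thesis using ij j by auto
  next
    case (Suc i')
    then have "before L x y" unfolding before_def using ij j by (intro exI[of _ i'] exI[of _ j']) simp
    then show ?thesis ..
  qed
next
  assume "(x = z \<and> y \<in> set L) \<or> before L x y"
  then show "before (z # L) x y"
  proof
    assume "x = z \<and> y \<in> set L"
    then obtain j where "j < length L" "L ! j = y" "x = z" by (metis in_set_conv_nth)
    then show ?thesis unfolding before_def by (intro exI[of _ 0] exI[of _ "Suc j"]) simp
  next
    assume "before L x y"
    then obtain i j where "i < j" "j < length L" "L ! i = x" "L ! j = y" unfolding before_def by blast
    then show ?thesis unfolding before_def by (intro exI[of _ "Suc i"] exI[of _ "Suc j"]) simp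
  qed
qed

lemma before_append:
  "before (L @ M) x y \<longleftrightarrow> before L x y \<or> (x \<in> set L \<and> y \<in> set M) \<or> before M x y"
proof (induction L)
  case Nil
  then show ?case by (simp add: before_def)
qed (auto simp: before_Cons)

lemma before_mem: "before L x y \<Longrightarrow> x \<in> set L \<and> y \<in> set L"
  unfolding before_def by (metis nth_mem order_less_trans)

lemma before_asym:
  assumes "distinct L" "x \<in> set L" "y \<in> set L" "x \<noteq> y"
  shows "before L y x \<longleftrightarrow> \<not> before L x y"
proof -
  obtain i j where ij: "i < length L" "L ! i = x" "j < length L" "L ! j = y"
    using assms by (metis in_set_conv_nth)
  then have "before L x y \<longleftrightarrow> i < j" "before L y x \<longleftrightarrow> j < i" using before_nth assms(1) by metis+
  moreover have "i \<noteq> j" using ij assms(4) by auto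
  ultimately show ?thesis by auto
qed

lemma before_map_inj:
  assumes "inj_on g (set L)" "x \<in> set L" "y \<in> set L"
  shows "before (map g L) (g x) (g y) \<longleftrightarrow> before L x y"
proof
  assume "before (map g L) (g x) (g y)"
  then obtain i j where "i < j" "j < length L" "g (L ! i) = g x" "g (L ! j) = g y"
    unfolding before_def by auto
  moreover from this have "L ! i = x" "L ! j = y"
    using assms by (meson inj_onD nth_mem order_less_trans)+
  ultimately show "before L x y" unfolding before_def by blast
next
  assume "before L x y"
  then obtain i j where "i < j" "j < length L" "L ! i = x" "L ! j = y" unfolding before_def by blast
  then show "before (map g L) (g x) (g y)" unfolding before_def by (intro exI[of _ i] exI[of _ j]) simp
qed

lemma before_determines:
  assumes "distinct xs" "distinct ys" "set xs = set ys"
    and "\<And>x y. x \<in> set xs \<Longrightarrow> y \<in> set xs \<Longrightarrow> x \<noteq> y \<Longrightarrow> before xs x y \<longleftrightarrow> before ys x y"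
  shows "xs = ys"
  using assms
proof (induction xs arbitrary: ys)
  case (Cons x xs)
  obtain y ys' where ys: "ys = y # ys'" using Cons.prems by (cases ys) auto
  have xy: "x = y"
  proof (rule ccontr)
    assume ne: "x \<noteq> y"
    have m: "y \<in> set xs" "x \<in> set ys'" using ne Cons.prems(3) ys by auto
    then have "before (x # xs) x y" by (simp add: before_Cons)
    then have "before (y # ys') x y" using Cons.prems(4)[of x y] ne m ys by simp
    then have "before ys' x y" using ne by (simp add: before_Cons)
    then show False using before_mem Cons.prems(2) ys by fastforce
  qed
  have "xs = ys'"
  proof (rule Cons.IH)
    show "set xs = set ys'" using Cons.prems(1-3) ys xy by auto
    fix u v assume uv: "u \<in> set xs" "v \<in> set xs" "u \<noteq> v"
    then have "u \<noteq> x" using Cons.prems by auto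
    then show "before xs u v \<longleftrightarrow> before ys' u v"
      using Cons.prems(4)[of u v] uv ys xy by (simp add: before_Cons)
  qed (use Cons.prems ys in auto)
  then show ?case using xy ys by simp
qed simp

text \<open>The relation \<open>M\<close> abstracts from the condition that the move spaces of two elements meet
  nontrivially.\<close>

locale ordered_lift = lift W K T h1 h2 n G H F
  for W :: "('b, 'n) monoid_scheme" and K T h1 h2 n and G :: "('a, 'm) monoid_scheme" and H F +
  fixes M :: "'b \<Rightarrow> 'b \<Rightarrow> bool"
  assumes M_disj: "W.fac xs \<Longrightarrow> a < b \<Longrightarrow> b \<le> a' \<Longrightarrow> a' < b' \<Longrightarrow> b' \<le> n \<Longrightarrow>
      \<not> M (W.seg xs a b) (W.seg xs a' b')"
    and M_nest: "W.fac xs \<Longrightarrow> a \<le> a' \<Longrightarrow> a' < b' \<Longrightarrow> b' \<le> b \<Longrightarrow> b \<le> n \<Longrightarrow>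
      M (W.seg xs a b) (W.seg xs a' b')"
    and M_sym: "M x y \<Longrightarrow> M y x"
    and M_inv: "x \<in> carrier W \<Longrightarrow> M (inv\<^bsub>W\<^esub> x) y \<longleftrightarrow> M x y"

locale ordered_data =
  ordered_lift W K T h1 h2 n G H F M + lift_data W K T h1 h2 n G H F a0 b0 p f A B A'
  for W :: "('b, 'n) monoid_scheme" and K T h1 h2 n and G :: "('a, 'm) monoid_scheme" and H F M
    and a0 b0 p :: 'a and f A B A'
begin

definition ratio :: "'a \<Rightarrow> 'a \<Rightarrow> 'b" where "ratio x y = F y \<otimes>\<^bsub>W\<^esub> inv\<^bsub>W\<^esub> (F x)"

lemma M_sym_iff: "M x y \<longleftrightarrow> M y x"
  using M_sym by blast

lemma ratio_M:
  assumes q: "(i, j, a, b) \<in> G.pairs (f c)" and xy: "{x, y} = {L c ! i, L c ! j}"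
  shows "M (ratio x y) z \<longleftrightarrow> M (W.seg Z (off c + a) (off c + b)) z"
proof -
  note s = pair_step[OF q]
  let ?s = "W.seg Z (off c + a) (off c + b)"
  have sc: "?s \<in> carrier W" using s(4) W.H_carrier W.h1_carrier by auto
  have Fi: "F (L c ! i) \<in> carrier W" using FL_carrier[of "L c ! i" c] s(5,6) by simp
  have r: "F (L c ! j) \<otimes>\<^bsub>W\<^esub> inv\<^bsub>W\<^esub> (F (L c ! i)) = ?s" using s(1) sc Fi by (simp add: W.m_assoc)
  have r': "F (L c ! i) \<otimes>\<^bsub>W\<^esub> inv\<^bsub>W\<^esub> (F (L c ! j)) = inv\<^bsub>W\<^esub> ?s"
    using s(1) sc Fi by (simp add: W.inv_mult_group W.m_assoc[symmetric])
  consider "x = L c ! j" "y = L c ! i" | "x = L c ! i" "y = L c ! j" using xy by (auto simp: doubleton_eq_iff)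
  then show ?thesis
    by cases (simp_all add: ratio_def r r' M_inv[OF sc])
qed

text \<open>If two arcs are disjoint, both ends of one precede both ends of the other. If they are
  nested, the ends of the outer arc lie on different sides of the inner one, so replacing both edges
  by their partners reverses the order. \<open>M\<close> decides which case occurs.\<close>

lemma arcs_before:
  assumes "R c x x'" "R c y y'" "y \<noteq> x" "y \<noteq> x'"
  shows "before (L c) x y \<longleftrightarrow> (before (L c) x' y' \<noteq> M (ratio x x') (ratio y y'))"
proof -
  obtain i j a b where q: "(i, j, a, b) \<in> G.pairs (f c)" and x: "{x, x'} = {L c ! i, L c ! j}"
    using assms(1) linked_def by auto
  obtain k l d e where q': "(k, l, d, e) \<in> G.pairs (f c)" and y: "{y, y'} = {L c ! k, L c ! l}"
    using assms(2) linked_def by auto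
  note s = pair_step[OF q] and s' = pair_step[OF q']
  have "(i, j, a, b) \<noteq> (k, l, d, e)" using x y assms(3,4) by (auto simp: doubleton_eq_iff)
  then have lam: "(j < k \<and> b \<le> d) \<or> (l < i \<and> e \<le> a)
    \<or> (i < k \<and> l < j \<and> a \<le> d \<and> e \<le> b) \<or> (k < i \<and> j < l \<and> d \<le> a \<and> b \<le> e)"
    using G.pairs_laminar[OF q q'] by blast
  let ?s = "W.seg Z (off c + a) (off c + b)" and ?s' = "W.seg Z (off c + d) (off c + e)"
  have M: "M (ratio x x') (ratio y y') \<longleftrightarrow> M ?s ?s'"
    using ratio_M[OF q x] ratio_M[OF q' y] M_sym_iff by metis
  have bef: "before (L c) (L c ! i) (L c ! k) \<longleftrightarrow> i < k" "before (L c) (L c ! i) (L c ! l) \<longleftrightarrow> i < l"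
    "before (L c) (L c ! j) (L c ! k) \<longleftrightarrow> j < k" "before (L c) (L c ! j) (L c ! l) \<longleftrightarrow> j < l"
    using before_nth[OF L_distinct] s(5,6) s'(5,6) by simp_all
  have xx: "(x = L c ! i \<and> x' = L c ! j) \<or> (x = L c ! j \<and> x' = L c ! i)"
    and yy: "(y = L c ! k \<and> y' = L c ! l) \<or> (y = L c ! l \<and> y' = L c ! k)"
    using x y by (auto simp: doubleton_eq_iff)
  from lam consider (1) "j < k" "b \<le> d" | (2) "l < i" "e \<le> a" | (3) "i < k" "l < j" "a \<le> d" "e \<le> b"
    | (4) "k < i" "j < l" "d \<le> a" "b \<le> e" by blast
  then show ?thesis
  proof cases
    case 1
    then have "\<not> M ?s ?s'" using M_disj[OF facZ, of "off c + a" "off c + b" "off c + d" "off c + e"] s s' by simp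
    moreover have "i < k \<and> i < l \<and> j < k \<and> j < l" using 1 s(5) s'(5) by auto
    ultimately show ?thesis unfolding M using xx yy by (elim disjE conjE) (simp_all add: bef)
  next
    case 2
    then have "\<not> M ?s' ?s" using M_disj[OF facZ, of "off c + d" "off c + e" "off c + a" "off c + b"] s s' by simp
    then have "\<not> M ?s ?s'" using M_sym by blast
    moreover have "\<not> i < k \<and> \<not> i < l \<and> \<not> j < k \<and> \<not> j < l" using 2 s(5) s'(5) by auto
    ultimately show ?thesis unfolding M using xx yy by (elim disjE conjE) (simp_all add: bef)
  next
    case 3
    then have "M ?s ?s'" using M_nest[OF facZ, of "off c + a" "off c + d" "off c + e" "off c + b"] s s' by simp
    moreover have "i < k \<and> i < l \<and> \<not> j < k \<and> \<not> j < l" using 3 s(5) s'(5) by auto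
    ultimately show ?thesis unfolding M using xx yy by (elim disjE conjE) (simp_all add: bef)
  next
    case 4
    then have "M ?s' ?s" using M_nest[OF facZ, of "off c + d" "off c + a" "off c + b" "off c + e"] s s' by simp
    then have "M ?s ?s'" using M_sym by blast
    moreover have "\<not> i < k \<and> i < l \<and> \<not> j < k \<and> j < l" using 4 s(5) s'(5) by auto
    ultimately show ?thesis unfolding M using xx yy by (elim disjE conjE) (simp_all add: bef)
  qed
qed

text \<open>The second walk runs through \<open>B\<close> backwards. Reversing it makes both lists
  traverse \<open>B\<close> in the same direction, with the surviving edges in front.\<close>

definition N :: "bool \<Rightarrow> 'a list" where "N c = (if c then A @ B else rev A' @ B)"

lemma N_L: "N c = (if c then L c else rev (L c))"
  by (simp add: N_def L_def)

lemma arcs_N: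
  assumes "R c x x'" "R c y y'" "y \<noteq> x" "y \<noteq> x'"
  shows "before (N c) x y \<longleftrightarrow> (before (N c) x' y' \<noteq> M (ratio x x') (ratio y y'))"
proof (cases c)
  case True
  then show ?thesis using arcs_before[OF assms] by (simp add: N_L)
next
  case False
  have m: "x \<in> set (L c)" "x' \<in> set (L c)" "y \<in> set (L c)" "y' \<in> set (L c)"
    using assms(1,2) linked_dom[OF L_length] linked_sym by blast+
  have "x' \<noteq> y'"
  proof
    assume "x' = y'"
    then have "R c x' x" "R c x' y" using assms linked_sym by blast+
    then show False using linked_unique[OF L_distinct L_length] assms(3) by blast
  qed
  then have "before (N c) x' y' \<longleftrightarrow> \<not> before (L c) x' y'"
    using before_rev[OF L_distinct m(2,4)] False by (simp add: N_L)
  moreover have "before (N c) x y \<longleftrightarrow> \<not> before (L c) x y"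
    using before_rev[OF L_distinct m(1,3)] False assms(3) by (simp add: N_L)
  ultimately show ?thesis using arcs_before[OF assms] by simp
qed

lemma N_inner: "x \<in> set B \<Longrightarrow> y \<in> set B \<Longrightarrow> before (N c) x y \<longleftrightarrow> before B x y"
  using dAB before_mem[of A x y] before_mem[of "rev A'" x y] by (auto simp: N_def before_append)

lemma N_end:
  assumes "x \<in> set (L c)" "x \<in> set A \<union> set A'" "y \<in> set B"
  shows "before (N c) x y" "\<not> before (N c) y x"
proof -
  have d: "set A \<inter> set B = {}" "set B \<inter> set A' = {}" using dAB by auto
  have x: "x \<in> set (if c then A else rev A')" using assms d ends(2) unfolding L_def by (auto split: if_splits)
  have y: "y \<notin> set (if c then A else rev A')" using assms(3) d by auto
  have "x \<notin> set B" using assms(2) d by blast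
  moreover have "N c = (if c then A else rev A') @ B" by (simp add: N_def)
  ultimately show "before (N c) x y" "\<not> before (N c) y x"
    using x y assms(3) before_mem[of B y x] before_mem[of "if c then A else rev A'" y x]
    by (auto simp: before_append simp del: set_rev)
qed

lemma N_ends:
  assumes "a0 \<in> set (L c)" "b0 \<in> set (L c)"
  shows "before (N c) a0 b0 \<longleftrightarrow> c"
proof -
  have d: "set A \<inter> set B = {}" "set B \<inter> set A' = {}" using dAB by auto
  have "a0 \<notin> set B" "b0 \<notin> set B" using ends(1) d by blast+
  then have m: "a0 \<in> set (if c then A else A')" "b0 \<in> set (if c then A else A')"
    using assms unfolding L_def by (auto split: if_splits)
  show ?thesis
  proof (cases c)
    case True
    then have "a0 \<in> set A" "b0 \<in> set A" using m by auto
    then have "x \<notin> set A'" for x using ends by (metis IntI UnCI empty_iff insertE)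
    then have "A' = []" by (cases "A'") auto
    then have "A = [a0, b0]" using AA' by simp
    moreover have "N c = A @ B" using True by (simp add: N_def)
    ultimately have "N c = a0 # b0 # B" by (metis append_Cons append_Nil)
    then show ?thesis using True by (simp add: before_Cons)
  next
    case False
    then have "a0 \<in> set A'" "b0 \<in> set A'" using m by auto
    then have "x \<notin> set A" for x using ends by (metis IntI UnCI empty_iff insertE)
    then have "A = []" by (cases "A") auto
    then have "A' = [a0, b0]" using AA' by simp
    moreover have "N c = rev A' @ B" using False by (simp add: N_def)
    moreover have "rev [a0, b0] = [b0, a0]" by simp
    ultimately have "N c = b0 # a0 # B" by (metis append_Cons append_Nil)
    then show ?thesis using False a0b0 \<open>a0 \<notin> set B\<close> \<open>b0 \<notin> set B\<close> before_mem[of B a0 b0]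
      by (auto simp: before_Cons)
  qed
qed

end

context free_prod
begin

lemma elliptic_iff:
  assumes "u \<in> carrier G"
  shows "x \<in> conjg G u ` H c \<longleftrightarrow> x \<in> carrier G \<and> inv u \<otimes> x \<otimes> u \<in> H c"
proof
  assume "x \<in> conjg G u ` H c"
  then obtain k where k: "k \<in> H c" "x = conjg G u k" by auto
  then have "k \<in> carrier G" using H_carrier by blast
  moreover from this have "inv u \<otimes> x \<otimes> u = k"
    using k assms by (simp add: conjg_def m_assoc) (simp add: m_assoc[symmetric])
  ultimately show "x \<in> carrier G \<and> inv u \<otimes> x \<otimes> u \<in> H c" using k assms by auto
next
  assume x: "x \<in> carrier G \<and> inv u \<otimes> x \<otimes> u \<in> H c"
  then have "x = conjg G u (inv u \<otimes> x \<otimes> u)"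
    using assms by (simp add: conjg_def m_assoc) (simp add: m_assoc[symmetric])
  then show "x \<in> conjg G u ` H c" using x by blast
qed

text \<open>The common pairs force the same tree shape, since the first branch returns at the same
  position in both. Cancelling the edge there gives equal products of the branches, and so on down
  to leaves with equal products, where \<open>base\<close> applies. The property \<open>P\<close>
  stands for what blocks inherit from the tuple.\<close>

lemma same_trace:
  assumes P: "\<And>us vs ws. P (us @ vs @ ws) \<Longrightarrow> P vs"
    and base: "\<And>c u rs rs'. P rs \<Longrightarrow> P rs' \<Longrightarrow> u \<in> carrier G \<Longrightarrow> forest c u (Leaf rs) \<Longrightarrow>
      forest c u (Leaf rs') \<Longrightarrow> prodl G rs = prodl G rs' \<Longrightarrow> heq G rs rs'"
    and "forest c u f" "forest c u g" "u \<in> carrier G" "trace f = trace g"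
    and "prodl G (flat f) = prodl G (flat g)" "P (flat f)" "P (flat g)"
    and "\<And>i j a b. (i, j, a, b) \<in> pairs f \<Longrightarrow> \<exists>a' b'. (i, j, a', b') \<in> pairs g"
  shows "heq G (flat f) (flat g)"
  using assms(3-)
proof (induction f arbitrary: c u g)
  case (Leaf rs)
  then obtain rs' where "g = Leaf rs'" using trace_eq_Nil[of g] by auto
  then show ?case using base[of rs rs' u c] Leaf.prems by simp
next
  case (Branch e t f)
  obtain e' t' f' where g: "g = Branch e' t' f'" using Branch.prems(4) by (cases g) auto
  let ?p = "prodl G (flat t)" and ?p' = "prodl G (flat t')" and ?l = "length (trace t)"
  have e: "e \<in> carrier G" and t: "forest (\<not> c) e t" and f: "forest c u f" and u: "u \<in> carrier G"
    using Branch.prems by auto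
  have ee: "e' = e" using Branch.prems(4) g by simp
  have t': "forest (\<not> c) e t'" and f': "forest c u f'" using Branch.prems(2) g ee by auto
  have c: "set (flat t) \<subseteq> carrier G" "set (flat f) \<subseteq> carrier G" "set (flat t') \<subseteq> carrier G"
    "set (flat f') \<subseteq> carrier G"
    using forest_flat t f t' f' by blast+
  then have pc: "?p \<in> carrier G" "?p' \<in> carrier G" by auto
  have "(0, Suc ?l, 0, length (flat t)) \<in> pairs (Branch e t f)" by simp
  then obtain a b where "(0, Suc ?l, a, b) \<in> pairs g" using Branch.prems(8) by blast
  then have len: "length (trace t') = ?l" unfolding g by auto
  have tl: "trace t @ [?p \<otimes> e] @ map ((\<otimes>) ?p) (trace f) = trace t' @ [?p' \<otimes> e] @ map ((\<otimes>) ?p') (trace f')"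
    using Branch.prems(4) g ee by simp
  then have tt: "trace t = trace t'" and r: "?p \<otimes> e = ?p' \<otimes> e"
    "map ((\<otimes>) ?p) (trace f) = map ((\<otimes>) ?p') (trace f')"
    using len by (auto simp: append_eq_append_conv)
  have pp: "?p = ?p'" using r(1) pc e by simp
  have tc: "set (trace f) \<subseteq> carrier G" "set (trace f') \<subseteq> carrier G" using trace_carrier f f' u by blast+
  have ff: "trace f = trace f'"
    by (rule map_inj_on[of "(\<otimes>) ?p"])
      (use r(2) pp inj_on_subset[OF inj_on_mult[OF pc(1)], of "set (trace f) \<union> set (trace f')"] tc in auto)
  have "?p \<otimes> prodl G (flat f) = ?p' \<otimes> prodl G (flat f')"
    using Branch.prems(5) c g by (simp add: prodl_append)
  then have qq: "prodl G (flat f) = prodl G (flat f')" using pp pc c prodl_closed by simp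
  have Pt: "P (flat t)" "P (flat t')" using P[of "[]" "flat t" "flat f"] P[of "[]" "flat t'" "flat f'"]
    Branch.prems(6,7) g by simp_all
  have Pf: "P (flat f)" "P (flat f')" using P[of "flat t" "flat f" "[]"] P[of "flat t'" "flat f'" "[]"]
    Branch.prems(6,7) g by simp_all
  have 1: "heq G (flat t) (flat t')"
  proof (rule Branch.IH(1)[OF t t' e tt pp Pt])
    fix i j a b assume q: "(i, j, a, b) \<in> pairs t"
    then obtain a' b' where "(Suc i, Suc j, a', b') \<in> pairs g" using Branch.prems(8) pairs_left by blast
    moreover have "j < ?l" using pairs_bounds[OF q] by simp
    ultimately show "\<exists>a' b'. (i, j, a', b') \<in> pairs t'" unfolding g using len by auto
  qed
  have 2: "heq G (flat f) (flat f')"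
  proof (rule Branch.IH(2)[OF f f' u ff qq Pf])
    fix i j a b assume q: "(i, j, a, b) \<in> pairs f"
    then obtain a' b' where "(i + ?l + 2, j + ?l + 2, a', b') \<in> pairs g"
      using Branch.prems(8) pairs_right by blast
    then have "(\<exists>a b. (i, j, a, b) \<in> pairs f') \<or> (Suc (i + ?l), Suc (j + ?l), a', b') \<in> pairs t'"
      unfolding g using len by (auto, blast)
    then show "\<exists>a' b'. (i, j, a', b') \<in> pairs f'" using pairs_bounds len by fastforce
  qed
  show ?case using heq_append[OF 1 2] g by simp
qed

end

section \<open>Comparing two lifts with equal product\<close>

text \<open>Transitivity is assumed only for blocks of reduced factorizations inside one factor, as
  needed at the leaves. Injectivity of \<open>F\<close> on the vertex groups allows edges to be
  recovered from their images.\<close>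

locale comparison = ordered_lift W K T h1 h2 n G H F M
  for W :: "('b, 'n) monoid_scheme" and K T h1 h2 n and G :: "('a, 'm) monoid_scheme" and H F M +
  assumes transitive: "W.fac (us @ rs @ ws) \<Longrightarrow> W.fac (us' @ rs' @ ws') \<Longrightarrow> set rs \<subseteq> K d \<Longrightarrow>
      set rs' \<subseteq> K d \<Longrightarrow> prodl W rs = prodl W rs' \<Longrightarrow> heq W rs rs'"
    and F_inj: "inj_on F (H c)"
begin

lemma F_star_inj:
  assumes "u \<in> carrier G" "x \<in> carrier G" "y \<in> carrier G" "inv\<^bsub>G\<^esub> u \<otimes>\<^bsub>G\<^esub> x \<in> H c"
    "inv\<^bsub>G\<^esub> u \<otimes>\<^bsub>G\<^esub> y \<in> H c" "F x = F y"
  shows "x = y"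
proof -
  have "F (inv\<^bsub>G\<^esub> u \<otimes>\<^bsub>G\<^esub> x) = F (inv\<^bsub>G\<^esub> u \<otimes>\<^bsub>G\<^esub> y)" using assms by simp
  then have "inv\<^bsub>G\<^esub> u \<otimes>\<^bsub>G\<^esub> x = inv\<^bsub>G\<^esub> u \<otimes>\<^bsub>G\<^esub> y" using inj_onD[OF F_inj] assms(4,5) by blast
  then show ?thesis using assms(1-3) by simp
qed

lemma path_F_inj:
  "G.path c u es \<Longrightarrow> G.path c u es' \<Longrightarrow> u \<in> carrier G \<Longrightarrow> map F es = map F es' \<Longrightarrow> es = es'"
proof (induction es arbitrary: c u es')
  case (Cons e es)
  obtain e' es'' where e': "es' = e' # es''" using Cons.prems(4) by (cases es') auto
  then have "e = e'" using Cons.prems F_star_inj[of u e e' c] by auto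
  then show ?case using Cons.IH[of "\<not> c" e es''] Cons.prems e' by auto
qed simp

text \<open>A braid found in \<open>W\<close> is applied to the lift. Its result has the right image
  and stays in the stabilizer of the vertex, where \<open>F\<close> is injective.\<close>

lemma lift_transitive:
  assumes "W.fac (us @ map F rs @ ws)" "W.fac (us' @ map F rs' @ ws')"
    and "set (map F rs) \<subseteq> K d" "set (map F rs') \<subseteq> K d" "u \<in> carrier G"
    and "G.forest c u (Leaf rs)" "G.forest c u (Leaf rs')" "prodl G rs = prodl G rs'"
  shows "heq G rs rs'"
proof -
  have c: "set rs \<subseteq> carrier G" "set rs' \<subseteq> carrier G" using assms by auto
  have "prodl W (map F rs) = prodl W (map F rs')" using F_prodl c assms(8) by metis
  then have "heq W (map F rs) (map F rs')" using transitive assms(1-4) by blast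
  then obtain w where w: "braid_word (length rs) w" "hurwitz W w (map F rs) = map F rs'"
    by (auto simp: heq_def)
  let ?xs = "hurwitz G w rs"
  have h: "heq G rs ?xs" using w c by (auto simp: heq_def)
  interpret C: free_prod G "\<lambda>c. conjg G u ` H c" by (rule G.free_prod_conj[OF assms(5)])
  have S: "set rs \<subseteq> conjg G u ` H c" "set rs' \<subseteq> conjg G u ` H c"
    using G.elliptic_iff[OF assms(5)] assms(6,7) by auto
  have "set ?xs \<subseteq> conjg G u ` H c" using G.heq_subgroup[OF h C.H_subgroup S(1)] .
  moreover have "map F ?xs = map F rs'"
    using hurwitz_map_hom[OF G.group_axioms W.group_axioms F_hom c(1), of w] w by simp
  moreover have "inj_on F (conjg G u ` H c)"
  proof (rule inj_onI)
    fix x y assume xy: "x \<in> conjg G u ` H c" "y \<in> conjg G u ` H c" "F x = F y"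
    then have c: "x \<in> carrier G" "y \<in> carrier G" "inv\<^bsub>G\<^esub> u \<otimes>\<^bsub>G\<^esub> x \<otimes>\<^bsub>G\<^esub> u \<in> H c" "inv\<^bsub>G\<^esub> u \<otimes>\<^bsub>G\<^esub> y \<otimes>\<^bsub>G\<^esub> u \<in> H c"
      using G.elliptic_iff[OF assms(5)] by blast+
    have "x \<otimes>\<^bsub>G\<^esub> u = y \<otimes>\<^bsub>G\<^esub> u"
      by (rule F_star_inj[of u _ _ c]) (use c assms(5) xy(3) in \<open>simp_all add: G.m_assoc\<close>)
    then show "x = y" using c assms(5) by simp
  qed
  ultimately have "?xs = rs'" using S(2) by (meson inj_on_subset map_inj_on le_sup_iff)
  then show ?thesis using h by simp
qed

text \<open>Equal normal forms let the edges of the two chains correspond by index. The order of two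
  inner edges is then computed from the ends of the chain by \<open>arcs_N\<close>, with the same
  answer for both forests.\<close>

lemma same_order:
  assumes d1: "data a0 b0 p f A B A'" and d2: "data a0 b0 q g C E C'"
  shows "A = C \<and> map F B = map F E \<and> (\<exists>vs vs'. map F (a0 # vs) = map F (a0 # vs') \<and>
    distinct (map F (a0 # vs)) \<and> set (a0 # vs) = set A \<union> set B \<union> set A' \<and>
    set (a0 # vs') = set C \<union> set E \<union> set C' \<and>
    chain (\<lambda>c. linked (g c) (if c then C @ E else rev E @ C')) (a0 \<in> set A) (a0 # vs') \<and>
    (\<forall>c x y. linked (f c) (if c then A @ B else rev B @ A') x y \<longrightarrow>
       (\<exists>i<length vs. c = (even i = (a0 \<in> set A)) \<and> {x, y} = {(a0 # vs) ! i, (a0 # vs) ! Suc i})))"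
proof -
  interpret X: ordered_data W K T h1 h2 n G H F M a0 b0 p f A B A'
    by (unfold_locales) (rule d1)
  interpret Y: ordered_data W K T h1 h2 n G H F M a0 b0 q g C E C'
    by (unfold_locales) (rule d2)
  interpret K': free_prod W W.K' by (rule W.free_prod_conj[OF W.h1_carrier])
  obtain vs zs where v: "chain X.R X.c0 (a0 # vs)" "distinct (a0 # vs)" "distinct (map F (a0 # vs))" "vs \<noteq> []"
    "last vs = b0" "set (a0 # vs) = set A \<union> set B \<union> set A'"
    "\<forall>c x y. X.R c x y \<longrightarrow> (\<exists>i<length vs. c = (even i = X.c0) \<and>
          ({x, y} = {(a0 # vs) ! i, (a0 # vs) ! Suc i}))"
    "alternating W W.K' X.c0 zs" "length zs = length vs" "F a0 = prodl W zs \<otimes>\<^bsub>W\<^esub> F b0"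
    "map F (a0 # vs) = chase.walk W zs (F a0)" "b0 \<in> set A \<longleftrightarrow> (odd (length vs) = X.c0)"
    using X.normal_form by blast
  obtain vs' zs' where v': "chain Y.R Y.c0 (a0 # vs')" "distinct (a0 # vs')" "distinct (map F (a0 # vs'))"
    "vs' \<noteq> []" "last vs' = b0" "set (a0 # vs') = set C \<union> set E \<union> set C'"
    "alternating W W.K' Y.c0 zs'" "length zs' = length vs'" "F a0 = prodl W zs' \<otimes>\<^bsub>W\<^esub> F b0"
    "map F (a0 # vs') = chase.walk W zs' (F a0)" "b0 \<in> set C \<longleftrightarrow> (odd (length vs') = Y.c0)"
    using Y.normal_form by blast
  have mem: "a0 \<in> set A \<union> set B \<union> set A'" "b0 \<in> set A \<union> set B \<union> set A'" using X.ends(1) by blast+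
  have carr: "x \<in> carrier G" if "x \<in> set A \<union> set B \<union> set A'" for x
    using that X.L_carrier[of True] X.L_carrier[of False] unfolding X.L_def by auto
  then have Fb: "F b0 \<in> carrier W" using mem by simp
  have pz: "prodl W zs \<in> carrier W" "prodl W zs' \<in> carrier W"
    using K'.alternating_carrier v(8) v'(7) by blast+
  then have "prodl W zs = prodl W zs'" using v(10) v'(9) Fb W.right_cancel by metis
  from K'.alternating_unique[OF v(8) v'(7) this]
  have zz: "zs = zs'" and c0: "X.c0 = Y.c0" using v(4,9) by auto
  have len: "length vs' = length vs" using zz v(9) v'(8) by simp
  have FV: "map F (a0 # vs) = map F (a0 # vs')" using zz v(11) v'(10) by simp
  have bC: "b0 \<in> set A \<longleftrightarrow> b0 \<in> set C" using v(12) v'(11) c0 len by simp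
  have AC: "A = C"
  proof -
    \<comment> \<open>The way \<open>[a0, b0]\<close> is divided between the two walks can be read
      off from the membership of its two entries in the first part.\<close>
    have form: "S = (if a0 \<in> set S then if b0 \<in> set S then [a0, b0] else [a0] else [])"
      if "S @ S' = [a0, b0]" for S S'
      using that X.a0b0 by (auto simp: append_eq_Cons_conv)
    show ?thesis using form[OF X.AA'] form[OF Y.AA'] c0 bC by metis
  qed
  let ?V = "a0 # vs" and ?V' = "a0 # vs'" and ?l = "length vs"
  have FVi: "F (?V ! i) = F (?V' ! i)" if "i \<le> ?l" for i
    using arg_cong[OF FV, of "\<lambda>xs. xs ! i"] that len by (simp del: list.map)
  have l: "?V ! ?l = b0" "?V' ! ?l = b0"
    using v(4,5) v'(4,5) len by (simp_all add: last_conv_nth nth_Cons')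
  have nV: "?V ! i = ?V ! j \<longleftrightarrow> i = j" if "i \<le> ?l" "j \<le> ?l" for i j
    using v(2) that by (simp add: nth_eq_iff_index_eq del: nth_Cons_Suc)
  have nV': "?V' ! i = ?V' ! j \<longleftrightarrow> i = j" if "i \<le> ?l" "j \<le> ?l" for i j
    using v'(2) that len by (simp add: nth_eq_iff_index_eq del: nth_Cons_Suc)
  have inB: "?V ! i \<in> set B" if "0 < i" "i < ?l" for i
  proof -
    have "?V ! i \<in> set ?V" using that by (intro nth_mem) simp
    moreover have "?V ! i \<noteq> ?V ! 0" "?V ! i \<noteq> ?V ! ?l" using nV[of i 0] nV[of i ?l] that by simp_all
    ultimately show ?thesis using v(6) X.ends(1) l by auto
  qed
  have inE: "?V' ! i \<in> set E" if "0 < i" "i < ?l" for i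
  proof -
    have "?V' ! i \<in> set ?V'" using that len by (intro nth_mem) simp
    moreover have "?V' ! i \<noteq> ?V' ! 0" "?V' ! i \<noteq> ?V' ! ?l" using nV'[of i 0] nV'[of i ?l] that by simp_all
    ultimately show ?thesis using v'(6) Y.ends(1) l by auto
  qed
  have ch: "X.R (even i = X.c0) (?V ! i) (?V ! Suc i)" "Y.R (even i = X.c0) (?V' ! i) (?V' ! Suc i)"
    if "i < ?l" for i
    using chain_nth[OF v(1), of i] chain_nth[OF v'(1), of i] that len c0 by simp_all
  have dom: "?V ! i \<in> set (X.L (even i = X.c0))" "?V ! Suc i \<in> set (X.L (even i = X.c0))"
    "?V' ! i \<in> set (Y.L (even i = X.c0))" "?V' ! Suc i \<in> set (Y.L (even i = X.c0))" if "i < ?l" for i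
    using linked_dom[OF X.L_length] linked_dom[OF Y.L_length] ch[OF that] linked_sym by blast+
  have rat: "X.ratio (?V ! i) (?V ! j) = Y.ratio (?V' ! i) (?V' ! j)" if "i \<le> ?l" "j \<le> ?l" for i j
    unfolding X.ratio_def Y.ratio_def using FVi that by simp
  \<comment> \<open>If an end of the chain is involved, the order is known outright: the ends are
    surviving edges and precede \<open>B\<close> in \<open>N c\<close>. Inner pairs are left to the
    induction.\<close>
  have star: "before (X.N c) (?V ! i) (?V ! j) \<longleftrightarrow> before (Y.N c) (?V' ! i) (?V' ! j)"
    if ij: "i < j" "j \<le> ?l" and m: "?V ! i \<in> set (X.L c)" "?V ! j \<in> set (X.L c)"
      "?V' ! i \<in> set (Y.L c)" "?V' ! j \<in> set (Y.L c)"
      and IH: "0 < i \<Longrightarrow> j < ?l \<Longrightarrow> before B (?V ! i) (?V ! j) \<longleftrightarrow> before E (?V' ! i) (?V' ! j)" for i j c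
  proof -
    consider "0 < i" "j < ?l" | "i = 0" "j < ?l" | "0 < i" "j = ?l" | "i = 0" "j = ?l"
      using ij by linarith
    then show ?thesis
    proof cases
      case 1
      then show ?thesis
        using X.N_inner[OF inB inB, of i j c] Y.N_inner[OF inE inE, of i j c] ij IH by simp
    next
      case 2
      then have "?V ! j \<in> set B" "?V' ! j \<in> set E" using inB inE ij by auto
      moreover have "a0 \<in> set A \<union> set A'" "a0 \<in> set C \<union> set C'" using X.ends Y.ends by blast+
      ultimately show ?thesis using 2 X.N_end(1)[of a0 c] Y.N_end(1)[of a0 c] m by simp
    next
      case 3
      then have "?V ! i \<in> set B" "?V' ! i \<in> set E" using inB inE ij by auto
      moreover have "b0 \<in> set A \<union> set A'" "b0 \<in> set C \<union> set C'" using X.ends Y.ends by blast+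
      moreover have "?V ! j = b0" "?V' ! j = b0" using 3 l by auto
      ultimately show ?thesis using X.N_end(2)[of b0 c "?V ! i"] Y.N_end(2)[of b0 c "?V' ! i"] m by simp
    next
      case 4
      then have "?V ! j = b0" "?V' ! j = b0" using l by auto
      then show ?thesis using 4 X.N_ends[of c] Y.N_ends[of c] m by simp
    qed
  qed
  \<comment> \<open>Both edges move along a link of the same colour: \<open>j\<close> to
    \<open>Suc j\<close>, and \<open>i\<close> to its successor or predecessor according to parity.
    The distance from the larger index to the end of the chain decreases.\<close>
  have order: "before B (?V ! i) (?V ! j) \<longleftrightarrow> before E (?V' ! i) (?V' ! j)"
    if "0 < i" "i < j" "j < ?l" for i j
    using that
  proof (induction "?l - j" arbitrary: i j rule: less_induct)
    case less
    let ?c = "even j = X.c0"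
    have IH: "before B (?V ! i') (?V ! Suc j) \<longleftrightarrow> before E (?V' ! i') (?V' ! Suc j)"
      if "0 < i'" "i' < Suc j" "Suc j < ?l" for i'
      using less.hyps[of "Suc j" i'] that less.prems by linarith
    obtain k where k: "k < Suc j" "k \<noteq> j" "k \<le> ?l" "X.R ?c (?V ! i) (?V ! k)" "Y.R ?c (?V' ! i) (?V' ! k)"
    proof (cases "even i = even j")
      case True
      then have "i \<noteq> j" "Suc i \<noteq> j" using less.prems by auto
      then show thesis using that[of "Suc i"] ch[of i] True less.prems by simp
    next
      case False
      obtain i0 where i0: "i = Suc i0" using less.prems by (cases i) auto
      then have "even i0 = even j" using False by auto
      then show thesis using that[of i0] ch[of i0] i0 less.prems linked_sym by simp
    qed
    have s: "before (X.N ?c) (?V ! k) (?V ! Suc j) \<longleftrightarrow> before (Y.N ?c) (?V' ! k) (?V' ! Suc j)"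
    proof (rule star[OF k(1)])
      show "?V ! k \<in> set (X.L ?c)" "?V' ! k \<in> set (Y.L ?c)"
        using k linked_sym linked_dom[OF X.L_length] linked_dom[OF Y.L_length] by blast+
    qed (use dom[of j] less.prems k IH in auto)
    have "before (X.N ?c) (?V ! i) (?V ! j) \<longleftrightarrow>
        (before (X.N ?c) (?V ! k) (?V ! Suc j) \<noteq> M (X.ratio (?V ! i) (?V ! k)) (X.ratio (?V ! j) (?V ! Suc j)))"
      by (rule X.arcs_N[OF k(4) ch(1)]) (use nV[of j i] nV[of j k] less.prems k in auto)
    moreover have "before (Y.N ?c) (?V' ! i) (?V' ! j) \<longleftrightarrow>
        (before (Y.N ?c) (?V' ! k) (?V' ! Suc j) \<noteq> M (Y.ratio (?V' ! i) (?V' ! k)) (Y.ratio (?V' ! j) (?V' ! Suc j)))"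
      by (rule Y.arcs_N[OF k(5) ch(2)]) (use nV'[of j i] nV'[of j k] less.prems k in auto)
    moreover have "X.ratio (?V ! i) (?V ! k) = Y.ratio (?V' ! i) (?V' ! k)"
      "X.ratio (?V ! j) (?V ! Suc j) = Y.ratio (?V' ! j) (?V' ! Suc j)"
      using rat[of i k] rat[of j "Suc j"] less.prems k(3) by simp_all
    ultimately have "before (X.N ?c) (?V ! i) (?V ! j) \<longleftrightarrow> before (Y.N ?c) (?V' ! i) (?V' ! j)"
      using s by simp
    then show ?case
      using X.N_inner[OF inB inB, of i j ?c] Y.N_inner[OF inE inE, of i j ?c] less.prems by simp
  qed
  have Binj: "inj_on F (set ?V)" "inj_on F (set ?V')" using v(3) v'(3) by (simp_all only: distinct_map)
  have dB: "set B \<inter> (set A \<union> set A') = {}" "set E \<inter> (set C \<union> set C') = {}"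
    using X.dAB Y.dAB by auto
  have setB: "x \<in> set B \<longleftrightarrow> (\<exists>i. 0 < i \<and> i < ?l \<and> x = ?V ! i)" for x
  proof
    assume x: "x \<in> set B"
    then have "x \<in> set ?V" using v(6) by blast
    then obtain i where i: "i < length ?V" "?V ! i = x" by (metis in_set_conv_nth)
    have "x \<noteq> a0" "x \<noteq> b0" using x dB X.ends(1) by blast+
    then have "i \<noteq> 0" "i \<noteq> ?l" using i(2) l by (metis nth_Cons_0)+
    then show "\<exists>i. 0 < i \<and> i < ?l \<and> x = ?V ! i" using i by (intro exI[of _ i]) auto
  qed (use inB in auto)
  have setE: "x \<in> set E \<longleftrightarrow> (\<exists>i. 0 < i \<and> i < ?l \<and> x = ?V' ! i)" for x
  proof
    assume x: "x \<in> set E"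
    then have "x \<in> set ?V'" using v'(6) by blast
    then obtain i where i: "i < length ?V'" "?V' ! i = x" by (metis in_set_conv_nth)
    have "x \<noteq> a0" "x \<noteq> b0" using x dB Y.ends(1) by blast+
    then have "i \<noteq> 0" "i \<noteq> ?l" using i(2) l by (metis nth_Cons_0)+
    then show "\<exists>i. 0 < i \<and> i < ?l \<and> x = ?V' ! i" using i len by (intro exI[of _ i]) auto
  qed (use inE in auto)
  have subs: "set B \<subseteq> set ?V" "set E \<subseteq> set ?V'" using v(6) v'(6) by auto
  have distB: "distinct B" "distinct E" using X.dAB Y.dAB by auto
  have BE: "map F B = map F E"
  proof (rule before_determines)
    show "distinct (map F B)" "distinct (map F E)"
      using distB inj_on_subset[OF Binj(1) subs(1)] inj_on_subset[OF Binj(2) subs(2)]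
      by (simp_all add: distinct_map)
    have "y \<in> F ` set B \<longleftrightarrow> (\<exists>i. 0 < i \<and> i < ?l \<and> y = F (?V ! i))" for y
      unfolding image_iff Bex_def setB by blast
    moreover have "y \<in> F ` set E \<longleftrightarrow> (\<exists>i. 0 < i \<and> i < ?l \<and> y = F (?V' ! i))" for y
      unfolding image_iff Bex_def setE by blast
    ultimately have "y \<in> F ` set B \<longleftrightarrow> y \<in> F ` set E" for y
      using FVi less_imp_le_nat by (metis (no_types, lifting))
    then show "set (map F B) = set (map F E)" by auto
    fix y z assume yz: "y \<in> set (map F B)" "z \<in> set (map F B)" "y \<noteq> z"
    then obtain i j where ij: "0 < i" "i < ?l" "y = F (?V ! i)" "0 < j" "j < ?l" "z = F (?V ! j)"
      unfolding set_map image_iff Bex_def setB by blast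
    have bB: "before (map F B) (F (?V ! i)) (F (?V ! j)) \<longleftrightarrow> before B (?V ! i) (?V ! j)"
      by (rule before_map_inj[OF inj_on_subset[OF Binj(1) subs(1)] inB inB]) (use ij in auto)
    have bE: "before (map F E) (F (?V' ! i)) (F (?V' ! j)) \<longleftrightarrow> before E (?V' ! i) (?V' ! j)"
      by (rule before_map_inj[OF inj_on_subset[OF Binj(2) subs(2)] inE inE]) (use ij in auto)
    have "i \<noteq> j" using ij(3,6) yz(3) by blast
    have "before B (?V ! i) (?V ! j) \<longleftrightarrow> before E (?V' ! i) (?V' ! j)"
    proof (cases "i < j")
      case True
      then show ?thesis using order ij by blast
    next
      case False
      then have "before B (?V ! j) (?V ! i) \<longleftrightarrow> before E (?V' ! j) (?V' ! i)"
        using order ij \<open>i \<noteq> j\<close> by simp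
      moreover have "?V ! i \<noteq> ?V ! j" "?V' ! i \<noteq> ?V' ! j" using nV[of i j] nV'[of i j] ij \<open>i \<noteq> j\<close> by auto
      ultimately show ?thesis
        using before_asym[OF distB(1) inB inB, of j i] before_asym[OF distB(2) inE inE, of j i] ij by simp
    qed
    moreover have "y = F (?V' ! i)" "z = F (?V' ! j)"
      using FVi[of i] FVi[of j] ij(2,3,5,6) by (metis less_imp_le_nat)+
    ultimately show "before (map F B) y z \<longleftrightarrow> before (map F E) y z"
      using bB bE ij(3,6) by metis
  qed
  have chY: "chain (\<lambda>c. linked (g c) (if c then C @ E else rev E @ C')) (a0 \<in> set A) ?V'"
    using v'(1) c0 unfolding Y.L_def by simp
  show ?thesis using AC BE FV v(3,6,7) v'(6) chY unfolding X.L_def by blast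
qed

text \<open>Equal images of the walks give equal walks, because a path lifts uniquely from its
  starting vertex. Equal walks with equal pairs leave only the leaves to be compared.\<close>

theorem lifts_equivalent:
  assumes ell: "\<forall>y\<in>set (Y1 @ Y2). G.elliptic y" "\<forall>y\<in>set (Y1' @ Y2'). G.elliptic y"
    and fac: "W.fac (map F Y1 @ map F Y2)" "W.fac (map F Y1' @ map F Y2')"
    and K: "set (map F Y1) \<subseteq> K True" "set (map F Y2) \<subseteq> K False"
      "set (map F Y1') \<subseteq> K True" "set (map F Y2') \<subseteq> K False"
    and h1: "prodl W (map F Y1) = h1" "prodl W (map F Y1') = h1"
    and same: "prodl G (Y1 @ Y2) = prodl G (Y1' @ Y2')"
    and L: "G.path True \<one>\<^bsub>G\<^esub> [a0, b0]" "a0 \<noteq> b0" "inv\<^bsub>G\<^esub> b0 \<otimes>\<^bsub>G\<^esub> prodl G (Y1 @ Y2) \<in> H True"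
  shows "heq G (Y1 @ Y2) (Y1' @ Y2')"
proof -
  let ?p = "prodl G Y1" and ?q = "prodl G Y1'"
  have Yc: "set Y1 \<subseteq> carrier G" "set Y2 \<subseteq> carrier G" "set Y1' \<subseteq> carrier G" "set Y2' \<subseteq> carrier G"
    using ell G.elliptic_carrier by auto
  obtain f A B A' where d1: "data a0 b0 ?p f A B A'" "heq G Y1 (flat (f True))" "heq G Y2 (flat (f False))"
    using data_exists[OF ell(1) fac(1) K(1,2) h1(1) L] by blast
  obtain g C E C' where d2: "data a0 b0 ?q g C E C'" "heq G Y1' (flat (g True))" "heq G Y2' (flat (g False))"
    using data_exists[OF ell(2) fac(2) K(3,4) h1(2) L(1,2)] L(3) same by auto
  interpret X: lift_data W K T h1 h2 n G H F a0 b0 ?p f A B A'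
    by (unfold_locales) (rule d1)
  interpret Y: lift_data W K T h1 h2 n G H F a0 b0 ?q g C E C'
    by (unfold_locales) (rule d2)
  have pc: "?p \<in> carrier G" "?q \<in> carrier G" using Yc by auto
  from same_order[OF d1(1) d2(1)] obtain vs vs' where AC: "A = C" and BE: "map F B = map F E"
    and FV: "map F (a0 # vs) = map F (a0 # vs')" and dV: "distinct (map F (a0 # vs))"
    and sV: "set (a0 # vs) = set A \<union> set B \<union> set A'" "set (a0 # vs') = set C \<union> set E \<union> set C'"
    and ch: "chain (\<lambda>c. linked (g c) (if c then C @ E else rev E @ C')) (a0 \<in> set A) (a0 # vs')"
    and nb: "\<forall>c x y. linked (f c) (if c then A @ B else rev B @ A') x y \<longrightarrow>
       (\<exists>i<length vs. c = (even i = (a0 \<in> set A)) \<and> {x, y} = {(a0 # vs) ! i, (a0 # vs) ! Suc i})"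
    by blast
  note TX = G.trace_path_end[OF X.forest[of True] G.one_closed]
    and TY = G.trace_path_end[OF Y.forest[of True] G.one_closed]
  have "A @ B = C @ E"
    by (rule path_F_inj[of True "\<one>\<^bsub>G\<^esub>"]) (use TX TY X.tr Y.tr AC BE in auto)
  then have BE': "B = E" using AC by simp
  have AC': "A' = C'" using X.AA' Y.AA' AC by (metis append_same_eq same_append_eq)
  have tT: "G.trace (f True) = G.trace (g True)" using X.tr Y.tr AC BE' by simp
  have pf: "prodl G (flat (f True)) = ?p" "prodl G (flat (g True)) = ?q"
    using G.heq_prodl d1 d2 by auto
  let ?e = "last (\<one>\<^bsub>G\<^esub> # G.trace (f True))"
  have e: "?e \<in> carrier G" using X.trace_carrier[of True] last_in_set[of "\<one>\<^bsub>G\<^esub> # G.trace (f True)"] by auto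
  \<comment> \<open>Both products represent the end vertex of the common first walk and have image
    \<open>h1\<close>; \<open>F\<close> is injective around a vertex.\<close>
  have pq: "?p = ?q"
    by (rule F_star_inj[of ?e _ _ True]) (use e pc TX TY tT pf X.p(2) Y.p(2) in simp_all)
  have tF: "G.trace (f False) = G.trace (g False)"
  proof (rule map_inj_on)
    show "map ((\<otimes>\<^bsub>G\<^esub>) ?p) (G.trace (f False)) = map ((\<otimes>\<^bsub>G\<^esub>) ?p) (G.trace (g False))"
      using X.tr(2) Y.tr(2) BE' AC' pq by simp
    show "inj_on ((\<otimes>\<^bsub>G\<^esub>) ?p) (set (G.trace (f False)) \<union> set (G.trace (g False)))"
      by (rule inj_on_subset[OF G.inj_on_mult[OF pc(1)]])
        (use X.trace_carrier Y.trace_carrier in simp)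
  qed
  have tr: "G.trace (f c) = G.trace (g c)" for c using tT tF by (cases c) auto
  have VV: "vs = vs'"
  proof -
    have "inj_on F (set (a0 # vs))" using dV by (simp only: distinct_map)
    moreover have "set (a0 # vs') = set (a0 # vs)" using sV AC BE' AC' by simp
    ultimately have "inj_on F (set (a0 # vs) \<union> set (a0 # vs'))" by (simp only: Un_absorb)
    from map_inj_on[OF FV this] have "a0 # vs = a0 # vs'" .
    then show ?thesis by simp
  qed
  have LL: "X.L c = Y.L c" for c by (simp add: X.L_def Y.L_def AC BE' AC')
  \<comment> \<open>A pair of crossings in \<open>f\<close> is a link of its chain, both chains
    coincide, and a link of the chain of \<open>g\<close> comes from a pair in
    \<open>g\<close>.\<close>
  have prs: "\<exists>a' b'. (i, j, a', b') \<in> G.pairs (g c)" if q: "(i, j, a, b) \<in> G.pairs (f c)" for i j a b c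
  proof -
    have "linked (f c) (X.L c) (X.L c ! i) (X.L c ! j)" unfolding linked_def using q by blast
    then obtain k where k: "k < length vs" "c = (even k = (a0 \<in> set A))"
      "{X.L c ! i, X.L c ! j} = {(a0 # vs) ! k, (a0 # vs) ! Suc k}"
      using nb unfolding X.L_def by blast
    have "linked (g c) (Y.L c) ((a0 # vs) ! k) ((a0 # vs) ! Suc k)"
      using chain_nth[OF ch, of k] k(1,2) unfolding Y.L_def VV by simp
    then obtain i' j' a' b' where q': "(i', j', a', b') \<in> G.pairs (g c)"
      "{(a0 # vs) ! k, (a0 # vs) ! Suc k} = {Y.L c ! i', Y.L c ! j'}"
      unfolding linked_def by blast
    have q2: "{X.L c ! i, X.L c ! j} = {X.L c ! i', X.L c ! j'}"
      using trans[OF k(3) q'(2)] unfolding LL .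
    have b: "i < j" "j < length (X.L c)" "i' < j'" "j' < length (X.L c)"
      using X.pair_step(5,6)[OF q] Y.pair_step(5,6)[OF q'(1)] LL by auto
    then have "i = i' \<and> j = j'"
      using q2 X.L_distinct[of c] by (auto simp: doubleton_eq_iff nth_eq_iff_index_eq)
    then show ?thesis using q'(1) by blast
  qed
  have pr: "prodl G (flat (f c)) = prodl G (flat (g c))" for c
  proof (cases c)
    case False
    have fc: "prodl G (flat (f False)) = prodl G Y2" "prodl G (flat (g False)) = prodl G Y2'"
      using G.heq_prodl d1 d2 by auto
    have "?p \<otimes>\<^bsub>G\<^esub> prodl G Y2 = ?p \<otimes>\<^bsub>G\<^esub> prodl G Y2'"
      using same pq Yc by (simp add: G.prodl_append)
    then show ?thesis using False fc pc Yc G.prodl_closed by simp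
  qed (use pf pq in simp)
  have heq: "heq G (flat (f c)) (flat (g c))" for c
  proof (rule G.same_trace[where P = "\<lambda>rs. \<exists>us ws. W.fac (us @ map F rs @ ws) \<and> set (map F rs) \<subseteq> K c"])
    show "\<exists>us ws. W.fac (us @ map F vs @ ws) \<and> set (map F vs) \<subseteq> K c"
      if "\<exists>us' ws'. W.fac (us' @ map F (us @ vs @ ws) @ ws') \<and> set (map F (us @ vs @ ws)) \<subseteq> K c" for us vs ws
    proof -
      from that obtain us' ws' where "W.fac ((us' @ map F us) @ map F vs @ (map F ws @ ws'))"
        "set (map F vs) \<subseteq> K c" by auto
      then show ?thesis by blast
    qed
    have "\<exists>us ws. W.fac (us @ map F (flat (f c)) @ ws)"
      using X.facZ unfolding X.Z_def by (cases c) (metis append_Nil, metis append_Nil2)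
    then show "\<exists>us ws. W.fac (us @ map F (flat (f c)) @ ws) \<and> set (map F (flat (f c))) \<subseteq> K c"
      using X.flat_K by blast
    have "\<exists>us ws. W.fac (us @ map F (flat (g c)) @ ws)"
      using Y.facZ unfolding Y.Z_def by (cases c) (metis append_Nil, metis append_Nil2)
    then show "\<exists>us ws. W.fac (us @ map F (flat (g c)) @ ws) \<and> set (map F (flat (g c))) \<subseteq> K c"
      using Y.flat_K by blast
  qed (use lift_transitive X.forest Y.forest tr pr prs in \<open>blast+\<close>)
  have "heq G (Y1 @ Y2) (flat (f True) @ flat (f False))" using G.heq_append d1 by blast
  also have "heq G (flat (f True) @ flat (f False)) (flat (g True) @ flat (g False))"
    using G.heq_append heq by blast
  also have "heq G (flat (g True) @ flat (g False)) (Y1' @ Y2')"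
    using G.heq_sym[OF G.heq_append] d2 by blast
  finally show ?thesis .
qed

end

section \<open>Presented groups\<close>

definition eval_word :: "('a, 'm) monoid_scheme \<Rightarrow> ('g \<Rightarrow> 'a) \<Rightarrow> ('g \<times> bool) list \<Rightarrow> 'a" where
  "eval_word K \<theta> w = prodl K (map (\<lambda>(x, b). if b then \<theta> x else inv\<^bsub>K\<^esub> (\<theta> x)) w)"

lemma eval_word_Nil [simp]: "eval_word K \<theta> [] = \<one>\<^bsub>K\<^esub>"
  and eval_word_Cons [simp]: "eval_word K \<theta> (l # w) =
    (if snd l then \<theta> (fst l) else inv\<^bsub>K\<^esub> (\<theta> (fst l))) \<otimes>\<^bsub>K\<^esub> eval_word K \<theta> w"
  by (simp_all add: eval_word_def split: prod.splits)

lemma eval_word_cong: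
  "(\<And>x. x \<in> fst ` set w \<Longrightarrow> \<theta> x = \<theta>' x) \<Longrightarrow> eval_word K \<theta> w = eval_word K \<theta>' w"
  by (induction w) auto

definition word_over :: "'g set \<Rightarrow> ('g \<times> bool) list \<Rightarrow> bool" where
  "word_over Gen w \<longleftrightarrow> set w \<subseteq> Gen \<times> UNIV"

lemma word_over_simps [simp]: "word_over Gen []" "word_over Gen (l # w) \<longleftrightarrow> fst l \<in> Gen \<and> word_over Gen w"
  "word_over Gen (u @ v) \<longleftrightarrow> word_over Gen u \<and> word_over Gen v" "word_over Gen (inv_word w) \<longleftrightarrow> word_over Gen w"
  by (auto simp: word_over_def inv_word_def mem_Times_iff)

lemma inv_word_simps [simp]: "inv_word [] = []" "inv_word (u @ v) = inv_word v @ inv_word u"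
  "inv_word (l # w) = inv_word w @ [(fst l, \<not> snd l)]" "inv_word (inv_word w) = w"
  by (auto simp: inv_word_def rev_map comp_def case_prod_beta)

context group
begin

lemma eval_word_closed:
  "\<theta> ` Gen \<subseteq> carrier G \<Longrightarrow> word_over Gen w \<Longrightarrow> eval_word G \<theta> w \<in> carrier G"
  by (induction w) auto

lemma eval_word_append:
  "\<theta> ` Gen \<subseteq> carrier G \<Longrightarrow> word_over Gen u \<Longrightarrow> word_over Gen v \<Longrightarrow>
   eval_word G \<theta> (u @ v) = eval_word G \<theta> u \<otimes> eval_word G \<theta> v"
  by (induction u) (auto simp: eval_word_closed m_assoc image_subset_iff)

lemma eval_word_inv_word:
  assumes "\<theta> ` Gen \<subseteq> carrier G" "word_over Gen w"
  shows "eval_word G \<theta> (inv_word w) = inv (eval_word G \<theta> w)"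
  using assms(2)
proof (induction w)
  case (Cons l w)
  have "\<theta> (fst l) \<in> carrier G" using Cons.prems assms by auto
  then show ?case using Cons assms eval_word_closed[of \<theta> Gen w]
    by (simp add: eval_word_append[OF assms(1)] inv_mult_group)
qed simp

lemma eval_word_word_cong:
  fixes \<theta> :: "'g \<Rightarrow> 'a"
  assumes "\<theta> ` Gen \<subseteq> carrier G" "\<And>r. r \<in> R \<Longrightarrow> word_over Gen r" "\<And>r. r \<in> R \<Longrightarrow> eval_word G \<theta> r = \<one>"
    and "word_cong R u v" "word_over Gen u" "word_over Gen v"
  shows "eval_word G \<theta> u = eval_word G \<theta> v"
proof -
  \<comment> \<open>A congruence between words over \<open>Gen\<close> may pass through foreign
    letters, which are evaluated to the identity.\<close>
  let ?\<theta> = "\<lambda>x. if x \<in> Gen then \<theta> x else \<one>"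
  have c: "?\<theta> ` UNIV \<subseteq> carrier G" using assms(1) by auto
  have o: "word_over UNIV w" for w :: "('g \<times> bool) list" by (simp add: word_over_def)
  have e: "eval_word G ?\<theta> w = eval_word G \<theta> w" if "word_over Gen w" for w
    using that by (intro eval_word_cong) (auto simp: word_over_def)
  have "eval_word G ?\<theta> u = eval_word G ?\<theta> v"
    using assms(4)
  proof (induction)
    case (wc_cancel x b)
    have "x \<in> Gen \<Longrightarrow> \<theta> x \<in> carrier G" using assms(1) by blast
    then show ?case by (cases b; cases "x \<in> Gen") simp_all
  next
    case (wc_rel r)
    then show ?case using e assms(2,3) by simp
  next
    case (wc_app u u' v v')
    then show ?case using eval_word_append[OF c o o] by simp
  qed auto
  then show ?thesis using e assms(5,6) by simp
qed

end

lemma word_cong_inverse: "word_cong R (w @ inv_word w) []"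
proof (induction w)
  case Nil
  then show ?case by (simp add: wc_refl)
next
  case (Cons l w)
  obtain x b where l: "l = (x, b)" by fastforce
  have "word_cong R ((w @ inv_word w) @ [(x, \<not> b)]) ([] @ [(x, \<not> b)])"
    using Cons.IH by (rule wc_app[OF _ wc_refl])
  then have "word_cong R ([l] @ (w @ inv_word w) @ [(x, \<not> b)]) ([l] @ [(x, \<not> b)])"
    using wc_app[OF wc_refl] by (metis append_Nil)
  moreover have "word_cong R ([l] @ [(x, \<not> b)]) []" using wc_cancel[of R x b] l by simp
  ultimately show ?case using wc_trans l by fastforce
qed

lemma word_class_eq: "word_class R u = word_class R v \<longleftrightarrow> word_cong R u v"
  unfolding word_class_def using wc_refl wc_sym wc_trans by blast

lemma presented_group_mult:
  "word_class R u \<otimes>\<^bsub>presented_group Gen R\<^esub> word_class R v = word_class R (u @ v)"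
proof -
  have "{w. \<exists>a\<in>word_class R u. \<exists>b\<in>word_class R v. word_cong R (a @ b) w} = word_class R (u @ v)"
    unfolding word_class_def using wc_refl wc_sym wc_trans wc_app by blast
  then show ?thesis by (simp add: presented_group_def)
qed

lemma presented_group_carrier:
  "carrier (presented_group Gen R) = {word_class R w | w. word_over Gen w}"
  by (simp add: presented_group_def word_over_def)

lemma presented_group_one: "\<one>\<^bsub>presented_group Gen R\<^esub> = word_class R []"
  by (simp add: presented_group_def)

lemma group_presented_group: "group (presented_group Gen R)"
proof (rule groupI)
  fix x y z
  assume "x \<in> carrier (presented_group Gen R)" "y \<in> carrier (presented_group Gen R)"
    "z \<in> carrier (presented_group Gen R)"
  then obtain u v w where *: "x = word_class R u" "y = word_class R v" "z = word_class R w"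
    "word_over Gen u" "word_over Gen v" "word_over Gen w" unfolding presented_group_carrier by blast
  then show "x \<otimes>\<^bsub>presented_group Gen R\<^esub> y \<in> carrier (presented_group Gen R)"
    unfolding presented_group_mult *(1,2) presented_group_carrier by (auto intro!: exI[of _ "u @ v"])
  show "x \<otimes>\<^bsub>presented_group Gen R\<^esub> y \<otimes>\<^bsub>presented_group Gen R\<^esub> z
      = x \<otimes>\<^bsub>presented_group Gen R\<^esub> (y \<otimes>\<^bsub>presented_group Gen R\<^esub> z)"
    unfolding * presented_group_mult by simp
next
  show "\<one>\<^bsub>presented_group Gen R\<^esub> \<in> carrier (presented_group Gen R)"
    unfolding presented_group_one presented_group_carrier by (auto intro!: exI[of _ "[]"])
next
  fix x assume "x \<in> carrier (presented_group Gen R)"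
  then obtain u where u: "x = word_class R u" "word_over Gen u" unfolding presented_group_carrier by blast
  then show "\<one>\<^bsub>presented_group Gen R\<^esub> \<otimes>\<^bsub>presented_group Gen R\<^esub> x = x"
    by (simp add: presented_group_one presented_group_mult)
  have "word_class R (inv_word u) \<otimes>\<^bsub>presented_group Gen R\<^esub> x = \<one>\<^bsub>presented_group Gen R\<^esub>"
    unfolding u presented_group_mult presented_group_one word_class_eq
    using word_cong_inverse[of R "inv_word u"] by simp
  moreover have "word_class R (inv_word u) \<in> carrier (presented_group Gen R)"
    using u unfolding presented_group_carrier by (auto intro!: exI[of _ "inv_word u"])
  ultimately show "\<exists>y\<in>carrier (presented_group Gen R). y \<otimes>\<^bsub>presented_group Gen R\<^esub> x = \<one>\<^bsub>presented_group Gen R\<^esub>"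
    by blast
qed

text \<open>This form with a generator map \<gamma> treats abstractly presented groups and groups
  generated by their own elements alike. The last clause is what homomorphisms are built
  from.\<close>

definition pres_by :: "('a, 'm) monoid_scheme \<Rightarrow> ('g \<Rightarrow> 'a) \<Rightarrow> 'g set \<Rightarrow> ('g \<times> bool) list set \<Rightarrow> bool" where
  "pres_by G \<gamma> Gen R \<longleftrightarrow> group G \<and> \<gamma> ` Gen \<subseteq> carrier G \<and>
     (\<forall>x\<in>carrier G. \<exists>w. word_over Gen w \<and> eval_word G \<gamma> w = x) \<and>
     (\<forall>r\<in>R. word_over Gen r) \<and>
     (\<forall>w. word_over Gen w \<longrightarrow> (eval_word G \<gamma> w = \<one>\<^bsub>G\<^esub> \<longleftrightarrow> word_cong R w []))"

lemma eval_pres_gen: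
  "word_over Gen w \<Longrightarrow> eval_word (presented_group Gen R) (pres_gen R) w = word_class R w"
proof (induction w)
  case (Cons l w)
  interpret group "presented_group Gen R" by (rule group_presented_group)
  obtain x b where l: "l = (x, b)" by fastforce
  have "inv\<^bsub>presented_group Gen R\<^esub> (pres_gen R x) = word_class R [(x, False)]"
  proof (rule inv_equality)
    show "word_class R [(x, False)] \<otimes>\<^bsub>presented_group Gen R\<^esub> pres_gen R x = \<one>\<^bsub>presented_group Gen R\<^esub>"
      unfolding pres_gen_def presented_group_mult presented_group_one word_class_eq
      using wc_cancel[of R x False] by simp
    show "word_class R [(x, False)] \<in> carrier (presented_group Gen R)"
      "pres_gen R x \<in> carrier (presented_group Gen R)"
      using Cons.prems l unfolding presented_group_carrier pres_gen_def
      by (auto intro: exI[of _ "[(x, False)]"] exI[of _ "[(x, True)]"])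
  qed
  then show ?case using Cons l by (cases b) (simp_all add: presented_group_mult pres_gen_def)
qed (simp add: presented_group_one)

lemma pres_by_presented_group:
  assumes "\<And>r. r \<in> R \<Longrightarrow> word_over Gen r"
  shows "pres_by (presented_group Gen R) (pres_gen R) Gen R"
  unfolding pres_by_def
proof (intro conjI)
  show "pres_gen R ` Gen \<subseteq> carrier (presented_group Gen R)"
    unfolding presented_group_carrier pres_gen_def by (auto intro!: exI[of _ "[(_, True)]"])
  show "\<forall>x\<in>carrier (presented_group Gen R). \<exists>w. word_over Gen w \<and>
      eval_word (presented_group Gen R) (pres_gen R) w = x"
    unfolding presented_group_carrier using eval_pres_gen by blast
  show "\<forall>w. word_over Gen w \<longrightarrow> (eval_word (presented_group Gen R) (pres_gen R) w
      = \<one>\<^bsub>presented_group Gen R\<^esub> \<longleftrightarrow> word_cong R w [])"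
    by (simp add: eval_pres_gen presented_group_one word_class_eq)
qed (use assms group_presented_group in auto)

lemma hom_eval_word:
  assumes "group G" "group K" "F \<in> hom G K" "\<gamma> ` Gen \<subseteq> carrier G" "word_over Gen w"
  shows "F (eval_word G \<gamma> w) = eval_word K (F \<circ> \<gamma>) w"
  using assms(5)
proof (induction w)
  case Nil
  then show ?case using hom_one[OF assms(3,1,2)] by simp
next
  case (Cons l w)
  interpret F: group_hom G K F using assms by (simp add: group_hom_def group_hom_axioms_def)
  have "\<gamma> (fst l) \<in> carrier G" "eval_word G \<gamma> w \<in> carrier G"
    using Cons.prems assms(4) F.G.eval_word_closed[OF assms(4), of w] by auto
  then show ?case using Cons by simp
qed

lemma pres_by_presents:
  assumes "group W" "presents W S R" "S \<subseteq> carrier W" "\<And>r. r \<in> R \<Longrightarrow> word_over S r"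
  shows "pres_by W (\<lambda>x. x) S R"
proof -
  let ?P = "presented_group S R"
  obtain \<phi> where \<phi>: "\<phi> \<in> iso ?P W" "\<And>x. x \<in> S \<Longrightarrow> \<phi> (pres_gen R x) = x"
    using assms(2) unfolding presents_def by blast
  have hom: "\<phi> \<in> hom ?P W" and bij: "bij_betw \<phi> (carrier ?P) (carrier W)"
    using \<phi>(1) by (auto simp: iso_def)
  have P: "pres_by ?P (pres_gen R) S R" by (rule pres_by_presented_group[OF assms(4)])
  have ev: "\<phi> (word_class R w) = eval_word W (\<lambda>x. x) w" if w: "word_over S w" for w
  proof -
    have "\<phi> (word_class R w) = eval_word W (\<phi> \<circ> pres_gen R) w"
      using hom_eval_word[OF group_presented_group assms(1) hom _ w] P eval_pres_gen[OF w]
      unfolding pres_by_def by metis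
    also have "\<dots> = eval_word W (\<lambda>x. x) w"
      using w \<phi>(2) by (intro eval_word_cong) (auto simp: word_over_def)
    finally show ?thesis .
  qed
  show ?thesis
    unfolding pres_by_def
  proof (intro conjI ballI allI impI)
    fix x assume "x \<in> carrier W"
    then obtain y where y: "y \<in> carrier ?P" "\<phi> y = x" using bij by (metis bij_betw_imp_surj_on imageE)
    then obtain w where "word_over S w" "y = word_class R w" unfolding presented_group_carrier by auto
    then show "\<exists>w. word_over S w \<and> eval_word W (\<lambda>x. x) w = x" using ev y(2) by metis
  next
    fix w assume w: "word_over S w"
    have "word_class R w \<in> carrier ?P" "word_class R [] \<in> carrier ?P"
      using w word_over_simps(1)[of S] unfolding presented_group_carrier by blast+
    then have "\<phi> (word_class R w) = \<phi> (word_class R []) \<longleftrightarrow> word_class R w = word_class R []"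
      using inj_on_eq_iff[OF bij_betw_imp_inj_on[OF bij]] by simp
    then show "eval_word W (\<lambda>x. x) w = \<one>\<^bsub>W\<^esub> \<longleftrightarrow> word_cong R w []"
      using ev[OF w] ev[of "[]"] word_class_eq by simp
  qed (use assms in auto)
qed

lemma pres_by_hom:
  assumes P: "pres_by G \<gamma> Gen R" and K: "group K" and \<theta>: "\<theta> ` Gen \<subseteq> carrier K"
    and rel: "\<And>r. r \<in> R \<Longrightarrow> eval_word K \<theta> r = \<one>\<^bsub>K\<^esub>"
  shows "\<exists>F\<in>hom G K. \<forall>w. word_over Gen w \<longrightarrow> F (eval_word G \<gamma> w) = eval_word K \<theta> w"
proof -
  interpret G: group G using P by (simp add: pres_by_def)
  interpret K: group K by fact
  have \<gamma>: "\<gamma> ` Gen \<subseteq> carrier G" and R: "\<And>r. r \<in> R \<Longrightarrow> word_over Gen r"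
    and ker: "\<And>w. word_over Gen w \<Longrightarrow> eval_word G \<gamma> w = \<one>\<^bsub>G\<^esub> \<longleftrightarrow> word_cong R w []"
    and sur: "\<And>x. x \<in> carrier G \<Longrightarrow> \<exists>w. word_over Gen w \<and> eval_word G \<gamma> w = x"
    using P by (auto simp: pres_by_def)
  have wd: "eval_word K \<theta> u = eval_word K \<theta> v"
    if uv: "word_over Gen u" "word_over Gen v" "eval_word G \<gamma> u = eval_word G \<gamma> v" for u v
  proof -
    have "eval_word G \<gamma> (u @ inv_word v) = \<one>\<^bsub>G\<^esub>"
      using uv G.eval_word_closed[OF \<gamma> uv(2)]
      by (simp add: G.eval_word_append[OF \<gamma>] G.eval_word_inv_word[OF \<gamma>])
    then have "word_cong R (u @ inv_word v) []" using ker[of "u @ inv_word v"] uv by simp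
    then have "eval_word K \<theta> (u @ inv_word v) = \<one>\<^bsub>K\<^esub>"
      using K.eval_word_word_cong[OF \<theta> R rel, where u = "u @ inv_word v" and v = "[]"] uv by simp
    then have "eval_word K \<theta> u \<otimes>\<^bsub>K\<^esub> inv\<^bsub>K\<^esub> (eval_word K \<theta> v) = \<one>\<^bsub>K\<^esub>"
      using uv by (simp add: K.eval_word_append[OF \<theta>] K.eval_word_inv_word[OF \<theta>])
    then show ?thesis using K.eval_word_closed[OF \<theta>] uv by (metis K.inv_equality K.inv_inv K.inv_closed)
  qed
  define rep where "rep x = (SOME w. word_over Gen w \<and> eval_word G \<gamma> w = x)" for x
  have rep: "word_over Gen (rep x)" "eval_word G \<gamma> (rep x) = x" if "x \<in> carrier G" for x
    using someI_ex[OF sur[OF that]] unfolding rep_def by blast+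
  define F where "F x = eval_word K \<theta> (rep x)" for x
  have F: "F (eval_word G \<gamma> w) = eval_word K \<theta> w" if "word_over Gen w" for w
    unfolding F_def using wd rep G.eval_word_closed[OF \<gamma> that] that by metis
  have "F \<in> hom G K"
  proof (rule homI)
    fix x assume "x \<in> carrier G"
    then show "F x \<in> carrier K" unfolding F_def using rep K.eval_word_closed[OF \<theta>] by blast
  next
    fix x y assume xy: "x \<in> carrier G" "y \<in> carrier G"
    have "x \<otimes>\<^bsub>G\<^esub> y = eval_word G \<gamma> (rep x @ rep y)" using rep xy by (simp add: G.eval_word_append[OF \<gamma>])
    then have "F (x \<otimes>\<^bsub>G\<^esub> y) = eval_word K \<theta> (rep x @ rep y)" using F rep xy by simp
    then show "F (x \<otimes>\<^bsub>G\<^esub> y) = F x \<otimes>\<^bsub>K\<^esub> F y"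
      using rep xy by (simp add: F_def K.eval_word_append[OF \<theta>])
  qed
  then show ?thesis using F by blast
qed

lemma pres_by_hom_gen:
  assumes "pres_by G \<gamma> Gen R" "group K" "\<theta> ` Gen \<subseteq> carrier K"
    and "\<And>r. r \<in> R \<Longrightarrow> eval_word K \<theta> r = \<one>\<^bsub>K\<^esub>"
  shows "\<exists>F\<in>hom G K. \<forall>g\<in>Gen. F (\<gamma> g) = \<theta> g"
proof -
  interpret G: group G using assms(1) by (simp add: pres_by_def)
  interpret K: group K by fact
  obtain F where F: "F \<in> hom G K" "\<And>w. word_over Gen w \<Longrightarrow> F (eval_word G \<gamma> w) = eval_word K \<theta> w"
    using pres_by_hom[OF assms] by blast
  have "F (\<gamma> g) = \<theta> g" if "g \<in> Gen" for g
  proof -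
    have "\<gamma> g \<in> carrier G" "\<theta> g \<in> carrier K" using that assms by (auto simp: pres_by_def)
    then show ?thesis using F(2)[of "[(g, True)]"] that by simp
  qed
  then show ?thesis using F(1) by blast
qed

lemma pres_by_hom_eqI:
  assumes P: "pres_by G \<gamma> Gen R" and K: "group K" and F: "F \<in> hom G K" "F' \<in> hom G K"
    and eq: "\<And>g. g \<in> Gen \<Longrightarrow> F (\<gamma> g) = F' (\<gamma> g)" and x: "x \<in> carrier G"
  shows "F x = F' x"
proof -
  have G: "group G" "\<gamma> ` Gen \<subseteq> carrier G" using P by (auto simp: pres_by_def)
  obtain w where w: "word_over Gen w" "eval_word G \<gamma> w = x" using P x by (auto simp: pres_by_def)
  have "eval_word K (F \<circ> \<gamma>) w = eval_word K (F' \<circ> \<gamma>) w"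
    using w(1) eq by (intro eval_word_cong) (auto simp: word_over_def)
  then show ?thesis
    using hom_eval_word[OF G(1) K F(1) G(2) w(1)] hom_eval_word[OF G(1) K F(2) G(2) w(1)] w(2) by simp
qed

text \<open>No relator mixes the colours, as happens when all matrix entries between two sets of
  generators are infinite. Such a presentation describes a free product.\<close>

locale coloured_presentation = group G for G (structure) +
  fixes \<gamma> :: "'g \<Rightarrow> 'a" and Gen R and col :: "'g \<Rightarrow> bool"
  assumes pres: "pres_by G \<gamma> Gen R"
    and mono: "r \<in> R \<Longrightarrow> \<exists>c. \<forall>x\<in>fst ` set r. col x = c"
begin

definition star :: "bool \<Rightarrow> 'a set" where
  "star c = {eval_word G \<gamma> w | w. word_over {g \<in> Gen. col g = c} w}"

lemma \<gamma>: "\<gamma> ` Gen \<subseteq> carrier G" "\<gamma> ` {g \<in> Gen. col g = c} \<subseteq> carrier G"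
  using pres by (auto simp: pres_by_def)

lemma star_subgroup: "subgroup (star c) G"
proof (rule subgroupI)
  show "star c \<subseteq> carrier G" using eval_word_closed[OF \<gamma>(2)] unfolding star_def by blast
  show "star c \<noteq> {}" unfolding star_def by (auto intro!: exI[of _ "[]"])
next
  fix a assume "a \<in> star c"
  then obtain w where "word_over {g \<in> Gen. col g = c} w" "a = eval_word G \<gamma> w" unfolding star_def by blast
  then show "inv a \<in> star c"
    unfolding star_def using eval_word_inv_word[OF \<gamma>(2)] by (auto intro!: exI[of _ "inv_word w"])
next
  fix a b assume "a \<in> star c" "b \<in> star c"
  then obtain u v where "word_over {g \<in> Gen. col g = c} u" "a = eval_word G \<gamma> u"
    "word_over {g \<in> Gen. col g = c} v" "b = eval_word G \<gamma> v" unfolding star_def by blast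
  then show "a \<otimes> b \<in> star c"
    unfolding star_def using eval_word_append[OF \<gamma>(2)] by (auto intro!: exI[of _ "u @ v"])
qed

lemma gen_star: "g \<in> Gen \<Longrightarrow> \<gamma> g \<in> star (col g)"
  unfolding star_def using \<gamma>(1) by (auto intro!: exI[of _ "[(g, True)]"])

definition push :: "bool \<Rightarrow> 'a \<Rightarrow> (bool \<times> 'a) list \<Rightarrow> (bool \<times> 'a) list" where
  "push c h xs = (if h = \<one> then xs else (c, h) # xs)"

text \<open>Van der Waerden's action on normal forms.\<close>

definition act :: "bool \<Rightarrow> 'a \<Rightarrow> (bool \<times> 'a) list \<Rightarrow> (bool \<times> 'a) list" where
  "act c h xs = (if xs \<noteq> [] \<and> fst (hd xs) = c then push c (h \<otimes> snd (hd xs)) (tl xs) else push c h xs)"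

definition words :: "(bool \<times> 'a) list set" where
  "words = {xs. (\<forall>(c, x)\<in>set xs. x \<in> star c \<and> x \<noteq> \<one>) \<and> distinct_adj (map fst xs)}"

lemma words_Cons: "(d, y) # ys \<in> words \<longleftrightarrow>
    y \<in> star d \<and> y \<noteq> \<one> \<and> ys \<in> words \<and> (ys = [] \<or> fst (hd ys) \<noteq> d)"
  by (cases ys) (auto simp: words_def)

lemma act_words: "h \<in> star c \<Longrightarrow> xs \<in> words \<Longrightarrow> act c h xs \<in> words"
  using subgroup.m_closed[OF star_subgroup]
  by (cases xs) (auto simp: act_def push_def words_Cons)

lemma star_carrier: "h \<in> star c \<Longrightarrow> h \<in> carrier G"
  using subgroup.mem_carrier[OF star_subgroup] .

lemma act_one: "xs \<in> words \<Longrightarrow> act c \<one> xs = xs"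
  by (cases xs) (auto simp: act_def push_def words_Cons star_carrier)

lemma act_mult:
  assumes "h \<in> star c" "h' \<in> star c" "xs \<in> words"
  shows "act c h (act c h' xs) = act c (h \<otimes> h') xs"
proof -
  have c: "h \<in> carrier G" "h' \<in> carrier G" using assms star_carrier by auto
  show ?thesis
  proof (cases "xs \<noteq> [] \<and> fst (hd xs) = c")
    case False
    then have n: "act c k xs = push c k xs" for k unfolding act_def by argo
    show ?thesis
    proof (cases "h' = \<one>")
      case True
      then show ?thesis using c unfolding n by (simp add: push_def n)
    next
      case False
      then have "act c h (push c h' xs) = push c (h \<otimes> h') xs" by (simp add: act_def push_def)
      then show ?thesis unfolding n .
    qed
  next
    case True
    then obtain y ys where xs: "xs = (c, y) # ys" by (cases xs) auto
    then have y: "y \<in> carrier G" "ys = [] \<or> fst (hd ys) \<noteq> c"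
      using assms(3) star_carrier by (auto simp: words_Cons)
    show ?thesis
    proof (cases "h' \<otimes> y = \<one>")
      case True
      then have "h \<otimes> h' \<otimes> y = h" using c y by (simp add: m_assoc)
      moreover have "act c h ys = push c h ys" using y(2) unfolding act_def by argo
      ultimately show ?thesis using True xs by (simp add: act_def push_def)
    next
      case False
      then show ?thesis using y c xs by (simp add: act_def push_def m_assoc)
    qed
  qed
qed

text \<open>The group \<open>BijGroup\<close> consists of extensional functions, hence the
  restriction to the set acted upon.\<close>

definition perm :: "bool \<Rightarrow> 'a \<Rightarrow> (bool \<times> 'a) list \<Rightarrow> (bool \<times> 'a) list" where
  "perm c h = restrict (act c h) words"

lemma perm_Bij: "h \<in> star c \<Longrightarrow> perm c h \<in> carrier (BijGroup words)"
proof -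
  assume h: "h \<in> star c"
  then have i: "inv h \<in> star c" using subgroup.m_inv_closed[OF star_subgroup] by blast
  have hc: "h \<in> carrier G" using h star_carrier by blast
  have "bij_betw (act c h) words words"
    by (rule bij_betw_byWitness[of _ "act c (inv h)"])
      (use act_mult h i hc act_one act_words in auto)
  moreover have "bij_betw (restrict (act c h) words) words words \<longleftrightarrow> bij_betw (act c h) words words"
    by (rule bij_betw_cong) simp
  ultimately show ?thesis by (simp add: BijGroup_def Bij_def perm_def)
qed

lemma perm_mult: "h \<in> star c \<Longrightarrow> h' \<in> star c \<Longrightarrow>
    perm c h \<otimes>\<^bsub>BijGroup words\<^esub> perm c h' = perm c (h \<otimes> h')"
  using perm_Bij[of h c] perm_Bij[of h' c] act_mult act_words
  by (auto simp: BijGroup_def perm_def compose_def restrict_def fun_eq_iff)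

lemma perm_one: "perm c \<one> = \<one>\<^bsub>BijGroup words\<^esub>"
  by (auto simp: BijGroup_def perm_def restrict_def fun_eq_iff act_one)

lemma perm_inv: "h \<in> star c \<Longrightarrow> inv\<^bsub>BijGroup words\<^esub> (perm c h) = perm c (inv h)"
  by (rule group.inv_equality[OF group_BijGroup])
    (use perm_mult[of "inv h" c h] perm_one[of c] perm_Bij star_carrier
      subgroup.m_inv_closed[OF star_subgroup] in simp_all)

lemma eval_perm:
  "word_over {g \<in> Gen. col g = c} w \<Longrightarrow>
   eval_word (BijGroup words) (\<lambda>g. perm (col g) (\<gamma> g)) w = perm c (eval_word G \<gamma> w)"
proof (induction w)
  case (Cons l w)
  have g: "\<gamma> (fst l) \<in> star c" using Cons.prems gen_star[of "fst l"] by auto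
  have i: "inv (\<gamma> (fst l)) \<in> star c" using subgroup.m_inv_closed[OF star_subgroup g] .
  have e: "eval_word G \<gamma> w \<in> star c" using Cons.prems unfolding star_def by auto
  show ?case using Cons g i e by (simp add: perm_mult perm_inv)
qed (simp add: perm_one)

text \<open>Acting on the empty list, an alternating product writes out its own letters, so a
  nonempty one cannot be the identity. Relators act trivially because each lies in one factor, whose
  action is already multiplicative.\<close>

theorem free_prod_star: "free_prod G star"
proof (intro free_prod.intro free_prod_axioms.intro group_axioms star_subgroup)
  let ?K = "BijGroup words"
  have K: "group ?K" by (rule group_BijGroup)
  have Ron: "word_over Gen r" if "r \<in> R" for r using pres that by (simp add: pres_by_def)
  have "eval_word ?K (\<lambda>g. perm (col g) (\<gamma> g)) r = \<one>\<^bsub>?K\<^esub>" if r: "r \<in> R" for r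
  proof -
    obtain c where c: "\<forall>x\<in>fst ` set r. col x = c" using mono[OF r] by blast
    then have w: "word_over {g \<in> Gen. col g = c} r" using Ron[OF r] by (fastforce simp: word_over_def)
    have "eval_word G \<gamma> r = \<one>" using pres r wc_rel[OF r] Ron[OF r] by (simp add: pres_by_def)
    then show ?thesis using eval_perm[OF w] perm_one by simp
  qed
  moreover have "(\<lambda>g. perm (col g) (\<gamma> g)) ` Gen \<subseteq> carrier ?K" using perm_Bij gen_star by blast
  ultimately obtain F where F: "F \<in> hom G ?K"
    "\<And>w. word_over Gen w \<Longrightarrow> F (eval_word G \<gamma> w) = eval_word ?K (\<lambda>g. perm (col g) (\<gamma> g)) w"
    using pres_by_hom[OF pres K] by blast
  have Fs: "F h = perm c h" if "h \<in> star c" for h c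
  proof -
    obtain w where w: "word_over {g \<in> Gen. col g = c} w" "h = eval_word G \<gamma> w"
      using \<open>h \<in> star c\<close> unfolding star_def by blast
    then have "word_over Gen w" by (auto simp: word_over_def)
    then show ?thesis using F(2) eval_perm[OF w(1)] w(2) by simp
  qed
  have nil: "[] \<in> words" by (simp add: words_def)
  have cl: "\<exists>ys. F (prodl G xs) [] = ys \<and> ys \<in> words \<and> length ys = length xs
      \<and> (xs \<noteq> [] \<longrightarrow> fst (hd ys) = c) \<and> set xs \<subseteq> carrier G" if "alternating G star c xs" for c xs
    using that
  proof (induction xs arbitrary: c)
    case Nil
    show ?case using hom_one[OF F(1) group_axioms K] nil by (simp add: BijGroup_def)
  next
    case (Cons x xs)
    then obtain ys where ys: "F (prodl G xs) [] = ys" "ys \<in> words" "length ys = length xs"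
      "xs \<noteq> [] \<longrightarrow> fst (hd ys) = (\<not> c)" "set xs \<subseteq> carrier G" by auto
    have x: "x \<in> star c" "x \<noteq> \<one>" using Cons.prems by auto
    have p: "prodl G xs \<in> carrier G" using ys by blast
    have "F (x \<otimes> prodl G xs) = perm c x \<otimes>\<^bsub>?K\<^esub> F (prodl G xs)"
      using hom_mult[OF F(1) star_carrier[OF x(1)] p] Fs[OF x(1)] by simp
    moreover have "F (prodl G xs) \<in> Bij words" using hom_in_carrier[OF F(1) p] by (simp add: BijGroup_def)
    moreover have "perm c x \<in> Bij words" using perm_Bij[OF x(1)] by (simp add: BijGroup_def)
    ultimately have "F (x \<otimes> prodl G xs) [] = act c x ys"
      using nil ys(1,2) by (simp add: BijGroup_def compose_def perm_def)
    moreover have "act c x ys = (c, x) # ys"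
      using ys x by (cases "xs = []") (auto simp: act_def push_def)
    ultimately show ?case using act_words[OF x(1) ys(2)] ys x star_carrier[OF x(1)] by auto
  qed
  fix c xs assume a: "alternating G star c xs" "xs \<noteq> []"
  show "prodl G xs \<noteq> \<one>"
  proof
    assume "prodl G xs = \<one>"
    then have "F (prodl G xs) [] = []" using hom_one[OF F(1) group_axioms K] nil by (simp add: BijGroup_def)
    then show False using cl[OF a(1)] a(2) by auto
  qed
next
  fix g assume "g \<in> carrier G"
  then obtain w where w: "word_over Gen w" "eval_word G \<gamma> w = g" using pres by (auto simp: pres_by_def)
  have "\<exists>xs. set xs \<subseteq> star True \<union> star False \<and> prodl G xs = eval_word G \<gamma> w"
    using w(1)
  proof (induction w)
    case (Cons l w)
    then obtain xs where xs: "set xs \<subseteq> star True \<union> star False" "prodl G xs = eval_word G \<gamma> w" by auto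
    have "\<gamma> (fst l) \<in> star (col (fst l))" using Cons.prems gen_star by simp
    moreover from this have "inv (\<gamma> (fst l)) \<in> star (col (fst l))"
      using subgroup.m_inv_closed[OF star_subgroup] by blast
    ultimately show ?case using xs
      by (intro exI[of _ "(if snd l then \<gamma> (fst l) else inv (\<gamma> (fst l))) # xs"])
        (cases "col (fst l)"; auto)
  qed (auto intro: exI[of _ "[]"])
  then show "\<exists>xs. set xs \<subseteq> star True \<union> star False \<and> prodl G xs = g" using w(2) by simp
qed

end

lemma word_over_alt_word: "s \<in> S \<Longrightarrow> t \<in> S \<Longrightarrow> word_over S (alt_word s t n)"
  by (auto simp: word_over_def alt_word_def)

lemma alt_word_0 [simp]: "alt_word s t 0 = []"
  by (simp add: alt_word_def)

lemma alt_word_Suc: "alt_word s t (Suc n) = (s, True) # alt_word t s n"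
proof -
  have "[0..<Suc n] = 0 # map Suc [0..<n]" by (simp add: upt_conv_Cons map_Suc_upt)
  then show ?thesis by (simp add: alt_word_def)
qed

section \<open>The geometric representation\<close>

locale cox_form =
  fixes S :: "'a set" and m :: "'a \<Rightarrow> 'a \<Rightarrow> enat"
  assumes fin: "finite S" and mat: "coxeter_matrix S m"
begin

text \<open>Twice the usual Tits form, so that reflections need no factor two. The entry
  \<open>m s s = 1\<close> gives the value 2 on the diagonal.\<close>

definition form :: "'a \<Rightarrow> 'a \<Rightarrow> real" where
  "form s t = (case m s t of enat k \<Rightarrow> - 2 * cos (pi / k) | \<infinity> \<Rightarrow> - 2)"

text \<open>The second component is a parameter on which the reflections act trivially. It makes the
  move space of a Coxeter element full even if the form is degenerate.\<close>

definition coord :: "'a \<Rightarrow> ('a \<Rightarrow> real) \<times> ('a \<Rightarrow> real) \<Rightarrow> real" where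
  "coord s p = (\<Sum>r\<in>S. form s r * fst p r) + snd p s"

definition refl :: "'a \<Rightarrow> ('a \<Rightarrow> real) \<times> ('a \<Rightarrow> real) \<Rightarrow> ('a \<Rightarrow> real) \<times> ('a \<Rightarrow> real)" where
  "refl s p = ((fst p)(s := fst p s - coord s p), snd p)"

lemma snd_refl [simp]: "snd (refl s p) = snd p"
  by (simp add: refl_def)

lemma fst_refl: "fst (refl s p) x = fst p x - (if x = s then coord s p else 0)"
  by (simp add: refl_def)

lemma coord_refl: "s \<in> S \<Longrightarrow> coord t (refl s p) = coord t p - form t s * coord s p"
proof -
  assume s: "s \<in> S"
  have "(\<Sum>r\<in>S. form t r * fst (refl s p) r)
      = (\<Sum>r\<in>S. form t r * fst p r - (if r = s then form t s * coord s p else 0))"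
    by (intro sum.cong) (auto simp: fst_refl algebra_simps)
  also have "\<dots> = (\<Sum>r\<in>S. form t r * fst p r) - form t s * coord s p"
    using s fin by (simp add: sum_subtractf)
  finally show ?thesis by (simp add: coord_def)
qed

lemma form_self: "s \<in> S \<Longrightarrow> form s s = 2"
  using mat by (simp add: coxeter_matrix_def form_def one_enat_def)

lemma form_sym: "s \<in> S \<Longrightarrow> t \<in> S \<Longrightarrow> form s t = form t s"
  using mat by (simp add: coxeter_matrix_def form_def)

lemma refl_refl: "s \<in> S \<Longrightarrow> refl s (refl s p) = p"
  by (intro prod_eqI ext) (auto simp: fst_refl coord_refl form_self)

text \<open>The two coordinates follow a recurrence solved by sines of multiples of \<theta>, hence
  have period \<open>k\<close>. The displacement over one period is a combination of their sums, and
  these satisfy a homogeneous system whose only solution is zero because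
  \<open>c\<^sup>2 \<noteq> 1\<close>. The computation also covers the parameters in the second
  component.\<close>

lemma dihedral:
  assumes "s \<in> S" "t \<in> S" "s \<noteq> t" "m s t = enat k"
  shows "((refl s \<circ> refl t) ^^ k) p = p"
proof -
  have "enat 2 \<le> m s t" using mat assms(1-3) by (simp add: coxeter_matrix_def numeral_eq_enat)
  then have k: "k \<ge> 2" using assms(4) by simp
  define \<theta> where "\<theta> = pi / real k"
  define c where "c = cos \<theta>"
  have k\<theta>: "real k * \<theta> = pi" using k by (simp add: \<theta>_def)
  have s0: "sin \<theta> \<noteq> 0"
  proof -
    have "0 < \<theta>" "\<theta> < pi" using k by (simp_all add: \<theta>_def field_simps)
    then show ?thesis using sin_gt_zero[of \<theta>] by simp
  qed
  have Ast: "form s t = - 2 * c" "form t s = - 2 * c"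
    using assms form_sym[of s t] by (simp_all add: form_def c_def \<theta>_def)
  define P where "P j = ((refl s \<circ> refl t) ^^ j) p" for j
  define a where "a j = coord s (P j)" for j
  define b where "b j = coord t (P j)" for j
  have PS: "P (Suc j) = refl s (refl t (P j))" for j by (simp add: P_def)
  have aS: "a (Suc j) = - a j - 2 * c * b j" for j
    using assms(1,2) by (simp add: a_def b_def PS coord_refl form_self Ast)
  have bS: "b (Suc j) = 2 * c * a j + (4 * c\<^sup>2 - 1) * b j" for j
    using assms(1,2) by (simp add: a_def b_def PS coord_refl form_self Ast algebra_simps power2_eq_square)
  have fS: "fst (P (Suc j)) x = fst (P j) x - (if x = t then b j else 0)
      - (if x = s then a j + 2 * c * b j else 0)" for j x
    using assms(1,2) by (simp add: a_def b_def PS fst_refl coord_refl Ast)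
  \<comment> \<open>The function interpolates both coordinate sequences: even arguments give
    \<open>b\<close> and odd ones give \<open>- a\<close>, each multiplied by
    \<open>sin \<theta>\<close>.\<close>
  define y where "y r = b 0 * sin ((r + 1) * \<theta>) + a 0 * sin (r * \<theta>)" for r :: real
  have y_rec: "y (r + 1) = 2 * c * y r - y (r - 1)" for r
  proof -
    have t: "sin (u + \<theta>) = 2 * c * sin u - sin (u - \<theta>)" for u
      by (simp add: c_def sin_add sin_diff)
    have "sin ((r + 1 + 1) * \<theta>) = 2 * c * sin ((r + 1) * \<theta>) - sin ((r - 1 + 1) * \<theta>)"
      using t[of "(r + 1) * \<theta>"] by (simp add: algebra_simps)
    moreover have "sin ((r + 1) * \<theta>) = 2 * c * sin (r * \<theta>) - sin ((r - 1) * \<theta>)"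
      using t[of "r * \<theta>"] by (simp add: algebra_simps)
    ultimately show ?thesis unfolding y_def by (simp only:) (simp add: algebra_simps)
  qed
  have ab: "b j * sin \<theta> = y (2 * real j) \<and> a j * sin \<theta> = - y (2 * real j - 1)" for j
  proof (induction j)
    case 0
    show ?case by (simp add: y_def)
  next
    case (Suc j)
    have y1: "y (2 * real j + 1) = 2 * c * (b j * sin \<theta>) + a j * sin \<theta>"
      using y_rec[of "2 * real j"] Suc by simp
    have "y (2 * real j + 2) = 2 * c * y (2 * real j + 1) - y (2 * real j)"
      using y_rec[of "2 * real j + 1"] by (simp add: algebra_simps)
    then have "y (2 * real (Suc j)) = 2 * c * (2 * c * (b j * sin \<theta>) + a j * sin \<theta>) - b j * sin \<theta>"
      using y1 Suc by (simp add: algebra_simps)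
    then show ?case using y1 by (simp add: aS bS algebra_simps power2_eq_square)
  qed
  have y_per: "y (r + 2 * real k) = y r" for r
  proof -
    have "sin ((u + 2 * real k) * \<theta>) = sin (u * \<theta>)" for u
    proof -
      have "(u + 2 * real k) * \<theta> = u * \<theta> + 2 * (real k * \<theta>)" by (simp add: algebra_simps)
      then show ?thesis using k\<theta> by simp
    qed
    from this[of "r + 1"] this[of r] show ?thesis
      unfolding y_def by (simp add: algebra_simps)
  qed
  have "b k * sin \<theta> = b 0 * sin \<theta>" "a k * sin \<theta> = a 0 * sin \<theta>"
    using ab[of k] ab[of 0] y_per[of 0] y_per[of "-1"] by (simp_all add: algebra_simps)
  then have per: "b k = b 0" "a k = a 0" using s0 by simp_all
  \<comment> \<open>Summing the recurrences over a full period turns them into equations for the two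
    sums, since the boundary terms cancel.\<close>
  have tel: "(\<Sum>j<k. g (Suc j)) = (\<Sum>j<k. g j) + g k - g 0" for g :: "nat \<Rightarrow> real"
    by (induction k) auto
  let ?A = "\<Sum>j<k. a j" and ?B = "\<Sum>j<k. b j"
  have "?A = - ?A - 2 * c * ?B"
    using tel[of a] per by (simp add: aS sum_subtractf sum_negf sum_distrib_left)
  then have A: "?A = - c * ?B" by simp
  have "?B = 2 * c * ?A + (4 * c\<^sup>2 - 1) * ?B"
    using tel[of b] per by (simp add: bS sum.distrib sum_distrib_left)
  then have "2 * (1 - c\<^sup>2) * ?B = 0" unfolding A by (simp add: algebra_simps power2_eq_square)
  moreover have "1 - c\<^sup>2 \<noteq> 0" unfolding c_def sin_squared_eq[symmetric] using s0 by simp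
  ultimately have B0: "?B = 0" by simp
  then have A0: "?A = 0" using A by simp
  have "fst (P n) x = fst p x - (if x = t then \<Sum>j<n. b j else 0)
      - (if x = s then (\<Sum>j<n. a j) + 2 * c * (\<Sum>j<n. b j) else 0)" for n x
    by (induction n) (auto simp: fS algebra_simps, simp_all add: P_def)
  then have "fst (P k) = fst p" using A0 B0 by auto
  moreover have "snd (P n) = snd p" for n by (induction n) (simp_all add: PS, simp add: P_def)
  ultimately show ?thesis unfolding P_def by (simp add: prod_eq_iff)
qed

lemma refl_Bij: "s \<in> S \<Longrightarrow> refl s \<in> carrier (BijGroup UNIV)"
  by (simp add: BijGroup_def Bij_def) (rule o_bij[of "refl s"]; simp add: fun_eq_iff refl_refl)

lemma eval_refl:
  "word_over S w \<Longrightarrow> eval_word (BijGroup UNIV) refl w = foldr (\<lambda>l f. refl (fst l) \<circ> f) w id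
    \<and> eval_word (BijGroup UNIV) refl w \<in> carrier (BijGroup UNIV)"
proof (induction w)
  case Nil
  then show ?case by (auto simp: BijGroup_def Bij_def id_def intro: bij_id[unfolded id_def])
next
  case (Cons l w)
  let ?K = "BijGroup (UNIV :: (('a \<Rightarrow> real) \<times> ('a \<Rightarrow> real)) set)"
  have K: "group ?K" by (rule group_BijGroup)
  have r: "refl (fst l) \<in> carrier ?K" using refl_Bij Cons.prems by simp
  have m: "f \<otimes>\<^bsub>?K\<^esub> g = f \<circ> g" if "f \<in> carrier ?K" "g \<in> carrier ?K" for f g
    using that by (simp add: BijGroup_def compose_def comp_def restrict_def)
  have "refl (fst l) \<otimes>\<^bsub>?K\<^esub> refl (fst l) = \<one>\<^bsub>?K\<^esub>"
    using m[OF r r] refl_refl Cons.prems by (simp add: BijGroup_def fun_eq_iff)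
  then have i: "inv\<^bsub>?K\<^esub> (refl (fst l)) = refl (fst l)" using group.inv_equality[OF K _ r r] by simp
  note both = Cons.IH[OF conjunct2[OF Cons.prems[unfolded word_over_simps(2)]]]
  note IH = conjunct1[OF both] and e = conjunct2[OF both]
  have "eval_word ?K refl (l # w) = refl (fst l) \<otimes>\<^bsub>?K\<^esub> eval_word ?K refl w" using i by simp
  moreover have "refl (fst l) \<otimes>\<^bsub>?K\<^esub> eval_word ?K refl w \<in> carrier ?K"
    using monoid.m_closed[OF group.is_monoid[OF K] r e] .
  moreover have "refl (fst l) \<otimes>\<^bsub>?K\<^esub> eval_word ?K refl w = foldr (\<lambda>l f. refl (fst l) \<circ> f) (l # w) id"
    using m[OF r e] unfolding IH by simp
  ultimately show ?case by (simp only:)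
qed

lemma relators_refl:
  assumes "r \<in> coxeter_relators S m"
  shows "eval_word (BijGroup UNIV) refl r = \<one>\<^bsub>BijGroup UNIV\<^esub>"
proof -
  obtain s t k where r: "r = alt_word s t (2 * k)" and st: "s \<in> S" "t \<in> S" "m s t = enat k"
    using assms unfolding coxeter_relators_def by blast
  have f: "foldr (\<lambda>l f. refl (fst l) \<circ> f) (alt_word s t (2 * n)) id = (refl s \<circ> refl t) ^^ n" for n
    by (induction n) (simp_all add: alt_word_Suc comp_assoc funpow_Suc_right[symmetric])
  have "((refl s \<circ> refl t) ^^ k) p = p" for p
  proof (cases "s = t")
    case True
    then have "refl s \<circ> refl t = id" using st refl_refl by (simp add: fun_eq_iff)
    then show ?thesis by simp
  next
    case False
    then show ?thesis using dihedral st by blast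
  qed
  then have "(refl s \<circ> refl t) ^^ k = id" by (simp add: fun_eq_iff)
  then show ?thesis using eval_refl[of r] word_over_alt_word[OF st(1,2)] unfolding r f
    by (simp add: BijGroup_def id_def fun_eq_iff)
qed

end

section \<open>Linear algebra in spaces of functions\<close>

declare plus_fun_apply [simp del] zero_fun_apply [simp del] minus_apply [simp del] uminus_apply [simp del]

definition fscale :: "real \<Rightarrow> ('a \<Rightarrow> real) \<Rightarrow> 'a \<Rightarrow> real" where
  "fscale c f = (\<lambda>x. c * f x)"

interpretation fspace: vector_space "fscale :: real \<Rightarrow> ('a \<Rightarrow> real) \<Rightarrow> 'a \<Rightarrow> real"
  by unfold_locales (auto simp: fscale_def fun_eq_iff algebra_simps plus_fun_apply)

lemma fscale_apply: "fscale c f x = c * f x"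
  by (simp add: fscale_def)

text \<open>Pointwise evaluation is used only on request, so that sums and multiples of vectors keep
  the shape that the span rules expect.\<close>

lemmas fun_simps = fscale_apply plus_fun_apply zero_fun_apply minus_apply uminus_apply

lemma (in vector_space) span_Int_eq_0:
  assumes "independent B" "I \<subseteq> B" "J \<subseteq> B" "I \<inter> J = {}" "v \<in> span I" "v \<in> span J"
  shows "v = 0"
proof -
  have "representation B v b = 0" for b
    using representation_extend[OF assms(1,5,2)] representation_extend[OF assms(1,6,3)]
      representation_ne_zero[of I v b] representation_ne_zero[of J v b] assms(4) by (metis disjoint_iff)
  moreover have "v \<in> span B" using span_mono[OF assms(2)] assms(5) by blast
  ultimately show ?thesis using sum_nonzero_representation_eq[OF assms(1), of v] by simp
qed

text \<open>A finite set whose span contains \<open>n\<close> independent vectors has at least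
  \<open>n\<close> elements, so a family of \<open>n\<close> terms has room for neither a repetition
  nor a redundant member.\<close>

lemma (in vector_space) spanning_independent:
  assumes E: "independent E" "card E = n" "E \<subseteq> span (\<beta> ` {..<n})"
  shows "inj_on \<beta> {..<n}" "independent (\<beta> ` {..<n})"
proof -
  have le: "n \<le> card B" if "finite B" "E \<subseteq> span B" for B
    using independent_span_bound[OF that(1) E(1) that(2)] E(2) by simp
  have "card (\<beta> ` {..<n}) = n" using le[OF _ E(3)] card_image_le[of "{..<n}" \<beta>] by simp
  then show "inj_on \<beta> {..<n}" by (intro eq_card_imp_inj_on) auto
  show "independent (\<beta> ` {..<n})"
  proof
    assume "dependent (\<beta> ` {..<n})"
    then obtain a where a: "a \<in> \<beta> ` {..<n}" "a \<in> span (\<beta> ` {..<n} - {a})" unfolding dependent_def by blast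
    let ?B = "\<beta> ` {..<n} - {a}"
    have "span (insert a ?B) = span ?B" using span_redundant[OF a(2)] .
    moreover have "insert a ?B = \<beta> ` {..<n}" using a(1) by blast
    ultimately have "n \<le> card ?B" using le[of ?B] E(3) by simp
    moreover have "card ?B < card (\<beta> ` {..<n})" using a(1) by (intro psubset_card_mono) auto
    ultimately show False using \<open>card (\<beta> ` {..<n}) = n\<close> by simp
  qed
qed

lemma conjg_reflections:
  assumes "group W" "S \<subseteq> carrier W" "g \<in> carrier W" "t \<in> reflections W S"
  shows "g \<otimes>\<^bsub>W\<^esub> t \<otimes>\<^bsub>W\<^esub> inv\<^bsub>W\<^esub> g \<in> reflections W S"
proof -
  interpret group W by fact
  obtain w s where w: "w \<in> carrier W" "s \<in> S" "t = w \<otimes>\<^bsub>W\<^esub> s \<otimes>\<^bsub>W\<^esub> inv\<^bsub>W\<^esub> w"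
    using assms(4) unfolding reflections_def by blast
  then have "g \<otimes>\<^bsub>W\<^esub> t \<otimes>\<^bsub>W\<^esub> inv\<^bsub>W\<^esub> g = (g \<otimes>\<^bsub>W\<^esub> w) \<otimes>\<^bsub>W\<^esub> s \<otimes>\<^bsub>W\<^esub> inv\<^bsub>W\<^esub> (g \<otimes>\<^bsub>W\<^esub> w)"
    using assms(2,3) by (simp add: inv_mult_group m_assoc subset_iff)
  then show ?thesis unfolding reflections_def using w assms(3) by blast
qed

lemma reflections_carrier: "group W \<Longrightarrow> S \<subseteq> carrier W \<Longrightarrow> reflections W S \<subseteq> carrier W"
  unfolding reflections_def by (auto simp: group.is_monoid monoid.m_closed group.inv_closed subset_iff)

section \<open>Move spaces of elements of a Coxeter group\<close>

locale coxeter = group W for W :: "('a, 'n) monoid_scheme" (structure) +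
  fixes S :: "'a set" and m :: "'a \<Rightarrow> 'a \<Rightarrow> enat" and ss :: "'a list"
  assumes cox: "coxeter_system W S m" and ss: "distinct ss" "set ss = S"
begin

lemma S_carrier: "S \<subseteq> carrier W"
  using cox by (simp add: coxeter_system_def)

sublocale cox_form S m
  using cox ss by unfold_locales (auto simp: coxeter_system_def)

lemma coxeter_relators_over: "r \<in> coxeter_relators S m \<Longrightarrow> word_over S r"
  using word_over_alt_word unfolding coxeter_relators_def by auto

lemma pres: "pres_by W (\<lambda>x. x) S (coxeter_relators S m)"
  using pres_by_presents[OF group_axioms _ S_carrier coxeter_relators_over] cox
  by (simp add: coxeter_system_def)

text \<open>The target is the group of all bijections of the space, for which the universal property
  of the presentation is at hand. Linearity is recovered afterwards by induction on words.\<close>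

definition rep :: "'a \<Rightarrow> ('a \<Rightarrow> real) \<times> ('a \<Rightarrow> real) \<Rightarrow> ('a \<Rightarrow> real) \<times> ('a \<Rightarrow> real)" where
  "rep = (SOME F. F \<in> hom W (BijGroup UNIV) \<and>
     (\<forall>w. word_over S w \<longrightarrow> F (eval_word W (\<lambda>x. x) w) = eval_word (BijGroup UNIV) refl w))"

lemma rep: "rep \<in> hom W (BijGroup UNIV)"
  "word_over S w \<Longrightarrow> rep (eval_word W (\<lambda>x. x) w) = foldr (\<lambda>l f. refl (fst l) \<circ> f) w id"
proof -
  have "\<exists>F. F \<in> hom W (BijGroup UNIV) \<and>
     (\<forall>w. word_over S w \<longrightarrow> F (eval_word W (\<lambda>x. x) w) = eval_word (BijGroup UNIV) refl w)"
    using pres_by_hom[OF pres group_BijGroup, of refl UNIV] refl_Bij relators_refl by blast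
  from someI_ex[OF this] show "rep \<in> hom W (BijGroup UNIV)"
    "word_over S w \<Longrightarrow> rep (eval_word W (\<lambda>x. x) w) = foldr (\<lambda>l f. refl (fst l) \<circ> f) w id"
    unfolding rep_def[symmetric] using eval_refl by auto
qed

lemma rep_mult: "g \<in> carrier W \<Longrightarrow> h \<in> carrier W \<Longrightarrow> rep (g \<otimes> h) p = rep g (rep h p)"
  using hom_mult[OF rep(1), of g h] hom_in_carrier[OF rep(1), of g] hom_in_carrier[OF rep(1), of h]
  by (simp add: BijGroup_def compose_def)

lemma rep_one: "rep \<one> p = p"
  using hom_one[OF rep(1) group_axioms group_BijGroup] by (simp add: BijGroup_def)

lemma rep_gen: "s \<in> S \<Longrightarrow> rep s = refl s"
  using rep(2)[of "[(s, True)]"] S_carrier by (simp add: subset_iff)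

lemma rep_inv: "g \<in> carrier W \<Longrightarrow> rep (inv g) (rep g p) = p" "g \<in> carrier W \<Longrightarrow> rep g (rep (inv g) p) = p"
  using rep_mult[of "inv g" g p] rep_mult[of g "inv g" p] rep_one by simp_all

lemma coord_lin: "coord s (v + fscale c v', z + fscale c z') = coord s (v, z) + c * coord s (v', z')"
  by (simp add: fun_simps coord_def algebra_simps sum.distrib sum_distrib_left)

lemma rep_props:
  assumes "g \<in> carrier W"
  shows "snd (rep g p) = snd p"
    and "rep g (v + fscale c v', z + fscale c z')
      = (fst (rep g (v, z)) + fscale c (fst (rep g (v', z'))), z + fscale c z')"
    and "\<exists>c. fst (rep g p) = fst p + (\<Sum>s\<in>S. fscale (c s) (\<lambda>x. if x = s then 1 else 0))"
proof -
  obtain w where w: "word_over S w" "eval_word W (\<lambda>x. x) w = g" using pres assms by (auto simp: pres_by_def)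
  let ?f = "foldr (\<lambda>l f. refl (fst l) \<circ> f) w id"
  let ?e = "\<lambda>s x :: 'a. if x = s then (1 :: real) else 0"
  have g: "rep g = ?f" using rep(2)[OF w(1)] w(2) by simp
  show 1: "snd (rep g p) = snd p" for p unfolding g by (induction w) auto
  have "fst (?f (v + fscale c v', z + fscale c z')) = fst (?f (v, z)) + fscale c (fst (?f (v', z')))"
  proof (induction w)
    case (Cons l w)
    let ?h = "foldr (\<lambda>l f. refl (fst l) \<circ> f) w id"
    have s: "snd (?h p) = snd p" for p by (induction w) auto
    have q: "?h (v + fscale c v', z + fscale c z')
        = (fst (?h (v, z)) + fscale c (fst (?h (v', z'))), z + fscale c z')"
      by (rule prod_eqI) (simp only: Cons.IH fst_conv, simp only: s snd_conv)
    have p: "?h (v, z) = (fst (?h (v, z)), z)" "?h (v', z') = (fst (?h (v', z')), z')"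
      using s by (simp_all add: prod_eq_iff)
    have cd: "coord (fst l) (?h (v + fscale c v', z + fscale c z'))
        = coord (fst l) (?h (v, z)) + c * coord (fst l) (?h (v', z'))"
      unfolding q using coord_lin p by metis
    have "fst (refl (fst l) (?h (v + fscale c v', z + fscale c z'))) x
        = (fst (refl (fst l) (?h (v, z))) + fscale c (fst (refl (fst l) (?h (v', z'))))) x" for x
      unfolding plus_fun_apply fscale_apply fst_refl cd Cons.IH
      by (simp add: plus_fun_apply fscale_apply algebra_simps)
    moreover have "foldr (\<lambda>l f. refl (fst l) \<circ> f) (l # w) id p = refl (fst l) (?h p)" for p by simp
    ultimately show ?case by (intro ext) presburger
  qed simp
  then show "rep g (v + fscale c v', z + fscale c z')
      = (fst (rep g (v, z)) + fscale c (fst (rep g (v', z'))), z + fscale c z')"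
    using 1[of "(v + fscale c v', z + fscale c z')"] unfolding g by (simp add: prod_eq_iff)
  show "\<exists>c. fst (rep g p) = fst p + (\<Sum>s\<in>S. fscale (c s) (?e s))"
    unfolding g using w(1)
  proof (induction w)
    case Nil
    show ?case by (intro exI[of _ "\<lambda>_. 0"]) (simp add: fun_simps fun_eq_iff)
  next
    case (Cons l w)
    let ?h = "foldr (\<lambda>l f. refl (fst l) \<circ> f) w id"
    obtain c where c: "fst (?h p) = fst p + (\<Sum>s\<in>S. fscale (c s) (?e s))"
      using Cons.IH[OF conjunct2[OF Cons.prems[unfolded word_over_simps(2)]]] by blast
    let ?k = "coord (fst l) (?h p)"
    have "fst (refl (fst l) (?h p)) = fst (?h p) + fscale (- ?k) (?e (fst l))"
      by (auto simp: fun_simps fun_eq_iff fst_refl)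
    also have "fscale (- ?k) (?e (fst l)) = (\<Sum>s\<in>S. fscale (if s = fst l then - ?k else 0) (?e s))"
    proof -
      have "(\<Sum>s\<in>S. fscale (if s = fst l then - ?k else 0) (?e s))
          = (\<Sum>s\<in>S. if s = fst l then fscale (- ?k) (?e s) else 0)"
        by (intro sum.cong) (auto simp: fun_simps fun_eq_iff)
      then show ?thesis using Cons.prems fin by simp
    qed
    finally have "fst (refl (fst l) (?h p))
        = fst p + (\<Sum>s\<in>S. fscale (c s + (if s = fst l then - ?k else 0)) (?e s))"
      unfolding c by (simp only: fspace.scale_left_distrib sum.distrib add.assoc)
    moreover have "foldr (\<lambda>l f. refl (fst l) \<circ> f) (l # w) id p = refl (fst l) (?h p)" by simp
    ultimately show ?case
      by (intro exI[of _ "\<lambda>s. c s + (if s = fst l then - ?k else 0)"]) presburger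
  qed
qed

text \<open>The move space, the image of \<open>g - 1\<close>, with the parameters in the second
  component ranging freely.\<close>

definition mov :: "'a \<Rightarrow> ('a \<Rightarrow> real) set" where
  "mov g = {fst (rep g p) - fst p | p. True}"

lemma mov_mult: "g \<in> carrier W \<Longrightarrow> h \<in> carrier W \<Longrightarrow> x \<in> mov (g \<otimes> h) \<Longrightarrow> \<exists>y\<in>mov g. \<exists>z\<in>mov h. x = y + z"
proof -
  assume *: "g \<in> carrier W" "h \<in> carrier W" "x \<in> mov (g \<otimes> h)"
  then obtain p where "x = fst (rep g (rep h p)) - fst p" unfolding mov_def by (auto simp: rep_mult)
  then have "x = (fst (rep g (rep h p)) - fst (rep h p)) + (fst (rep h p) - fst p)" by simp
  then show ?thesis unfolding mov_def by blast
qed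

lemma mov_one: "mov \<one> = {0}"
  by (auto simp: mov_def rep_one)

lemma mov_inv: "g \<in> carrier W \<Longrightarrow> x \<in> mov g \<Longrightarrow> - x \<in> mov (inv g)"
proof -
  assume g: "g \<in> carrier W" and "x \<in> mov g"
  then obtain p where "x = fst (rep g p) - fst p" unfolding mov_def by blast
  then have "- x = fst (rep (inv g) (rep g p)) - fst (rep g p)" using rep_inv(1)[OF g] by simp
  then show ?thesis unfolding mov_def by blast
qed

definition T :: "'a set" where "T = reflections W S"

text \<open>A vector is chosen by the two properties used later. For a conjugate of the simple
  reflection \<open>s\<close> by \<open>w\<close>, the image of the basis vector of \<open>s\<close>
  under \<open>w\<close> has them.\<close>

definition root :: "'a \<Rightarrow> ('a \<Rightarrow> real)" where
  "root t = (SOME \<beta>. mov t \<subseteq> fspace.span {\<beta>} \<and> \<beta> \<in> fspace.span ((\<lambda>s x. if x = s then 1 else 0) ` S))"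

lemma root:
  assumes "t \<in> T"
  shows "mov t \<subseteq> fspace.span {root t}" "root t \<in> fspace.span ((\<lambda>s x. if x = s then 1 else 0) ` S)"
proof -
  let ?e = "\<lambda>s x :: 'a. if x = s then (1 :: real) else 0"
  obtain w s where w: "w \<in> carrier W" "s \<in> S" "t = w \<otimes> s \<otimes> inv w"
    using assms unfolding T_def reflections_def by blast
  have sc: "s \<in> carrier W" using w S_carrier by blast
  let ?b = "fst (rep w (?e s, 0))"
  have "mov t \<subseteq> fspace.span {?b}"
  proof
    fix x assume "x \<in> mov t"
    then obtain p where x: "x = fst (rep t p) - fst p" unfolding mov_def by blast
    let ?q = "rep (inv w) p"
    have "rep t p = rep w (refl s ?q)" using w sc by (simp add: rep_mult rep_gen)
    also have "refl s ?q = (fst ?q + fscale (- coord s ?q) (?e s), snd ?q + fscale (- coord s ?q) 0)"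
      by (auto simp: fun_simps prod_eq_iff fun_eq_iff fst_refl)
    also have "rep w \<dots> = (fst (rep w (fst ?q, snd ?q)) + fscale (- coord s ?q) ?b, snd ?q + fscale (- coord s ?q) 0)"
      by (rule rep_props(2)[OF w(1)])
    also have "rep w (fst ?q, snd ?q) = p" using rep_inv(2)[OF w(1)] by simp
    finally have r: "rep t p = (fst p + fscale (- coord s ?q) ?b, snd ?q + fscale (- coord s ?q) 0)" .
    have "x = fscale (- coord s ?q) ?b" unfolding x r fst_conv by (rule add_diff_cancel_left')
    then show "x \<in> fspace.span {?b}" by (simp only:) (intro fspace.span_scale fspace.span_base, simp)
  qed
  moreover have "?b \<in> fspace.span (?e ` S)"
  proof -
    obtain c where c: "?b = ?e s + (\<Sum>s\<in>S. fscale (c s) (?e s))"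
      using rep_props(3)[OF w(1), of "(?e s, 0)"] by auto
    show ?thesis unfolding c
      by (intro fspace.span_add fspace.span_sum fspace.span_scale fspace.span_base imageI w(2))
  qed
  ultimately have "mov t \<subseteq> fspace.span {?b} \<and> ?b \<in> fspace.span (?e ` S)" by blast
  from someI[of "\<lambda>\<beta>. mov t \<subseteq> fspace.span {\<beta>} \<and> \<beta> \<in> fspace.span (?e ` S)", OF this]
  show "mov t \<subseteq> fspace.span {root t}" "root t \<in> fspace.span (?e ` S)" unfolding root_def by blast+
qed

lemma T_carrier: "T \<subseteq> carrier W"
  unfolding T_def using reflections_carrier[OF group_axioms S_carrier] .

lemma mov_prodl:
  "set ts \<subseteq> T \<Longrightarrow> mov (prodl W ts) \<subseteq> fspace.span (root ` set ts)"
proof (induction ts)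
  case (Cons t ts)
  show ?case
  proof
    fix x assume "x \<in> mov (prodl W (t # ts))"
    moreover have "t \<in> carrier W" "prodl W ts \<in> carrier W" using Cons.prems T_carrier by auto
    ultimately obtain y z where "y \<in> mov t" "z \<in> mov (prodl W ts)" "x = y + z" using mov_mult by fastforce
    moreover have "fspace.span {root t} \<subseteq> fspace.span (root ` set (t # ts))"
      "fspace.span (root ` set ts) \<subseteq> fspace.span (root ` set (t # ts))"
      by (intro fspace.span_mono; auto)+
    ultimately show "x \<in> fspace.span (root ` set (t # ts))"
      using root(1)[of t] Cons by (auto intro!: fspace.span_add)
  qed
qed (simp add: mov_one)

text \<open>When \<open>s\<close> is put in front, the parameter at \<open>s\<close> is still free
  and can be chosen so that the coordinate at \<open>s\<close> is minus the prescribed entry. The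
  quantifier over all \<open>z\<close> that agree with \<open>z0\<close> on \<open>l\<close> keeps
  the remaining parameters free for the induction.\<close>

lemma mov_coxeter_element:
  assumes "distinct l" "set l \<subseteq> S"
  shows "\<exists>z0. \<forall>z. (\<forall>s\<in>set l. z s = z0 s) \<longrightarrow> rep (prodl W l) (0, z) = (\<lambda>s. if s \<in> set l then x s else 0, z)"
  using assms
proof (induction l)
  case Nil
  then show ?case by (auto simp: rep_one fun_eq_iff zero_fun_apply)
next
  case (Cons s l)
  then obtain z0 where z0: "\<forall>z. (\<forall>s\<in>set l. z s = z0 s) \<longrightarrow>
      rep (prodl W l) (0, z) = (\<lambda>s. if s \<in> set l then x s else 0, z)" by auto
  let ?v = "\<lambda>s. if s \<in> set l then x s else 0"
  define d where "d = - x s - (\<Sum>r\<in>S. form s r * ?v r)"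
  have c: "s \<in> S" "s \<in> carrier W" "prodl W l \<in> carrier W" using Cons.prems S_carrier by auto
  have "rep (prodl W (s # l)) (0, z) = (\<lambda>s'. if s' \<in> set (s # l) then x s' else 0, z)"
    if z: "\<forall>r\<in>set (s # l). z r = (z0(s := d)) r" for z
  proof -
    have "\<forall>r\<in>set l. z r = z0 r" using z Cons.prems by auto
    then have "rep (prodl W (s # l)) (0, z) = refl s (?v, z)" using z0 c by (simp add: rep_mult rep_gen)
    moreover have "coord s (?v, z) = - x s" using z by (simp add: coord_def d_def)
    ultimately show ?thesis using Cons.prems(1) by (auto simp: fun_simps prod_eq_iff fun_eq_iff fst_refl)
  qed
  then show ?case by blast
qed

lemma basis_in_mov: "v \<in> fspace.span ((\<lambda>s x. if x = s then 1 else 0) ` S) \<Longrightarrow> v \<in> mov (prodl W ss)"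
proof -
  assume v: "v \<in> fspace.span ((\<lambda>s x. if x = s then 1 else 0) ` S)"
  have "v s = 0" if "s \<notin> S" for s
    using v that by (induction rule: fspace.span_induct_alt) (auto simp: fun_simps split: if_splits)
  then have vv: "(\<lambda>s. if s \<in> set ss then v s else 0) = v" using ss by auto
  obtain z0 where "rep (prodl W ss) (0, z0) = (\<lambda>s. if s \<in> set ss then v s else 0, z0)"
    using mov_coxeter_element[of ss v] ss by auto
  then have "v = fst (rep (prodl W ss) (0, z0)) - fst (0 :: 'a \<Rightarrow> real, z0)" using vv by simp
  then show ?thesis unfolding mov_def by blast
qed

lemma basis_independent:
  "fspace.independent ((\<lambda>s x. if x = s then 1 else (0 :: real)) ` S)"
  "card ((\<lambda>s x. if x = s then 1 else (0 :: real)) ` S) = length ss"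
proof -
  let ?e = "\<lambda>s x :: 'a. if x = s then (1 :: real) else 0"
  have inj: "inj_on ?e A" for A by (auto simp: inj_on_def fun_eq_iff split: if_splits)
  show "card (?e ` S) = length ss" using card_image[OF inj] ss distinct_card by metis
  show "fspace.independent (?e ` S)"
    unfolding fspace.dependent_def
  proof
    assume "\<exists>a\<in>?e ` S. a \<in> fspace.span (?e ` S - {a})"
    then obtain s where s: "s \<in> S" "?e s \<in> fspace.span (?e ` S - {?e s})" by blast
    have "v s = 0" if "v \<in> fspace.span (?e ` S - {?e s})" for v
      using that by (induction rule: fspace.span_induct_alt) (auto simp: fun_simps split: if_splits)
    from this[OF s(2)] show False by simp
  qed
qed

end

section \<open>Move spaces of segments of a factorization\<close>

context coxeter
begin

lemma basis_span:
  assumes "set ts \<subseteq> T" "prodl W ts = prodl W ss"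
  shows "(\<lambda>s x. if x = s then 1 else (0 :: real)) ` S \<subseteq> fspace.span (root ` set ts)"
proof -
  have "v \<in> mov (prodl W ss)" if "v \<in> (\<lambda>s x. if x = s then 1 else (0 :: real)) ` S" for v
    using basis_in_mov[OF fspace.span_base[OF that]] .
  then show ?thesis using mov_prodl[OF assms(1)] assms(2) by auto
qed

text \<open>The roots of the letters span the move space of the Coxeter element, which contains the
  basis indexed by \<open>S\<close>.\<close>

lemma reflection_length:
  assumes "set ts \<subseteq> T" "prodl W ts = prodl W ss"
  shows "length ss \<le> length ts"
proof -
  have "length ss \<le> card (root ` set ts)"
    using fspace.independent_span_bound[OF _ basis_independent(1) basis_span[OF assms]]
      basis_independent(2) by simp
  also have "\<dots> \<le> length ts" using card_image_le[of "set ts" root] card_length[of ts] by simp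
  finally show ?thesis .
qed

definition segment :: "'a list \<Rightarrow> nat \<Rightarrow> nat \<Rightarrow> 'a" where
  "segment ts a b = prodl W (take b ts) \<otimes> inv (prodl W (take a ts))"

definition overlap :: "'a \<Rightarrow> 'a \<Rightarrow> bool" where
  "overlap x y \<longleftrightarrow> (\<exists>v. v \<noteq> 0 \<and> v \<in> mov x \<and> v \<in> mov y)"

lemma overlap_sym: "overlap x y \<Longrightarrow> overlap y x"
  unfolding overlap_def by blast

text \<open>Inverting an element negates its move vectors, and a move space is closed under negation
  because the action is linear. A return crossing may thus be read in either direction.\<close>

lemma overlap_inv: "x \<in> carrier W \<Longrightarrow> overlap (inv x) y \<longleftrightarrow> overlap x y"
proof -
  assume x: "x \<in> carrier W"
  have neg: "v \<in> mov g \<Longrightarrow> - v \<in> mov g" if "g \<in> carrier W" for v g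
  proof -
    assume "v \<in> mov g"
    then obtain p where v: "v = fst (rep g p) - fst p" unfolding mov_def by blast
    have "rep g (0 + fscale (- 1) (fst p), 0 + fscale (- 1) (snd p))
        = (fst (rep g (0, 0)) + fscale (- 1) (fst (rep g p)), 0 + fscale (- 1) (snd p))"
      using rep_props(2)[OF that, of 0 "- 1" "fst p" 0 "snd p"] by simp
    moreover have "fst (rep g (0, 0)) = 0"
    proof -
      have "rep g (0, 0) = (fst (rep g (0, 0)) + fst (rep g (0, 0)), 0)"
        using rep_props(2)[OF that, of 0 1 0 0 0] by simp
      then have "fst (rep g (0, 0)) = fst (rep g (0, 0)) + fst (rep g (0, 0))" by (metis fst_conv)
      then show ?thesis by simp
    qed
    ultimately have "- v = fst (rep g (fscale (- 1) (fst p), fscale (- 1) (snd p))) - fscale (- 1) (fst p)"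
      using v by simp
    then show "- v \<in> mov g" unfolding mov_def by (metis (mono_tags, lifting) fst_conv mem_Collect_eq)
  qed
  have "mov (inv x) = mov x"
  proof
    show "mov (inv x) \<subseteq> mov x" using mov_inv[of "inv x"] neg x by fastforce
    show "mov x \<subseteq> mov (inv x)" using mov_inv[of x] neg[of "inv x"] x by fastforce
  qed
  then show ?thesis by (simp add: overlap_def)
qed

context
  fixes ts assumes ts: "set ts \<subseteq> T" "prodl W ts = prodl W ss" "length ts = length ss"
begin

text \<open>Conjugating each letter by the prefix before it turns a segment into the product of
  consecutive reflections, taken in decreasing order.\<close>

definition refl_at :: "nat \<Rightarrow> 'a" where
  "refl_at i = prodl W (take i ts) \<otimes> ts ! i \<otimes> inv (prodl W (take i ts))"

definition \<beta> :: "nat \<Rightarrow> ('a \<Rightarrow> real)" where "\<beta> i = root (refl_at i)"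

lemma take_closed: "prodl W (take i ts) \<in> carrier W"
proof -
  have "set (take i ts) \<subseteq> carrier W" using set_take_subset[of i ts] ts(1) T_carrier by blast
  then show ?thesis by blast
qed

lemma refl_at_T: "i < length ss \<Longrightarrow> refl_at i \<in> T"
  unfolding refl_at_def T_def
  by (rule conjg_reflections[OF group_axioms S_carrier take_closed])
    (use ts nth_mem[of i ts] in \<open>auto simp: T_def\<close>)

lemma segment_Suc:
  assumes "b < length ss"
  shows "segment ts a (Suc b) = refl_at b \<otimes> segment ts a b"
proof -
  have "ts ! b \<in> set ts" using assms ts(3) by simp
  then have t: "ts ! b \<in> carrier W" using ts(1) T_carrier by blast
  have "set (take b ts) \<subseteq> carrier W" using set_take_subset[of b ts] ts(1) T_carrier by blast
  then have "prodl W (take (Suc b) ts) = prodl W (take b ts) \<otimes> ts ! b"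
    using assms ts(3) t by (simp add: take_Suc_conv_app_nth prodl_append)
  then show ?thesis unfolding segment_def refl_at_def
    using take_closed[of b] take_closed[of a] t by (simp add: m_assoc) (simp add: m_assoc[symmetric])
qed

lemma segment_prodl:
  "a \<le> b \<Longrightarrow> b \<le> length ss \<Longrightarrow> segment ts a b = prodl W (map refl_at (rev [a..<b]))"
proof (induction b rule: dec_induct)
  case base
  then show ?case using take_closed[of a] by (simp add: segment_def)
next
  case (step b)
  then show ?case using segment_Suc[of b a] by simp
qed

lemma mov_segment:
  assumes "a \<le> b" "b \<le> length ss"
  shows "mov (segment ts a b) \<subseteq> fspace.span (\<beta> ` {a..<b})"
proof -
  have "set (map refl_at (rev [a..<b])) \<subseteq> T" using refl_at_T assms by auto
  from mov_prodl[OF this] show ?thesis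
    unfolding segment_prodl[OF assms] by (simp add: image_image \<beta>_def)
qed

lemma segment_all: "segment ts 0 (length ss) = prodl W ss"
  using ts take_closed[of "length ss"] by (simp add: segment_def)

text \<open>There are as many of these roots as simple generators, and they span the full move space
  of the Coxeter element.\<close>

lemma \<beta>_independent: "inj_on \<beta> {..<length ss}" "fspace.independent (\<beta> ` {..<length ss})"
proof -
  have "v \<in> fspace.span (\<beta> ` {..<length ss})" if "v \<in> (\<lambda>s x. if x = s then 1 else (0 :: real)) ` S" for v
    using basis_in_mov[OF fspace.span_base[OF that]] mov_segment[of 0 "length ss"] segment_all
    by (auto simp: atLeast0LessThan)
  then have "(\<lambda>s x. if x = s then 1 else (0 :: real)) ` S \<subseteq> fspace.span (\<beta> ` {..<length ss})" by blast
  from fspace.spanning_independent[OF basis_independent this]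
  show "inj_on \<beta> {..<length ss}" "fspace.independent (\<beta> ` {..<length ss})" .
qed

lemma span_disjoint:
  assumes "I \<subseteq> {..<length ss}" "J \<subseteq> {..<length ss}" "I \<inter> J = {}"
    and "v \<in> fspace.span (\<beta> ` I)" "v \<in> fspace.span (\<beta> ` J)"
  shows "v = 0"
proof (rule fspace.span_Int_eq_0[OF \<beta>_independent(2) _ _ _ assms(4,5)])
  show "\<beta> ` I \<inter> \<beta> ` J = {}"
    using inj_on_image_Int[OF \<beta>_independent(1) assms(1,2)] assms(3) by simp
qed (use assms in auto)

lemma segment_disjoint:
  assumes "a < b" "b \<le> a'" "a' < b'" "b' \<le> length ss"
  shows "\<not> overlap (segment ts a b) (segment ts a' b')"
proof
  assume "overlap (segment ts a b) (segment ts a' b')"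
  then obtain v where v: "v \<noteq> 0" "v \<in> mov (segment ts a b)" "v \<in> mov (segment ts a' b')"
    unfolding overlap_def by blast
  have "v = 0"
    by (rule span_disjoint[of "{a..<b}" "{a'..<b'}"])
      (use v mov_segment[of a b] mov_segment[of a' b'] assms in auto)
  then show False using v(1) by blast
qed

text \<open>The root lies in the move space of the whole product and hence splits into contributions
  of the segments before, inside and after the interval. By independence the outer contributions
  cancel. Thus the move space of a segment contains the roots of all its letters.\<close>

lemma \<beta>_mov:
  assumes "a \<le> i" "i < b" "b \<le> length ss"
  shows "\<beta> i \<in> mov (segment ts a b)"
proof -
  let ?n = "length ss"
  have c: "segment ts x y \<in> carrier W" for x y using take_closed by (simp add: segment_def)
  have "segment ts x z = segment ts y z \<otimes> segment ts x y" for x y z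
    unfolding segment_def using take_closed[of x] take_closed[of y] take_closed[of z]
    by (simp add: m_assoc) (simp add: m_assoc[symmetric])
  then have s: "prodl W ss = segment ts b ?n \<otimes> (segment ts a b \<otimes> segment ts 0 a)"
    using segment_all by metis
  have "refl_at i \<in> T" using refl_at_T assms by simp
  then have "\<beta> i \<in> mov (prodl W ss)" unfolding \<beta>_def using basis_in_mov root(2) by blast
  then obtain y1 u where 1: "y1 \<in> mov (segment ts b ?n)" "u \<in> mov (segment ts a b \<otimes> segment ts 0 a)"
    "\<beta> i = y1 + u"
    unfolding s using mov_mult[OF c m_closed[OF c c]] by blast
  then obtain y y0 where 2: "y \<in> mov (segment ts a b)" "y0 \<in> mov (segment ts 0 a)" "u = y + y0"
    using mov_mult[OF c c] by blast
  have y1: "y1 \<in> fspace.span (\<beta> ` ({..<a} \<union> {b..<?n}))"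
    using 1(1) mov_segment[of b ?n] assms fspace.span_mono[of "\<beta> ` {b..<?n}" "\<beta> ` ({..<a} \<union> {b..<?n})"] by auto
  have "fspace.span (\<beta> ` {0..<a}) \<subseteq> fspace.span (\<beta> ` ({..<a} \<union> {b..<?n}))"
    by (intro fspace.span_mono image_mono) auto
  then have y0: "y0 \<in> fspace.span (\<beta> ` ({..<a} \<union> {b..<?n}))"
    using 2(2) mov_segment[of 0 a] assms by auto
  have d: "\<beta> i - y = y1 + y0" using 1(3) 2(3) by (simp add: algebra_simps)
  have "\<beta> i - y = 0"
  proof (rule span_disjoint[of "{..<a} \<union> {b..<?n}" "{a..<b}"])
    show "\<beta> i - y \<in> fspace.span (\<beta> ` ({..<a} \<union> {b..<?n}))" unfolding d using y1 y0 by (rule fspace.span_add)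
    show "\<beta> i - y \<in> fspace.span (\<beta> ` {a..<b})"
      by (rule fspace.span_diff[OF fspace.span_base]) (use 2(1) mov_segment[of a b] assms in auto)
  qed (use assms in auto)
  then show ?thesis using 2(1) by simp
qed

lemma segment_nested:
  assumes "a \<le> a'" "a' < b'" "b' \<le> b" "b \<le> length ss"
  shows "overlap (segment ts a b) (segment ts a' b')"
proof -
  have "\<beta> a' \<noteq> 0"
    using \<beta>_independent(2) assms fspace.dependent_zero[of "\<beta> ` {..<length ss}"] by (metis image_eqI lessThan_iff order_less_le_trans order_trans)
  moreover have "\<beta> a' \<in> mov (segment ts a b)" "\<beta> a' \<in> mov (segment ts a' b')"
    using \<beta>_mov assms by auto
  ultimately show ?thesis unfolding overlap_def by blast
qed

end

lemma T_conj: "g \<in> carrier W \<Longrightarrow> t \<in> T \<Longrightarrow> g \<otimes> t \<otimes> inv g \<in> T"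
  unfolding T_def using conjg_reflections[OF group_axioms S_carrier] .

lemma S_T: "S \<subseteq> T"
  unfolding T_def reflections_def using S_carrier by (force intro: exI[of _ \<one>])

end

section \<open>Trivial letters, conjugacy classes and front letters\<close>

context group
begin

lemma conjg_eq_one_iff: "g \<in> carrier G \<Longrightarrow> x \<in> carrier G \<Longrightarrow> conjg G g x = \<one> \<longleftrightarrow> x = \<one>"
  using conjg_inv_cancel(2)[of g x] by (metis conjg_m_one inv_closed)

text \<open>A move that involves an identity letter only changes its place, so it disappears from
  the shortened tuple. This makes retractions usable, which send the letters of the other factor to
  the identity.\<close>

lemma heq_delete_ones:
  assumes "heq G xs ys"
  shows "heq G (filter (\<lambda>x. x \<noteq> \<one>) xs) (filter (\<lambda>x. x \<noteq> \<one>) ys)"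
proof -
  let ?d = "filter (\<lambda>x. x \<noteq> \<one>)"
  have step: "heq G (?d zs) (?d (hurwitz_step G l zs))" if c: "set zs \<subseteq> carrier G" for l zs
  proof (cases rule: hurwitz_step_cases[of l zs])
    case 1
    then show ?thesis using c heq_refl[of "?d zs"] by auto
  next
    case (2 us x y vs b)
    have xy: "x \<in> carrier G" "y \<in> carrier G" and uv: "set (?d us) \<subseteq> carrier G" "set (?d vs) \<subseteq> carrier G"
      using c 2 by auto
    let ?p = "if b then [x \<otimes> y \<otimes> inv x, x] else [y, inv y \<otimes> x \<otimes> y]"
    have "heq G (?d [x, y]) (?d ?p)"
    proof (cases "x = \<one> \<or> y = \<one>")
      case True
      then have e: "?d ?p = ?d [x, y]" using xy by auto
      have "set (?d [x, y]) \<subseteq> carrier G" using xy by auto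
      then show ?thesis unfolding e by (rule heq_refl)
    next
      case False
      have "x \<otimes> y \<otimes> inv x \<noteq> \<one>" "inv y \<otimes> x \<otimes> y \<noteq> \<one>"
        using False xy conjg_eq_one_iff[of x y] conjg_eq_one_iff[of "inv y" x] by (auto simp: conjg_def)
      then have "?d [x, y] = [x, y]" "?d ?p = ?p" using False by auto
      moreover have "heq G [x, y] ?p"
        unfolding heq_def using xy hurwitz_step_split[of G "[]" b x y "[]"]
        by (auto intro!: exI[of _ "[(0, b)]"])
      ultimately show ?thesis by simp
    qed
    from heq_context[OF this uv] have "heq G (?d (us @ [x, y] @ vs)) (?d (us @ ?p @ vs))"
      by (simp only: filter_append)
    moreover have "zs = us @ [x, y] @ vs" "hurwitz_step G l zs = us @ ?p @ vs"
      using 2 by (simp_all add: hurwitz_step_split)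
    ultimately show ?thesis by (simp only:)
  qed
  have "heq G (?d zs) (?d (hurwitz G w zs))" if "set zs \<subseteq> carrier G" for w zs
    using that
  proof (induction w arbitrary: zs)
    case Nil
    then show ?case using heq_refl[of "?d zs"] by auto
  next
    case (Cons l w)
    have a: "set (hurwitz_step G l zs) \<subseteq> carrier G" using hurwitz_step_closed[OF Cons.prems order_refl] by simp
    show ?case unfolding hurwitz_Cons by (rule heq_trans[OF step[OF Cons.prems] Cons.IH[OF a]])
  qed
  then show ?thesis using assms by (auto simp: heq_def)
qed

text \<open>Moves permute the letters up to conjugation, so the number of letters with a conjugation
  invariant property is preserved.\<close>

lemma heq_filter_length:
  assumes "heq G xs ys" "\<And>g x. g \<in> carrier G \<Longrightarrow> x \<in> carrier G \<Longrightarrow> P (g \<otimes> x \<otimes> inv g) \<longleftrightarrow> P x"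
  shows "length (filter P ys) = length (filter P xs)"
proof -
  have step: "length (filter P (hurwitz_step G l zs)) = length (filter P zs)"
    if c: "set zs \<subseteq> carrier G" for l zs
  proof (cases rule: hurwitz_step_cases[of l zs])
    case (2 us x y vs b)
    then have "x \<in> carrier G" "y \<in> carrier G" using c by auto
    then have "P (x \<otimes> y \<otimes> inv x) \<longleftrightarrow> P y" "P (inv y \<otimes> x \<otimes> y) \<longleftrightarrow> P x"
      using assms(2)[of x y] assms(2)[of "inv y" x] by auto
    then show ?thesis using 2 by (auto simp: hurwitz_step_split)
  qed simp
  have "length (filter P (hurwitz G w zs)) = length (filter P zs)" if "set zs \<subseteq> carrier G" for w zs
    using that
  proof (induction w arbitrary: zs)
    case (Cons l w)
    have "set (hurwitz_step G l zs) \<subseteq> carrier G" using hurwitz_step_closed[OF Cons.prems order_refl] by simp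
    then show ?case using step[OF Cons.prems] Cons.IH by simp
  qed simp
  then show ?thesis using assms(1) by (auto simp: heq_def)
qed

lemma prodl_filter_one: "set xs \<subseteq> carrier G \<Longrightarrow> prodl G (filter (\<lambda>x. x \<noteq> \<one>) xs) = prodl G xs"
  by (induction xs) (auto simp: prodl_closed)

end

lemma hom_prodl:
  assumes "group G" "group K" "F \<in> hom G K" "set xs \<subseteq> carrier G"
  shows "F (prodl G xs) = prodl K (map F xs)"
  using assms(4)
proof (induction xs)
  case Nil
  then show ?case using hom_one[OF assms(3,1,2)] by simp
next
  case (Cons x xs)
  then show ?case using hom_mult[OF assms(3), of x "prodl G xs"] group.prodl_closed[OF assms(1), of xs] by simp
qed

text \<open>An inverse generator moves its right letter to the left unchanged. Letter
  \<open>i\<close> therefore arrives in front without being conjugated.\<close>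

definition front_word :: "nat \<Rightarrow> (nat \<times> bool) list" where
  "front_word i = rev (map (\<lambda>j. (j, False)) [0..<i])"

lemma front_word: 
  assumes "i < length xs"
  shows "braid_word (length xs) (front_word i)" "hd (hurwitz G (front_word i) xs) = xs ! i"
proof -
  show "braid_word (length xs) (front_word i)" using assms by (auto simp: front_word_def braid_word_def)
  show "hd (hurwitz G (front_word i) xs) = xs ! i"
    using assms
  proof (induction i arbitrary: xs)
    case 0
    then show ?case by (simp add: front_word_def hd_conv_nth)
  next
    case (Suc i)
    have "hurwitz_step G (i, False) xs ! i = xs ! Suc i" "i < length (hurwitz_step G (i, False) xs)"
      using Suc.prems by (simp_all add: hurwitz_step_def)
    then show ?case using Suc.IH[of "hurwitz_step G (i, False) xs"] by (simp add: front_word_def)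
  qed
qed

section \<open>Reflection length and the interval below the Coxeter element\<close>

context coxeter
begin

lemma S_involution: "s \<in> S \<Longrightarrow> s \<otimes> s = \<one>"
proof -
  assume s: "s \<in> S"
  then have "m s s = enat 1" using mat by (simp add: coxeter_matrix_def one_enat_def)
  then have "alt_word s s (2 * 1) \<in> coxeter_relators S m" unfolding coxeter_relators_def using s by blast
  then have "eval_word W (\<lambda>x. x) (alt_word s s (2 * 1)) = \<one>"
    using pres wc_rel coxeter_relators_over unfolding pres_by_def by metis
  moreover have "alt_word s s (2 * 1) = [(s, True), (s, True)]"
    by (simp add: numeral_2_eq_2 alt_word_Suc)
  ultimately show ?thesis using s S_carrier by (simp add: subset_iff)
qed

lemma T_inv: "t \<in> T \<Longrightarrow> inv t = t"
proof -
  assume "t \<in> T"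
  then obtain w s where w: "w \<in> carrier W" "s \<in> S" "t = w \<otimes> s \<otimes> inv w" unfolding T_def reflections_def by blast
  then have s: "s \<in> carrier W" "inv s = s" using S_carrier S_involution inv_equality by auto
  then show ?thesis using w by (simp add: inv_mult_group m_assoc)
qed

lemma T_Un_inv: "T \<union> (\<lambda>x. inv x) ` T = T"
  using T_inv by auto

lemma T_closed: "set xs \<subseteq> T \<Longrightarrow> set xs \<subseteq> carrier W"
  using T_carrier by blast

lemma generated_by_T: "a \<in> carrier W \<Longrightarrow> \<exists>xs. set xs \<subseteq> T \<and> prodl W xs = a"
proof -
  assume "a \<in> carrier W"
  then obtain w where w: "word_over S w" "eval_word W (\<lambda>x. x) w = a" using pres by (auto simp: pres_by_def)
  have "prodl W (map fst w) = eval_word W (\<lambda>x. x) w \<and> set (map fst w) \<subseteq> T"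
    using w(1) S_T T_inv by (induction w) auto
  then show ?thesis using w(2) by metis
qed

lemma len_def': "len W T a = (LEAST k. \<exists>xs. set xs \<subseteq> T \<and> length xs = k \<and> prodl W xs = a)"
  unfolding len_def T_Un_inv ..

lemma len_le: "set xs \<subseteq> T \<Longrightarrow> len W T (prodl W xs) \<le> length xs"
  unfolding len_def' by (rule Least_le) blast

lemma len_witness: "a \<in> carrier W \<Longrightarrow> \<exists>xs. set xs \<subseteq> T \<and> length xs = len W T a \<and> prodl W xs = a"
  unfolding len_def' by (rule LeastI_ex) (use generated_by_T in blast)

lemma red_iff: "xs \<in> red W T a \<longleftrightarrow> set xs \<subseteq> T \<and> prodl W xs = a \<and> length xs = len W T a"
  unfolding red_def T_Un_inv by blast

definition fac :: "'a list \<Rightarrow> bool" where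
  "fac xs \<longleftrightarrow> set xs \<subseteq> T \<and> prodl W xs = prodl W ss \<and> length xs = length ss"

lemma fac_ss: "fac ss"
  unfolding fac_def using S_T ss by blast

lemma ss_carrier: "set ss \<subseteq> carrier W"
  using fac_ss T_closed unfolding fac_def by blast

lemma len_h: "len W T (prodl W ss) = length ss"
proof (rule antisym)
  show "len W T (prodl W ss) \<le> length ss" using len_le fac_ss by (simp add: fac_def)
  show "length ss \<le> len W T (prodl W ss)"
    using len_witness[of "prodl W ss"] reflection_length ss_carrier prodl_closed by metis
qed

lemma fac_heq: "fac xs \<Longrightarrow> heq W xs ys \<Longrightarrow> fac ys"
  unfolding fac_def using heq_closed[OF _ _ T_carrier T_conj] heq_prodl heq_length by metis

text \<open>A shorter word for a block could be substituted in the factorization, against the lower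
  bound on its length.\<close>

lemma sub_red:
  assumes "fac (us @ vs @ ws)"
  shows "vs \<in> red W T (prodl W vs)"
proof -
  have T: "set us \<subseteq> T" "set vs \<subseteq> T" "set ws \<subseteq> T" using assms by (auto simp: fac_def)
  note c = T_closed[OF T(1)] T_closed[OF T(2)] T_closed[OF T(3)]
  obtain ys where ys: "set ys \<subseteq> T" "length ys = len W T (prodl W vs)" "prodl W ys = prodl W vs"
    using len_witness[OF prodl_closed[OF c(2)]] by blast
  have "prodl W (us @ ys @ ws) = prodl W (us @ vs @ ws)"
    using c T_closed[OF ys(1)] ys(3) by (simp add: prodl_append)
  then have "length ss \<le> length (us @ ys @ ws)"
    using reflection_length[of "us @ ys @ ws"] T ys(1) assms unfolding fac_def by simp
  then have "length vs \<le> length ys" using assms unfolding fac_def by simp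
  then show ?thesis using red_iff T(2) ys(2) len_le[OF T(2)] by simp
qed

text \<open>Hurwitz moves bring the block to the front. Block and remainder are then both reduced,
  so their lengths add up.\<close>

lemma sub_interval:
  assumes "fac (us @ vs @ ws)"
  shows "prodl W vs \<in> interval W T (prodl W ss)"
proof -
  have T: "set us \<subseteq> T" "set vs \<subseteq> T" "set ws \<subseteq> T" using assms by (auto simp: fac_def)
  note c = T_closed[OF T(1)] T_closed[OF T(2)] T_closed[OF T(3)]
  let ?us = "map (conjg W (inv (prodl W vs))) us"
  have "heq W (us @ vs @ ws) (vs @ ?us @ ws)"
    using heq_context[OF heq_move'[OF c(1,2)], of "[]" ws] c(3) by simp
  then have f: "fac (vs @ ?us @ ws)" using fac_heq assms by blast
  have "?us @ ws \<in> red W T (prodl W (?us @ ws))" using sub_red[of vs "?us @ ws" "[]"] f by simp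
  then have l: "len W T (prodl W (?us @ ws)) = length (?us @ ws)" by (simp add: red_iff)
  have "set (?us @ ws) \<subseteq> carrier W" using f T_closed[of "?us @ ws"] by (simp add: fac_def)
  then have pc: "prodl W vs \<in> carrier W" "prodl W (?us @ ws) \<in> carrier W"
    and "prodl W (vs @ ?us @ ws) = prodl W vs \<otimes> prodl W (?us @ ws)"
    using c prodl_append[of vs "?us @ ws"] prodl_closed by auto
  then have "inv (prodl W vs) \<otimes> prodl W ss = prodl W (?us @ ws)"
    using f unfolding fac_def by (simp add: m_assoc[symmetric])
  moreover have "len W T (prodl W vs) = length vs" using sub_red[OF assms] by (simp add: red_iff)
  ultimately show ?thesis
    using l pc f unfolding interval_def prefix_le_def len_h by (simp add: fac_def)
qed

lemma interval_fac:
  assumes "a \<in> interval W T (prodl W ss)" "xs \<in> red W T a" "zs \<in> red W T (inv a \<otimes> prodl W ss)"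
  shows "fac (xs @ zs)"
proof -
  have a: "a \<in> carrier W" "len W T a + len W T (inv a \<otimes> prodl W ss) = length ss"
    using assms(1) len_h by (auto simp: interval_def prefix_le_def)
  have "set xs \<subseteq> T" "set zs \<subseteq> T" using assms by (auto simp: red_iff)
  moreover have "prodl W (xs @ zs) = a \<otimes> (inv a \<otimes> prodl W ss)"
    using T_closed[OF calculation(1)] T_closed[OF calculation(2)] assms by (simp add: prodl_append red_iff)
  moreover have "a \<otimes> (inv a \<otimes> prodl W ss) = prodl W ss"
    using a prodl_closed[OF ss_carrier] by (simp add: m_assoc[symmetric])
  ultimately show ?thesis using a(2) assms by (simp add: fac_def red_iff)
qed

lemma red_exists: "a \<in> carrier W \<Longrightarrow> \<exists>zs. zs \<in> red W T a"
  using len_witness red_iff by metis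

lemma fac_sub_nontrivial: "fac (us @ vs @ ws) \<Longrightarrow> prodl W vs = \<one> \<Longrightarrow> vs = []"
  using sub_red[of us vs ws] len_le[of "[]"] by (simp add: red_iff)

lemma fac_ne_one: "fac xs \<Longrightarrow> x \<in> set xs \<Longrightarrow> x \<noteq> \<one>"
proof
  assume "fac xs" "x \<in> set xs" "x = \<one>"
  then obtain us ws where "xs = us @ [\<one>] @ ws" using split_list by fastforce
  then show False using fac_sub_nontrivial[of us "[\<one>]" ws] \<open>fac xs\<close> by simp
qed

lemma pan_transitive_heq:
  assumes "pan_transitive W T (prodl W ss)" "fac (us @ xs @ ws)" "fac (us' @ ys @ ws')" "prodl W xs = prodl W ys"
  shows "heq W xs ys"
proof -
  have "xs \<in> red W T (prodl W xs)" "ys \<in> red W T (prodl W xs)" "prodl W xs \<in> interval W T (prodl W ss)"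
    using sub_red[OF assms(2)] sub_red[OF assms(3)] sub_interval[OF assms(2)] assms(4) by auto
  moreover from this obtain w where "braid_word (len W T (prodl W xs)) w" "hurwitz W w xs = ys"
    using assms(1) unfolding pan_transitive_def by blast
  ultimately show ?thesis unfolding heq_def using T_closed red_iff by auto
qed

end

section \<open>Free products of Coxeter systems\<close>

definition map_word :: "('h \<Rightarrow> 'g) \<Rightarrow> ('h \<times> bool) list \<Rightarrow> ('g \<times> bool) list" where
  "map_word \<iota> = map (map_prod \<iota> id)"

lemma map_word_simps [simp]: "map_word \<iota> [] = []" "map_word \<iota> (l # w) = (\<iota> (fst l), snd l) # map_word \<iota> w"
  "map_word \<iota> (u @ v) = map_word \<iota> u @ map_word \<iota> v"
  by (simp_all add: map_word_def map_prod_def case_prod_beta)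

lemma map_word_inv_word: "map_word \<iota> (inv_word w) = inv_word (map_word \<iota> w)"
  by (induction w) simp_all

lemma map_word_alt_word: "map_word \<iota> (alt_word s t n) = alt_word (\<iota> s) (\<iota> t) n"
  by (induction n arbitrary: s t) (simp_all add: alt_word_Suc)

lemma eval_word_map_word: "eval_word K \<theta> (map_word \<iota> w) = eval_word K (\<theta> \<circ> \<iota>) w"
  by (induction w) simp_all

lemma word_over_map_word: "word_over A w \<Longrightarrow> word_over (\<iota> ` A) (map_word \<iota> w)"
  by (induction w) auto

lemma word_over_image: "word_over (\<iota> ` A) w \<Longrightarrow> \<exists>v. word_over A v \<and> w = map_word \<iota> v"
proof (induction w)
  case (Cons l w)
  then obtain v a where "word_over A v" "w = map_word \<iota> v" "a \<in> A" "fst l = \<iota> a" by auto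
  then show ?case by (intro exI[of _ "(a, snd l) # v"]) (simp add: prod_eq_iff)
qed (auto intro: exI[of _ "[]"])

lemma word_over_mono: "word_over A w \<Longrightarrow> A \<subseteq> B \<Longrightarrow> word_over B w"
  by (auto simp: word_over_def)

text \<open>The last assumption makes it consistent to send all other generators to the identity,
  which gives a retraction onto the factor and makes the embedding injective.\<close>

locale pres_factor =
  fixes G' :: "('b, 'k) monoid_scheme" and \<gamma>' :: "'h \<Rightarrow> 'b" and Gen' R'
    and G :: "('a, 'n) monoid_scheme" and \<gamma> :: "'g \<Rightarrow> 'a" and Gen R and \<iota> :: "'h \<Rightarrow> 'g"
  assumes pres': "pres_by G' \<gamma>' Gen' R'" and pres: "pres_by G \<gamma> Gen R"
    and inj: "inj_on \<iota> Gen'" and sub: "\<iota> ` Gen' \<subseteq> Gen"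
    and rel: "q \<in> R' \<Longrightarrow> map_word \<iota> q \<in> R"
    and rel': "r \<in> R \<Longrightarrow> (\<exists>r'\<in>R'. r = map_word \<iota> r') \<or> fst ` set r \<inter> \<iota> ` Gen' = {}"
begin

sublocale G': group G' using pres' by (simp add: pres_by_def)
sublocale G: group G using pres by (simp add: pres_by_def)

lemma gens: "\<gamma>' ` Gen' \<subseteq> carrier G'" "\<gamma> ` Gen \<subseteq> carrier G" "\<gamma> ` \<iota> ` Gen' \<subseteq> carrier G"
  using pres pres' sub by (auto simp: pres_by_def)

lemma relator_one: "q \<in> R' \<Longrightarrow> eval_word G' \<gamma>' q = \<one>\<^bsub>G'\<^esub>" "r \<in> R \<Longrightarrow> eval_word G \<gamma> r = \<one>\<^bsub>G\<^esub>"
  using pres pres' wc_rel by (auto simp: pres_by_def)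

lemma relator_over: "q \<in> R' \<Longrightarrow> word_over Gen' q" "r \<in> R \<Longrightarrow> word_over Gen r"
  using pres pres' by (auto simp: pres_by_def)

definition emb :: "'b \<Rightarrow> 'a" where
  "emb = (SOME F. F \<in> hom G' G \<and> (\<forall>g\<in>Gen'. F (\<gamma>' g) = \<gamma> (\<iota> g)))"

definition ret :: "'a \<Rightarrow> 'b" where
  "ret = (SOME F. F \<in> hom G G' \<and> (\<forall>g\<in>Gen'. F (\<gamma> (\<iota> g)) = \<gamma>' g) \<and> (\<forall>g\<in>Gen - \<iota> ` Gen'. F (\<gamma> g) = \<one>\<^bsub>G'\<^esub>))"

lemma emb: "emb \<in> hom G' G" "g \<in> Gen' \<Longrightarrow> emb (\<gamma>' g) = \<gamma> (\<iota> g)"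
proof -
  have "\<exists>F\<in>hom G' G. \<forall>g\<in>Gen'. F (\<gamma>' g) = (\<gamma> \<circ> \<iota>) g"
  proof (rule pres_by_hom_gen[OF pres' G.group_axioms])
    fix r assume "r \<in> R'"
    then show "eval_word G (\<gamma> \<circ> \<iota>) r = \<one>\<^bsub>G\<^esub>"
      using rel relator_one(2) unfolding eval_word_map_word[symmetric] by blast
  qed (use gens in auto)
  then have "\<exists>F. F \<in> hom G' G \<and> (\<forall>g\<in>Gen'. F (\<gamma>' g) = \<gamma> (\<iota> g))" by auto
  from someI_ex[OF this] show "emb \<in> hom G' G" "g \<in> Gen' \<Longrightarrow> emb (\<gamma>' g) = \<gamma> (\<iota> g)"
    unfolding emb_def by blast+
qed

lemma ret: "ret \<in> hom G G'" "g \<in> Gen' \<Longrightarrow> ret (\<gamma> (\<iota> g)) = \<gamma>' g" "y \<in> Gen - \<iota> ` Gen' \<Longrightarrow> ret (\<gamma> y) = \<one>\<^bsub>G'\<^esub>"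
proof -
  let ?\<theta> = "\<lambda>g. if g \<in> \<iota> ` Gen' then \<gamma>' (the_inv_into Gen' \<iota> g) else \<one>\<^bsub>G'\<^esub>"
  have \<theta>: "?\<theta> (\<iota> g) = \<gamma>' g" if "g \<in> Gen'" for g using that by (simp add: the_inv_into_f_f[OF inj])
  have c: "?\<theta> ` Gen \<subseteq> carrier G'" using gens(1) the_inv_into_into[OF inj _ order_refl] by auto
  have "\<exists>F\<in>hom G G'. \<forall>g\<in>Gen. F (\<gamma> g) = ?\<theta> g"
  proof (rule pres_by_hom_gen[OF pres G'.group_axioms c])
    fix r assume r: "r \<in> R"
    from rel'[OF r] show "eval_word G' ?\<theta> r = \<one>\<^bsub>G'\<^esub>"
    proof
      assume "\<exists>r'\<in>R'. r = map_word \<iota> r'"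
      then obtain r' where r': "r' \<in> R'" "r = map_word \<iota> r'" by blast
      have "eval_word G' (?\<theta> \<circ> \<iota>) r' = eval_word G' \<gamma>' r'"
      proof (rule eval_word_cong)
        fix x assume "x \<in> fst ` set r'"
        then have "x \<in> Gen'" using relator_over(1)[OF r'(1)] by (force simp: word_over_def)
        then show "(?\<theta> \<circ> \<iota>) x = \<gamma>' x" unfolding comp_apply by (rule \<theta>)
      qed
      then show ?thesis using relator_one(1)[OF r'(1)] r'(2) by (simp add: eval_word_map_word)
    next
      assume "fst ` set r \<inter> \<iota> ` Gen' = {}"
      then show ?thesis by (induction r) auto
    qed
  qed
  then have "\<exists>F. F \<in> hom G G' \<and> (\<forall>g\<in>Gen'. F (\<gamma> (\<iota> g)) = \<gamma>' g) \<and> (\<forall>g\<in>Gen - \<iota> ` Gen'. F (\<gamma> g) = \<one>\<^bsub>G'\<^esub>)"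
    using \<theta> sub by fastforce
  from someI_ex[OF this] show "ret \<in> hom G G'" "g \<in> Gen' \<Longrightarrow> ret (\<gamma> (\<iota> g)) = \<gamma>' g"
    "y \<in> Gen - \<iota> ` Gen' \<Longrightarrow> ret (\<gamma> y) = \<one>\<^bsub>G'\<^esub>"
    unfolding ret_def by blast+
qed

lemma emb_carrier: "x \<in> carrier G' \<Longrightarrow> emb x \<in> carrier G"
  using hom_in_carrier[OF emb(1)] .

lemma ret_carrier: "x \<in> carrier G \<Longrightarrow> ret x \<in> carrier G'"
  using hom_in_carrier[OF ret(1)] .

lemma ret_emb: "x \<in> carrier G' \<Longrightarrow> ret (emb x) = x"
  using pres_by_hom_eqI[OF pres' G'.group_axioms, of "ret \<circ> emb" "\<lambda>x. x" x]
    hom_compose[OF emb(1) ret(1)] emb(2) ret(2) by (simp add: hom_def)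

lemma star_emb: "{eval_word G \<gamma> w | w. word_over (\<iota> ` Gen') w} = emb ` carrier G'"
proof -
  have e: "emb (eval_word G' \<gamma>' v) = eval_word G \<gamma> (map_word \<iota> v)" if "word_over Gen' v" for v
  proof -
    have "emb (eval_word G' \<gamma>' v) = eval_word G (emb \<circ> \<gamma>') v"
      using hom_eval_word[OF G'.group_axioms G.group_axioms emb(1) gens(1) that] .
    also have "\<dots> = eval_word G (\<gamma> \<circ> \<iota>) v"
      using that emb(2) by (intro eval_word_cong) (auto simp: word_over_def)
    finally show ?thesis by (simp add: eval_word_map_word)
  qed
  show ?thesis
  proof (intro equalityI subsetI)
    fix x assume "x \<in> {eval_word G \<gamma> w | w. word_over (\<iota> ` Gen') w}"
    then obtain w where w: "word_over (\<iota> ` Gen') w" "x = eval_word G \<gamma> w" by blast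
    obtain v where v: "word_over Gen' v" "w = map_word \<iota> v" using word_over_image[OF w(1)] by blast
    then have "x = emb (eval_word G' \<gamma>' v)" using e w(2) by simp
    then show "x \<in> emb ` carrier G'" using G'.eval_word_closed[OF gens(1) v(1)] by (rule image_eqI)
  next
    fix x assume "x \<in> emb ` carrier G'"
    then obtain y where y: "y \<in> carrier G'" "x = emb y" by blast
    then obtain v where v: "word_over Gen' v" "eval_word G' \<gamma>' v = y" using pres' unfolding pres_by_def by blast
    then have "x = eval_word G \<gamma> (map_word \<iota> v)" using e y(2) by blast
    then show "x \<in> {eval_word G \<gamma> w | w. word_over (\<iota> ` Gen') w}" using word_over_map_word[OF v(1)] by blast
  qed
qed

lemma emb_ret: "y \<in> emb ` carrier G' \<Longrightarrow> emb (ret y) = y"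
  using ret_emb by auto

lemma ret_other: "word_over (Gen - \<iota> ` Gen') w \<Longrightarrow> ret (eval_word G \<gamma> w) = \<one>\<^bsub>G'\<^esub>"
proof (induction w)
  case Nil
  then show ?case using hom_one[OF ret(1) G.group_axioms G'.group_axioms] by simp
next
  case (Cons l w)
  interpret R: group_hom G G' ret by unfold_locales (rule ret(1))
  have "\<gamma> (fst l) \<in> carrier G" "ret (\<gamma> (fst l)) = \<one>\<^bsub>G'\<^esub>" using Cons.prems gens(2) ret(3) by auto
  moreover have "eval_word G \<gamma> w \<in> carrier G"
    using Cons.prems G.eval_word_closed[OF gens(2)] word_over_mono[of "Gen - \<iota> ` Gen'" w Gen] by auto
  ultimately show ?case using Cons by simp
qed

end

text \<open>A common shape for Coxeter and Artin relators, so that the conditions on a free factor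
  are verified only once.\<close>

definition rels :: "('g \<Rightarrow> 'g \<Rightarrow> nat \<Rightarrow> ('g \<times> bool) list) \<Rightarrow> 'g set \<Rightarrow> ('g \<Rightarrow> 'g \<Rightarrow> enat) \<Rightarrow> ('g \<times> bool) list set" where
  "rels f S m = {f s t n | s t n. s \<in> S \<and> t \<in> S \<and> m s t = enat n}"

lemma coxeter_relators_rels: "coxeter_relators S m = rels (\<lambda>s t n. alt_word s t (2 * n)) S m"
  and artin_relators_rels:
    "artin_relators S m = rels (\<lambda>s t n. alt_word s t n @ inv_word (alt_word t s n)) S m"
  unfolding coxeter_relators_def artin_relators_def rels_def by auto

lemma rels_factor:
  assumes nat: "\<And>s t n. f (\<iota> s) (\<iota> t) n = map_word \<iota> (f' s t n)"
    and lett: "\<And>s t n. fst ` set (f s t n) \<subseteq> {s, t}"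
    and sub: "\<iota> ` S' \<subseteq> S" and m_eq: "\<And>s t. s \<in> S' \<Longrightarrow> t \<in> S' \<Longrightarrow> m (\<iota> s) (\<iota> t) = m' s t"
    and m_inf: "\<And>s t. s \<in> S' \<Longrightarrow> t \<in> S - \<iota> ` S' \<Longrightarrow> m (\<iota> s) t = \<infinity> \<and> m t (\<iota> s) = \<infinity>"
  shows "q \<in> rels f' S' m' \<Longrightarrow> map_word \<iota> q \<in> rels f S m"
    and "r \<in> rels f S m \<Longrightarrow> (\<exists>r'\<in>rels f' S' m'. r = map_word \<iota> r') \<or> fst ` set r \<inter> \<iota> ` S' = {}"
proof -
  assume "q \<in> rels f' S' m'"
  then obtain s t n where st: "s \<in> S'" "t \<in> S'" "m' s t = enat n" "q = f' s t n" unfolding rels_def by blast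
  then have "map_word \<iota> q = f (\<iota> s) (\<iota> t) n" "\<iota> s \<in> S" "\<iota> t \<in> S" "m (\<iota> s) (\<iota> t) = enat n"
    using nat m_eq sub by auto
  then show "map_word \<iota> q \<in> rels f S m" unfolding rels_def by blast
next
  assume "r \<in> rels f S m"
  then obtain s t n where r: "s \<in> S" "t \<in> S" "m s t = enat n" "r = f s t n" unfolding rels_def by blast
  show "(\<exists>r'\<in>rels f' S' m'. r = map_word \<iota> r') \<or> fst ` set r \<inter> \<iota> ` S' = {}"
  proof (cases "s \<in> \<iota> ` S' \<or> t \<in> \<iota> ` S'")
    case False
    then show ?thesis using lett[of s t n] r(4) by blast
  next
    case True
    then have "s \<in> \<iota> ` S'" "t \<in> \<iota> ` S'" using m_inf r by fastforce+
    then obtain s' t' where st: "s' \<in> S'" "t' \<in> S'" "s = \<iota> s'" "t = \<iota> t'" by blast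
    then have "m' s' t' = enat n" using m_eq r by metis
    then have "f' s' t' n \<in> rels f' S' m'" unfolding rels_def using st by blast
    then show ?thesis using r st nat by metis
  qed
qed

lemma alt_word_letters: "fst ` set (alt_word s t n) \<subseteq> {s, t}"
  by (auto simp: alt_word_def)

lemma inv_word_letters: "fst ` set (inv_word w) = fst ` set w"
  by (force simp: inv_word_def)

lemma relators_factor:
  fixes \<iota> :: "'h \<Rightarrow> 'g"
  assumes sub: "\<iota> ` S' \<subseteq> S" and m_eq: "\<And>s t. s \<in> S' \<Longrightarrow> t \<in> S' \<Longrightarrow> m (\<iota> s) (\<iota> t) = m' s t"
    and m_inf: "\<And>s t. s \<in> S' \<Longrightarrow> t \<in> S - \<iota> ` S' \<Longrightarrow> m (\<iota> s) t = \<infinity> \<and> m t (\<iota> s) = \<infinity>"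
  shows "q \<in> coxeter_relators S' m' \<Longrightarrow> map_word \<iota> q \<in> coxeter_relators S m"
    and "r \<in> coxeter_relators S m \<Longrightarrow>
      (\<exists>r'\<in>coxeter_relators S' m'. r = map_word \<iota> r') \<or> fst ` set r \<inter> \<iota> ` S' = {}"
    and "q \<in> artin_relators S' m' \<Longrightarrow> map_word \<iota> q \<in> artin_relators S m"
    and "r \<in> artin_relators S m \<Longrightarrow>
      (\<exists>r'\<in>artin_relators S' m'. r = map_word \<iota> r') \<or> fst ` set r \<inter> \<iota> ` S' = {}"
proof -
  let ?c = "\<lambda>(s :: 'g) t n. alt_word s t (2 * n)" and ?c' = "\<lambda>(s :: 'h) t n. alt_word s t (2 * n)"
  let ?a = "\<lambda>(s :: 'g) t n. alt_word s t n @ inv_word (alt_word t s n)"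
    and ?a' = "\<lambda>(s :: 'h) t n. alt_word s t n @ inv_word (alt_word t s n)"
  have nat: "?c (\<iota> s) (\<iota> t) n = map_word \<iota> (?c' s t n)" "?a (\<iota> s) (\<iota> t) n = map_word \<iota> (?a' s t n)" for s t n
    by (simp_all add: map_word_alt_word map_word_inv_word)
  have letc: "fst ` set (?c s t n) \<subseteq> {s, t}" for s t :: 'g and n using alt_word_letters .
  have leta: "fst ` set (?a s t n) \<subseteq> {s, t}" for s t :: 'g and n
    using alt_word_letters[of s t n] alt_word_letters[of t s n] inv_word_letters[of "alt_word t s n"]
    by (auto simp: image_Un)
  note c = rels_factor[where f = ?c and \<iota> = \<iota> and f' = ?c' and m = m and m' = m', OF nat(1) letc sub m_eq m_inf]
  note a = rels_factor[where f = ?a and \<iota> = \<iota> and f' = ?a' and m = m and m' = m', OF nat(2) leta sub m_eq m_inf]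
  show "q \<in> coxeter_relators S' m' \<Longrightarrow> map_word \<iota> q \<in> coxeter_relators S m"
    "r \<in> coxeter_relators S m \<Longrightarrow>
      (\<exists>r'\<in>coxeter_relators S' m'. r = map_word \<iota> r') \<or> fst ` set r \<inter> \<iota> ` S' = {}"
    unfolding coxeter_relators_rels using c by blast+
  show "q \<in> artin_relators S' m' \<Longrightarrow> map_word \<iota> q \<in> artin_relators S m"
    "r \<in> artin_relators S m \<Longrightarrow>
      (\<exists>r'\<in>artin_relators S' m'. r = map_word \<iota> r') \<or> fst ` set r \<inter> \<iota> ` S' = {}"
    unfolding artin_relators_rels using a by blast+
qed

lemma artin_relators_over: "r \<in> artin_relators S m \<Longrightarrow> word_over S r"
  unfolding artin_relators_def using word_over_alt_word by fastforce

lemma pres_artin: "pres_by (artin_group S m) (artin_gen S m) S (artin_relators S m)"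
proof -
  have "artin_gen S m = pres_gen (artin_relators S m)" by (simp add: artin_gen_def fun_eq_iff)
  then show ?thesis using pres_by_presented_group[OF artin_relators_over] by (simp add: artin_group_def)
qed

lemma (in coxeter) T_ne_one: "t \<in> T \<Longrightarrow> t \<noteq> \<one>"
proof
  assume "t \<in> T" "t = \<one>"
  then obtain w s where w: "w \<in> carrier W" "s \<in> S" "w \<otimes> s \<otimes> inv w = \<one>" unfolding T_def reflections_def by force
  then have "s = \<one>" using conjg_eq_one_iff[of w s] S_carrier by (auto simp: conjg_def)
  then show False using fac_ne_one[OF fac_ss, of s] w(2) ss by simp
qed

text \<open>The last two assumptions make the nontrivial letters of the retracted Coxeter word a
  reduced factorization in the factor.\<close>

locale cox_sub = F: coxeter W' S' m' ss' + C: coxeter W S m ss +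
    P: pres_factor W' "\<lambda>x. x" S' "coxeter_relators S' m'" W "\<lambda>x. x" S "coxeter_relators S m" \<iota>
  for W' :: "('b, 'k) monoid_scheme" and S' m' ss' and W :: "('a, 'n) monoid_scheme" and S m ss and \<iota> +
  assumes count: "length (filter (\<lambda>s. s \<in> \<iota> ` S') ss) = length ss'"
    and ret_h: "P.ret (prodl W ss) = prodl W' ss'"
begin

definition st :: "'a set" where "st = P.emb ` carrier W'"

lemma emb_gen: "s \<in> S' \<Longrightarrow> P.emb s = \<iota> s"
  using P.emb(2) by simp

lemma ret_conj:
  assumes "w \<in> carrier W" "x \<in> carrier W"
  shows "P.ret (w \<otimes>\<^bsub>W\<^esub> x \<otimes>\<^bsub>W\<^esub> inv\<^bsub>W\<^esub> w) = P.ret w \<otimes>\<^bsub>W'\<^esub> P.ret x \<otimes>\<^bsub>W'\<^esub> inv\<^bsub>W'\<^esub> (P.ret w)"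
proof -
  interpret R: group_hom W W' P.ret by unfold_locales (rule P.ret(1))
  show ?thesis using assms by simp
qed

lemma ret_T: "t \<in> C.T \<Longrightarrow> P.ret t \<in> F.T \<or> P.ret t = \<one>\<^bsub>W'\<^esub>"
proof -
  assume "t \<in> C.T"
  then obtain w s where w: "w \<in> carrier W" "s \<in> S" "t = w \<otimes>\<^bsub>W\<^esub> s \<otimes>\<^bsub>W\<^esub> inv\<^bsub>W\<^esub> w"
    unfolding C.T_def reflections_def by blast
  have s: "s \<in> carrier W" using w C.S_carrier by blast
  show ?thesis
  proof (cases "s \<in> \<iota> ` S'")
    case True
    then have "P.ret s \<in> S'" using P.ret(2) by auto
    then show ?thesis unfolding w(3) ret_conj[OF w(1) s]
      using F.T_conj[of "P.ret w" "P.ret s"] F.S_T P.ret_carrier[OF w(1)] by blast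
  next
    case False
    then have "P.ret s = \<one>\<^bsub>W'\<^esub>" using P.ret(3)[of s] w by simp
    then show ?thesis unfolding w(3) ret_conj[OF w(1) s] using P.ret_carrier[OF w(1)] by simp
  qed
qed

lemma st_ret_T: "t \<in> C.T \<Longrightarrow> t \<in> st \<Longrightarrow> P.ret t \<in> F.T"
proof -
  assume t: "t \<in> C.T" "t \<in> st"
  have "P.ret t \<noteq> \<one>\<^bsub>W'\<^esub>"
  proof
    assume "P.ret t = \<one>\<^bsub>W'\<^esub>"
    then have "t = P.emb \<one>\<^bsub>W'\<^esub>" using P.emb_ret[of t] t(2) unfolding st_def by simp
    then have "t = \<one>\<^bsub>W\<^esub>" using hom_one[OF P.emb(1) F.group_axioms C.group_axioms] by simp
    then show False using C.T_ne_one t(1) by blast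
  qed
  then show ?thesis using ret_T t(1) by blast
qed

lemma emb_ret_map: "set ts \<subseteq> st \<Longrightarrow> map P.emb (map P.ret ts) = ts"
  unfolding st_def using P.emb_ret by (auto intro!: map_idI)

lemma ret_prodl: "set ts \<subseteq> carrier W \<Longrightarrow> prodl W' (map P.ret ts) = P.ret (prodl W ts)"
  using hom_prodl[OF C.group_axioms F.group_axioms P.ret(1)] by simp

lemma st_length:
  assumes "set ts \<subseteq> C.T" "set ts \<subseteq> st" "prodl W ts = P.emb (prodl W' ss')"
  shows "length ss' \<le> length ts"
    and "length ts = length ss' \<Longrightarrow> F.fac (map P.ret ts)"
proof -
  have T: "set (map P.ret ts) \<subseteq> F.T" using st_ret_T assms by auto
  have p: "prodl W' (map P.ret ts) = prodl W' ss'"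
    using ret_prodl[OF C.T_closed[OF assms(1)]] assms(3) P.ret_emb F.prodl_closed[OF F.ss_carrier] by simp
  show "length ss' \<le> length ts" using F.reflection_length[OF T p] by simp
  show "length ts = length ss' \<Longrightarrow> F.fac (map P.ret ts)" using T p by (simp add: F.fac_def)
qed

lemma st_standard:
  assumes "pan_transitive W' F.T (prodl W' ss')"
    and "set ts \<subseteq> C.T" "set ts \<subseteq> st" "prodl W ts = P.emb (prodl W' ss')" "length ts = length ss'"
  shows "heq W ts (map P.emb ss')"
proof -
  have "F.fac (map P.ret ts)" using st_length(2)[OF assms(2-5)] .
  then have "heq W' (map P.ret ts) ss'"
    using F.pan_transitive_heq[OF assms(1), of "[]" "map P.ret ts" "[]" "[]" ss' "[]"] F.fac_ss
    by (simp add: F.fac_def)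
  from heq_map_hom[OF F.group_axioms C.group_axioms P.emb(1) this]
  show ?thesis unfolding emb_ret_map[OF assms(3)] .
qed

text \<open>Being a block of a factorization in \<open>W\<close> is turned into being a prefix of
  one in the factor, where pan-transitivity is available. The resulting braid is then carried back
  by the embedding.\<close>

lemma sub_transitive:
  assumes pan: "pan_transitive W' F.T (prodl W' ss')"
    and std: "\<And>xs. C.fac xs \<Longrightarrow> heq W ss xs"
    and fac: "C.fac (us @ rs @ ws)" "C.fac (us' @ rs' @ ws')"
    and st: "set rs \<subseteq> st" "set rs' \<subseteq> st" and eq: "prodl W rs = prodl W rs'"
  shows "heq W rs rs'"
proof -
  let ?one = "\<lambda>x. P.ret x \<noteq> \<one>\<^bsub>W'\<^esub>"
  have inv: "?one (g \<otimes>\<^bsub>W\<^esub> x \<otimes>\<^bsub>W\<^esub> inv\<^bsub>W\<^esub> g) \<longleftrightarrow> ?one x" if "g \<in> carrier W" "x \<in> carrier W" for g x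
    unfolding ret_conj[OF that]
    using F.conjg_eq_one_iff[of "P.ret g" "P.ret x"] P.ret_carrier that by (simp add: conjg_def)
  have "filter ?one ss = filter (\<lambda>s. s \<in> \<iota> ` S') ss"
  proof (rule filter_cong[OF refl])
    fix s assume s: "s \<in> set ss"
    show "?one s \<longleftrightarrow> s \<in> \<iota> ` S'"
    proof (cases "s \<in> \<iota> ` S'")
      case True
      then have "P.ret s \<in> F.T" using P.ret(2) F.S_T by auto
      then show ?thesis using True F.T_ne_one by blast
    next
      case False
      then show ?thesis using P.ret(3)[of s] s C.ss by simp
    qed
  qed
  \<comment> \<open>Having a nontrivial retraction is invariant under conjugation, and by
    \<open>std\<close> all factorizations are equivalent to the Coxeter word, so they have equally
    many such letters.\<close>
  then have cnt: "length (filter ?one xs) = length ss'" if "C.fac xs" for xs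
    using C.heq_filter_length[OF std[OF that], of ?one] inv count by simp
  \<comment> \<open>The block is moved to the front, the tuple is retracted and trivial letters are
    deleted. The count shows that the result has minimal length in the factor.\<close>
  have key: "\<exists>zs. F.fac (map P.ret rs @ zs)" if f: "C.fac (us @ rs @ ws)" and st: "set rs \<subseteq> st" for us rs ws
  proof -
    have T: "set us \<subseteq> C.T" "set rs \<subseteq> C.T" "set ws \<subseteq> C.T" using f by (auto simp: C.fac_def)
    define vs where "vs = map (conjg W (inv\<^bsub>W\<^esub> (prodl W rs))) us @ ws"
    have "heq W (us @ rs @ ws) (rs @ vs)"
      using C.heq_context[OF C.heq_move'[OF C.T_closed[OF T(1)] C.T_closed[OF T(2)]], of "[]" ws]
        C.T_closed[OF T(3)] by (simp add: vs_def)
    then have fv: "C.fac (rs @ vs)" using C.fac_heq f by blast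
    then have c: "set (rs @ vs) \<subseteq> C.T" by (simp add: C.fac_def)
    have "map P.ret (filter ?one (rs @ vs)) = filter (\<lambda>x. x \<noteq> \<one>\<^bsub>W'\<^esub>) (map P.ret (rs @ vs))"
      by (simp add: filter_map comp_def)
    moreover have "set (map P.ret (rs @ vs)) \<subseteq> carrier W'"
      using P.ret_carrier C.T_closed[OF c] by auto
    ultimately have "prodl W' (map P.ret (filter ?one (rs @ vs))) = prodl W' (map P.ret (rs @ vs))"
      using F.prodl_filter_one by metis
    also have "\<dots> = prodl W' ss'" using ret_prodl[OF C.T_closed[OF c]] fv ret_h by (simp add: C.fac_def)
    finally have p: "prodl W' (map P.ret (filter ?one (rs @ vs))) = prodl W' ss'" .
    have "set (map P.ret (filter ?one (rs @ vs))) \<subseteq> F.T" using ret_T c by auto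
    then have "F.fac (map P.ret (filter ?one (rs @ vs)))" using p cnt[OF fv] by (simp add: F.fac_def)
    moreover have "filter ?one rs = rs"
      using st_ret_T F.T_ne_one T(2) st by (auto intro!: filter_True)
    ultimately show ?thesis by auto
  qed
  obtain zs zs' where z: "F.fac (map P.ret rs @ zs)" "F.fac (map P.ret rs' @ zs')"
    using key[OF fac(1) st(1)] key[OF fac(2) st(2)] by blast
  have c: "set rs \<subseteq> carrier W" "set rs' \<subseteq> carrier W" using fac C.T_closed by (auto simp: C.fac_def)
  have "heq W' (map P.ret rs) (map P.ret rs')"
    using F.pan_transitive_heq[OF pan, of "[]" "map P.ret rs" zs "[]" "map P.ret rs'" zs'] z
      ret_prodl[OF c(1)] ret_prodl[OF c(2)] eq by simp
  from heq_map_hom[OF F.group_axioms C.group_axioms P.emb(1) this]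
  show ?thesis unfolding emb_ret_map[OF st(1)] emb_ret_map[OF st(2)] .
qed

end

text \<open>Only the Coxeter matrix of \<open>W\<close> is prescribed; the free product structure is
  derived from the presentation through the colouring \<open>col\<close>.\<close>

locale coxeter_free_product =
  C1: coxeter W1 S1 m1 s1s + C2: coxeter W2 S2 m2 s2s + C: coxeter W S m "map \<iota>1 s1s @ map \<iota>2 s2s"
  for W1 :: "('a, 'n1) monoid_scheme" and S1 m1 s1s and W2 :: "('b, 'n2) monoid_scheme" and S2 m2 s2s
    and W :: "('c, 'n3) monoid_scheme" and S m \<iota>1 \<iota>2 +
  assumes inj1: "inj_on \<iota>1 S1" and inj2: "inj_on \<iota>2 S2"
    and disj: "\<iota>1 ` S1 \<inter> \<iota>2 ` S2 = {}"
    and m_1: "\<And>a b. a \<in> S1 \<Longrightarrow> b \<in> S1 \<Longrightarrow> m (\<iota>1 a) (\<iota>1 b) = m1 a b"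
    and m_2: "\<And>a b. a \<in> S2 \<Longrightarrow> b \<in> S2 \<Longrightarrow> m (\<iota>2 a) (\<iota>2 b) = m2 a b"
    and m_12: "\<And>a b. a \<in> S1 \<Longrightarrow> b \<in> S2 \<Longrightarrow> m (\<iota>1 a) (\<iota>2 b) = \<infinity> \<and> m (\<iota>2 b) (\<iota>1 a) = \<infinity>"
begin

abbreviation ss :: "'c list" where "ss \<equiv> map \<iota>1 s1s @ map \<iota>2 s2s"

lemma S_def: "S = \<iota>1 ` S1 \<union> \<iota>2 ` S2"
  using C.ss(2) C1.ss(2) C2.ss(2) by auto

lemma S_minus: "S - \<iota>1 ` S1 = \<iota>2 ` S2" "S - \<iota>2 ` S2 = \<iota>1 ` S1"
  using S_def disj by auto

lemma m_inf1: "s \<in> S1 \<Longrightarrow> t \<in> S - \<iota>1 ` S1 \<Longrightarrow> m (\<iota>1 s) t = \<infinity> \<and> m t (\<iota>1 s) = \<infinity>"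
  and m_inf2: "u \<in> S2 \<Longrightarrow> t \<in> S - \<iota>2 ` S2 \<Longrightarrow> m (\<iota>2 u) t = \<infinity> \<and> m t (\<iota>2 u) = \<infinity>"
  unfolding S_minus using m_12 by auto

lemma sub1: "\<iota>1 ` S1 \<subseteq> S" and sub2: "\<iota>2 ` S2 \<subseteq> S"
  using S_def by auto

sublocale P1: pres_factor W1 "\<lambda>x. x" S1 "coxeter_relators S1 m1" W "\<lambda>x. x" S "coxeter_relators S m" \<iota>1
  by unfold_locales (use C1.pres C.pres inj1 sub1 relators_factor(1,2)[where \<iota> = \<iota>1 and m = m and m' = m1, OF sub1 m_1 m_inf1] in auto)

sublocale P2: pres_factor W2 "\<lambda>x. x" S2 "coxeter_relators S2 m2" W "\<lambda>x. x" S "coxeter_relators S m" \<iota>2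
  by unfold_locales (use C2.pres C.pres inj2 sub2 relators_factor(1,2)[where \<iota> = \<iota>2 and m = m and m' = m2, OF sub2 m_2 m_inf2] in auto)

sublocale A1: pres_factor "artin_group S1 m1" "artin_gen S1 m1" S1 "artin_relators S1 m1"
    "artin_group S m" "artin_gen S m" S "artin_relators S m" \<iota>1
  by unfold_locales (use pres_artin inj1 sub1 relators_factor(3,4)[where \<iota> = \<iota>1 and m = m and m' = m1, OF sub1 m_1 m_inf1] in auto)

sublocale A2: pres_factor "artin_group S2 m2" "artin_gen S2 m2" S2 "artin_relators S2 m2"
    "artin_group S m" "artin_gen S m" S "artin_relators S m" \<iota>2
  by unfold_locales (use pres_artin inj2 sub2 relators_factor(3,4)[where \<iota> = \<iota>2 and m = m and m' = m2, OF sub2 m_2 m_inf2] in auto)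

definition col :: "'c \<Rightarrow> bool" where "col s \<longleftrightarrow> s \<in> \<iota>1 ` S1"

lemma col_sets: "{s \<in> S. col s = True} = \<iota>1 ` S1" "{s \<in> S. col s = False} = \<iota>2 ` S2"
  using sub1 S_minus(1) by (auto simp: col_def)

sublocale CP: coloured_presentation W "\<lambda>x. x" S "coxeter_relators S m" col
proof (unfold_locales)
  fix r assume r: "r \<in> coxeter_relators S m"
  show "\<exists>c. \<forall>x\<in>fst ` set r. col x = c"
    using P1.rel'[OF r]
  proof
    assume "\<exists>r'\<in>coxeter_relators S1 m1. r = map_word \<iota>1 r'"
    then obtain r' where "r' \<in> coxeter_relators S1 m1" "r = map_word \<iota>1 r'" by blast
    then have "word_over (\<iota>1 ` S1) r" using word_over_map_word C1.coxeter_relators_over by blast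
    then show ?thesis by (intro exI[of _ True]) (auto simp: word_over_def col_def)
  next
    assume "fst ` set r \<inter> \<iota>1 ` S1 = {}"
    then show ?thesis by (intro exI[of _ False]) (auto simp: col_def)
  qed
qed (rule C.pres)

sublocale AP: coloured_presentation "artin_group S m" "artin_gen S m" S "artin_relators S m" col
proof (unfold_locales)
  fix r assume r: "r \<in> artin_relators S m"
  show "\<exists>c. \<forall>x\<in>fst ` set r. col x = c"
    using A1.rel'[OF r]
  proof
    assume "\<exists>r'\<in>artin_relators S1 m1. r = map_word \<iota>1 r'"
    then obtain r' where "r' \<in> artin_relators S1 m1" "r = map_word \<iota>1 r'" by blast
    then have "word_over (\<iota>1 ` S1) r" using word_over_map_word artin_relators_over by blast
    then show ?thesis by (intro exI[of _ True]) (auto simp: word_over_def col_def)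
  next
    assume "fst ` set r \<inter> \<iota>1 ` S1 = {}"
    then show ?thesis by (intro exI[of _ False]) (auto simp: col_def)
  qed
qed (rule pres_artin)

abbreviation K :: "bool \<Rightarrow> 'c set" where "K \<equiv> CP.star"

lemma K_emb: "K True = P1.emb ` carrier W1" "K False = P2.emb ` carrier W2"
  unfolding CP.star_def col_sets P1.star_emb P2.star_emb by (rule refl)+

lemma AK_emb: "AP.star True = A1.emb ` carrier (artin_group S1 m1)"
  "AP.star False = A2.emb ` carrier (artin_group S2 m2)"
  unfolding AP.star_def col_sets A1.star_emb A2.star_emb by (rule refl)+

lemma ret_prodl_ss: "P1.ret (prodl W ss) = prodl W1 s1s" "P2.ret (prodl W ss) = prodl W2 s2s"
proof -
  have one: "prodl W1 (map (\<lambda>_. \<one>\<^bsub>W1\<^esub>) xs) = \<one>\<^bsub>W1\<^esub>" "prodl W2 (map (\<lambda>_. \<one>\<^bsub>W2\<^esub>) ys) = \<one>\<^bsub>W2\<^esub>" for xs ys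
    by (induction xs, simp_all) (induction ys, simp_all)
  have "map P1.ret ss = s1s @ map (\<lambda>_. \<one>\<^bsub>W1\<^esub>) s2s"
    using C1.ss(2) C2.ss(2) P1.ret(2) P1.ret(3) S_minus by (auto intro!: map_idI)
  then have "P1.ret (prodl W ss) = prodl W1 (s1s @ map (\<lambda>_. \<one>\<^bsub>W1\<^esub>) s2s)"
    using hom_prodl[OF C.group_axioms C1.group_axioms P1.ret(1) C.ss_carrier] by metis
  then show "P1.ret (prodl W ss) = prodl W1 s1s"
    using C1.ss_carrier by (subst (asm) C1.prodl_append) (auto simp: one C1.prodl_closed)
  have "map P2.ret ss = map (\<lambda>_. \<one>\<^bsub>W2\<^esub>) s1s @ s2s"
    using C1.ss(2) C2.ss(2) P2.ret(2) P2.ret(3) S_minus by (auto intro!: map_idI)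
  then have "P2.ret (prodl W ss) = prodl W2 (map (\<lambda>_. \<one>\<^bsub>W2\<^esub>) s1s @ s2s)"
    using hom_prodl[OF C.group_axioms C2.group_axioms P2.ret(1) C.ss_carrier] by metis
  then show "P2.ret (prodl W ss) = prodl W2 s2s"
    using C2.ss_carrier by (subst (asm) C2.prodl_append) (auto simp: one C2.prodl_closed)
qed

sublocale X1: cox_sub W1 S1 m1 s1s W S m ss \<iota>1
proof (unfold_locales)
  have "filter (\<lambda>s. s \<in> \<iota>1 ` S1) ss = map \<iota>1 s1s"
    using C1.ss(2) C2.ss(2) disj by (auto simp: filter_id_conv filter_empty_conv)
  then show "length (filter (\<lambda>s. s \<in> \<iota>1 ` S1) ss) = length s1s" by simp
qed (rule ret_prodl_ss)

sublocale X2: cox_sub W2 S2 m2 s2s W S m ss \<iota>2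
proof (unfold_locales)
  have "filter (\<lambda>s. s \<in> \<iota>2 ` S2) ss = map \<iota>2 s2s"
    using C1.ss(2) C2.ss(2) disj by (auto simp: filter_id_conv filter_empty_conv)
  then show "length (filter (\<lambda>s. s \<in> \<iota>2 ` S2) ss) = length s2s" by simp
qed (rule ret_prodl_ss)

definition h1 :: 'c where "h1 = prodl W (map \<iota>1 s1s)"
definition h2 :: 'c where "h2 = prodl W (map \<iota>2 s2s)"

lemma emb_h: "P1.emb (prodl W1 s1s) = h1" "P2.emb (prodl W2 s2s) = h2"
  and emb_ss: "map P1.emb s1s = map \<iota>1 s1s" "map P2.emb s2s = map \<iota>2 s2s"
proof -
  show e: "map P1.emb s1s = map \<iota>1 s1s" "map P2.emb s2s = map \<iota>2 s2s"
    using C1.ss(2) C2.ss(2) X1.emb_gen X2.emb_gen by auto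
  show "P1.emb (prodl W1 s1s) = h1" "P2.emb (prodl W2 s2s) = h2"
    using hom_prodl[OF C1.group_axioms C.group_axioms P1.emb(1) C1.ss_carrier]
      hom_prodl[OF C2.group_axioms C.group_axioms P2.emb(1) C2.ss_carrier] e
    by (simp_all add: h1_def h2_def)
qed

lemma h: "h1 \<in> K True" "h2 \<in> K False" "prodl W ss = h1 \<otimes>\<^bsub>W\<^esub> h2"
proof -
  show "h1 \<in> K True" "h2 \<in> K False"
    unfolding K_emb emb_h[symmetric] using C1.prodl_closed[OF C1.ss_carrier] C2.prodl_closed[OF C2.ss_carrier] by blast+
  show "prodl W ss = h1 \<otimes>\<^bsub>W\<^esub> h2"
    unfolding h1_def h2_def using C.ss_carrier by (simp add: C.prodl_append)
qed

sublocale Z: factorized W K C.T h1 h2 "length ss"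
  by (intro factorized.intro factorized_axioms.intro CP.free_prod_star)
    (use C.T_carrier C.T_conj h C.reflection_length in auto)

lemma Z_fac: "Z.fac = C.fac"
  by (intro ext) (simp only: Z.fac_def C.fac_def h(3))

lemma Z_seg: "Z.seg = C.segment"
  by (intro ext) (simp only: Z.seg_def C.segment_def)

end

section \<open>Braid relations and the map from the Artin group\<close>

context group
begin

definition alt_prod :: "'a \<Rightarrow> 'a \<Rightarrow> nat \<Rightarrow> 'a" where
  "alt_prod s t n = eval_word G (\<lambda>x. x) (alt_word s t n)"

lemma alt_prod_0 [simp]: "alt_prod s t 0 = \<one>"
  and alt_prod_Suc: "alt_prod s t (Suc n) = s \<otimes> alt_prod t s n"
  by (simp_all add: alt_prod_def alt_word_Suc)

lemma alt_prod_closed [simp]: "s \<in> carrier G \<Longrightarrow> t \<in> carrier G \<Longrightarrow> alt_prod s t n \<in> carrier G"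
  by (induction n arbitrary: s t) (simp_all add: alt_prod_Suc)

lemma alt_prod_snoc:
  "s \<in> carrier G \<Longrightarrow> t \<in> carrier G \<Longrightarrow> alt_prod s t (Suc n) = alt_prod s t n \<otimes> (if even n then s else t)"
proof (induction n arbitrary: s t)
  case (Suc n)
  have "alt_prod s t (Suc (Suc n)) = s \<otimes> (alt_prod t s n \<otimes> (if even n then t else s))"
    using alt_prod_Suc[of s t "Suc n"] Suc.IH[OF Suc.prems(2,1)] by metis
  also have "\<dots> = alt_prod s t (Suc n) \<otimes> (if even (Suc n) then s else t)"
    using Suc.prems by (simp add: alt_prod_Suc m_assoc)
  finally show ?case .
qed (simp add: alt_prod_Suc)

lemma alt_prod_add:
  "s \<in> carrier G \<Longrightarrow> t \<in> carrier G \<Longrightarrow>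
   alt_prod s t (i + j) = alt_prod s t i \<otimes> (if even i then alt_prod s t j else alt_prod t s j)"
  by (induction i arbitrary: s t) (simp_all add: alt_prod_Suc m_assoc)

lemma alt_prod_inv:
  assumes "s \<in> carrier G" "t \<in> carrier G" "s \<otimes> s = \<one>" "t \<otimes> t = \<one>"
  shows "inv (alt_prod s t n) = (if even n then alt_prod t s n else alt_prod s t n)"
  using assms
proof (induction n arbitrary: s t)
  case (Suc n)
  have i: "inv s = s" using Suc.prems inv_equality by simp
  have "inv (alt_prod s t (Suc n)) = (if even n then alt_prod s t n else alt_prod t s n) \<otimes> s"
    using Suc i by (simp add: alt_prod_Suc inv_mult_group)
  then show ?case using Suc.prems by (cases "even n") (simp_all add: alt_prod_snoc)
qed simp

end

context coxeter
begin

lemma braid_relation: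
  assumes "s \<in> S" "t \<in> S" "m s t = enat n"
  shows "alt_prod s t n = alt_prod t s n"
proof -
  have c: "s \<in> carrier W" "t \<in> carrier W" using assms S_carrier by auto
  have "alt_word s t (2 * n) \<in> coxeter_relators S m" unfolding coxeter_relators_def using assms by blast
  then have "alt_prod s t (n + n) = \<one>"
    using pres wc_rel coxeter_relators_over unfolding pres_by_def alt_prod_def mult_2[symmetric] by metis
  then have "alt_prod s t n \<otimes> (if even n then alt_prod s t n else alt_prod t s n) = \<one>"
    using alt_prod_add[OF c, of n n] by simp
  then have "alt_prod s t n = inv (if even n then alt_prod s t n else alt_prod t s n)"
    using c by (intro inv_equality[symmetric]) auto
  then show ?thesis
    using alt_prod_inv[OF c] alt_prod_inv[OF c(2,1)] S_involution assms by (auto split: if_splits)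
qed

definition art_hom :: "('a \<times> bool) list set \<Rightarrow> 'a" where
  "art_hom = (SOME F. F \<in> hom (artin_group S m) W \<and> (\<forall>s\<in>S. F (artin_gen S m s) = s))"

lemma art_hom: "art_hom \<in> hom (artin_group S m) W" "s \<in> S \<Longrightarrow> art_hom (artin_gen S m s) = s"
proof -
  have "\<exists>F\<in>hom (artin_group S m) W. \<forall>s\<in>S. F (artin_gen S m s) = s"
  proof (rule pres_by_hom_gen[OF pres_artin group_axioms])
    fix r assume "r \<in> artin_relators S m"
    then obtain s t n where r: "s \<in> S" "t \<in> S" "m s t = enat n" "r = alt_word s t n @ inv_word (alt_word t s n)"
      unfolding artin_relators_def by blast
    have c: "(\<lambda>x. x) ` S \<subseteq> carrier W" using S_carrier by auto
    have "s \<in> carrier W" "t \<in> carrier W" using r S_carrier by auto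
    then show "eval_word W (\<lambda>x. x) r = \<one>"
      using braid_relation[OF r(1-3)] unfolding r(4)
      by (simp add: eval_word_append[OF c] eval_word_inv_word[OF c] word_over_alt_word r alt_prod_def[symmetric])
  qed (use S_carrier in auto)
  then have "\<exists>F. F \<in> hom (artin_group S m) W \<and> (\<forall>s\<in>S. F (artin_gen S m s) = s)" by blast
  from someI_ex[OF this] show "art_hom \<in> hom (artin_group S m) W" "s \<in> S \<Longrightarrow> art_hom (artin_gen S m s) = s"
    unfolding art_hom_def by blast+
qed

abbreviation art_ss :: "('a \<times> bool) list set list" where
  "art_ss \<equiv> map (artin_gen S m) ss"

lemma art_group: "group (artin_group S m)"
  using pres_artin[of S m] by (simp add: pres_by_def)

lemma art_gen_carrier: "s \<in> S \<Longrightarrow> artin_gen S m s \<in> carrier (artin_group S m)"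
  using pres_artin[of S m] by (auto simp: pres_by_def)

lemma art_ss_carrier: "set art_ss \<subseteq> carrier (artin_group S m)"
  using art_gen_carrier ss by auto

lemma art_hom_ss: "map art_hom art_ss = ss"
  using art_hom(2) ss by (auto intro!: map_idI)

lemma art_ne_one: "s \<in> S \<Longrightarrow> artin_gen S m s \<noteq> \<one>\<^bsub>artin_group S m\<^esub>"
  using art_hom(2) hom_one[OF art_hom(1) art_group group_axioms] T_ne_one S_T by fastforce

end

locale art_sub = cox_sub W' S' m' ss' W S m ss \<iota> +
    A: pres_factor "artin_group S' m'" "artin_gen S' m'" S' "artin_relators S' m'"
      "artin_group S m" "artin_gen S m" S "artin_relators S m" \<iota>
  for W' :: "('b, 'k) monoid_scheme" and S' m' ss' and W :: "('a, 'n) monoid_scheme" and S m ss and \<iota> +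
  assumes filter_ss: "filter (\<lambda>s. s \<in> \<iota> ` S') ss = map \<iota> ss'"
begin

lemma art_hom_ret: "y \<in> carrier (artin_group S m) \<Longrightarrow> F.art_hom (A.ret y) = P.ret (C.art_hom y)"
proof -
  assume y: "y \<in> carrier (artin_group S m)"
  have "(F.art_hom \<circ> A.ret) y = (P.ret \<circ> C.art_hom) y"
  proof (rule pres_by_hom_eqI[OF pres_artin F.group_axioms _ _ _ y])
    show "F.art_hom \<circ> A.ret \<in> hom (artin_group S m) W'" using hom_compose[OF A.ret(1) F.art_hom(1)] .
    show "P.ret \<circ> C.art_hom \<in> hom (artin_group S m) W'" using hom_compose[OF C.art_hom(1) P.ret(1)] .
    fix s assume s: "s \<in> S"
    show "(F.art_hom \<circ> A.ret) (artin_gen S m s) = (P.ret \<circ> C.art_hom) (artin_gen S m s)"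
    proof (cases "s \<in> \<iota> ` S'")
      case True
      then show ?thesis using s A.ret(2) P.ret(2) F.art_hom(2) C.art_hom(2) by auto
    next
      case False
      then show ?thesis using s A.ret(3)[of s] P.ret(3)[of s] C.art_hom(2)
          hom_one[OF F.art_hom(1) F.art_group F.group_axioms] by simp
    qed
  qed
  then show ?thesis by simp
qed

text \<open>Retraction followed by deletion of trivial letters shows that the surviving part is a
  braid image of the generators of the smaller Artin group. That braid fixes the Coxeter word of the
  factor, so by \<open>ws\<close> it fixes the generators as well.\<close>

lemma recover_generators:
  assumes ws: "\<And>w. braid_word (length ss') w \<Longrightarrow> hurwitz W' w ss' = ss' \<Longrightarrow>
      hurwitz (artin_group S' m') w F.art_ss = F.art_ss"
    and Y: "heq (artin_group S m) C.art_ss Y"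
    and Y': "filter (\<lambda>x. x \<noteq> \<one>\<^bsub>artin_group S' m'\<^esub>) (map A.ret Y) = map A.ret Y'"
      "set Y' \<subseteq> A.emb ` carrier (artin_group S' m')" "map C.art_hom Y' = map \<iota> ss'"
  shows "Y' = map (artin_gen S m) (map \<iota> ss')"
proof -
  let ?one = "\<lambda>x. x \<noteq> \<one>\<^bsub>artin_group S' m'\<^esub>"
  have f: "filter ?one (map A.ret C.art_ss) = F.art_ss"
  proof -
    have r: "?one (A.ret (artin_gen S m s)) \<longleftrightarrow> s \<in> \<iota> ` S'" if "s \<in> S" for s
    proof (cases "s \<in> \<iota> ` S'")
      case True
      then show ?thesis using A.ret(2) F.art_ne_one by auto
    next
      case False
      then show ?thesis using A.ret(3)[of s] that by simp
    qed
    have "filter ?one (map A.ret C.art_ss) = map (A.ret \<circ> artin_gen S m) (filter (\<lambda>s. ?one (A.ret (artin_gen S m s))) ss)"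
      by (simp add: filter_map comp_def)
    also have "filter (\<lambda>s. ?one (A.ret (artin_gen S m s))) ss = filter (\<lambda>s. s \<in> \<iota> ` S') ss"
      by (rule filter_cong[OF refl]) (use r C.ss in auto)
    also have "map (A.ret \<circ> artin_gen S m) \<dots> = F.art_ss"
      unfolding filter_ss using A.ret(2) F.ss by auto
    finally show ?thesis .
  qed
  have "heq (artin_group S' m') F.art_ss (map A.ret Y')"
    using group.heq_delete_ones[OF F.art_group
        heq_map_hom[OF C.art_group F.art_group A.ret(1) Y]] unfolding f Y'(1) .
  then obtain w where w: "braid_word (length ss') w" "hurwitz (artin_group S' m') w F.art_ss = map A.ret Y'"
    by (auto simp: heq_def)
  have Yc: "set Y' \<subseteq> carrier (artin_group S m)" using Y'(2) A.emb_carrier by blast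
  have "hurwitz W' w ss' = map F.art_hom (map A.ret Y')"
    using hurwitz_map_hom[OF F.art_group F.group_axioms F.art_hom(1) F.art_ss_carrier, of w] w(2) F.art_hom_ss
    by simp
  also have "\<dots> = map P.ret (map C.art_hom Y')" using art_hom_ret Yc by auto
  also have "\<dots> = ss'" unfolding Y'(3) using P.ret(2) F.ss by (auto intro!: map_idI)
  finally have "map A.ret Y' = F.art_ss" using ws[OF w(1)] w(2) by simp
  then have "map A.emb (map A.ret Y') = map (artin_gen S m) (map \<iota> ss')"
    using A.emb(2) F.ss by auto
  moreover have "map A.emb (map A.ret Y') = Y'" using A.emb_ret Y'(2) by (auto intro!: map_idI)
  ultimately show ?thesis by simp
qed

end

lemma (in free_prod) elliptic_conj:
  "g \<in> carrier G \<Longrightarrow> elliptic x \<Longrightarrow> elliptic (g \<otimes> x \<otimes> inv g)"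
proof -
  assume g: "g \<in> carrier G" and "elliptic x"
  then obtain u d k where u: "u \<in> carrier G" "k \<in> H d" "x = conjg G u k" unfolding elliptic_def by blast
  then have "g \<otimes> x \<otimes> inv g = conjg G (g \<otimes> u) k"
    using conjg_conjg[OF g u(1) H_carrier[OF u(2)]] by (simp add: conjg_def)
  then show ?thesis unfolding elliptic_def using g u by blast
qed

lemma (in free_prod) elliptic_H: "x \<in> H c \<Longrightarrow> elliptic x"
  unfolding elliptic_def using H_carrier conjg_one by (metis one_closed)

lemma (in free_prod) elliptic_heq: "heq G xs ys \<Longrightarrow> \<forall>x\<in>set xs. elliptic x \<Longrightarrow> \<forall>x\<in>set ys. elliptic x"
  using heq_closed[of xs ys "{x. elliptic x}"] elliptic_carrier elliptic_conj by blast

section \<open>Factorizations of the Coxeter element of the free product\<close>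

context coxeter_free_product
begin

sublocale Y1: art_sub W1 S1 m1 s1s W S m ss \<iota>1
  by unfold_locales (use C1.ss(2) C2.ss(2) disj in \<open>auto simp: filter_id_conv filter_empty_conv\<close>)

sublocale Y2: art_sub W2 S2 m2 s2s W S m ss \<iota>2
  by unfold_locales (use C1.ss(2) C2.ss(2) disj in \<open>auto simp: filter_id_conv filter_empty_conv\<close>)

lemma S_K: "s \<in> S \<Longrightarrow> s \<in> K (col s)"
  using CP.gen_star .

lemma T_elliptic: "t \<in> C.T \<Longrightarrow> Z.elliptic t"
  unfolding C.T_def reflections_def using Z.elliptic_conj Z.elliptic_H S_K by blast

lemma all_True:
  assumes "s2s = []"
  shows "carrier W \<subseteq> K True" "carrier (artin_group S m) \<subseteq> AP.star True"
proof -
  have "S = \<iota>1 ` S1" using S_def C2.ss(2) assms by simp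
  then have e: "{s \<in> S. col s = True} = S" using col_sets by simp
  show "carrier W \<subseteq> K True"
  proof
    fix x assume "x \<in> carrier W"
    then obtain w where "word_over S w" "x = eval_word W (\<lambda>x. x) w" using C.pres unfolding pres_by_def by metis
    then show "x \<in> K True" unfolding CP.star_def e by blast
  qed
  show "carrier (artin_group S m) \<subseteq> AP.star True"
  proof
    fix x assume "x \<in> carrier (artin_group S m)"
    then obtain w where "word_over S w" "x = eval_word (artin_group S m) (artin_gen S m) w"
      using pres_artin[of S m] unfolding pres_by_def by metis
    then show "x \<in> AP.star True" unfolding AP.star_def e by blast
  qed
qed

lemma h2_ne_one: "s2s \<noteq> [] \<Longrightarrow> h2 \<noteq> \<one>\<^bsub>W\<^esub>"
  using C.fac_sub_nontrivial[of "map \<iota>1 s1s" "map \<iota>2 s2s" "[]"] C.fac_ss by (auto simp: h2_def)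

lemma h_carrier: "h1 \<in> carrier W" "h2 \<in> carrier W"
  using h Z.H_carrier by blast+

text \<open>The reduced path from the base vertex to its translate by \<open>h1 \<otimes> h2\<close>
  consists of the edges \<open>h1\<close> and \<open>h1 \<otimes> h2\<close>. A reduced forest
  therefore has one branch, with a leaf inside and a leaf outside, and moving the outer leaf to the
  front undoes the conjugation of the inner one by \<open>h1\<close>.\<close>

theorem split_factorization:
  assumes xs: "C.fac xs"
  shows "\<exists>as bs. heq W xs (as @ bs) \<and> set as \<subseteq> K True \<and> set bs \<subseteq> K False \<and> prodl W as = h1 \<and> prodl W bs = h2"
proof (cases "s2s = []")
  \<comment> \<open>Without a second factor the two edges coincide and the path is not
    reduced.\<close>
  case True
  have "set xs \<subseteq> carrier W" using xs C.T_closed by (simp add: C.fac_def)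
  moreover have e: "h2 = \<one>\<^bsub>W\<^esub>" unfolding h2_def using True by simp
  moreover have "prodl W xs = h1 \<otimes>\<^bsub>W\<^esub> h2" using xs h(3) by (simp only: C.fac_def)
  ultimately show ?thesis using all_True(1)[OF True] h_carrier(1) C.heq_refl
    by (intro exI[of _ xs] exI[of _ "[]"]) auto
next
  case False
  have xc: "set xs \<subseteq> carrier W" using xs C.T_closed by (simp add: C.fac_def)
  have px: "prodl W xs = h1 \<otimes>\<^bsub>W\<^esub> h2" using xs h(3) by (simp add: C.fac_def)
  have "C.nondegenerate xs" using Z.fac_nondegenerate xs Z_fac by simp
  moreover have "\<forall>x\<in>set xs. Z.elliptic x" using T_elliptic xs by (auto simp: C.fac_def)
  ultimately obtain f where f: "Z.forest True \<one>\<^bsub>W\<^esub> f" "heq W xs (flat f)" "distinct_adj (Z.trace f)"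
    using Z.reduced_forest by blast
  note T = Z.trace_path_end[OF f(1) C.one_closed]
  have pf: "prodl W (flat f) = h1 \<otimes>\<^bsub>W\<^esub> h2" using C.heq_prodl[OF f(2)] px by simp
  have hc: "h1 \<otimes>\<^bsub>W\<^esub> h2 \<in> carrier W" using h_carrier by simp
  have "inv\<^bsub>W\<^esub> h1 \<otimes>\<^bsub>W\<^esub> (h1 \<otimes>\<^bsub>W\<^esub> h2) = h2" using h_carrier by (simp add: C.m_assoc[symmetric])
  then have L: "Z.path True \<one>\<^bsub>W\<^esub> [h1, h1 \<otimes>\<^bsub>W\<^esub> h2]" using h h_carrier hc by simp
  have ne: "h1 \<noteq> h1 \<otimes>\<^bsub>W\<^esub> h2"
  proof
    assume "h1 = h1 \<otimes>\<^bsub>W\<^esub> h2"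
    then have "h1 \<otimes>\<^bsub>W\<^esub> h2 = h1 \<otimes>\<^bsub>W\<^esub> \<one>\<^bsub>W\<^esub>" using h_carrier by simp
    then show False using h2_ne_one[OF False] h_carrier C.l_cancel by blast
  qed
  have tr: "Z.trace f = [h1, h1 \<otimes>\<^bsub>W\<^esub> h2]"
    by (rule Z.path_unique[of True "\<one>\<^bsub>W\<^esub>"]) (use T L f(3) ne pf hc in auto)
  then obtain e t g where fb: "f = Branch e t g" by (cases f) auto
  then have "Z.trace t = []" "Z.trace g = []" using tr by (cases "Z.trace t"; cases "Z.trace g"; auto)+
  then obtain us rs where ug: "t = Leaf us" "g = Leaf rs" using Z.trace_eq_Nil by auto
  have e: "e = h1" "prodl W us \<otimes>\<^bsub>W\<^esub> h1 = h1 \<otimes>\<^bsub>W\<^esub> h2" using tr fb ug by auto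
  have us: "set us \<subseteq> carrier W" "\<forall>x\<in>set us. inv\<^bsub>W\<^esub> h1 \<otimes>\<^bsub>W\<^esub> x \<otimes>\<^bsub>W\<^esub> h1 \<in> K False"
    and rs: "set rs \<subseteq> carrier W" "\<forall>x\<in>set rs. inv\<^bsub>W\<^esub> \<one>\<^bsub>W\<^esub> \<otimes>\<^bsub>W\<^esub> x \<otimes>\<^bsub>W\<^esub> \<one>\<^bsub>W\<^esub> \<in> K True"
    using f(1) unfolding fb ug by (auto simp: e(1))
  have pc: "prodl W us \<in> carrier W" "prodl W rs \<in> carrier W" using us rs by auto
  have rs': "set rs \<subseteq> K True"
  proof
    fix x assume x: "x \<in> set rs"
    then have "x \<in> carrier W" using rs(1) by blast
    then show "x \<in> K True" using rs(2) x by auto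
  qed
  have "prodl W us \<otimes>\<^bsub>W\<^esub> prodl W rs = h1 \<otimes>\<^bsub>W\<^esub> h2" using pf fb ug us rs by (simp add: C.prodl_append)
  then have "prodl W us \<otimes>\<^bsub>W\<^esub> prodl W rs = prodl W us \<otimes>\<^bsub>W\<^esub> h1" using e(2) by simp
  then have prs: "prodl W rs = h1" using pc h_carrier by simp
  let ?bs = "map (conjg W (inv\<^bsub>W\<^esub> h1)) us"
  have "heq W (us @ rs) (rs @ ?bs)" using C.heq_move'[OF us(1) rs(1)] prs by simp
  then have hq: "heq W xs (rs @ ?bs)" using f(2) fb ug C.heq_trans by simp
  have bs: "set ?bs \<subseteq> K False" using us(2) h_carrier by (auto simp: conjg_def)
  have bc: "set ?bs \<subseteq> carrier W" using us(1) h_carrier by auto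
  have "prodl W rs \<otimes>\<^bsub>W\<^esub> prodl W ?bs = h1 \<otimes>\<^bsub>W\<^esub> h2"
    using C.heq_prodl[OF hq] px C.prodl_append[OF rs(1) bc] by simp
  moreover have "prodl W ?bs \<in> carrier W" using C.prodl_closed[OF bc] .
  ultimately have "prodl W ?bs = h2" using prs h_carrier by simp
  then show ?thesis using hq rs' bs prs by blast
qed

end

locale pan_factors = coxeter_free_product +
  assumes pan1: "pan_transitive W1 C1.T (prodl W1 s1s)"
    and pan2: "pan_transitive W2 C2.T (prodl W2 s2s)"
begin

text \<open>Each half is at least as long as the rank of its factor, and the total length is the sum
  of the ranks. Both halves are thus reduced, and transitivity in the factors applies to them
  separately.\<close>

theorem standard:
  assumes xs: "C.fac xs"
  shows "heq W ss xs"
proof -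
  obtain as bs where ab: "heq W xs (as @ bs)" "set as \<subseteq> K True" "set bs \<subseteq> K False" "prodl W as = h1" "prodl W bs = h2"
    using split_factorization[OF xs] by blast
  have f: "C.fac (as @ bs)" using C.fac_heq[OF xs ab(1)] .
  then have T: "set as \<subseteq> C.T" "set bs \<subseteq> C.T" by (auto simp: C.fac_def)
  have st: "set as \<subseteq> X1.st" "set bs \<subseteq> X2.st" using ab K_emb by (auto simp: X1.st_def X2.st_def)
  have p: "prodl W as = P1.emb (prodl W1 s1s)" "prodl W bs = P2.emb (prodl W2 s2s)" using ab emb_h by auto
  have "length as + length bs = length s1s + length s2s" using f by (simp add: C.fac_def)
  then have l: "length as = length s1s" "length bs = length s2s"
    using X1.st_length(1)[OF T(1) st(1) p(1)] X2.st_length(1)[OF T(2) st(2) p(2)] by auto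
  have "heq W (as @ bs) ss"
    using C.heq_append[OF X1.st_standard[OF pan1 T(1) st(1) p(1) l(1)] X2.st_standard[OF pan2 T(2) st(2) p(2) l(2)]]
    unfolding emb_ss .
  then show ?thesis using C.heq_sym C.heq_trans ab(1) by blast
qed

lemma K_transitive:
  assumes "C.fac (us @ rs @ ws)" "C.fac (us' @ rs' @ ws')" "set rs \<subseteq> K d" "set rs' \<subseteq> K d"
    "prodl W rs = prodl W rs'"
  shows "heq W rs rs'"
proof (cases d)
  case True
  then show ?thesis using X1.sub_transitive[OF pan1 standard assms(1,2)] assms(3-5) K_emb by (simp add: X1.st_def)
next
  case False
  then show ?thesis using X2.sub_transitive[OF pan2 standard assms(1,2)] assms(3-5) K_emb by (simp add: X2.st_def)
qed

end

section \<open>Braids that fix the Coxeter word\<close>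

locale stable_factors = coxeter_free_product +
  assumes ws1: "\<And>w. braid_word (length s1s) w \<Longrightarrow> hurwitz W1 w s1s = s1s \<Longrightarrow>
      hurwitz (artin_group S1 m1) w C1.art_ss = C1.art_ss"
    and ws2: "\<And>w. braid_word (length s2s) w \<Longrightarrow> hurwitz W2 w s2s = s2s \<Longrightarrow>
      hurwitz (artin_group S2 m2) w C2.art_ss = C2.art_ss"
begin

lemma art_hom_star: "x \<in> AP.star c \<Longrightarrow> C.art_hom x \<in> K c"
proof -
  assume "x \<in> AP.star c"
  then obtain w where w: "word_over {s \<in> S. col s = c} w" "x = eval_word (artin_group S m) (artin_gen S m) w"
    unfolding AP.star_def by blast
  have "C.art_hom x = eval_word W (C.art_hom \<circ> artin_gen S m) w"
    unfolding w(2) by (rule hom_eval_word[OF C.art_group C.group_axioms C.art_hom(1) _ w(1)]) (use C.art_gen_carrier in auto)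
  also have "\<dots> = eval_word W (\<lambda>x. x) w"
    by (rule eval_word_cong) (use w(1) C.art_hom(2) in \<open>auto simp: word_over_def\<close>)
  finally show ?thesis using w(1) unfolding CP.star_def by blast
qed

sublocale AL: lift W K C.T h1 h2 "length ss" "artin_group S m" AP.star C.art_hom
  by (intro lift.intro lift_axioms.intro Z.factorized_axioms AP.free_prod_star C.art_hom(1))

lemma art_gen_star: "s \<in> S \<Longrightarrow> artin_gen S m s \<in> AP.star (col s)"
  using AP.gen_star .

text \<open>The chain of crossings from \<open>g1\<close> to \<open>g1 \<otimes> g2\<close> has to
  spell an element of a single factor, so it consists of one link. Hence nothing cancels between the
  walks of the two halves: the first half stays at the base vertex and the second makes one
  excursion.\<close>

theorem artin_split:
  assumes w: "hurwitz W w ss = ss" "braid_word (length ss) w"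
    and Y: "hurwitz (artin_group S m) w C.art_ss = Y1 @ Y2" "length Y1 = length s1s"
  shows "set Y1 \<subseteq> AP.star True \<and> set Y2 \<subseteq> AP.star False"
proof -
  let ?A = "artin_group S m"
  have heqY: "heq ?A C.art_ss (Y1 @ Y2)" unfolding heq_def using w(2) Y(1) C.art_ss_carrier by auto
  have Yc: "set Y1 \<subseteq> carrier ?A" "set Y2 \<subseteq> carrier ?A" using A1.G.heq_carrier[OF heqY] by auto
  have "map C.art_hom (Y1 @ Y2) = ss"
    using hurwitz_map_hom[OF C.art_group C.group_axioms C.art_hom(1) C.art_ss_carrier, of w]
    unfolding Y(1) C.art_hom_ss w(1) by (rule sym)
  then have mY: "map C.art_hom Y1 = map \<iota>1 s1s" "map C.art_hom Y2 = map \<iota>2 s2s"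
    using Y(2) by (auto simp: append_eq_append_conv)
  show ?thesis
  proof (cases "s2s = []")
    case True
    then have "length (Y1 @ Y2) = length Y1" using heq_length[OF heqY] Y(2) by simp
    then have "Y2 = []" by simp
    then show ?thesis using all_True(2)[OF True] Yc by auto
  next
    case False
    define g1 where "g1 = prodl ?A (map (artin_gen S m) (map \<iota>1 s1s))"
    define g2 where "g2 = prodl ?A (map (artin_gen S m) (map \<iota>2 s2s))"
    have sub: "set (map \<iota>1 s1s) \<subseteq> S" "set (map \<iota>2 s2s) \<subseteq> S" using C.ss(2) by auto
    have cl: "\<And>s. s \<in> set (map \<iota>1 s1s) \<Longrightarrow> col s" "\<And>s. s \<in> set (map \<iota>2 s2s) \<Longrightarrow> \<not> col s"
      using C1.ss(2) C2.ss(2) disj by (auto simp: col_def)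
    have s1: "set (map (artin_gen S m) (map \<iota>1 s1s)) \<subseteq> AP.star True"
      using art_gen_star cl(1) sub(1) by fastforce
    have s2: "set (map (artin_gen S m) (map \<iota>2 s2s)) \<subseteq> AP.star False"
      using art_gen_star cl(2) sub(2) by fastforce
    have g: "g1 \<in> AP.star True" "g2 \<in> AP.star False"
      unfolding g1_def g2_def using AL.G.prodl_in_H s1 s2 by blast+
    then have gc: "g1 \<in> carrier ?A" "g2 \<in> carrier ?A" using AP.star_carrier by blast+
    have mh: "map C.art_hom (map (artin_gen S m) xs) = xs" if "set xs \<subseteq> S" for xs
      using that C.art_hom(2) by (auto intro!: map_idI)
    have cc: "set (map (artin_gen S m) xs) \<subseteq> carrier ?A" if "set xs \<subseteq> S" for xs
      using that C.art_gen_carrier by auto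
    have hg: "C.art_hom g1 = h1" "C.art_hom g2 = h2"
      unfolding g1_def g2_def h1_def h2_def
        hom_prodl[OF C.art_group C.group_axioms C.art_hom(1) cc[OF sub(1)]]
        hom_prodl[OF C.art_group C.group_axioms C.art_hom(1) cc[OF sub(2)]] mh[OF sub(1)] mh[OF sub(2)]
      by (rule refl)+
    have pY: "prodl ?A (Y1 @ Y2) = g1 \<otimes>\<^bsub>?A\<^esub> g2"
      using A1.G.heq_prodl[OF heqY] A1.G.prodl_append[OF cc[OF sub(1)] cc[OF sub(2)]] by (simp add: g1_def g2_def)
    have ell: "\<forall>y\<in>set (Y1 @ Y2). AL.G.elliptic y"
      by (rule AL.G.elliptic_heq[OF heqY]) (use AL.G.elliptic_H s1 s2 in auto)
    have hgg: "C.art_hom (g1 \<otimes>\<^bsub>?A\<^esub> g2) = h1 \<otimes>\<^bsub>W\<^esub> h2" using hom_mult[OF C.art_hom(1) gc] hg by simp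
    have h2ne: "h2 \<noteq> \<one>\<^bsub>W\<^esub>" using h2_ne_one[OF False] .
    have hne: "h1 \<noteq> h1 \<otimes>\<^bsub>W\<^esub> h2"
    proof
      assume "h1 = h1 \<otimes>\<^bsub>W\<^esub> h2"
      then have "h1 \<otimes>\<^bsub>W\<^esub> h2 = h1 \<otimes>\<^bsub>W\<^esub> \<one>\<^bsub>W\<^esub>" using h_carrier by simp
      then show False using h2ne h_carrier C.l_cancel by blast
    qed
    have "inv\<^bsub>?A\<^esub> g1 \<otimes>\<^bsub>?A\<^esub> (g1 \<otimes>\<^bsub>?A\<^esub> g2) = g2" using gc by (simp add: A1.G.m_assoc[symmetric])
    then have L: "AL.G.path True \<one>\<^bsub>?A\<^esub> [g1, g1 \<otimes>\<^bsub>?A\<^esub> g2]" using g gc by simp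
    have L2: "g1 \<noteq> g1 \<otimes>\<^bsub>?A\<^esub> g2" using hne hg(1) hgg by metis
    have L3: "inv\<^bsub>?A\<^esub> (g1 \<otimes>\<^bsub>?A\<^esub> g2) \<otimes>\<^bsub>?A\<^esub> prodl ?A (Y1 @ Y2) \<in> AP.star True"
      unfolding pY using gc by simp
    have fac: "Z.fac (map C.art_hom Y1 @ map C.art_hom Y2)" unfolding mY Z_fac by (rule C.fac_ss)
    have KY: "set (map C.art_hom Y1) \<subseteq> K True" "set (map C.art_hom Y2) \<subseteq> K False"
      unfolding mY using S_K sub cl by fastforce+
    have ph: "prodl W (map C.art_hom Y1) = h1" unfolding mY h1_def ..
    obtain f A B A' where d: "AL.data g1 (g1 \<otimes>\<^bsub>?A\<^esub> g2) (prodl ?A Y1) f A B A'"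
      "heq ?A Y1 (flat (f True))" "heq ?A Y2 (flat (f False))"
      using AL.data_exists[OF ell fac KY ph L L2 L3] by blast
    interpret D: lift_data W K C.T h1 h2 "length ss" ?A AP.star C.art_hom g1 "g1 \<otimes>\<^bsub>?A\<^esub> g2" "prodl ?A Y1" f A B A'
      by (intro lift_data.intro lift_data_axioms.intro AL.lift_axioms d(1))
    interpret K': free_prod W Z.K' by (rule Z.free_prod_conj[OF Z.h1_carrier])
    from D.normal_form obtain vs zs where "chain D.R D.c0 (g1 # vs)" "distinct (g1 # vs)"
      "distinct (map C.art_hom (g1 # vs))" and v6: "vs \<noteq> []" "last vs = g1 \<otimes>\<^bsub>?A\<^esub> g2"
      and v1: "set (g1 # vs) = set A \<union> set B \<union> set A'"
      and "\<forall>c x y. D.R c x y \<longrightarrow> (\<exists>i<length vs. c = (even i = D.c0) \<and>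
          ({x, y} = {(g1 # vs) ! i, (g1 # vs) ! Suc i}))"
      and v2: "alternating W Z.K' D.c0 zs" "length zs = length vs"
        "C.art_hom g1 = prodl W zs \<otimes>\<^bsub>W\<^esub> C.art_hom (g1 \<otimes>\<^bsub>?A\<^esub> g2)"
      and "map C.art_hom (g1 # vs) = chase.walk W zs (C.art_hom g1)"
      and v5: "(g1 \<otimes>\<^bsub>?A\<^esub> g2 \<in> set A) = (odd (length vs) = D.c0)"
      by (elim exE conjE)
    note v = v1 v2 v5 v6
    \<comment> \<open>The quotient of the positions \<open>h1\<close> and
      \<open>h1 \<otimes> h2\<close>, a single letter of the conjugated second factor.\<close>
    let ?c = "conjg W h1 (inv\<^bsub>W\<^esub> h2)"
    have pz: "prodl W zs \<in> carrier W" using K'.alternating_carrier[OF v(2)] by blast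
    have "?c \<otimes>\<^bsub>W\<^esub> (h1 \<otimes>\<^bsub>W\<^esub> h2) = h1"
      using h_carrier by (simp add: conjg_def C.m_assoc) (simp add: C.m_assoc[symmetric])
    then have "prodl W zs \<otimes>\<^bsub>W\<^esub> (h1 \<otimes>\<^bsub>W\<^esub> h2) = ?c \<otimes>\<^bsub>W\<^esub> (h1 \<otimes>\<^bsub>W\<^esub> h2)" using v(4) hg(1) hgg by simp
    then have "prodl W zs = ?c" using pz h_carrier by simp
    then have "prodl W zs = prodl W [?c]" using h_carrier by simp
    moreover have "alternating W Z.K' False [?c]"
    proof -
      have "?c \<in> Z.K' False" using Z.H_inv[OF h(2)] by blast
      moreover have "?c \<noteq> \<one>\<^bsub>W\<^esub>"
        using C.conjg_eq_one_iff[OF h_carrier(1), of "inv\<^bsub>W\<^esub> h2"] h2ne h_carrier by (metis C.inv_closed C.inv_inv C.inv_one)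
      ultimately show ?thesis by simp
    qed
    ultimately have z: "zs = [?c]" "D.c0 = False"
      using K'.alternating_unique[OF v(2)] by blast+
    have "length vs = 1" using v(3) z(1) by simp
    then have vs: "vs = [g1 \<otimes>\<^bsub>?A\<^esub> g2]" using v(6,7) by (cases vs) auto
    have "g1 \<notin> set A" "g1 \<otimes>\<^bsub>?A\<^esub> g2 \<notin> set A" using z(2) v(5) vs by auto
    then have "x \<notin> set A" for x using D.ends(1) by (metis UnI1 insertE singletonD)
    then have A0: "A = []" by (cases A) auto
    have A': "A' = [g1, g1 \<otimes>\<^bsub>?A\<^esub> g2]" using D.AA' A0 by simp
    have "set B \<subseteq> set (g1 # vs)" unfolding v(1) by blast
    also have "set (g1 # vs) = set A'" unfolding vs A' by simp
    finally have "set B \<subseteq> set A'" .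
    moreover have "set B \<inter> set A' = {}" using D.dAB(2) by simp
    ultimately have "set B = {}" by (metis Int_absorb2)
    then have B0: "B = []" by simp
    have tF: "AL.G.trace (f True) = []"
      "map ((\<otimes>\<^bsub>?A\<^esub>) (prodl ?A Y1)) (AL.G.trace (f False)) = [g1, g1 \<otimes>\<^bsub>?A\<^esub> g2]"
      using D.tr unfolding A0 B0 A' by auto
    obtain e t q where fF: "f False = Branch e t q" using tF(2) by (cases "f False") auto
    have "AL.G.trace t = []" "AL.G.trace q = []"
      using tF(2) unfolding fF by (cases "AL.G.trace t"; cases "AL.G.trace q"; auto)+
    then obtain rs us rs2 where lv: "f True = Leaf rs" "t = Leaf us" "q = Leaf rs2"
      using tF(1) AL.G.trace_eq_Nil by metis
    have eq: "prodl ?A Y1 \<otimes>\<^bsub>?A\<^esub> e = g1"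
      "prodl ?A Y1 \<otimes>\<^bsub>?A\<^esub> (prodl ?A us \<otimes>\<^bsub>?A\<^esub> e) = g1 \<otimes>\<^bsub>?A\<^esub> g2"
      using tF(2) unfolding fF lv by simp_all
    have fo: "AL.G.forest True \<one>\<^bsub>?A\<^esub> (Leaf rs)" "AL.G.forest True \<one>\<^bsub>?A\<^esub> (Branch e (Leaf us) (Leaf rs2))"
      using D.forest[of True] D.forest[of False] lv fF by auto
    have star1: "x \<in> AP.star True" if "AL.G.forest True \<one>\<^bsub>?A\<^esub> (Leaf xs)" "x \<in> set xs" for x xs
    proof -
      have "x \<in> carrier ?A" "inv\<^bsub>?A\<^esub> \<one>\<^bsub>?A\<^esub> \<otimes>\<^bsub>?A\<^esub> x \<otimes>\<^bsub>?A\<^esub> \<one>\<^bsub>?A\<^esub> \<in> AP.star True" using that by auto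
      then show ?thesis by simp
    qed
    have e: "e \<in> carrier ?A" and us: "set us \<subseteq> carrier ?A" "\<forall>x\<in>set us. inv\<^bsub>?A\<^esub> e \<otimes>\<^bsub>?A\<^esub> x \<otimes>\<^bsub>?A\<^esub> e \<in> AP.star False"
      using fo(2) by auto
    \<comment> \<open>A letter here fixes the base vertex and belongs to the second half, so its
      image lies in both factors and is trivial; a reduced factorization has no trivial
      letter.\<close>
    have "rs2 = []"
    proof (rule ccontr)
      assume "rs2 \<noteq> []"
      then obtain x where x: "x \<in> set rs2" by (cases rs2) auto
      then have "C.art_hom x \<in> K True" using art_hom_star star1[of rs2 x] fo(2) by simp
      moreover have "C.art_hom x \<in> K False" using D.flat_K[of False] x fF lv by auto
      ultimately have "C.art_hom x = \<one>\<^bsub>W\<^esub>" using Z.H_disjoint by blast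
      moreover have "C.art_hom x \<in> set D.Z" using x fF lv by (simp add: D.Z_def)
      ultimately show False using C.fac_ne_one D.facZ Z_fac by metis
    qed
    then have fl: "heq ?A Y1 rs" "heq ?A Y2 us" using d(2,3) fF lv by auto
    have pus: "prodl ?A us \<in> carrier ?A" "prodl ?A Y1 \<in> carrier ?A" using us Yc by auto
    have "prodl ?A Y1 \<otimes>\<^bsub>?A\<^esub> prodl ?A us = g1 \<otimes>\<^bsub>?A\<^esub> g2"
      using pY A1.G.heq_prodl[OF fl(2)] Yc by (simp add: A1.G.prodl_append)
    then have "prodl ?A Y1 \<otimes>\<^bsub>?A\<^esub> (prodl ?A us \<otimes>\<^bsub>?A\<^esub> e) = prodl ?A Y1 \<otimes>\<^bsub>?A\<^esub> (prodl ?A us \<otimes>\<^bsub>?A\<^esub> \<one>\<^bsub>?A\<^esub>)"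
      using eq(2) pus by simp
    then have "e = \<one>\<^bsub>?A\<^esub>" using pus e by simp
    have us': "set us \<subseteq> AP.star False"
    proof
      fix x assume x: "x \<in> set us"
      have "inv\<^bsub>?A\<^esub> \<one>\<^bsub>?A\<^esub> \<otimes>\<^bsub>?A\<^esub> x \<otimes>\<^bsub>?A\<^esub> \<one>\<^bsub>?A\<^esub> \<in> AP.star False"
        using us(2) x unfolding \<open>e = \<one>\<^bsub>?A\<^esub>\<close> by (rule bspec)
      then show "x \<in> AP.star False" using subsetD[OF us(1) x] by simp
    qed
    have rs': "set rs \<subseteq> AP.star True" using star1[OF fo(1)] by blast
    show ?thesis
      using A1.G.heq_subgroup[OF A1.G.heq_sym[OF fl(1)] AL.G.H_subgroup rs']
        A1.G.heq_subgroup[OF A1.G.heq_sym[OF fl(2)] AL.G.H_subgroup us'] by blast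
  qed
qed

text \<open>Once the halves lie in different factors, each retraction kills one half and no letter
  of the other, so the braid can be judged in each factor separately.\<close>

theorem artin_stable:
  assumes w: "hurwitz W w ss = ss" "braid_word (length ss) w"
  shows "hurwitz (artin_group S m) w C.art_ss = C.art_ss"
proof -
  let ?A = "artin_group S m"
  define Y where "Y = hurwitz ?A w C.art_ss"
  define Y1 where "Y1 = take (length s1s) Y"
  define Y2 where "Y2 = drop (length s1s) Y"
  have YY: "hurwitz ?A w C.art_ss = Y1 @ Y2" "length Y1 = length s1s"
    by (simp_all add: Y1_def Y2_def Y_def)
  have heqY: "heq ?A C.art_ss (Y1 @ Y2)" unfolding heq_def using w(2) YY(1) C.art_ss_carrier by auto
  have Yc: "set Y1 \<subseteq> carrier ?A" "set Y2 \<subseteq> carrier ?A" using A1.G.heq_carrier[OF heqY] by auto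
  have st: "set Y1 \<subseteq> AP.star True" "set Y2 \<subseteq> AP.star False" using artin_split[OF w YY] by auto
  have "map C.art_hom (Y1 @ Y2) = ss"
    using hurwitz_map_hom[OF C.art_group C.group_axioms C.art_hom(1) C.art_ss_carrier, of w]
    unfolding YY(1) C.art_hom_ss w(1) by (rule sym)
  then have mY: "map C.art_hom Y1 = map \<iota>1 s1s" "map C.art_hom Y2 = map \<iota>2 s2s"
    using YY(2) by (auto simp: append_eq_append_conv)
  have n1: "A1.ret y \<noteq> \<one>\<^bsub>artin_group S1 m1\<^esub>" if y: "y \<in> set Y1" for y
  proof
    assume "A1.ret y = \<one>\<^bsub>artin_group S1 m1\<^esub>"
    then have "P1.ret (C.art_hom y) = \<one>\<^bsub>W1\<^esub>"
      using Y1.art_hom_ret[of y] hom_one[OF C1.art_hom(1) C1.art_group C1.group_axioms] y Yc by auto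
    moreover have "C.art_hom y \<in> \<iota>1 ` S1" using mY(1) y C1.ss(2) by (metis image_eqI image_set)
    ultimately show False using P1.ret(2) C1.T_ne_one C1.S_T by fastforce
  qed
  have n2: "A2.ret y \<noteq> \<one>\<^bsub>artin_group S2 m2\<^esub>" if y: "y \<in> set Y2" for y
  proof
    assume "A2.ret y = \<one>\<^bsub>artin_group S2 m2\<^esub>"
    then have "P2.ret (C.art_hom y) = \<one>\<^bsub>W2\<^esub>"
      using Y2.art_hom_ret[of y] hom_one[OF C2.art_hom(1) C2.art_group C2.group_axioms] y Yc by auto
    moreover have "C.art_hom y \<in> \<iota>2 ` S2" using mY(2) y C2.ss(2) by (metis image_eqI image_set)
    ultimately show False using P2.ret(2) C2.T_ne_one C2.S_T by fastforce
  qed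
  have o1: "A1.ret y = \<one>\<^bsub>artin_group S1 m1\<^esub>" if "y \<in> set Y2" for y
    using that st(2) A1.ret_other S_minus(1) unfolding AP.star_def col_sets by auto
  have o2: "A2.ret y = \<one>\<^bsub>artin_group S2 m2\<^esub>" if "y \<in> set Y1" for y
    using that st(1) A2.ret_other S_minus(2) unfolding AP.star_def col_sets by auto
  have "Y1 = map (artin_gen S m) (map \<iota>1 s1s)"
  proof (rule Y1.recover_generators[OF ws1 heqY])
    show "filter (\<lambda>x. x \<noteq> \<one>\<^bsub>artin_group S1 m1\<^esub>) (map A1.ret (Y1 @ Y2)) = map A1.ret Y1"
      using n1 o1 by (auto simp: filter_id_conv filter_empty_conv)
    show "set Y1 \<subseteq> A1.emb ` carrier (artin_group S1 m1)" using st(1) AK_emb by simp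
  qed (use mY in auto)
  moreover have "Y2 = map (artin_gen S m) (map \<iota>2 s2s)"
  proof (rule Y2.recover_generators[OF ws2 heqY])
    show "filter (\<lambda>x. x \<noteq> \<one>\<^bsub>artin_group S2 m2\<^esub>) (map A2.ret (Y1 @ Y2)) = map A2.ret Y2"
      using n2 o2 by (auto simp: filter_id_conv filter_empty_conv)
    show "set Y2 \<subseteq> A2.emb ` carrier (artin_group S2 m2)" using st(2) AK_emb by simp
  qed (use mY in auto)
  ultimately show ?thesis using YY(1) by simp
qed

end

section \<open>The double of the Coxeter group\<close>

context coxeter_free_product
begin

definition dbl_rel :: "(('c + 'c) \<times> bool) list set" where
  "dbl_rel = map_word Inl ` coxeter_relators S m \<union> map_word Inr ` coxeter_relators S m"

definition dbl :: "(('c + 'c) \<times> bool) list set monoid" where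
  "dbl = presented_group (S <+> S) dbl_rel"

lemma pres_dbl: "pres_by dbl (pres_gen dbl_rel) (S <+> S) dbl_rel"
  unfolding dbl_def
proof (rule pres_by_presented_group)
  fix r assume "r \<in> dbl_rel"
  then obtain q where "q \<in> coxeter_relators S m" "r = map_word Inl q \<or> r = map_word Inr q"
    unfolding dbl_rel_def by blast
  then have "word_over (Inl ` S) r \<or> word_over (Inr ` S) r"
    using word_over_map_word C.coxeter_relators_over by blast
  then show "word_over (S <+> S) r" by (auto simp: word_over_def)
qed

lemma map_word_letters: "fst ` set (map_word \<iota> w) = \<iota> ` fst ` set w"
  by (force simp: map_word_def)

lemma map_word_disjoint: "fst ` set (map_word Inr w) \<inter> Inl ` A = {}" "fst ` set (map_word Inl w) \<inter> Inr ` A = {}"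
  unfolding map_word_letters by auto

sublocale D1: pres_factor W "\<lambda>x. x" S "coxeter_relators S m" dbl "pres_gen dbl_rel" "S <+> S" dbl_rel Inl
proof (unfold_locales)
  fix r assume "r \<in> dbl_rel"
  then consider (a) q where "q \<in> coxeter_relators S m" "r = map_word Inl q" | (b) q where "r = map_word Inr q"
    unfolding dbl_rel_def by blast
  then show "(\<exists>r'\<in>coxeter_relators S m. r = map_word Inl r') \<or> fst ` set r \<inter> Inl ` S = {}"
  proof cases
    case (b q)
    then show ?thesis using map_word_disjoint by metis
  qed blast
qed (use C.pres pres_dbl in \<open>auto simp: dbl_rel_def\<close>)

sublocale D2: pres_factor W "\<lambda>x. x" S "coxeter_relators S m" dbl "pres_gen dbl_rel" "S <+> S" dbl_rel Inr
proof (unfold_locales)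
  fix r assume "r \<in> dbl_rel"
  then consider (a) q where "q \<in> coxeter_relators S m" "r = map_word Inr q" | (b) q where "r = map_word Inl q"
    unfolding dbl_rel_def by blast
  then show "(\<exists>r'\<in>coxeter_relators S m. r = map_word Inr r') \<or> fst ` set r \<inter> Inr ` S = {}"
  proof cases
    case (b q)
    then show ?thesis using map_word_disjoint by metis
  qed blast
qed (use C.pres pres_dbl in \<open>auto simp: dbl_rel_def\<close>)

sublocale DP: coloured_presentation dbl "pres_gen dbl_rel" "S <+> S" dbl_rel isl
proof (unfold_locales)
  fix r assume "r \<in> dbl_rel"
  then consider (a) q where "r = map_word Inl q" | (b) q where "r = map_word Inr q" unfolding dbl_rel_def by blast
  then show "\<exists>c. \<forall>x\<in>fst ` set r. isl x = c"
  proof cases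
    case (a q)
    then have "\<forall>x\<in>fst ` set r. isl x = True" by (simp add: map_word_letters)
    then show ?thesis ..
  next
    case (b q)
    then have "\<forall>x\<in>fst ` set r. isl x = False" by (simp add: map_word_letters)
    then show ?thesis ..
  qed
qed (rule pres_dbl)

lemma dbl_sets: "{g \<in> S <+> S. isl g = True} = Inl ` S" "{g \<in> S <+> S. isl g = False} = Inr ` S"
  "(S <+> S) - Inl ` S = Inr ` S"
  by auto

lemma DK_emb: "DP.star True = D1.emb ` carrier W" "DP.star False = D2.emb ` carrier W"
  unfolding DP.star_def dbl_sets D1.star_emb D2.star_emb by (rule refl)+

definition fold_dbl :: "(('c + 'c) \<times> bool) list set \<Rightarrow> 'c" where
  "fold_dbl = (SOME F. F \<in> hom dbl W \<and> (\<forall>g\<in>S <+> S. F (pres_gen dbl_rel g) = case_sum (\<lambda>x. x) (\<lambda>x. x) g))"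

lemma fold_dbl: "fold_dbl \<in> hom dbl W" "g \<in> S <+> S \<Longrightarrow> fold_dbl (pres_gen dbl_rel g) = case_sum (\<lambda>x. x) (\<lambda>x. x) g"
proof -
  have "\<exists>F\<in>hom dbl W. \<forall>g\<in>S <+> S. F (pres_gen dbl_rel g) = case_sum (\<lambda>x. x) (\<lambda>x. x) g"
  proof (rule pres_by_hom_gen[OF pres_dbl C.group_axioms])
    fix r assume "r \<in> dbl_rel"
    then obtain q where "q \<in> coxeter_relators S m" "r = map_word Inl q \<or> r = map_word Inr q"
      unfolding dbl_rel_def by blast
    then show "eval_word W (case_sum (\<lambda>x. x) (\<lambda>x. x)) r = \<one>\<^bsub>W\<^esub>"
      using P1.relator_one(2) by (auto simp: eval_word_map_word comp_def)
  qed (use C.S_carrier in auto)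
  then have "\<exists>F. F \<in> hom dbl W \<and> (\<forall>g\<in>S <+> S. F (pres_gen dbl_rel g) = case_sum (\<lambda>x. x) (\<lambda>x. x) g)" by blast
  from someI_ex[OF this] show "fold_dbl \<in> hom dbl W"
    "g \<in> S <+> S \<Longrightarrow> fold_dbl (pres_gen dbl_rel g) = case_sum (\<lambda>x. x) (\<lambda>x. x) g"
    unfolding fold_dbl_def by blast+
qed

lemma fold_gen: "s \<in> S \<Longrightarrow> fold_dbl (pres_gen dbl_rel (Inl s)) = s" "s \<in> S \<Longrightarrow> fold_dbl (pres_gen dbl_rel (Inr s)) = s"
  by (simp_all add: fold_dbl(2) InlI InrI)

lemma fold_emb: "x \<in> carrier W \<Longrightarrow> fold_dbl (D1.emb x) = x" "x \<in> carrier W \<Longrightarrow> fold_dbl (D2.emb x) = x"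
proof -
  have i: "(\<lambda>x. x) \<in> hom W W" by (simp add: hom_def)
  assume x: "x \<in> carrier W"
  have "(fold_dbl \<circ> D1.emb) x = x"
    by (rule pres_by_hom_eqI[OF C.pres C.group_axioms hom_compose[OF D1.emb(1) fold_dbl(1)] i _ x])
      (simp add: D1.emb(2) fold_gen)
  then show "fold_dbl (D1.emb x) = x" by simp
  have "(fold_dbl \<circ> D2.emb) x = x"
    by (rule pres_by_hom_eqI[OF C.pres C.group_axioms hom_compose[OF D2.emb(1) fold_dbl(1)] i _ x])
      (simp add: D2.emb(2) fold_gen)
  then show "fold_dbl (D2.emb x) = x" by simp
qed

end

context pan_factors
begin

sublocale DC: comparison W K C.T h1 h2 "length ss" dbl DP.star fold_dbl C.overlap
proof (intro comparison.intro comparison_axioms.intro ordered_lift.intro ordered_lift_axioms.intro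
    lift.intro lift_axioms.intro Z.factorized_axioms DP.free_prod_star fold_dbl(1))
  show "\<not> C.overlap (Z.seg xs a b) (Z.seg xs a' b')"
    if "Z.fac xs" "a < b" "b \<le> a'" "a' < b'" "b' \<le> length ss" for xs a b a' b'
    using C.segment_disjoint[of xs a b a' b'] that unfolding Z_fac Z_seg C.fac_def by blast
  show "C.overlap (Z.seg xs a b) (Z.seg xs a' b')"
    if "Z.fac xs" "a \<le> a'" "a' < b'" "b' \<le> b" "b \<le> length ss" for xs a b a' b'
    using C.segment_nested[of xs a a' b' b] that unfolding Z_fac Z_seg C.fac_def by blast
  show "heq W rs rs'"
    if "Z.fac (us @ rs @ ws)" "Z.fac (us' @ rs' @ ws')" "set rs \<subseteq> K d" "set rs' \<subseteq> K d" "prodl W rs = prodl W rs'"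
    for us rs ws us' rs' ws' d
    using K_transitive that unfolding Z_fac by blast
  show "inj_on fold_dbl (DP.star c)" for c
  proof (rule inj_onI)
    fix x y assume "x \<in> DP.star c" "y \<in> DP.star c" "fold_dbl x = fold_dbl y"
    then show "x = y" using DK_emb fold_emb by (cases c) auto
  qed
qed (use C.overlap_sym C.overlap_inv in auto)

text \<open>The braid that turns \<open>xs @ zs\<close> into the Coxeter word is applied to the
  doubled tuple. Its result lies over the Coxeter word, while the product still separates the two
  copies.\<close>

lemma double_lift:
  assumes "C.fac (xs @ zs)"
  shows "\<exists>Y1 Y2. heq dbl (map D1.emb xs @ map D2.emb zs) (Y1 @ Y2) \<and> map fold_dbl Y1 = map \<iota>1 s1s
    \<and> map fold_dbl Y2 = map \<iota>2 s2s \<and> (\<forall>y\<in>set (Y1 @ Y2). DC.G.elliptic y)"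
proof -
  have c: "set xs \<subseteq> carrier W" "set zs \<subseteq> carrier W" using assms C.T_closed by (auto simp: C.fac_def)
  let ?C = "map D1.emb xs @ map D2.emb zs"
  have Cc: "set ?C \<subseteq> carrier dbl" using c D1.emb_carrier D2.emb_carrier by auto
  have FC: "map fold_dbl ?C = xs @ zs" using c fold_emb by (auto intro!: map_idI)
  obtain w where w: "braid_word (length (xs @ zs)) w" "hurwitz W w (xs @ zs) = ss"
    using C.heq_sym[OF standard[OF assms]] by (auto simp: heq_def)
  define Y where "Y = hurwitz dbl w ?C"
  have h: "heq dbl ?C Y" unfolding heq_def Y_def using w(1) Cc by auto
  have m: "map fold_dbl Y = ss"
    using hurwitz_map_hom[OF D1.G.group_axioms C.group_axioms fold_dbl(1) Cc, of w] unfolding FC w(2) Y_def by (rule sym)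
  define Y1 where "Y1 = take (length s1s) Y"
  define Y2 where "Y2 = drop (length s1s) Y"
  have YY: "Y = Y1 @ Y2" by (simp add: Y1_def Y2_def)
  have "map fold_dbl Y1 = map \<iota>1 s1s" "map fold_dbl Y2 = map \<iota>2 s2s"
    unfolding Y1_def Y2_def take_map[symmetric] drop_map[symmetric] m by simp_all
  moreover have "\<forall>y\<in>set Y. DC.G.elliptic y"
  proof (rule DC.G.elliptic_heq[OF h], rule ballI)
    fix y assume "y \<in> set ?C"
    then have "y \<in> DP.star True \<or> y \<in> DP.star False" unfolding DK_emb using c by auto
    then show "DC.G.elliptic y" using DC.G.elliptic_H by blast
  qed
  ultimately show ?thesis using h YY by blast
qed

text \<open>Since \<open>zs\<close> is shared, the two doubled tuples have the same product and the
  comparison of lifts connects them. The retraction to the first copy turns the letters from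
  \<open>zs\<close> into identities and leaves \<open>xs\<close> and \<open>ys\<close>.\<close>

theorem interval_transitive:
  assumes p: "p \<in> interval W C.T (prodl W ss)" and xs: "xs \<in> red W C.T p" and ys: "ys \<in> red W C.T p"
  shows "heq W xs ys"
proof -
  let ?c = "inv\<^bsub>W\<^esub> p \<otimes>\<^bsub>W\<^esub> prodl W ss"
  have pc: "p \<in> carrier W" using p by (simp add: interval_def)
  have hc: "prodl W ss \<in> carrier W" using C.prodl_closed[OF C.ss_carrier] .
  have cc: "?c \<in> carrier W" using pc hc by (rule C.m_closed[OF C.inv_closed])
  obtain zs where zs: "zs \<in> red W C.T ?c" using C.red_exists[OF cc] by blast
  have fx: "C.fac (xs @ zs)" and fy: "C.fac (ys @ zs)" using C.interval_fac[OF p] xs ys zs by auto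
  have pz: "prodl W zs = ?c" "prodl W xs = p" "prodl W ys = p" using xs ys zs by (auto simp: C.red_iff)
  have wc: "set xs \<subseteq> carrier W" "set ys \<subseteq> carrier W" "set zs \<subseteq> carrier W"
    using fx fy C.T_closed by (auto simp: C.fac_def)
  show ?thesis
  proof (cases "?c = \<one>\<^bsub>W\<^esub>")
    \<comment> \<open>Without a complement the path between the two vertices would not be reduced;
      here \<open>xs\<close> and \<open>ys\<close> are factorizations of the Coxeter element
      itself.\<close>
    case True
    then have "zs = []" using C.fac_sub_nontrivial[of xs zs "[]"] fx pz(1) by simp
    then have "C.fac xs" "C.fac ys" using fx fy by auto
    then show ?thesis using standard C.heq_sym C.heq_trans by blast
  next
    case False
    obtain Y1 Y2 where Y: "heq dbl (map D1.emb xs @ map D2.emb zs) (Y1 @ Y2)" "map fold_dbl Y1 = map \<iota>1 s1s"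
      "map fold_dbl Y2 = map \<iota>2 s2s" "\<forall>y\<in>set (Y1 @ Y2). DC.G.elliptic y"
      using double_lift[OF fx] by blast
    obtain Y1' Y2' where Y': "heq dbl (map D1.emb ys @ map D2.emb zs) (Y1' @ Y2')" "map fold_dbl Y1' = map \<iota>1 s1s"
      "map fold_dbl Y2' = map \<iota>2 s2s" "\<forall>y\<in>set (Y1' @ Y2'). DC.G.elliptic y"
      using double_lift[OF fy] by blast
    let ?a = "D1.emb p" and ?b = "D2.emb ?c"
    have ab: "?a \<in> carrier dbl" "?b \<in> carrier dbl" using D1.emb_carrier D2.emb_carrier pc cc by auto
    have ec: "set (map D1.emb xs) \<subseteq> carrier dbl" "set (map D1.emb ys) \<subseteq> carrier dbl" "set (map D2.emb zs) \<subseteq> carrier dbl"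
      using wc D1.emb_carrier D2.emb_carrier by auto
    have e1: "prodl dbl (map D1.emb us) = D1.emb (prodl W us)" "prodl dbl (map D2.emb us) = D2.emb (prodl W us)"
      if "set us \<subseteq> carrier W" for us
      using hom_prodl[OF C.group_axioms D1.G.group_axioms D1.emb(1) that]
        hom_prodl[OF C.group_axioms D1.G.group_axioms D2.emb(1) that] by simp_all
    have pr: "prodl dbl (Y1 @ Y2) = ?a \<otimes>\<^bsub>dbl\<^esub> ?b" "prodl dbl (Y1' @ Y2') = ?a \<otimes>\<^bsub>dbl\<^esub> ?b"
      unfolding D1.G.heq_prodl[OF Y(1)] D1.G.heq_prodl[OF Y'(1)]
        D1.G.prodl_append[OF ec(1,3)] D1.G.prodl_append[OF ec(2,3)] e1(1)[OF wc(1)] e1(1)[OF wc(2)] e1(2)[OF wc(3)] pz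
      by (rule refl)+
    have bne: "?b \<noteq> \<one>\<^bsub>dbl\<^esub>"
      using fold_emb(2)[OF cc] False hom_one[OF fold_dbl(1) D1.G.group_axioms C.group_axioms] by metis
    have "inv\<^bsub>dbl\<^esub> ?a \<otimes>\<^bsub>dbl\<^esub> (?a \<otimes>\<^bsub>dbl\<^esub> ?b) = ?b" using ab by (simp add: D1.G.m_assoc[symmetric])
    moreover have "?a \<in> DP.star True" "?b \<in> DP.star False" unfolding DK_emb using pc cc by blast+
    ultimately have L: "DC.G.path True \<one>\<^bsub>dbl\<^esub> [?a, ?a \<otimes>\<^bsub>dbl\<^esub> ?b]" using ab by simp
    have L2: "?a \<noteq> ?a \<otimes>\<^bsub>dbl\<^esub> ?b"
    proof
      assume "?a = ?a \<otimes>\<^bsub>dbl\<^esub> ?b"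
      then have "?a \<otimes>\<^bsub>dbl\<^esub> ?b = ?a \<otimes>\<^bsub>dbl\<^esub> \<one>\<^bsub>dbl\<^esub>" using ab by simp
      then show False using bne ab D1.G.l_cancel D1.G.one_closed by blast
    qed
    have L3: "inv\<^bsub>dbl\<^esub> (?a \<otimes>\<^bsub>dbl\<^esub> ?b) \<otimes>\<^bsub>dbl\<^esub> prodl dbl (Y1 @ Y2) \<in> DP.star True"
      unfolding pr using ab by simp
    have K1: "set (map \<iota>1 s1s) \<subseteq> K True" "set (map \<iota>2 s2s) \<subseteq> K False"
    proof -
      have "col s" if "s \<in> set (map \<iota>1 s1s)" for s using that C1.ss(2) by (auto simp: col_def)
      moreover have "\<not> col s" if "s \<in> set (map \<iota>2 s2s)" for s using that C2.ss(2) disj C1.ss(2) by (auto simp: col_def)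
      ultimately show "set (map \<iota>1 s1s) \<subseteq> K True" "set (map \<iota>2 s2s) \<subseteq> K False"
        using S_K C.ss(2) by (metis (full_types) UnCI set_append subsetI)+
    qed
    have zf: "Z.fac (map \<iota>1 s1s @ map \<iota>2 s2s)" unfolding Z_fac by (rule C.fac_ss)
    have "heq dbl (Y1 @ Y2) (Y1' @ Y2')"
      by (rule DC.lifts_equivalent[OF Y(4) Y'(4) _ _ _ _ _ _ _ _ _ L L2 L3])
        (unfold Y(2,3) Y'(2,3) pr, use zf K1 in \<open>simp_all add: h1_def\<close>)
    then have "heq dbl (map D1.emb xs @ map D2.emb zs) (map D1.emb ys @ map D2.emb zs)"
      using D1.G.heq_trans[OF D1.G.heq_trans[OF Y(1)] D1.G.heq_sym[OF Y'(1)]] by blast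
    from C.heq_delete_ones[OF heq_map_hom[OF D1.G.group_axioms C.group_axioms D1.ret(1) this]]
    have h: "heq W (filter (\<lambda>x. x \<noteq> \<one>\<^bsub>W\<^esub>) (map D1.ret (map D1.emb xs @ map D2.emb zs)))
      (filter (\<lambda>x. x \<noteq> \<one>\<^bsub>W\<^esub>) (map D1.ret (map D1.emb ys @ map D2.emb zs)))" .
    have z1: "D1.ret (D2.emb z) = \<one>\<^bsub>W\<^esub>" if "z \<in> carrier W" for z
    proof -
      have "D2.emb z \<in> DP.star False" using that DK_emb(2) by blast
      then obtain w where "word_over (Inr ` S) w" "D2.emb z = eval_word dbl (pres_gen dbl_rel) w"
        unfolding DP.star_def dbl_sets by blast
      then show ?thesis using D1.ret_other unfolding dbl_sets by simp
    qed
    have fl: "filter (\<lambda>x. x \<noteq> \<one>\<^bsub>W\<^esub>) (map D1.ret (map D1.emb us @ map D2.emb zs)) = us"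
      if f: "C.fac (us @ zs)" for us
    proof -
      have c: "set us \<subseteq> carrier W" using f C.T_closed by (auto simp: C.fac_def)
      have "map D1.ret (map D1.emb us) = us" using c D1.ret_emb by (auto intro!: map_idI)
      moreover have "filter (\<lambda>x. x \<noteq> \<one>\<^bsub>W\<^esub>) us = us" using C.fac_ne_one[OF f] by (auto intro!: filter_True)
      moreover have "filter (\<lambda>x. x \<noteq> \<one>\<^bsub>W\<^esub>) (map D1.ret (map D2.emb zs)) = []"
        using z1 wc(3) by (auto simp: filter_empty_conv)
      ultimately show ?thesis by (simp only: map_append filter_append append_Nil2)
    qed
    show ?thesis using h unfolding fl[OF fx] fl[OF fy] .
  qed
qed

end

section \<open>Artin groups and dual Artin groups\<close>

lemma word_over_positive [simp]: "word_over Gen (map (\<lambda>t. (t, True)) ts) \<longleftrightarrow> set ts \<subseteq> Gen"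
  by (auto simp: word_over_def)

lemma eval_word_positive [simp]: "eval_word K \<theta> (map (\<lambda>t. (t, True)) ts) = prodl K (map \<theta> ts)"
  by (simp add: eval_word_def comp_def)

text \<open>The first entry is a quotient of successive alternating products, and the second is
  forced by the invariance of the product.\<close>

lemma (in group) hurwitz_alternate:
  assumes "a \<in> carrier G" "b \<in> carrier G"
  shows "hurwitz G (replicate k (0, True)) [a, b] =
    [alt_prod a b (Suc k) \<otimes> inv (alt_prod a b k), inv (alt_prod a b (Suc k) \<otimes> inv (alt_prod a b k)) \<otimes> (a \<otimes> b)]"
proof (induction k)
  case 0
  then show ?case using assms by (simp add: alt_prod_Suc m_assoc[symmetric])
next
  case (Suc k)
  let ?v = "\<lambda>k. alt_prod a b (Suc k) \<otimes> inv (alt_prod a b k)"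
  have v: "?v k \<in> carrier G" using assms by simp
  have "?v (Suc k) = a \<otimes> b \<otimes> inv (?v k)"
    using assms by (simp add: alt_prod_Suc[of a b "Suc k"] alt_prod_Suc[of b a k] inv_mult_group m_assoc)
  moreover have "?v k \<otimes> (inv (?v k) \<otimes> (a \<otimes> b)) \<otimes> inv (?v k) = a \<otimes> b \<otimes> inv (?v k)"
    using v assms by (simp add: m_assoc[symmetric])
  moreover have "inv (a \<otimes> b \<otimes> inv (?v k)) \<otimes> (a \<otimes> b) = ?v k"
    using v assms by (simp add: inv_mult_group m_assoc[symmetric] del: inv_closed) (simp add: m_assoc)
  ultimately have "hurwitz_step G (0, True) [?v k, inv (?v k) \<otimes> (a \<otimes> b)] = [?v (Suc k), inv (?v (Suc k)) \<otimes> (a \<otimes> b)]"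
    by (simp add: hurwitz_step_def)
  moreover have "replicate (Suc k) (0::nat, True) = replicate k (0, True) @ [(0, True)]"
    by (simp add: replicate_append_same)
  ultimately show ?case using Suc.IH
    by (simp only: hurwitz_append hurwitz_Cons hurwitz_Nil)
qed

text \<open>This translates a braid relation of length \<open>n\<close> into a stabilizer condition:
  the \<open>n\<close>-th power of a braid generator fixes the pair.\<close>

lemma (in group) hurwitz_alternate_fixed_iff:
  assumes "a \<in> carrier G" "b \<in> carrier G"
  shows "hurwitz G (replicate n (0, True)) [a, b] = [a, b] \<longleftrightarrow> alt_prod a b n = alt_prod b a n"
proof -
  let ?p = "alt_prod a b n" and ?q = "alt_prod b a n"
  have c: "?p \<in> carrier G" "?q \<in> carrier G" using assms by simp_all
  have e: "a \<otimes> ?q \<otimes> inv ?p = a \<longleftrightarrow> ?p = ?q"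
  proof
    assume "a \<otimes> ?q \<otimes> inv ?p = a"
    then have "a \<otimes> (?q \<otimes> inv ?p) = a \<otimes> \<one>" using assms c by (simp add: m_assoc)
    then have "?q \<otimes> inv ?p = \<one>" using assms c by (simp del: r_one)
    then show "?p = ?q" using c by (metis inv_closed inv_inv inv_equality)
  qed (use assms c in \<open>simp add: m_assoc\<close>)
  show ?thesis unfolding hurwitz_alternate[OF assms] alt_prod_Suc
  proof
    assume "?p = ?q"
    then have "a \<otimes> ?q \<otimes> inv ?p = a" using e by simp
    then show "[a \<otimes> ?q \<otimes> inv ?p, inv (a \<otimes> ?q \<otimes> inv ?p) \<otimes> (a \<otimes> b)] = [a, b]"
      using assms by (simp add: m_assoc[symmetric])
  qed (use e in simp)
qed

locale stable_transitive = coxeter +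
  assumes interval_transitive:
      "p \<in> interval W T (prodl W ss) \<Longrightarrow> xs \<in> red W T p \<Longrightarrow> ys \<in> red W T p \<Longrightarrow> heq W xs ys"
    and stable: "braid_word (length ss) w \<Longrightarrow> hurwitz W w ss = ss \<Longrightarrow>
      hurwitz (artin_group S m) w art_ss = art_ss"
begin

abbreviation h where "h \<equiv> prodl W ss"
abbreviation A where "A \<equiv> artin_group S m"
abbreviation D where "D \<equiv> dual_artin_group W T h"
abbreviation gens where "gens \<equiv> T \<inter> interval W T h"
abbreviation dl where "dl \<equiv> pres_gen (dual_relators W T h)"

sublocale A: group A by (rule art_group)
sublocale D: group D unfolding dual_artin_group_def by (rule group_presented_group)

lemma fac_transitive: "fac xs \<Longrightarrow> fac ys \<Longrightarrow> heq W xs ys"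
  using interval_transitive[OF sub_interval[of "[]" xs "[]"]] sub_red[of "[]" xs "[]"] sub_red[of "[]" ys "[]"]
  by (simp add: fac_def)

lemma fac_gens: "fac xs \<Longrightarrow> set xs \<subseteq> gens"
proof
  fix x assume x: "fac xs" "x \<in> set xs"
  then obtain us ws where xs: "xs = us @ [x] @ ws" using split_list by fastforce
  have "x \<in> T" using x by (auto simp: fac_def)
  moreover have "prodl W [x] = x" using T_carrier calculation by auto
  ultimately show "x \<in> gens" using sub_interval[of us "[x]" ws] x(1) xs by simp
qed

lemma red_extend: "a \<in> interval W T h \<Longrightarrow> \<exists>zs. \<forall>ts\<in>red W T a. fac (ts @ zs)"
proof -
  assume a: "a \<in> interval W T h"
  then have "inv a \<otimes> h \<in> carrier W" using ss_carrier by (auto simp: interval_def)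
  from red_exists[OF this] show ?thesis using interval_fac[OF a] by blast
qed

lemma gen_extend: "t \<in> gens \<Longrightarrow> \<exists>zs. fac (t # zs)"
proof -
  assume t: "t \<in> gens"
  then have tc: "t \<in> carrier W" using T_carrier by blast
  have "len W T t \<noteq> 0"
  proof
    assume "len W T t = 0"
    then have "t = \<one>" using len_witness[OF tc] by auto
    then show False using t T_ne_one by blast
  qed
  moreover have "len W T t \<le> 1" using len_le[of "[t]"] t tc by simp
  ultimately have "[t] \<in> red W T t" using t tc by (simp add: red_iff)
  then show ?thesis using red_extend[of t] t by fastforce
qed

lemma dual_relators_over: "r \<in> dual_relators W T h \<Longrightarrow> word_over gens r"
proof -
  assume "r \<in> dual_relators W T h"
  then obtain ts ts' a where r: "r = map (\<lambda>t. (t, True)) ts @ inv_word (map (\<lambda>t. (t, True)) ts')"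
    "a \<in> interval W T h" "ts \<in> red W T a" "ts' \<in> red W T a" unfolding dual_relators_def by blast
  obtain zs where "\<forall>ts\<in>red W T a. fac (ts @ zs)" using red_extend[OF r(2)] by blast
  then have "set ts \<subseteq> gens" "set ts' \<subseteq> gens" using r fac_gens[of "_ @ zs"] by auto
  then show ?thesis unfolding r(1) by simp
qed

lemma pres_dual: "pres_by D dl gens (dual_relators W T h)"
  unfolding dual_artin_group_def by (rule pres_by_presented_group[OF dual_relators_over])

lemma dl_image: "dl ` gens \<subseteq> carrier D"
  using pres_dual unfolding pres_by_def by blast

lemma eval_relator:
  assumes "group K" "\<theta> ` gens \<subseteq> carrier K" "set ts \<subseteq> gens" "set ts' \<subseteq> gens"
  shows "eval_word K \<theta> (map (\<lambda>t. (t, True)) ts @ inv_word (map (\<lambda>t. (t, True)) ts')) = \<one>\<^bsub>K\<^esub>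
    \<longleftrightarrow> prodl K (map \<theta> ts) = prodl K (map \<theta> ts')"
proof -
  interpret K: group K by fact
  have c: "prodl K (map \<theta> ts) \<in> carrier K" "prodl K (map \<theta> ts') \<in> carrier K"
    by (rule K.prodl_closed, use assms(2-4) in \<open>auto simp: image_subset_iff subset_iff\<close>)+
  have "eval_word K \<theta> (map (\<lambda>t. (t, True)) ts @ inv_word (map (\<lambda>t. (t, True)) ts'))
      = prodl K (map \<theta> ts) \<otimes>\<^bsub>K\<^esub> inv\<^bsub>K\<^esub> (prodl K (map \<theta> ts'))"
    using assms by (simp add: K.eval_word_append[OF assms(2)] K.eval_word_inv_word[OF assms(2)])
  then show ?thesis using c by (metis K.inv_closed K.inv_equality K.inv_inv K.r_inv)
qed

lemma dual_relation:
  assumes "a \<in> interval W T h" "ts \<in> red W T a" "ts' \<in> red W T a"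
  shows "prodl D (map dl ts) = prodl D (map dl ts')"
proof -
  let ?r = "map (\<lambda>t. (t, True)) ts @ inv_word (map (\<lambda>t. (t, True)) ts')"
  have r: "?r \<in> dual_relators W T h" unfolding dual_relators_def using assms by blast
  then have o: "word_over gens ?r" by (rule dual_relators_over)
  then have "eval_word D dl ?r = \<one>\<^bsub>D\<^esub>" using pres_dual wc_rel[OF r] unfolding pres_by_def by blast
  then show ?thesis using eval_relator[OF D.group_axioms dl_image, of ts ts'] o by simp
qed

lemma dual_pair:
  assumes "fac (us @ [x, y] @ vs)" "fac (us @ [x', y'] @ vs)" "x \<otimes> y = x' \<otimes> y'"
  shows "dl x \<otimes>\<^bsub>D\<^esub> dl y = dl x' \<otimes>\<^bsub>D\<^esub> dl y'"
proof -
  have g: "{x, y, x', y'} \<subseteq> gens" using fac_gens[OF assms(1)] fac_gens[OF assms(2)] by auto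
  then have c: "{x, y, x', y'} \<subseteq> carrier W" using T_carrier by blast
  have p: "prodl W [x, y] = prodl W [x', y']" using c assms(3) by simp
  have "prodl D (map dl [x, y]) = prodl D (map dl [x', y'])"
    by (rule dual_relation[OF sub_interval[OF assms(1)] sub_red[OF assms(1)]]) (unfold p, rule sub_red[OF assms(2)])
  moreover have "{dl x, dl y, dl x', dl y'} \<subseteq> carrier D" using g dl_image by auto
  ultimately show ?thesis by simp
qed

lemma fac_step: "fac xs \<Longrightarrow> fac (hurwitz_step W l xs)"
proof (cases rule: hurwitz_step_cases[of l xs])
  case (2 us x y vs b)
  assume f: "fac xs"
  have "heq W xs (hurwitz_step W l xs)"
    unfolding heq_def using 2 f T_closed[of xs] by (auto simp: fac_def intro!: exI[of _ "[l]"])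
  then show ?thesis using f fac_heq by blast
qed simp

text \<open>A move replaces two neighbouring letters by another reduced factorization of their
  product, which is an instance of a dual relation. Hence the dual symbol of the conjugate that a
  move creates is the conjugate of the symbols.\<close>

lemma hurwitz_dual: "fac xs \<Longrightarrow> hurwitz D w (map dl xs) = map dl (hurwitz W w xs)"
proof (induction w arbitrary: xs)
  case (Cons l w)
  have "hurwitz_step D l (map dl xs) = map dl (hurwitz_step W l xs)"
  proof -
    obtain i b where l: "l = (i, b)" by fastforce
    show ?thesis
    proof (cases "Suc i < length xs")
      case True
      define us where "us = take i xs"
      define vs where "vs = drop (Suc (Suc i)) xs"
      define x where "x = xs ! i"
      define y where "y = xs ! Suc i"
      have xs: "xs = us @ x # y # vs" and l: "l = (length us, b)"
        using list_split_two[OF True] True l by (simp_all add: us_def vs_def x_def y_def)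
      have st: "hurwitz_step W l xs = us @ (if b then [x \<otimes> y \<otimes> inv x, x] else [y, inv y \<otimes> x \<otimes> y]) @ vs"
        unfolding xs l hurwitz_step_split by (rule refl)
      have f: "fac (us @ [x, y] @ vs)" using Cons.prems xs by simp
      have f': "fac (us @ (if b then [x \<otimes> y \<otimes> inv x, x] else [y, inv y \<otimes> x \<otimes> y]) @ vs)"
        using fac_step[OF Cons.prems, of l] unfolding st .
      have g: "x \<in> gens" "y \<in> gens" using fac_gens[OF f] by auto
      then have c: "x \<in> carrier W" "y \<in> carrier W" using T_carrier by auto
      have d: "dl x \<in> carrier D" "dl y \<in> carrier D" using g dl_image by auto
      show ?thesis
      proof (cases b)
        case True
        have f2: "fac (us @ [x \<otimes> y \<otimes> inv x, x] @ vs)" using f' True by simp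
        then have "x \<otimes> y \<otimes> inv x \<in> gens" using fac_gens by fastforce
        then have d2: "dl (x \<otimes> y \<otimes> inv x) \<in> carrier D" using dl_image by auto
        have "dl x \<otimes>\<^bsub>D\<^esub> dl y = dl (x \<otimes> y \<otimes> inv x) \<otimes>\<^bsub>D\<^esub> dl x"
          by (rule dual_pair[OF f f2]) (use c in \<open>simp add: m_assoc\<close>)
        then have "dl x \<otimes>\<^bsub>D\<^esub> dl y \<otimes>\<^bsub>D\<^esub> inv\<^bsub>D\<^esub> (dl x) = dl (x \<otimes> y \<otimes> inv x)"
          using d d2 by (simp add: D.m_assoc)
        then show ?thesis
          unfolding st using hurwitz_step_split[of D "map dl us" b "dl x" "dl y" "map dl vs"] True
          by (simp add: xs l)
      next
        case False
        have f2: "fac (us @ [y, inv y \<otimes> x \<otimes> y] @ vs)" using f' False by simp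
        then have "inv y \<otimes> x \<otimes> y \<in> gens" using fac_gens by fastforce
        then have d2: "dl (inv y \<otimes> x \<otimes> y) \<in> carrier D" using dl_image by auto
        have "dl x \<otimes>\<^bsub>D\<^esub> dl y = dl y \<otimes>\<^bsub>D\<^esub> dl (inv y \<otimes> x \<otimes> y)"
          by (rule dual_pair[OF f f2]) (use c in \<open>simp add: m_assoc[symmetric]\<close>)
        then have "inv\<^bsub>D\<^esub> (dl y) \<otimes>\<^bsub>D\<^esub> dl x \<otimes>\<^bsub>D\<^esub> dl y = dl (inv y \<otimes> x \<otimes> y)"
          using d d2 by (simp add: D.m_assoc) (simp add: D.m_assoc[symmetric])
        then show ?thesis
          unfolding st using hurwitz_step_split[of D "map dl us" b "dl x" "dl y" "map dl vs"] False
          by (simp add: xs l)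
      qed
    qed (simp add: l hurwitz_step_def)
  qed
  then show ?case using Cons.IH[OF fac_step[OF Cons.prems, of l]] by simp
qed simp

text \<open>The letter \<open>t\<close> is brought next to \<open>s\<close> without being changed. A
  power of a braid generator fixes this pair in \<open>W\<close>, and \<open>hurwitz_dual\<close>
  transfers the fixed point to the dual symbols.\<close>

lemma dual_braid_ordered:
  assumes st: "ss = us @ s # vs @ t # ws" and n: "m s t = enat n"
  shows "D.alt_prod (dl s) (dl t) n = D.alt_prod (dl t) (dl s) n"
proof -
  have c: "set us \<subseteq> carrier W" "set vs \<subseteq> carrier W" "set ws \<subseteq> carrier W" "s \<in> carrier W" "t \<in> carrier W"
    using ss_carrier st by auto
  let ?vs = "map (conjg W (inv (prodl W [t]))) vs"
  have "heq W ((us @ [s]) @ (vs @ [t]) @ ws) ((us @ [s]) @ ([t] @ ?vs) @ ws)"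
    by (rule heq_context[OF heq_move']) (use c in auto)
  then have f: "fac (us @ [s, t] @ ?vs @ ws)" using fac_heq[OF fac_ss] st by simp
  let ?w = "replicate n (0::nat, True)"
  have S: "s \<in> S" "t \<in> S" using st ss(2) by auto
  have w: "braid_word (Suc (Suc 0)) ?w" by (auto simp: braid_word_def)
  have "hurwitz W ?w [s, t] = [s, t]"
    using hurwitz_alternate_fixed_iff[OF c(4,5)] braid_relation[OF S n] by blast
  then have "hurwitz W (shift_word (length us) ?w) (us @ [s, t] @ ?vs @ ws) = us @ [s, t] @ ?vs @ ws"
    using hurwitz_context[of "[s, t]" ?w W us "?vs @ ws"] w by simp
  then have "hurwitz D (shift_word (length us) ?w) (map dl (us @ [s, t] @ ?vs @ ws)) = map dl (us @ [s, t] @ ?vs @ ws)"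
    unfolding hurwitz_dual[OF f] by simp
  then have "map dl us @ hurwitz D ?w [dl s, dl t] @ map dl (?vs @ ws) = map dl us @ [dl s, dl t] @ map dl (?vs @ ws)"
    using hurwitz_context[of "[dl s, dl t]" ?w D "map dl us" "map dl (?vs @ ws)"] w by simp
  then have "hurwitz D ?w [dl s, dl t] = [dl s, dl t]" by simp
  moreover have "dl s \<in> carrier D" "dl t \<in> carrier D" using fac_gens[OF f] dl_image by auto
  ultimately show ?thesis using D.hurwitz_alternate_fixed_iff by blast
qed

lemma dual_braid:
  assumes "s \<in> S" "t \<in> S" "m s t = enat n"
  shows "D.alt_prod (dl s) (dl t) n = D.alt_prod (dl t) (dl s) n"
proof (cases "s = t")
  case False
  have st: "s \<in> set ss" "t \<in> set ss" using assms ss(2) by auto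
  then obtain us vs where u: "ss = us @ s # vs" using split_list by fastforce
  show ?thesis
  proof (cases "t \<in> set vs")
    case True
    then obtain vs' ws where "vs = vs' @ t # ws" using split_list by fastforce
    then show ?thesis using dual_braid_ordered[of us s vs' t ws] u assms(3) by simp
  next
    case t: False
    then have "t \<in> set us" using st u False by auto
    then obtain us' us'' where "us = us' @ t # us''" using split_list by fastforce
    moreover have "m t s = enat n" using assms mat by (auto simp: coxeter_matrix_def)
    ultimately show ?thesis using dual_braid_ordered[of us' t us'' s vs] u by simp
  qed
qed simp

lemma S_gens: "S \<subseteq> gens"
  using fac_gens[OF fac_ss] ss(2) by simp

lemma to_dual: "\<exists>F\<in>hom A D. \<forall>s\<in>S. F (artin_gen S m s) = dl s"
proof (rule pres_by_hom_gen[OF pres_artin D.group_axioms])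
  show im: "dl ` S \<subseteq> carrier D" using S_gens dl_image by blast
  fix r assume "r \<in> artin_relators S m"
  then obtain s t n where r: "s \<in> S" "t \<in> S" "m s t = enat n" "r = alt_word s t n @ inv_word (alt_word t s n)"
    unfolding artin_relators_def by blast
  have e: "eval_word D dl (alt_word a b n) = D.alt_prod (dl a) (dl b) n" for a b
    unfolding D.alt_prod_def eval_word_def alt_word_def by (simp add: comp_def) (rule arg_cong[where f = "prodl D"], simp)
  have "dl s \<in> carrier D" "dl t \<in> carrier D" using im r by auto
  then show "eval_word D dl r = \<one>\<^bsub>D\<^esub>"
    using dual_braid[OF r(1-3)] r(1,2) unfolding r(4)
    by (simp add: D.eval_word_append[OF im] D.eval_word_inv_word[OF im] word_over_alt_word e)
qed

text \<open>Two braids that bring \<open>t\<close> to the front of the Coxeter word differ by one that fixes the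
  word and one that acts on the remaining letters only, so the first Artin letter depends on \<open>t\<close> alone.\<close>

definition lam :: "'a \<Rightarrow> ('a \<times> bool) list set" where
  "lam t = hd (hurwitz A (SOME w. braid_word (length ss) w \<and> (\<exists>r. hurwitz W w ss = t # r)) art_ss)"

lemma lam_unique:
  assumes w: "braid_word (length ss) w" "hurwitz W w ss = t # r"
    and w': "braid_word (length ss) w'" "hurwitz W w' ss = t # r'"
  shows "hd (hurwitz A w art_ss) = hd (hurwitz A w' art_ss)"
proof -
  have f: "fac (t # r)" "fac (t # r')"
    using fac_heq[OF fac_ss] w w' ss_carrier unfolding heq_def by metis+
  then have c: "t \<in> carrier W" "set r \<subseteq> carrier W" "set r' \<subseteq> carrier W"
    using T_closed[of "t # r"] T_closed[of "t # r'"] by (simp_all add: fac_def)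
  have "t \<otimes> prodl W r = t \<otimes> prodl W r'" using f by (simp add: fac_def)
  then have p: "prodl W r = prodl W r'" using c by (simp add: prodl_closed)
  have "heq W r r'"
    by (rule interval_transitive[OF sub_interval[of "[t]" r "[]"] sub_red[of "[t]" r "[]"]])
      (use f p sub_red[of "[t]" r' "[]"] in simp_all)
  then obtain v where v: "braid_word (length r) v" "hurwitz W v r = r'" by (auto simp: heq_def)
  have lr: "length ss = Suc (length r)" using w(2) length_hurwitz[of W w ss] by simp
  let ?v = "shift_word 1 v"
  have bv: "braid_word (length ss) ?v" using braid_word_shift[OF v(1), of 1] lr by simp
  have "hurwitz W ?v (t # r) = t # r'" using hurwitz_context[OF v(1), of W "[t]" "[]"] v(2) by simp
  then have "hurwitz W (w @ ?v @ inv_word w') ss = ss"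
    using w w' hurwitz_inv_word[OF ss_carrier, of w'] by (simp add: hurwitz_append)
  then have st: "hurwitz A (inv_word w') (hurwitz A ?v (hurwitz A w art_ss)) = art_ss"
    using stable[of "w @ ?v @ inv_word w'"] w w' bv by (simp add: hurwitz_append)
  have c': "set (hurwitz A ?v (hurwitz A w art_ss)) \<subseteq> carrier A"
    by (intro A.hurwitz_closed[OF A.hurwitz_closed[OF art_ss_carrier order_refl] order_refl]) simp_all
  have "hurwitz A w' (hurwitz A (inv_word w') (hurwitz A ?v (hurwitz A w art_ss))) = hurwitz A ?v (hurwitz A w art_ss)"
    using A.hurwitz_inv_word[OF c', of "inv_word w'"] by simp
  then have e: "hurwitz A w' art_ss = hurwitz A ?v (hurwitz A w art_ss)" unfolding st .
  obtain y ys where y: "hurwitz A w art_ss = y # ys" using lr by (metis length_Suc_conv length_hurwitz length_map)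
  then have "length ys = length r" using lr length_hurwitz[of A w art_ss] by simp
  then have "hurwitz A ?v (y # ys) = y # hurwitz A v ys"
    using hurwitz_context[of ys v A "[y]" "[]"] v(1) by simp
  then show ?thesis using e y by simp
qed

lemma hd_lam:
  assumes "braid_word (length ss) w" "hurwitz W w ss = t # r"
  shows "hd (hurwitz A w art_ss) = lam t"
proof -
  let ?P = "\<lambda>w. braid_word (length ss) w \<and> (\<exists>r. hurwitz W w ss = t # r)"
  have "?P (SOME w. ?P w)" by (rule someI[of ?P w]) (use assms in blast)
  then show ?thesis unfolding lam_def using lam_unique[OF assms] by blast
qed

text \<open>Appending \<open>front_word i\<close> reduces the claim at position \<open>i\<close> to
  the first position, where \<open>lam\<close> is defined.\<close>

lemma map_lam:
  assumes "braid_word (length ss) w"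
  shows "hurwitz A w art_ss = map lam (hurwitz W w ss)"
proof (rule nth_equalityI)
  fix i assume "i < length (hurwitz A w art_ss)"
  then have i: "i < length ss" by simp
  let ?w = "w @ front_word i"
  have b: "braid_word (length ss) ?w" using assms front_word(1)[OF i] by simp
  obtain t r where tr: "hurwitz W ?w ss = t # r" using i by (metis length_hurwitz list.exhaust list.size(3) not_less_zero)
  have "t = hurwitz W w ss ! i" using front_word(2)[of i "hurwitz W w ss" W] i tr by (simp add: hurwitz_append)
  moreover have "hurwitz A w art_ss ! i = lam t"
    using front_word(2)[of i "hurwitz A w art_ss" A] i hd_lam[OF b tr] by (simp add: hurwitz_append)
  ultimately show "hurwitz A w art_ss ! i = map lam (hurwitz W w ss) ! i" using i by simp
qed simp

text \<open>Transitivity provides a braid from the Coxeter word to \<open>xs\<close>, and the same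
  braid leads from the Artin generators to their values under \<open>lam\<close>.\<close>

lemma fac_lam:
  assumes "fac xs"
  shows "set (map lam xs) \<subseteq> carrier A \<and> prodl A (map lam xs) = prodl A art_ss"
proof -
  obtain w where w: "braid_word (length ss) w" "hurwitz W w ss = xs"
    using fac_transitive[OF fac_ss assms] by (auto simp: heq_def)
  have "heq A art_ss (map lam xs)"
    unfolding heq_def using w map_lam[OF w(1)] art_ss_carrier by auto
  then show ?thesis using A.heq_carrier A.heq_prodl by blast
qed

lemma lam_image: "lam ` gens \<subseteq> carrier A"
  using gen_extend fac_lam by fastforce

text \<open>Two reduced words of one element are extended by the same complement; the extended
  products agree, and the complement is cancelled.\<close>

lemma from_dual: "\<exists>F\<in>hom D A. \<forall>t\<in>gens. F (dl t) = lam t"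
proof (rule pres_by_hom_gen[OF pres_dual A.group_axioms lam_image])
  fix r assume "r \<in> dual_relators W T h"
  then obtain ts ts' a where r: "r = map (\<lambda>t. (t, True)) ts @ inv_word (map (\<lambda>t. (t, True)) ts')"
    "a \<in> interval W T h" "ts \<in> red W T a" "ts' \<in> red W T a" unfolding dual_relators_def by blast
  obtain zs where zs: "\<forall>ts\<in>red W T a. fac (ts @ zs)" using red_extend[OF r(2)] by blast
  then have f: "fac (ts @ zs)" "fac (ts' @ zs)" using r by auto
  then have c: "set (map lam ts) \<subseteq> carrier A" "set (map lam ts') \<subseteq> carrier A" "set (map lam zs) \<subseteq> carrier A"
    using fac_lam[OF f(1)] fac_lam[OF f(2)] by (simp_all add: image_Un)
  have "prodl A (map lam ts @ map lam zs) = prodl A (map lam ts' @ map lam zs)"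
    using fac_lam[OF f(1)] fac_lam[OF f(2)] by simp
  then have "prodl A (map lam ts) = prodl A (map lam ts')"
    unfolding A.prodl_append[OF c(1,3)] A.prodl_append[OF c(2,3)]
    using A.prodl_closed[OF c(1)] A.prodl_closed[OF c(2)] A.prodl_closed[OF c(3)] by simp
  moreover have "set ts \<subseteq> gens" "set ts' \<subseteq> gens" using fac_gens[OF f(1)] fac_gens[OF f(2)] by simp_all
  ultimately show "eval_word A lam r = \<one>\<^bsub>A\<^esub>" unfolding r(1) using eval_relator[OF A.group_axioms lam_image] by blast
qed

theorem artin_iso_dual: "A \<cong> D"
proof -
  obtain F where F: "F \<in> hom A D" "\<And>s. s \<in> S \<Longrightarrow> F (artin_gen S m s) = dl s" using to_dual by blast
  obtain F' where F': "F' \<in> hom D A" "\<And>t. t \<in> gens \<Longrightarrow> F' (dl t) = lam t" using from_dual by blast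
  have m: "map lam ss = art_ss" using map_lam[of "[]"] by simp
  have ls: "lam s = artin_gen S m s" if "s \<in> S" for s
    using m that ss(2) by (metis map_eq_conv)
  \<comment> \<open>The map \<open>F\<close> is prescribed on the generators alone. The braid that
    brings \<open>t\<close> to the front commutes with \<open>F\<close> and carries this information
    to \<open>t\<close>.\<close>
  have Fl: "F (lam t) = dl t" if t: "t \<in> gens" for t
  proof -
    obtain zs where zs: "fac (t # zs)" using gen_extend[OF t] by blast
    obtain w where w: "braid_word (length ss) w" "hurwitz W w ss = t # zs"
      using fac_transitive[OF fac_ss zs] by (auto simp: heq_def)
    have "map F art_ss = map dl ss" using F(2) ss(2) by auto
    then have "map F (hurwitz A w art_ss) = hurwitz D w (map dl ss)"
      using hurwitz_map_hom[OF A.group_axioms D.group_axioms F(1) art_ss_carrier, of w] by metis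
    also have "\<dots> = map dl (t # zs)" using hurwitz_dual[OF fac_ss] w(2) by simp
    finally show ?thesis using map_lam[OF w(1)] w(2) by simp
  qed
  have FF: "F' (F (artin_gen S m s)) = artin_gen S m s" if "s \<in> S" for s
    using F(2)[OF that] F'(2)[of s] ls[OF that] S_gens that by (metis subsetD)
  have "(F' \<circ> F) x = x" if "x \<in> carrier A" for x
    by (rule pres_by_hom_eqI[OF pres_artin A.group_axioms Group.hom_compose[OF F(1) F'(1)] _ _ that, of "\<lambda>x. x"])
      (simp_all add: hom_def FF)
  moreover have "(F \<circ> F') x = x" if "x \<in> carrier D" for x
    by (rule pres_by_hom_eqI[OF pres_dual D.group_axioms Group.hom_compose[OF F'(1) F(1)] _ _ that, of "\<lambda>x. x"])
      (use F'(2) Fl in \<open>auto simp: hom_def\<close>)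
  ultimately have "bij_betw F (carrier A) (carrier D)"
    using F(1) F'(1) by (intro bij_betwI[where g = F']) (auto simp: hom_def)
  then show ?thesis using F(1) unfolding is_iso_def iso_def by blast
qed

theorem art_well_stabilized: "well_stabilized W m ss"
  unfolding well_stabilized_def ss(2)
proof (intro allI impI iffI)
  fix w assume w: "braid_word (length ss) w"
  show "hurwitz A w art_ss = art_ss" if "hurwitz W w ss = ss" using stable[OF w that] .
  assume "hurwitz A w art_ss = art_ss"
  then show "hurwitz W w ss = ss"
    using hurwitz_map_hom[OF A.group_axioms group_axioms art_hom(1) art_ss_carrier, of w]
    by (simp only: art_hom_ss)
qed

theorem interval_pan_transitive: "pan_transitive W T h"
  unfolding pan_transitive_def
proof (intro ballI)
  fix a xs ys assume a: "a \<in> interval W T h" "xs \<in> red W T a" "ys \<in> red W T a"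
  from interval_transitive[OF this] show "\<exists>w. braid_word (len W T a) w \<and> hurwitz W w xs = ys"
    using a(2) by (auto simp: heq_def red_iff)
qed

end

section \<open>The theorem on free products\<close>

theorem theorem5p12:
  fixes W1 :: "'a monoid" and W2 :: "'b monoid" and W :: "'c monoid"
    and S1 :: "'a set" and S2 :: "'b set" and S :: "'c set"
    and m1 :: "'a \<Rightarrow> 'a \<Rightarrow> enat" and m2 :: "'b \<Rightarrow> 'b \<Rightarrow> enat" and m :: "'c \<Rightarrow> 'c \<Rightarrow> enat"
    and s1s :: "'a list" and s2s :: "'b list"
    and \<iota>1 :: "'a \<Rightarrow> 'c" and \<iota>2 :: "'b \<Rightarrow> 'c"
  assumes cox1: "coxeter_system W1 S1 m1" and fin1: "finite S1"
    and ord1: "distinct s1s" "set s1s = S1"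
    and cox2: "coxeter_system W2 S2 m2" and fin2: "finite S2"
    and ord2: "distinct s2s" "set s2s = S2"
    and inj1: "inj_on \<iota>1 S1" and inj2: "inj_on \<iota>2 S2"
    and disj: "\<iota>1 ` S1 \<inter> \<iota>2 ` S2 = {}"
    and S_def: "S = \<iota>1 ` S1 \<union> \<iota>2 ` S2"
    and m_1: "\<forall>a\<in>S1. \<forall>b\<in>S1. m (\<iota>1 a) (\<iota>1 b) = m1 a b"
    and m_2: "\<forall>a\<in>S2. \<forall>b\<in>S2. m (\<iota>2 a) (\<iota>2 b) = m2 a b"
    and m_12: "\<forall>a\<in>S1. \<forall>b\<in>S2. m (\<iota>1 a) (\<iota>2 b) = \<infinity> \<and> m (\<iota>2 b) (\<iota>1 a) = \<infinity>"
    and cox: "coxeter_system W S m"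
    and ws1: "well_stabilized W1 m1 s1s" and ws2: "well_stabilized W2 m2 s2s"
    and pt1: "pan_transitive W1 (reflections W1 S1) (prodl W1 s1s)"
    and pt2: "pan_transitive W2 (reflections W2 S2) (prodl W2 s2s)"
  shows "well_stabilized W m (map \<iota>1 s1s @ map \<iota>2 s2s)
    \<and> pan_transitive W (reflections W S) (prodl W (map \<iota>1 s1s @ map \<iota>2 s2s))
    \<and> artin_group S m \<cong> dual_artin_group W (reflections W S) (prodl W (map \<iota>1 s1s @ map \<iota>2 s2s))"
proof -
  have ss: "distinct (map \<iota>1 s1s @ map \<iota>2 s2s)" "set (map \<iota>1 s1s @ map \<iota>2 s2s) = S"
    using ord1 ord2 inj1 inj2 disj S_def by (auto simp: distinct_map)
  interpret C1: coxeter W1 S1 m1 s1s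
    using cox1 ord1 by (intro coxeter.intro coxeter_axioms.intro) (simp_all add: coxeter_system_def)
  interpret C2: coxeter W2 S2 m2 s2s
    using cox2 ord2 by (intro coxeter.intro coxeter_axioms.intro) (simp_all add: coxeter_system_def)
  have C: "coxeter W S m (map \<iota>1 s1s @ map \<iota>2 s2s)"
    using cox ss by (intro coxeter.intro coxeter_axioms.intro) (simp_all add: coxeter_system_def)
  interpret C: coxeter W S m "map \<iota>1 s1s @ map \<iota>2 s2s" by (rule C)
  have FP: "coxeter_free_product W1 S1 m1 s1s W2 S2 m2 s2s W S m \<iota>1 \<iota>2"
    by (intro coxeter_free_product.intro coxeter_free_product_axioms.intro C1.coxeter_axioms C2.coxeter_axioms C)
      (use inj1 inj2 disj m_1 m_2 m_12 in auto)
  interpret P: pan_factors W1 S1 m1 s1s W2 S2 m2 s2s W S m \<iota>1 \<iota>2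
    by (intro pan_factors.intro pan_factors_axioms.intro FP) (use pt1 pt2 in \<open>simp_all add: C1.T_def C2.T_def\<close>)
  interpret Q: stable_factors W1 S1 m1 s1s W2 S2 m2 s2s W S m \<iota>1 \<iota>2
    by (intro stable_factors.intro stable_factors_axioms.intro FP)
      (use ws1 ws2 ord1 ord2 in \<open>simp_all add: well_stabilized_def\<close>)
  interpret R: stable_transitive W S m "map \<iota>1 s1s @ map \<iota>2 s2s"
    by (intro stable_transitive.intro stable_transitive_axioms.intro C P.interval_transitive Q.artin_stable)
  show ?thesis
    using R.art_well_stabilized R.interval_pan_transitive R.artin_iso_dual by (simp only: C.T_def)
qed

end
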